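(* Let $A$ and $B$ be algebras in a finite multi-tensor category $\mathcal{C}$. (1) For a finite left $\mathcal{C}$-module category $\mathcal{M}$, the Nakayama functor of the category ${}_A\mathcal{M}$ of left $A$-modules in $\mathcal{M}$ is given by $\mathbb{N}_{{}_A\mathcal{M}}(\mathbf{M})=\mathbb{N}_{\mathcal{M}}(A^{\vee}\otimes_A\mathbf{M})$ for $\mathbf{M}\in{}_A\mathcal{M}$. (2) For a finite right $\mathcal{C}$-module category $\mathcal{M}$, the Nakayama functor of the category $\mathcal{M}_B$ of right $B$-modules in $\mathcal{M}$ is given by $\mathbb{N}_{\mathcal{M}_B}(\mathbf{M})=\mathbb{N}_{\mathcal{M}}(\mathbf{M}\otimes_B{}^{\vee}B)$ for $\mathbf{M}\in\mathcal{M}_B$. (3) For a finite $\mathcal{C}$-bimodule category $\mathcal{M}$, the Nakayama functor of the category ${}_A\mathcal{M}_B$ of $A$-$B$-bimodules in $\mathcal{M}$ is given by $\mathbb{N}_{{}_A\mathcal{M}_B}(\mathbf{M})=\mathbb{N}_{\mathcal{M}}(A^{\vee}\otimes_A\mathbf{M}\otimes_B{}^{\vee}B)$ for $\mathbf{M}\in{}_A\mathcal{M}_B$. Here equality means natural isomorphism of functors, and the right-hand sides carry the actions of $A$ and $B$ described in the context.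
   Context: $\Bbbk$ is a field. A finite abelian category is a $\Bbbk$-linear category equivalent to the category of finite-dimensional left modules over a finite-dimensional $\Bbbk$-algebra. For an object $M$ of such a category $\mathcal{M}$, the copower $(-)\otimes M$ from finite-dimensional vector spaces to $\mathcal{M}$ is the left adjoint of $\mathrm{Hom}_{\mathcal{M}}(M,-)$. The Nakayama functor is the coend $\mathbb{N}_{\mathcal{M}}(M)=\int^{X\in\mathcal{M}}\mathrm{Hom}_{\mathcal{M}}(M,X)^*\otimes X$, with universal dinatural transformation $i_{M,X}$. Canonical isomorphism: write $G^{\mathrm{ra}}$, $G^{\mathrm{rra}}$ for the right and double right adjoint. If a linear functor $G:\mathcal{M}\to\mathcal{N}$ of finite abelian categories admits a triple right adjoint, $\phi_G(M):G^{\mathrm{rra}}\mathbb{N}_{\mathcal{M}}(M)\to\mathbb{N}_{\mathcal{N}}(G(M))$ is the natural isomorphism such that $\phi_G(M)\circ G^{\mathrm{rra}}(i_{M,X})=i_{G(M),G^{\mathrm{rra}}(X)}\circ(t^*\otimes\mathrm{id})$ for all $X\in\mathcal M$ (using that $G^{\mathrm{rra}}$ preserves copowers), where $t:\mathrm{Hom}_{\mathcal{N}}(G(M),G^{\mathrm{rra}}(X))\cong\mathrm{Hom}_{\mathcal{M}}(M,G^{\mathrm{ra}}G^{\mathrm{rra}}(X))\to\mathrm{Hom}_{\mathcal{M}}(M,X)$ is adjunction followed by the counit of $G^{\mathrm{ra}}\dashv G^{\mathrm{rra}}$. All monoidal categories and module categories are assumed strict. A finite multi-tensor category is a finite abelian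 category with a rigid monoidal structure $(\otimes,\mathbb{1})$ with bilinear tensor product. The left dual $X^{\vee}$ comes with $\mathrm{ev}_X:X^{\vee}\otimes X\to\mathbb{1}$ and $\mathrm{coev}_X:\mathbb{1}\to X\otimes X^{\vee}$; the right dual ${}^{\vee}X$ with ${}\mathrm{ev}'_X:X\otimes{}^{\vee}X\to\mathbb{1}$ and $\mathrm{coev}'_X:\mathbb{1}\to{}^{\vee}X\otimes X$; the functors $(-)^{\vee}$, ${}^{\vee}(-)$ are assumed to be mutually inverse, strict and (order-reversing) monoidal. A finite left (right, bi-) $\mathcal{C}$-module category is a finite abelian category $\mathcal{M}$ with an action $\triangleright$ (resp. $\triangleleft$, both) of $\mathcal{C}$ that is linear and right exact in each variable. ${}_A\mathcal{M}$, $\mathcal{M}_B$, ${}_A\mathcal{M}_B$ are the categories of left $A$-modules (modules over the monad $A\triangleright(-)$), right $B$-modules, and $A$-$B$-bimodules in $\mathcal{M}$. Twisted structure of $\mathbb{N}_{\mathcal{M}}$: taking $G=X\triangleright(-)$, for which $G^{\mathrm{rra}}={}^{\vee\vee}X\triangleright(-)$, $\phi_G$ gives ${}^{\vee\vee}X\triangleright\mathbb{N}_{\mathcal{M}}(M)\cong\mathbb{N}_{\mathcal{M}}(X\triangleright M)$; taking $G=(-)\triangleleft X$, for which $G^{\mathrm{rra}}=(-)\triangleleft X^{\vee\vee}$, it gives $\mathbb{N}_{\mathcal{M}}(M)\triangleleft X^{\vee\vee}\cong\mathbb{N}_{\mathcal{M}}(M\triangleleft X)$. Consequently, if $M$ is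 a left $A^{\vee\vee}$-module, $\mathbb{N}_{\mathcal{M}}(M)$ is a left $A$-module by $A\triangleright\mathbb{N}_{\mathcal{M}}(M)\cong\mathbb{N}_{\mathcal{M}}(A^{\vee\vee}\triangleright M)\to\mathbb{N}_{\mathcal{M}}(M)$; if $M$ is a right ${}^{\vee\vee}B$-module, $\mathbb{N}_{\mathcal{M}}(M)$ is a right $B$-module by $\mathbb{N}_{\mathcal{M}}(M)\triangleleft B\cong\mathbb{N}_{\mathcal{M}}(M\triangleleft{}^{\vee\vee}B)\to\mathbb{N}_{\mathcal{M}}(M)$. With $m$ the multiplication of $A$, $A^{\vee}$ is an $A^{\vee\vee}$-$A$-bimodule: right action $(\mathrm{ev}_A\otimes\mathrm{id})(\mathrm{id}\otimes m\otimes\mathrm{id})(\mathrm{id}_{A^{\vee}}\otimes\mathrm{id}_A\otimes\mathrm{coev}_A)$, left action $(\mathrm{ev}_{A^{\vee}}\otimes\mathrm{id}_{A^{\vee}})(\mathrm{id}_{A^{\vee\vee}}\otimes m^{\vee})$ with $m^{\vee}:A^{\vee}\to A^{\vee}\otimes A^{\vee}$. Symmetrically (mirror image formulas with right duals), ${}^{\vee}B$ is a $B$-${}^{\vee\vee}B$-bimodule. For a bimodule $X$ over algebras $A'$, $A$ in $\mathcal{C}$ and $M\in{}_A\mathcal{M}$, $X\otimes_A M$ is the coequalizer of the two maps $X\triangleright A\triangleright M\rightrightarrows X\triangleright M$ given by the actions of $A$, a left $A'$-module; similarly on the right. Thus $A^{\vee}\otimes_A\mathbf{M}$ is a left $A^{\vee\vee}$-module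 and $\mathbf{M}\otimes_B{}^{\vee}B$ is a right ${}^{\vee\vee}B$-module, and $\mathbb{N}_{\mathcal{M}}$ turns these into a left $A$-module and a right $B$-module via the composites $A\triangleright\mathbb{N}_{\mathcal{M}}(A^{\vee}\otimes_A\mathbf{M})\cong\mathbb{N}_{\mathcal{M}}(A^{\vee\vee}\triangleright(A^{\vee}\otimes_A\mathbf{M}))\to\mathbb{N}_{\mathcal{M}}(A^{\vee}\otimes_A\mathbf{M})$ and $\mathbb{N}_{\mathcal{M}}(\mathbf{M}\otimes_B{}^{\vee}B)\triangleleft B\cong\mathbb{N}_{\mathcal{M}}((\mathbf{M}\otimes_B{}^{\vee}B)\triangleleft{}^{\vee\vee}B)\to\mathbb{N}_{\mathcal{M}}(\mathbf{M}\otimes_B{}^{\vee}B)$, respectively, where the isomorphisms are the twisted structure isomorphisms of $\mathbb{N}_{\mathcal{M}}$ and the second arrows are $\mathbb{N}_{\mathcal{M}}$ applied to the actions of $A^{\vee\vee}$ and ${}^{\vee\vee}B$; for $A^{\vee}\otimes_A\mathbf{M}\otimes_B{}^{\vee}B$ both actions are defined by the same two composites with this object in place of $A^{\vee}\otimes_A\mathbf{M}$ and $\mathbf{M}\otimes_B{}^{\vee}B$. *)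

theory Defs
  imports "HOL-Algebra.Module" "HOL-Library.FuncSet"
begin

section \<open>Vector spaces and linear categories\<close>

definition base_ring :: "'k::field ring" where
  "base_ring = \<lparr>carrier = UNIV, mult = (*), one = 1, zero = 0, add = (+)\<rparr>"

text \<open>
  Vector spaces are modules over \<^const>\<open>base_ring\<close> in the sense of HOL-Algebra. The fields
  \<^const>\<open>mult\<close> and \<^const>\<open>one\<close>, which the record type \<^typ>\<open>('k, 'v) module\<close> inherits from
  rings, are irrelevant for a vector space.
\<close>

abbreviation vector_space_on :: "('k::field, 'v) module \<Rightarrow> bool" where
  "vector_space_on V \<equiv> Module.module base_ring V"

definition lin :: "('k, 'v) module \<Rightarrow> ('k, 'w) module \<Rightarrow> ('v \<Rightarrow> 'w) set" where
  "lin V W = {f \<in> carrier V \<rightarrow> carrier W.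
     (\<forall>v\<in>carrier V. \<forall>v'\<in>carrier V. f (v \<oplus>\<^bsub>V\<^esub> v') = f v \<oplus>\<^bsub>W\<^esub> f v') \<and>
     (\<forall>a. \<forall>v\<in>carrier V. f (a \<odot>\<^bsub>V\<^esub> v) = a \<odot>\<^bsub>W\<^esub> f v)}"

definition fin_dim :: "('k, 'v) module \<Rightarrow> bool" where
  "fin_dim V \<longleftrightarrow> (\<exists>S. finite S \<and> S \<subseteq> carrier V \<and>
     (\<forall>v\<in>carrier V. \<exists>c. v = (\<Oplus>\<^bsub>V\<^esub>s\<in>S. c s \<odot>\<^bsub>V\<^esub> s)))"

definition dual_space :: "('k::field, 'v) module \<Rightarrow> ('k, 'v \<Rightarrow> 'k) module" where
  "dual_space V = \<lparr>
     carrier = {\<xi> \<in> extensional (carrier V).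
       (\<forall>v\<in>carrier V. \<forall>v'\<in>carrier V. \<xi> (v \<oplus>\<^bsub>V\<^esub> v') = \<xi> v + \<xi> v') \<and>
       (\<forall>a. \<forall>v\<in>carrier V. \<xi> (a \<odot>\<^bsub>V\<^esub> v) = a * \<xi> v)},
     mult = undefined, one = undefined,
     zero = (\<lambda>v\<in>carrier V. 0),
     add = (\<lambda>\<xi> \<zeta>. \<lambda>v\<in>carrier V. \<xi> v + \<zeta> v),
     smult = (\<lambda>a \<xi>. \<lambda>v\<in>carrier V. a * \<xi> v)\<rparr>"

text \<open>The transpose \<open>f\<^sup>* : W\<^sup>* \<rightarrow> V\<^sup>*\<close> of a linear map \<open>f : V \<rightarrow> W\<close>.\<close>

definition transp :: "('k, 'v) module \<Rightarrow> ('v \<Rightarrow> 'w) \<Rightarrow> ('w \<Rightarrow> 'k) \<Rightarrow> ('v \<Rightarrow> 'k)" where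
  "transp V f \<xi> = (\<lambda>v\<in>carrier V. \<xi> (f v))"

text \<open>
  Composition is a single operation on arrow names, and likewise the action of a bifunctor on
  arrows below. If the hom spaces are pairwise disjoint, this is the usual notion, and every
  category is isomorphic to one of this kind. Disjointness is not imposed, so that an arrow of a
  category of modules can be an arrow of the underlying category.
\<close>

record ('o, 'm, 'k) lcat =
  Obj :: "'o set"
  Hom :: "'o \<Rightarrow> 'o \<Rightarrow> ('k, 'm) module"
  Id :: "'o \<Rightarrow> 'm"
  Comp :: "'m \<Rightarrow> 'm \<Rightarrow> 'm"  (infixr "\<cdot>\<index>" 55)

abbreviation arr :: "('o, 'm, 'k, 'z) lcat_scheme \<Rightarrow> 'o \<Rightarrow> 'o \<Rightarrow> 'm set" where
  "arr C X Y \<equiv> carrier (Hom C X Y)"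

locale lin_category =
  fixes C :: "('o, 'm, 'k::field, 'z) lcat_scheme" (structure)
  assumes hom_space: "\<lbrakk>X \<in> Obj C; Y \<in> Obj C\<rbrakk> \<Longrightarrow> vector_space_on (Hom C X Y)"
    and id_arr: "X \<in> Obj C \<Longrightarrow> Id C X \<in> arr C X X"
    and comp_arr: "\<lbrakk>X \<in> Obj C; Y \<in> Obj C; Z \<in> Obj C; f \<in> arr C X Y; g \<in> arr C Y Z\<rbrakk>
      \<Longrightarrow> g \<cdot> f \<in> arr C X Z"
    and id_left: "\<lbrakk>X \<in> Obj C; Y \<in> Obj C; f \<in> arr C X Y\<rbrakk> \<Longrightarrow> Id C Y \<cdot> f = f"
    and id_right: "\<lbrakk>X \<in> Obj C; Y \<in> Obj C; f \<in> arr C X Y\<rbrakk> \<Longrightarrow> f \<cdot> Id C X = f"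
    and comp_assoc: "\<lbrakk>W \<in> Obj C; X \<in> Obj C; Y \<in> Obj C; Z \<in> Obj C;
      f \<in> arr C W X; g \<in> arr C X Y; h \<in> arr C Y Z\<rbrakk> \<Longrightarrow> (h \<cdot> g) \<cdot> f = h \<cdot> (g \<cdot> f)"
    and comp_lin_left: "\<lbrakk>X \<in> Obj C; Y \<in> Obj C; Z \<in> Obj C; f \<in> arr C X Y\<rbrakk>
      \<Longrightarrow> (\<lambda>g. g \<cdot> f) \<in> lin (Hom C Y Z) (Hom C X Z)"
    and comp_lin_right: "\<lbrakk>X \<in> Obj C; Y \<in> Obj C; Z \<in> Obj C; g \<in> arr C Y Z\<rbrakk>
      \<Longrightarrow> (\<lambda>f. g \<cdot> f) \<in> lin (Hom C X Y) (Hom C X Z)"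

definition is_iso :: "('o, 'm, 'k, 'z) lcat_scheme \<Rightarrow> 'o \<Rightarrow> 'o \<Rightarrow> 'm \<Rightarrow> bool" where
  "is_iso C X Y f \<longleftrightarrow> f \<in> arr C X Y \<and>
     (\<exists>g\<in>arr C Y X. g \<cdot>\<^bsub>C\<^esub> f = Id C X \<and> f \<cdot>\<^bsub>C\<^esub> g = Id C Y)"

record ('o, 'm, 'p, 'n) fctr =
  Fo :: "'o \<Rightarrow> 'p"
  Fa :: "'o \<Rightarrow> 'o \<Rightarrow> 'm \<Rightarrow> 'n"

locale lin_functor = dom: lin_category C + cod: lin_category D
  for C :: "('o, 'm, 'k::field, 'y) lcat_scheme" and D :: "('p, 'n, 'k, 'z) lcat_scheme" +
  fixes F :: "('o, 'm, 'p, 'n) fctr"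
  assumes obj: "X \<in> Obj C \<Longrightarrow> Fo F X \<in> Obj D"
    and arrow: "\<lbrakk>X \<in> Obj C; Y \<in> Obj C\<rbrakk>
      \<Longrightarrow> Fa F X Y \<in> lin (Hom C X Y) (Hom D (Fo F X) (Fo F Y))"
    and ident: "X \<in> Obj C \<Longrightarrow> Fa F X X (Id C X) = Id D (Fo F X)"
    and comp: "\<lbrakk>X \<in> Obj C; Y \<in> Obj C; Z \<in> Obj C; f \<in> arr C X Y; g \<in> arr C Y Z\<rbrakk>
      \<Longrightarrow> Fa F X Z (g \<cdot>\<^bsub>C\<^esub> f) = Fa F Y Z g \<cdot>\<^bsub>D\<^esub> Fa F X Y f"

definition fid :: "('o, 'm, 'o, 'm) fctr" where
  "fid = \<lparr>Fo = (\<lambda>X. X), Fa = (\<lambda>X Y f. f)\<rparr>"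

definition fcomp :: "('p, 'n, 'q, 'l) fctr \<Rightarrow> ('o, 'm, 'p, 'n) fctr \<Rightarrow> ('o, 'm, 'q, 'l) fctr" where
  "fcomp G F = \<lparr>Fo = (\<lambda>X. Fo G (Fo F X)),
     Fa = (\<lambda>X Y f. Fa G (Fo F X) (Fo F Y) (Fa F X Y f))\<rparr>"

definition nat_iso :: "('o, 'm, 'k::field, 'y) lcat_scheme \<Rightarrow> ('p, 'n, 'k, 'z) lcat_scheme
    \<Rightarrow> ('o, 'm, 'p, 'n) fctr \<Rightarrow> ('o, 'm, 'p, 'n) fctr \<Rightarrow> bool" where
  "nat_iso C D F G \<longleftrightarrow> lin_functor C D F \<and> lin_functor C D G \<and>
     (\<exists>\<theta>. (\<forall>X\<in>Obj C. is_iso D (Fo F X) (Fo G X) (\<theta> X)) \<and>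
       (\<forall>X\<in>Obj C. \<forall>Y\<in>Obj C. \<forall>f\<in>arr C X Y. \<theta> Y \<cdot>\<^bsub>D\<^esub> Fa F X Y f = Fa G X Y f \<cdot>\<^bsub>D\<^esub> \<theta> X))"

definition equivalent_cats ::
  "('o, 'm, 'k::field, 'y) lcat_scheme \<Rightarrow> ('p, 'n, 'k, 'z) lcat_scheme \<Rightarrow> bool" where
  "equivalent_cats C D \<longleftrightarrow> (\<exists>F G. lin_functor C D F \<and> lin_functor D C G \<and>
     nat_iso C C (fcomp G F) fid \<and> nat_iso D D (fcomp F G) fid)"


section \<open>Finite abelian categories\<close>

text \<open>An algebra is a record of type \<^typ>\<open>('k, 'r) module\<close> all of whose fields are used.\<close>

definition kalgebra :: "('k::field, 'r) module \<Rightarrow> bool" where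
  "kalgebra R \<longleftrightarrow> ring R \<and> vector_space_on R \<and>
     (\<forall>a. \<forall>x\<in>carrier R. \<forall>y\<in>carrier R.
        (a \<odot>\<^bsub>R\<^esub> x) \<otimes>\<^bsub>R\<^esub> y = a \<odot>\<^bsub>R\<^esub> (x \<otimes>\<^bsub>R\<^esub> y) \<and> x \<otimes>\<^bsub>R\<^esub> (a \<odot>\<^bsub>R\<^esub> y) = a \<odot>\<^bsub>R\<^esub> (x \<otimes>\<^bsub>R\<^esub> y))"

type_synonym ('k, 'r, 'v) rmod = "('k, 'v) module \<times> ('r \<Rightarrow> 'v \<Rightarrow> 'v)"

definition fd_left_module :: "('k::field, 'r) module \<Rightarrow> ('k, 'r, 'v) rmod \<Rightarrow> bool" where
  "fd_left_module R = (\<lambda>(V, \<alpha>). vector_space_on V \<and> fin_dim V \<and>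
     (\<forall>x\<in>carrier R. \<alpha> x \<in> lin V V) \<and>
     (\<forall>v\<in>carrier V. (\<lambda>x. \<alpha> x v) \<in> lin R V) \<and>
     (\<forall>v\<in>carrier V. \<alpha> \<one>\<^bsub>R\<^esub> v = v) \<and>
     (\<forall>x\<in>carrier R. \<forall>y\<in>carrier R. \<forall>v\<in>carrier V. \<alpha> (x \<otimes>\<^bsub>R\<^esub> y) v = \<alpha> x (\<alpha> y v)))"

text \<open>
  The category of finite-dimensional left \<open>R\<close>-modules. A module map is represented as a partial
  function whose domain is the carrier of the source module.
\<close>

definition fd_modules ::
  "('k::field, 'r) module \<Rightarrow> (('k, 'r, 'v) rmod, 'v \<Rightarrow> 'v option, 'k) lcat" where
  "fd_modules R = \<lparr>
     Obj = {M. fd_left_module R M},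
     Hom = (\<lambda>(V, \<alpha>) (W, \<beta>). \<lparr>
       carrier = {f. dom f = carrier V \<and> (\<lambda>v. the (f v)) \<in> lin V W \<and>
         (\<forall>x\<in>carrier R. \<forall>v\<in>carrier V. the (f (\<alpha> x v)) = \<beta> x (the (f v)))},
       mult = undefined, one = undefined,
       zero = (\<lambda>v. if v \<in> carrier V then Some \<zero>\<^bsub>W\<^esub> else None),
       add = (\<lambda>f g v. if v \<in> carrier V then Some (the (f v) \<oplus>\<^bsub>W\<^esub> the (g v)) else None),
       smult = (\<lambda>a f v. if v \<in> carrier V then Some (a \<odot>\<^bsub>W\<^esub> the (f v)) else None)\<rparr>),
     Id = (\<lambda>(V, \<alpha>) v. if v \<in> carrier V then Some v else None),
     Comp = (\<circ>\<^sub>m)\<rparr>"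

text \<open>
  The type \<^typ>\<open>nat \<Rightarrow> 'k\<close> contains a copy of every finite-dimensional vector space, so restricting
  the algebra and its modules to carriers in this type loses nothing up to equivalence.
\<close>

definition finite_abelian :: "('o, 'm, 'k::field, 'z) lcat_scheme \<Rightarrow> bool" where
  "finite_abelian C \<longleftrightarrow> (\<exists>R :: ('k, nat \<Rightarrow> 'k) module. kalgebra R \<and> fin_dim R \<and>
     equivalent_cats C (fd_modules R ::
       (('k, nat \<Rightarrow> 'k, nat \<Rightarrow> 'k) rmod, (nat \<Rightarrow> 'k) \<Rightarrow> (nat \<Rightarrow> 'k) option, 'k) lcat))"

definition is_coequalizer ::
  "('o, 'm, 'k, 'z) lcat_scheme \<Rightarrow> 'o \<Rightarrow> 'o \<Rightarrow> 'm \<Rightarrow> 'm \<Rightarrow> 'o \<Rightarrow> 'm \<Rightarrow> bool" where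
  "is_coequalizer C X Y f g Q q \<longleftrightarrow> Q \<in> Obj C \<and> q \<in> arr C Y Q \<and> q \<cdot>\<^bsub>C\<^esub> f = q \<cdot>\<^bsub>C\<^esub> g \<and>
     (\<forall>Z\<in>Obj C. \<forall>h\<in>arr C Y Z. h \<cdot>\<^bsub>C\<^esub> f = h \<cdot>\<^bsub>C\<^esub> g \<longrightarrow> (\<exists>!k. k \<in> arr C Q Z \<and> k \<cdot>\<^bsub>C\<^esub> q = h))"

definition coeq :: "('o, 'm, 'k, 'z) lcat_scheme \<Rightarrow> 'o \<Rightarrow> 'o \<Rightarrow> 'm \<Rightarrow> 'm \<Rightarrow> 'o \<times> 'm" where
  "coeq C X Y f g = (SOME (Q, q). is_coequalizer C X Y f g Q q)"

text \<open>The arrow \<open>Q \<rightarrow> Z\<close> induced by \<open>h\<close> along an epimorphism \<open>q\<close> with target \<open>Q\<close>.\<close>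

definition desc :: "('o, 'm, 'k, 'z) lcat_scheme \<Rightarrow> 'o \<Rightarrow> 'o \<Rightarrow> 'm \<Rightarrow> 'm \<Rightarrow> 'm" where
  "desc C Q Z q h = (THE k. k \<in> arr C Q Z \<and> k \<cdot>\<^bsub>C\<^esub> q = h)"

text \<open>
  \<open>X \<rightarrow> Y \<rightarrow> Q \<rightarrow> 0\<close> is exact iff \<open>Y \<rightarrow> Q\<close> is a cokernel of \<open>X \<rightarrow> Y\<close>; a right exact linear functor
  preserves these sequences.
\<close>

definition right_exact :: "('o, 'm, 'k, 'y) lcat_scheme \<Rightarrow> ('p, 'n, 'k, 'z) lcat_scheme
    \<Rightarrow> ('o, 'm, 'p, 'n) fctr \<Rightarrow> bool" where
  "right_exact C D F \<longleftrightarrow> (\<forall>X\<in>Obj C. \<forall>Y\<in>Obj C. \<forall>f\<in>arr C X Y. \<forall>Q q.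
     is_coequalizer C X Y f \<zero>\<^bsub>Hom C X Y\<^esub> Q q \<longrightarrow>
     is_coequalizer D (Fo F X) (Fo F Y) (Fa F X Y f) \<zero>\<^bsub>Hom D (Fo F X) (Fo F Y)\<^esub>
       (Fo F Q) (Fa F Y Q q))"


section \<open>Copowers and the Nakayama functor\<close>

text \<open>
  \<open>P\<close> with \<open>u : V \<rightarrow> Hom(M, P)\<close> is the value \<open>V \<otimes> M\<close> of the left adjoint of \<open>Hom(M, -)\<close>, together
  with the unit of the adjunction at \<open>V\<close>.
\<close>

definition is_copower :: "('o, 'm, 'k, 'z) lcat_scheme \<Rightarrow> ('k, 'v) module \<Rightarrow> 'o \<Rightarrow> 'o
    \<Rightarrow> ('v \<Rightarrow> 'm) \<Rightarrow> bool" where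
  "is_copower C V M P u \<longleftrightarrow> P \<in> Obj C \<and> u \<in> lin V (Hom C M P) \<and>
     (\<forall>Y\<in>Obj C. \<forall>g\<in>lin V (Hom C M Y).
        \<exists>!h. h \<in> arr C P Y \<and> (\<forall>v\<in>carrier V. h \<cdot>\<^bsub>C\<^esub> u v = g v))"

definition copower :: "('o, 'm, 'k, 'z) lcat_scheme \<Rightarrow> ('k, 'v) module \<Rightarrow> 'o
    \<Rightarrow> 'o \<times> ('v \<Rightarrow> 'm)" where
  "copower C V M = (SOME (P, u). is_copower C V M P u)"

definition cpo :: "('o, 'm, 'k, 'z) lcat_scheme \<Rightarrow> ('k, 'v) module \<Rightarrow> 'o \<Rightarrow> 'o" where
  "cpo C V M = fst (copower C V M)"

definition cpu :: "('o, 'm, 'k, 'z) lcat_scheme \<Rightarrow> ('k, 'v) module \<Rightarrow> 'o \<Rightarrow> 'v \<Rightarrow> 'm" where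
  "cpu C V M = snd (copower C V M)"

text \<open>The arrow \<open>V \<otimes> M \<rightarrow> Y\<close> corresponding to a linear map \<open>g : V \<rightarrow> Hom(M, Y)\<close>.\<close>

definition cp_desc :: "('o, 'm, 'k, 'z) lcat_scheme \<Rightarrow> ('k, 'v) module \<Rightarrow> 'o \<Rightarrow> 'o
    \<Rightarrow> ('v \<Rightarrow> 'm) \<Rightarrow> 'm" where
  "cp_desc C V M Y g = (THE h. h \<in> arr C (cpo C V M) Y \<and>
     (\<forall>v\<in>carrier V. h \<cdot>\<^bsub>C\<^esub> cpu C V M v = g v))"

text \<open>\<open>\<phi> \<otimes> f : V \<otimes> M \<rightarrow> W \<otimes> N\<close> for \<open>\<phi> : V \<rightarrow> W\<close> and \<open>f : M \<rightarrow> N\<close>.\<close>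

definition cp_map :: "('o, 'm, 'k, 'z) lcat_scheme \<Rightarrow> ('k, 'v) module \<Rightarrow> ('k, 'w) module
    \<Rightarrow> ('v \<Rightarrow> 'w) \<Rightarrow> 'o \<Rightarrow> 'o \<Rightarrow> 'm \<Rightarrow> 'm" where
  "cp_map C V W \<phi> M N f = cp_desc C V M (cpo C W N) (\<lambda>v. cpu C W N (\<phi> v) \<cdot>\<^bsub>C\<^esub> f)"

abbreviation hom_dual :: "('o, 'm, 'k::field, 'z) lcat_scheme \<Rightarrow> 'o \<Rightarrow> 'o \<Rightarrow> ('k, 'm \<Rightarrow> 'k) module"
  where "hom_dual C M X \<equiv> dual_space (Hom C M X)"

text \<open>
  A dinatural transformation from the functor \<open>(X', X) \<mapsto> Hom(M, X')\<^sup>* \<otimes> X\<close> on \<open>C\<^sup>o\<^sup>p \<times> C\<close>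
  to the constant functor \<open>Z\<close>.
\<close>

definition nak_dinatural :: "('o, 'm, 'k::field, 'z) lcat_scheme \<Rightarrow> 'o \<Rightarrow> 'o
    \<Rightarrow> ('o \<Rightarrow> 'm) \<Rightarrow> bool" where
  "nak_dinatural C M Z \<alpha> \<longleftrightarrow>
     (\<forall>X\<in>Obj C. \<alpha> X \<in> arr C (cpo C (hom_dual C M X) X) Z) \<and>
     (\<forall>X\<in>Obj C. \<forall>Y\<in>Obj C. \<forall>f\<in>arr C X Y.
        \<alpha> X \<cdot>\<^bsub>C\<^esub> cp_map C (hom_dual C M Y) (hom_dual C M X)
                   (transp (Hom C M X) (\<lambda>h. f \<cdot>\<^bsub>C\<^esub> h)) X X (Id C X)
        = \<alpha> Y \<cdot>\<^bsub>C\<^esub> cp_map C (hom_dual C M Y) (hom_dual C M Y) (\<lambda>\<xi>. \<xi>) X Y f)"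

definition is_nak_coend :: "('o, 'm, 'k::field, 'z) lcat_scheme \<Rightarrow> 'o \<Rightarrow> 'o
    \<Rightarrow> ('o \<Rightarrow> 'm) \<Rightarrow> bool" where
  "is_nak_coend C M N i \<longleftrightarrow> N \<in> Obj C \<and> nak_dinatural C M N i \<and>
     (\<forall>Z\<in>Obj C. \<forall>\<alpha>. nak_dinatural C M Z \<alpha> \<longrightarrow>
        (\<exists>!h. h \<in> arr C N Z \<and> (\<forall>X\<in>Obj C. h \<cdot>\<^bsub>C\<^esub> i X = \<alpha> X)))"

text \<open>
  \<open>N\<close> is the Nakayama functor, \<open>i M X : Hom(M, X)\<^sup>* \<otimes> X \<rightarrow> N(M)\<close> the universal dinatural
  transformation. The last clause says how the coend depends functorially on \<open>M\<close>.
\<close>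

definition is_nakayama :: "('o, 'm, 'k::field, 'z) lcat_scheme \<Rightarrow> ('o, 'm, 'o, 'm) fctr
    \<Rightarrow> ('o \<Rightarrow> 'o \<Rightarrow> 'm) \<Rightarrow> bool" where
  "is_nakayama C N i \<longleftrightarrow> lin_functor C C N \<and>
     (\<forall>M\<in>Obj C. is_nak_coend C M (Fo N M) (i M)) \<and>
     (\<forall>M\<in>Obj C. \<forall>M'\<in>Obj C. \<forall>g\<in>arr C M M'. \<forall>X\<in>Obj C.
        Fa N M M' g \<cdot>\<^bsub>C\<^esub> i M X
        = i M' X \<cdot>\<^bsub>C\<^esub> cp_map C (hom_dual C M X) (hom_dual C M' X)
            (transp (Hom C M' X) (\<lambda>h. h \<cdot>\<^bsub>C\<^esub> g)) X X (Id C X))"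

text \<open>
  A Nakayama functor of \<open>C\<close> exists, and every one is isomorphic to \<open>F\<close>; it is determined up to
  natural isomorphism.
\<close>

definition nakayama_given_by :: "('o, 'm, 'k::field, 'z) lcat_scheme \<Rightarrow> ('o, 'm, 'o, 'm) fctr
    \<Rightarrow> bool" where
  "nakayama_given_by C F \<longleftrightarrow> (\<exists>N i. is_nakayama C N i) \<and>
     (\<forall>N i. is_nakayama C N i \<longrightarrow> nat_iso C C N F)"

text \<open>
  The map \<open>t : Hom(G M, G\<^sup>r\<^sup>r\<^sup>a X) \<rightarrow> Hom(M, X)\<close>, where \<open>H = G\<^sup>r\<^sup>a\<close>, \<open>K = G\<^sup>r\<^sup>r\<^sup>a\<close>, \<open>\<eta>\<close> is the unit of
  \<open>G \<stileturn> H\<close> and \<open>\<epsilon>\<close> is the counit of \<open>H \<stileturn> K\<close>.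
\<close>

definition nak_t :: "('o, 'm, 'k, 'y) lcat_scheme \<Rightarrow> ('o, 'm, 'p, 'n) fctr
    \<Rightarrow> ('p, 'n, 'o, 'm) fctr \<Rightarrow> ('o, 'm, 'p, 'n) fctr \<Rightarrow> ('o \<Rightarrow> 'm) \<Rightarrow> ('o \<Rightarrow> 'm)
    \<Rightarrow> 'o \<Rightarrow> 'o \<Rightarrow> 'n \<Rightarrow> 'm" where
  "nak_t C G H K \<eta> \<epsilon> M X f = \<epsilon> X \<cdot>\<^bsub>C\<^esub> (Fa H (Fo G M) (Fo K X) f \<cdot>\<^bsub>C\<^esub> \<eta> M)"

text \<open>
  The canonical isomorphism \<open>\<phi>\<^sub>G(M) : K(N M) \<rightarrow> N'(G M)\<close>. The arrow
  \<open>Hom(M, X)\<^sup>* \<otimes> K X \<rightarrow> K(Hom(M, X)\<^sup>* \<otimes> X)\<close> composed with \<open>K(i)\<close> is the comparison by which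
  \<open>K\<close> preserves copowers.
\<close>

definition nak_phi :: "('o, 'm, 'k::field, 'y) lcat_scheme \<Rightarrow> ('p, 'n, 'k, 'z) lcat_scheme
    \<Rightarrow> ('o, 'm, 'o, 'm) fctr \<Rightarrow> ('o \<Rightarrow> 'o \<Rightarrow> 'm) \<Rightarrow> ('p, 'n, 'p, 'n) fctr \<Rightarrow> ('p \<Rightarrow> 'p \<Rightarrow> 'n)
    \<Rightarrow> ('o, 'm, 'p, 'n) fctr \<Rightarrow> ('p, 'n, 'o, 'm) fctr \<Rightarrow> ('o, 'm, 'p, 'n) fctr
    \<Rightarrow> ('o \<Rightarrow> 'm) \<Rightarrow> ('o \<Rightarrow> 'm) \<Rightarrow> 'o \<Rightarrow> 'n" where
  "nak_phi C D N i N' i' G H K \<eta> \<epsilon> M =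
     (THE p. is_iso D (Fo K (Fo N M)) (Fo N' (Fo G M)) p \<and>
        (\<forall>X\<in>Obj C. let V = hom_dual C M X; P = cpo C V X in
           p \<cdot>\<^bsub>D\<^esub> (Fa K P (Fo N M) (i M X) \<cdot>\<^bsub>D\<^esub>
                  cp_desc D V (Fo K X) (Fo K P) (\<lambda>\<xi>. Fa K X P (cpu C V X \<xi>)))
           = i' (Fo G M) (Fo K X) \<cdot>\<^bsub>D\<^esub>
               cp_map D V (hom_dual D (Fo G M) (Fo K X))
                 (transp (Hom D (Fo G M) (Fo K X)) (nak_t C G H K \<eta> \<epsilon> M X))
                 (Fo K X) (Fo K X) (Id D (Fo K X))))"


section \<open>Finite multi-tensor categories\<close>

locale bilin_bifunctor = one: lin_category C + two: lin_category D + cod: lin_category E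
  for C :: "('o1, 'm1, 'k::field, 'x) lcat_scheme"
    and D :: "('o2, 'm2, 'k, 'y) lcat_scheme"
    and E :: "('o3, 'm3, 'k, 'z) lcat_scheme" +
  fixes bo :: "'o1 \<Rightarrow> 'o2 \<Rightarrow> 'o3" and ba :: "'m1 \<Rightarrow> 'm2 \<Rightarrow> 'm3"
  assumes bo_obj: "\<lbrakk>X \<in> Obj C; U \<in> Obj D\<rbrakk> \<Longrightarrow> bo X U \<in> Obj E"
    and ba_arr: "\<lbrakk>X \<in> Obj C; Y \<in> Obj C; U \<in> Obj D; V \<in> Obj D; f \<in> arr C X Y; g \<in> arr D U V\<rbrakk>
      \<Longrightarrow> ba f g \<in> arr E (bo X U) (bo Y V)"
    and ba_id: "\<lbrakk>X \<in> Obj C; U \<in> Obj D\<rbrakk> \<Longrightarrow> ba (Id C X) (Id D U) = Id E (bo X U)"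
    and ba_comp: "\<lbrakk>X \<in> Obj C; Y \<in> Obj C; Z \<in> Obj C; U \<in> Obj D; V \<in> Obj D; W \<in> Obj D;
      f \<in> arr C X Y; f' \<in> arr C Y Z; g \<in> arr D U V; g' \<in> arr D V W\<rbrakk>
      \<Longrightarrow> ba (f' \<cdot>\<^bsub>C\<^esub> f) (g' \<cdot>\<^bsub>D\<^esub> g) = ba f' g' \<cdot>\<^bsub>E\<^esub> ba f g"
    and ba_lin_left: "\<lbrakk>X \<in> Obj C; Y \<in> Obj C; U \<in> Obj D; V \<in> Obj D; g \<in> arr D U V\<rbrakk>
      \<Longrightarrow> (\<lambda>f. ba f g) \<in> lin (Hom C X Y) (Hom E (bo X U) (bo Y V))"
    and ba_lin_right: "\<lbrakk>X \<in> Obj C; Y \<in> Obj C; U \<in> Obj D; V \<in> Obj D; f \<in> arr C X Y\<rbrakk>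
      \<Longrightarrow> (\<lambda>g. ba f g) \<in> lin (Hom D U V) (Hom E (bo X U) (bo Y V))"

text \<open>
  Strict monoidal categories with chosen duals: \<open>ldual X\<close> is the left dual of \<open>X\<close>, with
  \<open>ldual X \<otimes> X \<rightarrow> 1\<close> and \<open>1 \<rightarrow> X \<otimes> ldual X\<close>; \<open>rdual X\<close> is the right dual, with
  \<open>X \<otimes> rdual X \<rightarrow> 1\<close> and \<open>1 \<rightarrow> rdual X \<otimes> X\<close>.
\<close>

record ('o, 'm, 'k) mcat = "('o, 'm, 'k) lcat" +
  tens_obj :: "'o \<Rightarrow> 'o \<Rightarrow> 'o"  (infixr "\<boxtimes>\<index>" 70)
  tens_arr :: "'m \<Rightarrow> 'm \<Rightarrow> 'm"  (infixr "\<boxdot>\<index>" 70)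
  unit_obj :: 'o
  ldual :: "'o \<Rightarrow> 'o"
  ev :: "'o \<Rightarrow> 'm"
  coev :: "'o \<Rightarrow> 'm"
  rdual :: "'o \<Rightarrow> 'o"
  rev_ev :: "'o \<Rightarrow> 'm"
  rev_coev :: "'o \<Rightarrow> 'm"

locale strict_monoidal = bilin_bifunctor C C C "tens_obj C" "tens_arr C"
  for C :: "('o, 'm, 'k::field, 'z) mcat_scheme" (structure) +
  assumes unit_in: "unit_obj C \<in> Obj C"
    and unit_left: "X \<in> Obj C \<Longrightarrow> unit_obj C \<boxtimes> X = X"
    and unit_right: "X \<in> Obj C \<Longrightarrow> X \<boxtimes> unit_obj C = X"
    and tens_assoc: "\<lbrakk>X \<in> Obj C; Y \<in> Obj C; Z \<in> Obj C\<rbrakk>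
      \<Longrightarrow> (X \<boxtimes> Y) \<boxtimes> Z = X \<boxtimes> (Y \<boxtimes> Z)"
    and unit_left_arr: "\<lbrakk>X \<in> Obj C; Y \<in> Obj C; f \<in> arr C X Y\<rbrakk>
      \<Longrightarrow> Id C (unit_obj C) \<boxdot> f = f"
    and unit_right_arr: "\<lbrakk>X \<in> Obj C; Y \<in> Obj C; f \<in> arr C X Y\<rbrakk>
      \<Longrightarrow> f \<boxdot> Id C (unit_obj C) = f"
    and tens_assoc_arr: "\<lbrakk>X \<in> Obj C; X' \<in> Obj C; Y \<in> Obj C; Y' \<in> Obj C; Z \<in> Obj C; Z' \<in> Obj C;
      f \<in> arr C X X'; g \<in> arr C Y Y'; h \<in> arr C Z Z'\<rbrakk>
      \<Longrightarrow> (f \<boxdot> g) \<boxdot> h = f \<boxdot> (g \<boxdot> h)"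

text \<open>
  The last three groups of axioms say that the functors \<open>ldual\<close> and \<open>rdual\<close> are mutually inverse
  and that \<open>ldual\<close> is strict monoidal, i.e. that the canonical isomorphisms
  \<open>rdual (ldual X) \<cong> X\<close>, \<open>ldual (rdual X) \<cong> X\<close>, \<open>ldual 1 \<cong> 1\<close> and
  \<open>ldual (X \<otimes> Y) \<cong> ldual Y \<otimes> ldual X\<close> are identities. The analogous equations for \<open>rdual\<close> follow.
\<close>

locale strict_rigid = strict_monoidal +
  assumes ldual_obj: "X \<in> Obj C \<Longrightarrow> ldual C X \<in> Obj C"
    and ev_arr: "X \<in> Obj C \<Longrightarrow> ev C X \<in> arr C (ldual C X \<boxtimes> X) (unit_obj C)"
    and coev_arr: "X \<in> Obj C \<Longrightarrow> coev C X \<in> arr C (unit_obj C) (X \<boxtimes> ldual C X)"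
    and ldual_zigzag: "X \<in> Obj C \<Longrightarrow> (Id C X \<boxdot> ev C X) \<cdot> (coev C X \<boxdot> Id C X) = Id C X"
    and ldual_zigzag': "X \<in> Obj C \<Longrightarrow>
      (ev C X \<boxdot> Id C (ldual C X)) \<cdot> (Id C (ldual C X) \<boxdot> coev C X) = Id C (ldual C X)"
    and rdual_obj: "X \<in> Obj C \<Longrightarrow> rdual C X \<in> Obj C"
    and rev_ev_arr: "X \<in> Obj C \<Longrightarrow> rev_ev C X \<in> arr C (X \<boxtimes> rdual C X) (unit_obj C)"
    and rev_coev_arr: "X \<in> Obj C \<Longrightarrow> rev_coev C X \<in> arr C (unit_obj C) (rdual C X \<boxtimes> X)"
    and rdual_zigzag: "X \<in> Obj C \<Longrightarrow>
      (rev_ev C X \<boxdot> Id C X) \<cdot> (Id C X \<boxdot> rev_coev C X) = Id C X"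
    and rdual_zigzag': "X \<in> Obj C \<Longrightarrow>
      (Id C (rdual C X) \<boxdot> rev_ev C X) \<cdot> (rev_coev C X \<boxdot> Id C (rdual C X)) = Id C (rdual C X)"
    and rdual_ldual: "X \<in> Obj C \<Longrightarrow> rdual C (ldual C X) = X"
    and ldual_rdual: "X \<in> Obj C \<Longrightarrow> ldual C (rdual C X) = X"
    and rev_ev_ldual: "X \<in> Obj C \<Longrightarrow> rev_ev C (ldual C X) = ev C X"
    and rev_coev_ldual: "X \<in> Obj C \<Longrightarrow> rev_coev C (ldual C X) = coev C X"
    and ldual_unit: "ldual C (unit_obj C) = unit_obj C"
    and ev_unit: "ev C (unit_obj C) = Id C (unit_obj C)"
    and coev_unit: "coev C (unit_obj C) = Id C (unit_obj C)"
    and ldual_tens: "\<lbrakk>X \<in> Obj C; Y \<in> Obj C\<rbrakk> \<Longrightarrow> ldual C (X \<boxtimes> Y) = ldual C Y \<boxtimes> ldual C X"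
    and ev_tens: "\<lbrakk>X \<in> Obj C; Y \<in> Obj C\<rbrakk> \<Longrightarrow>
      ev C (X \<boxtimes> Y) = ev C Y \<cdot> (Id C (ldual C Y) \<boxdot> ev C X \<boxdot> Id C Y)"
    and coev_tens: "\<lbrakk>X \<in> Obj C; Y \<in> Obj C\<rbrakk> \<Longrightarrow>
      coev C (X \<boxtimes> Y) = (Id C X \<boxdot> coev C Y \<boxdot> Id C (ldual C X)) \<cdot> coev C X"

definition finite_multitensor :: "('o, 'm, 'k::field, 'z) mcat_scheme \<Rightarrow> bool" where
  "finite_multitensor C \<longleftrightarrow> finite_abelian C \<and> strict_rigid C"

text \<open>The dual arrows \<open>f\<^sup>\<or> : ldual Y \<rightarrow> ldual X\<close> and \<open>\<^sup>\<or>f : rdual Y \<rightarrow> rdual X\<close> of \<open>f : X \<rightarrow> Y\<close>.\<close>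

definition ldual_arr :: "('o, 'm, 'k, 'z) mcat_scheme \<Rightarrow> 'o \<Rightarrow> 'o \<Rightarrow> 'm \<Rightarrow> 'm" where
  "ldual_arr C X Y f =
     (ev C Y \<boxdot>\<^bsub>C\<^esub> Id C (ldual C X)) \<cdot>\<^bsub>C\<^esub>
     (Id C (ldual C Y) \<boxdot>\<^bsub>C\<^esub> f \<boxdot>\<^bsub>C\<^esub> Id C (ldual C X)) \<cdot>\<^bsub>C\<^esub>
     (Id C (ldual C Y) \<boxdot>\<^bsub>C\<^esub> coev C X)"

definition rdual_arr :: "('o, 'm, 'k, 'z) mcat_scheme \<Rightarrow> 'o \<Rightarrow> 'o \<Rightarrow> 'm \<Rightarrow> 'm" where
  "rdual_arr C X Y f =
     (Id C (rdual C X) \<boxdot>\<^bsub>C\<^esub> rev_ev C Y) \<cdot>\<^bsub>C\<^esub>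
     (Id C (rdual C X) \<boxdot>\<^bsub>C\<^esub> f \<boxdot>\<^bsub>C\<^esub> Id C (rdual C Y)) \<cdot>\<^bsub>C\<^esub>
     (rev_coev C X \<boxdot>\<^bsub>C\<^esub> Id C (rdual C Y))"


section \<open>Finite module categories\<close>

record ('c, 'd, 'o, 'm) laction =
  lact_obj :: "'c \<Rightarrow> 'o \<Rightarrow> 'o"  (infixr "\<rhd>\<index>" 70)
  lact_arr :: "'d \<Rightarrow> 'm \<Rightarrow> 'm"  (infixr "\<triangleright>\<index>" 70)

record ('c, 'd, 'o, 'm) raction =
  ract_obj :: "'o \<Rightarrow> 'c \<Rightarrow> 'o"  (infixl "\<lhd>\<index>" 70)
  ract_arr :: "'m \<Rightarrow> 'd \<Rightarrow> 'm"  (infixl "\<triangleleft>\<index>" 70)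

text \<open>The functor \<open>X \<rhd> (-)\<close> on \<open>M\<close> and the functor \<open>(-) \<rhd> U\<close> from \<open>C\<close> to \<open>M\<close>; similarly for
  right actions.\<close>

definition lact_by :: "('c, 'd, 'k, 'y) lcat_scheme \<Rightarrow> ('c, 'd, 'o, 'm) laction \<Rightarrow> 'c
    \<Rightarrow> ('o, 'm, 'o, 'm) fctr" where
  "lact_by C L X = \<lparr>Fo = (\<lambda>U. X \<rhd>\<^bsub>L\<^esub> U), Fa = (\<lambda>U V f. Id C X \<triangleright>\<^bsub>L\<^esub> f)\<rparr>"

definition lact_on :: "('o, 'm, 'k, 'z) lcat_scheme \<Rightarrow> ('c, 'd, 'o, 'm) laction \<Rightarrow> 'o
    \<Rightarrow> ('c, 'd, 'o, 'm) fctr" where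
  "lact_on M L U = \<lparr>Fo = (\<lambda>X. X \<rhd>\<^bsub>L\<^esub> U), Fa = (\<lambda>X Y f. f \<triangleright>\<^bsub>L\<^esub> Id M U)\<rparr>"

definition ract_by :: "('c, 'd, 'k, 'y) lcat_scheme \<Rightarrow> ('c, 'd, 'o, 'm) raction \<Rightarrow> 'c
    \<Rightarrow> ('o, 'm, 'o, 'm) fctr" where
  "ract_by C R X = \<lparr>Fo = (\<lambda>U. U \<lhd>\<^bsub>R\<^esub> X), Fa = (\<lambda>U V f. f \<triangleleft>\<^bsub>R\<^esub> Id C X)\<rparr>"

definition ract_on :: "('o, 'm, 'k, 'z) lcat_scheme \<Rightarrow> ('c, 'd, 'o, 'm) raction \<Rightarrow> 'o
    \<Rightarrow> ('c, 'd, 'o, 'm) fctr" where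
  "ract_on M R U = \<lparr>Fo = (\<lambda>X. U \<lhd>\<^bsub>R\<^esub> X), Fa = (\<lambda>X Y f. Id M U \<triangleleft>\<^bsub>R\<^esub> f)\<rparr>"

locale finite_left_module_category =
  bilin_bifunctor C M M "lact_obj L" "lact_arr L"
  for C :: "('c, 'd, 'k::field, 'y) mcat_scheme" and M :: "('o, 'm, 'k, 'z) lcat_scheme"
    and L :: "('c, 'd, 'o, 'm) laction" (structure) +
  assumes finite: "finite_abelian M"
    and lunit: "U \<in> Obj M \<Longrightarrow> unit_obj C \<rhd> U = U"
    and lassoc: "\<lbrakk>X \<in> Obj C; Y \<in> Obj C; U \<in> Obj M\<rbrakk> \<Longrightarrow> (X \<boxtimes>\<^bsub>C\<^esub> Y) \<rhd> U = X \<rhd> (Y \<rhd> U)"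
    and lunit_arr: "\<lbrakk>U \<in> Obj M; V \<in> Obj M; h \<in> arr M U V\<rbrakk> \<Longrightarrow> Id C (unit_obj C) \<triangleright> h = h"
    and lassoc_arr: "\<lbrakk>X \<in> Obj C; X' \<in> Obj C; Y \<in> Obj C; Y' \<in> Obj C; U \<in> Obj M; V \<in> Obj M;
      f \<in> arr C X X'; g \<in> arr C Y Y'; h \<in> arr M U V\<rbrakk> \<Longrightarrow> (f \<boxdot>\<^bsub>C\<^esub> g) \<triangleright> h = f \<triangleright> (g \<triangleright> h)"
    and lexact_by: "X \<in> Obj C \<Longrightarrow> right_exact M M (lact_by C L X)"
    and lexact_on: "U \<in> Obj M \<Longrightarrow> right_exact C M (lact_on M L U)"

locale finite_right_module_category =
  bilin_bifunctor M C M "ract_obj R" "ract_arr R"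
  for C :: "('c, 'd, 'k::field, 'y) mcat_scheme" and M :: "('o, 'm, 'k, 'z) lcat_scheme"
    and R :: "('c, 'd, 'o, 'm) raction" (structure) +
  assumes finite: "finite_abelian M"
    and runit: "U \<in> Obj M \<Longrightarrow> U \<lhd> unit_obj C = U"
    and rassoc: "\<lbrakk>X \<in> Obj C; Y \<in> Obj C; U \<in> Obj M\<rbrakk> \<Longrightarrow> U \<lhd> (X \<boxtimes>\<^bsub>C\<^esub> Y) = (U \<lhd> X) \<lhd> Y"
    and runit_arr: "\<lbrakk>U \<in> Obj M; V \<in> Obj M; h \<in> arr M U V\<rbrakk> \<Longrightarrow> h \<triangleleft> Id C (unit_obj C) = h"
    and rassoc_arr: "\<lbrakk>X \<in> Obj C; X' \<in> Obj C; Y \<in> Obj C; Y' \<in> Obj C; U \<in> Obj M; V \<in> Obj M;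
      f \<in> arr C X X'; g \<in> arr C Y Y'; h \<in> arr M U V\<rbrakk> \<Longrightarrow> h \<triangleleft> (f \<boxdot>\<^bsub>C\<^esub> g) = (h \<triangleleft> f) \<triangleleft> g"
    and rexact_by: "X \<in> Obj C \<Longrightarrow> right_exact M M (ract_by C R X)"
    and rexact_on: "U \<in> Obj M \<Longrightarrow> right_exact C M (ract_on M R U)"

locale finite_bimodule_category =
  left: finite_left_module_category C M L + right: finite_right_module_category C M R
  for C :: "('c, 'd, 'k::field, 'y) mcat_scheme" and M :: "('o, 'm, 'k, 'z) lcat_scheme"
    and L :: "('c, 'd, 'o, 'm) laction" and R :: "('c, 'd, 'o, 'm) raction" +
  assumes middle: "\<lbrakk>X \<in> Obj C; Y \<in> Obj C; U \<in> Obj M\<rbrakk>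
      \<Longrightarrow> (X \<rhd>\<^bsub>L\<^esub> U) \<lhd>\<^bsub>R\<^esub> Y = X \<rhd>\<^bsub>L\<^esub> (U \<lhd>\<^bsub>R\<^esub> Y)"
    and middle_arr: "\<lbrakk>X \<in> Obj C; X' \<in> Obj C; Y \<in> Obj C; Y' \<in> Obj C; U \<in> Obj M; V \<in> Obj M;
      f \<in> arr C X X'; g \<in> arr C Y Y'; h \<in> arr M U V\<rbrakk>
      \<Longrightarrow> (f \<triangleright>\<^bsub>L\<^esub> h) \<triangleleft>\<^bsub>R\<^esub> g = f \<triangleright>\<^bsub>L\<^esub> (h \<triangleleft>\<^bsub>R\<^esub> g)"


section \<open>Algebras and modules\<close>

record ('c, 'd) algebra_obj =
  aobj :: 'c
  amult :: 'd
  aunit :: 'd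

definition is_algebra :: "('c, 'd, 'k, 'z) mcat_scheme \<Rightarrow> ('c, 'd) algebra_obj \<Rightarrow> bool" where
  "is_algebra C A \<longleftrightarrow> aobj A \<in> Obj C \<and>
     amult A \<in> arr C (aobj A \<boxtimes>\<^bsub>C\<^esub> aobj A) (aobj A) \<and> aunit A \<in> arr C (unit_obj C) (aobj A) \<and>
     amult A \<cdot>\<^bsub>C\<^esub> (amult A \<boxdot>\<^bsub>C\<^esub> Id C (aobj A)) = amult A \<cdot>\<^bsub>C\<^esub> (Id C (aobj A) \<boxdot>\<^bsub>C\<^esub> amult A) \<and>
     amult A \<cdot>\<^bsub>C\<^esub> (aunit A \<boxdot>\<^bsub>C\<^esub> Id C (aobj A)) = Id C (aobj A) \<and>
     amult A \<cdot>\<^bsub>C\<^esub> (Id C (aobj A) \<boxdot>\<^bsub>C\<^esub> aunit A) = Id C (aobj A)"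

definition is_left_module :: "('c, 'd, 'k, 'y) mcat_scheme \<Rightarrow> ('o, 'm, 'k, 'z) lcat_scheme
    \<Rightarrow> ('c, 'd, 'o, 'm) laction \<Rightarrow> ('c, 'd) algebra_obj \<Rightarrow> 'o \<Rightarrow> 'm \<Rightarrow> bool" where
  "is_left_module C M L A U \<rho> \<longleftrightarrow> U \<in> Obj M \<and> \<rho> \<in> arr M (aobj A \<rhd>\<^bsub>L\<^esub> U) U \<and>
     \<rho> \<cdot>\<^bsub>M\<^esub> (amult A \<triangleright>\<^bsub>L\<^esub> Id M U) = \<rho> \<cdot>\<^bsub>M\<^esub> (Id C (aobj A) \<triangleright>\<^bsub>L\<^esub> \<rho>) \<and>
     \<rho> \<cdot>\<^bsub>M\<^esub> (aunit A \<triangleright>\<^bsub>L\<^esub> Id M U) = Id M U"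

definition is_right_module :: "('c, 'd, 'k, 'y) mcat_scheme \<Rightarrow> ('o, 'm, 'k, 'z) lcat_scheme
    \<Rightarrow> ('c, 'd, 'o, 'm) raction \<Rightarrow> ('c, 'd) algebra_obj \<Rightarrow> 'o \<Rightarrow> 'm \<Rightarrow> bool" where
  "is_right_module C M R B U \<sigma> \<longleftrightarrow> U \<in> Obj M \<and> \<sigma> \<in> arr M (U \<lhd>\<^bsub>R\<^esub> aobj B) U \<and>
     \<sigma> \<cdot>\<^bsub>M\<^esub> (Id M U \<triangleleft>\<^bsub>R\<^esub> amult B) = \<sigma> \<cdot>\<^bsub>M\<^esub> (\<sigma> \<triangleleft>\<^bsub>R\<^esub> Id C (aobj B)) \<and>
     \<sigma> \<cdot>\<^bsub>M\<^esub> (Id M U \<triangleleft>\<^bsub>R\<^esub> aunit B) = Id M U"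

definition left_modules :: "('c, 'd, 'k, 'y) mcat_scheme \<Rightarrow> ('o, 'm, 'k, 'z) lcat_scheme
    \<Rightarrow> ('c, 'd, 'o, 'm) laction \<Rightarrow> ('c, 'd) algebra_obj \<Rightarrow> ('o \<times> 'm, 'm, 'k) lcat" where
  "left_modules C M L A = \<lparr>
     Obj = {(U, \<rho>). is_left_module C M L A U \<rho>},
     Hom = (\<lambda>(U, \<rho>) (V, \<sigma>). (Hom M U V)\<lparr>carrier :=
       {f \<in> arr M U V. f \<cdot>\<^bsub>M\<^esub> \<rho> = \<sigma> \<cdot>\<^bsub>M\<^esub> (Id C (aobj A) \<triangleright>\<^bsub>L\<^esub> f)}\<rparr>),
     Id = (\<lambda>(U, \<rho>). Id M U),
     Comp = Comp M\<rparr>"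

definition right_modules :: "('c, 'd, 'k, 'y) mcat_scheme \<Rightarrow> ('o, 'm, 'k, 'z) lcat_scheme
    \<Rightarrow> ('c, 'd, 'o, 'm) raction \<Rightarrow> ('c, 'd) algebra_obj \<Rightarrow> ('o \<times> 'm, 'm, 'k) lcat" where
  "right_modules C M R B = \<lparr>
     Obj = {(U, \<sigma>). is_right_module C M R B U \<sigma>},
     Hom = (\<lambda>(U, \<sigma>) (V, \<tau>). (Hom M U V)\<lparr>carrier :=
       {f \<in> arr M U V. f \<cdot>\<^bsub>M\<^esub> \<sigma> = \<tau> \<cdot>\<^bsub>M\<^esub> (f \<triangleleft>\<^bsub>R\<^esub> Id C (aobj B))}\<rparr>),
     Id = (\<lambda>(U, \<sigma>). Id M U),
     Comp = Comp M\<rparr>"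

definition bimodules :: "('c, 'd, 'k, 'y) mcat_scheme \<Rightarrow> ('o, 'm, 'k, 'z) lcat_scheme
    \<Rightarrow> ('c, 'd, 'o, 'm) laction \<Rightarrow> ('c, 'd, 'o, 'm) raction
    \<Rightarrow> ('c, 'd) algebra_obj \<Rightarrow> ('c, 'd) algebra_obj \<Rightarrow> ('o \<times> 'm \<times> 'm, 'm, 'k) lcat" where
  "bimodules C M L R A B = \<lparr>
     Obj = {(U, \<rho>, \<sigma>). is_left_module C M L A U \<rho> \<and> is_right_module C M R B U \<sigma> \<and>
       \<sigma> \<cdot>\<^bsub>M\<^esub> (\<rho> \<triangleleft>\<^bsub>R\<^esub> Id C (aobj B)) = \<rho> \<cdot>\<^bsub>M\<^esub> (Id C (aobj A) \<triangleright>\<^bsub>L\<^esub> \<sigma>)},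
     Hom = (\<lambda>(U, \<rho>, \<sigma>) (V, \<rho>', \<sigma>'). (Hom M U V)\<lparr>carrier :=
       {f \<in> arr M U V. f \<cdot>\<^bsub>M\<^esub> \<rho> = \<rho>' \<cdot>\<^bsub>M\<^esub> (Id C (aobj A) \<triangleright>\<^bsub>L\<^esub> f) \<and>
                      f \<cdot>\<^bsub>M\<^esub> \<sigma> = \<sigma>' \<cdot>\<^bsub>M\<^esub> (f \<triangleleft>\<^bsub>R\<^esub> Id C (aobj B))}\<rparr>),
     Id = (\<lambda>(U, \<rho>, \<sigma>). Id M U),
     Comp = Comp M\<rparr>"

text \<open>
  With \<open>A\<^sup>\<or> = ldual A\<close>: the right action \<open>A\<^sup>\<or> \<otimes> A \<rightarrow> A\<^sup>\<or>\<close> and the left action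
  \<open>A\<^sup>\<or>\<^sup>\<or> \<otimes> A\<^sup>\<or> \<rightarrow> A\<^sup>\<or>\<close>.
\<close>

definition ldual_ract :: "('c, 'd, 'k, 'z) mcat_scheme \<Rightarrow> ('c, 'd) algebra_obj \<Rightarrow> 'd" where
  "ldual_ract C A = (let a = aobj A; a' = ldual C a in
     (ev C a \<boxdot>\<^bsub>C\<^esub> Id C a') \<cdot>\<^bsub>C\<^esub>
     (Id C a' \<boxdot>\<^bsub>C\<^esub> amult A \<boxdot>\<^bsub>C\<^esub> Id C a') \<cdot>\<^bsub>C\<^esub>
     (Id C a' \<boxdot>\<^bsub>C\<^esub> Id C a \<boxdot>\<^bsub>C\<^esub> coev C a))"

definition ldual_lact :: "('c, 'd, 'k, 'z) mcat_scheme \<Rightarrow> ('c, 'd) algebra_obj \<Rightarrow> 'd" where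
  "ldual_lact C A = (let a = aobj A; a' = ldual C a; a'' = ldual C a' in
     (ev C a' \<boxdot>\<^bsub>C\<^esub> Id C a') \<cdot>\<^bsub>C\<^esub>
     (Id C a'' \<boxdot>\<^bsub>C\<^esub> ldual_arr C (a \<boxtimes>\<^bsub>C\<^esub> a) a (amult A)))"

text \<open>
  With \<open>\<^sup>\<or>B = rdual B\<close>: the left action \<open>B \<otimes> \<^sup>\<or>B \<rightarrow> \<^sup>\<or>B\<close> and the right action
  \<open>\<^sup>\<or>B \<otimes> \<^sup>\<or>\<^sup>\<or>B \<rightarrow> \<^sup>\<or>B\<close>.
\<close>

definition rdual_lact :: "('c, 'd, 'k, 'z) mcat_scheme \<Rightarrow> ('c, 'd) algebra_obj \<Rightarrow> 'd" where
  "rdual_lact C B = (let b = aobj B; b' = rdual C b in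
     (Id C b' \<boxdot>\<^bsub>C\<^esub> rev_ev C b) \<cdot>\<^bsub>C\<^esub>
     (Id C b' \<boxdot>\<^bsub>C\<^esub> amult B \<boxdot>\<^bsub>C\<^esub> Id C b') \<cdot>\<^bsub>C\<^esub>
     (rev_coev C b \<boxdot>\<^bsub>C\<^esub> Id C b \<boxdot>\<^bsub>C\<^esub> Id C b'))"

definition rdual_ract :: "('c, 'd, 'k, 'z) mcat_scheme \<Rightarrow> ('c, 'd) algebra_obj \<Rightarrow> 'd" where
  "rdual_ract C B = (let b = aobj B; b' = rdual C b; b'' = rdual C b' in
     (Id C b' \<boxdot>\<^bsub>C\<^esub> rev_ev C b') \<cdot>\<^bsub>C\<^esub>
     (rdual_arr C (b \<boxtimes>\<^bsub>C\<^esub> b) b (amult B) \<boxdot>\<^bsub>C\<^esub> Id C b''))"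


section \<open>Relative tensor products with the dual bimodules\<close>

text \<open>\<open>A\<^sup>\<or> \<otimes>\<^sub>A U\<close> and the projection from \<open>A\<^sup>\<or> \<rhd> U\<close>, for a left \<open>A\<close>-module \<open>(U, \<rho>)\<close>.\<close>

definition ltens :: "('c, 'd, 'k, 'y) mcat_scheme \<Rightarrow> ('o, 'm, 'k, 'z) lcat_scheme
    \<Rightarrow> ('c, 'd, 'o, 'm) laction \<Rightarrow> ('c, 'd) algebra_obj \<Rightarrow> 'o \<times> 'm \<Rightarrow> 'o \<times> 'm" where
  "ltens C M L A = (\<lambda>(U, \<rho>). let a = aobj A; a' = ldual C a in
     coeq M (a' \<rhd>\<^bsub>L\<^esub> a \<rhd>\<^bsub>L\<^esub> U) (a' \<rhd>\<^bsub>L\<^esub> U)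
       (ldual_ract C A \<triangleright>\<^bsub>L\<^esub> Id M U) (Id C a' \<triangleright>\<^bsub>L\<^esub> \<rho>))"

definition ltens_arr :: "('c, 'd, 'k, 'y) mcat_scheme \<Rightarrow> ('o, 'm, 'k, 'z) lcat_scheme
    \<Rightarrow> ('c, 'd, 'o, 'm) laction \<Rightarrow> ('c, 'd) algebra_obj \<Rightarrow> 'o \<times> 'm \<Rightarrow> 'o \<times> 'm \<Rightarrow> 'm \<Rightarrow> 'm" where
  "ltens_arr C M L A u v f = (let (Q, q) = ltens C M L A u; (Q', q') = ltens C M L A v in
     desc M Q Q' q (q' \<cdot>\<^bsub>M\<^esub> (Id C (ldual C (aobj A)) \<triangleright>\<^bsub>L\<^esub> f)))"

text \<open>The left action of \<open>A\<^sup>\<or>\<^sup>\<or>\<close> on \<open>A\<^sup>\<or> \<otimes>\<^sub>A U\<close>.\<close>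

definition ltens_lact :: "('c, 'd, 'k, 'y) mcat_scheme \<Rightarrow> ('o, 'm, 'k, 'z) lcat_scheme
    \<Rightarrow> ('c, 'd, 'o, 'm) laction \<Rightarrow> ('c, 'd) algebra_obj \<Rightarrow> 'o \<times> 'm \<Rightarrow> 'm" where
  "ltens_lact C M L A u = (let (Q, q) = ltens C M L A u; a'' = ldual C (ldual C (aobj A)) in
     desc M (a'' \<rhd>\<^bsub>L\<^esub> Q) Q (Id C a'' \<triangleright>\<^bsub>L\<^esub> q) (q \<cdot>\<^bsub>M\<^esub> (ldual_lact C A \<triangleright>\<^bsub>L\<^esub> Id M (fst u))))"

text \<open>\<open>U \<otimes>\<^sub>B \<^sup>\<or>B\<close> and the projection from \<open>U \<lhd> \<^sup>\<or>B\<close>, for a right \<open>B\<close>-module \<open>(U, \<sigma>)\<close>.\<close>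

definition rtens :: "('c, 'd, 'k, 'y) mcat_scheme \<Rightarrow> ('o, 'm, 'k, 'z) lcat_scheme
    \<Rightarrow> ('c, 'd, 'o, 'm) raction \<Rightarrow> ('c, 'd) algebra_obj \<Rightarrow> 'o \<times> 'm \<Rightarrow> 'o \<times> 'm" where
  "rtens C M R B = (\<lambda>(U, \<sigma>). let b = aobj B; b' = rdual C b in
     coeq M (U \<lhd>\<^bsub>R\<^esub> b \<lhd>\<^bsub>R\<^esub> b') (U \<lhd>\<^bsub>R\<^esub> b')
       (\<sigma> \<triangleleft>\<^bsub>R\<^esub> Id C b') (Id M U \<triangleleft>\<^bsub>R\<^esub> rdual_lact C B))"

definition rtens_arr :: "('c, 'd, 'k, 'y) mcat_scheme \<Rightarrow> ('o, 'm, 'k, 'z) lcat_scheme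
    \<Rightarrow> ('c, 'd, 'o, 'm) raction \<Rightarrow> ('c, 'd) algebra_obj \<Rightarrow> 'o \<times> 'm \<Rightarrow> 'o \<times> 'm \<Rightarrow> 'm \<Rightarrow> 'm" where
  "rtens_arr C M R B u v f = (let (Q, q) = rtens C M R B u; (Q', q') = rtens C M R B v in
     desc M Q Q' q (q' \<cdot>\<^bsub>M\<^esub> (f \<triangleleft>\<^bsub>R\<^esub> Id C (rdual C (aobj B)))))"

text \<open>The right action of \<open>\<^sup>\<or>\<^sup>\<or>B\<close> on \<open>U \<otimes>\<^sub>B \<^sup>\<or>B\<close>.\<close>

definition rtens_ract :: "('c, 'd, 'k, 'y) mcat_scheme \<Rightarrow> ('o, 'm, 'k, 'z) lcat_scheme
    \<Rightarrow> ('c, 'd, 'o, 'm) raction \<Rightarrow> ('c, 'd) algebra_obj \<Rightarrow> 'o \<times> 'm \<Rightarrow> 'm" where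
  "rtens_ract C M R B u = (let (Q, q) = rtens C M R B u; b'' = rdual C (rdual C (aobj B)) in
     desc M (Q \<lhd>\<^bsub>R\<^esub> b'') Q (q \<triangleleft>\<^bsub>R\<^esub> Id C b'') (q \<cdot>\<^bsub>M\<^esub> (Id M (fst u) \<triangleleft>\<^bsub>R\<^esub> rdual_ract C B)))"

text \<open>
  For an \<open>A\<close>-\<open>B\<close>-bimodule \<open>(U, \<rho>, \<sigma>)\<close>: the object \<open>A\<^sup>\<or> \<otimes>\<^sub>A U\<close> with its induced right
  \<open>B\<close>-action. The triple tensor product \<open>A\<^sup>\<or> \<otimes>\<^sub>A U \<otimes>\<^sub>B \<^sup>\<or>B\<close> is bracketed to the left.
\<close>

definition ltens_rmod :: "('c, 'd, 'k, 'y) mcat_scheme \<Rightarrow> ('o, 'm, 'k, 'z) lcat_scheme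
    \<Rightarrow> ('c, 'd, 'o, 'm) laction \<Rightarrow> ('c, 'd, 'o, 'm) raction
    \<Rightarrow> ('c, 'd) algebra_obj \<Rightarrow> ('c, 'd) algebra_obj \<Rightarrow> 'o \<times> 'm \<times> 'm \<Rightarrow> 'o \<times> 'm" where
  "ltens_rmod C M L R A B = (\<lambda>(U, \<rho>, \<sigma>). let (Q, q) = ltens C M L A (U, \<rho>) in
     (Q, desc M (Q \<lhd>\<^bsub>R\<^esub> aobj B) Q (q \<triangleleft>\<^bsub>R\<^esub> Id C (aobj B))
           (q \<cdot>\<^bsub>M\<^esub> (Id C (ldual C (aobj A)) \<triangleright>\<^bsub>L\<^esub> \<sigma>))))"

definition btens :: "('c, 'd, 'k, 'y) mcat_scheme \<Rightarrow> ('o, 'm, 'k, 'z) lcat_scheme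
    \<Rightarrow> ('c, 'd, 'o, 'm) laction \<Rightarrow> ('c, 'd, 'o, 'm) raction
    \<Rightarrow> ('c, 'd) algebra_obj \<Rightarrow> ('c, 'd) algebra_obj \<Rightarrow> 'o \<times> 'm \<times> 'm \<Rightarrow> 'o \<times> 'm" where
  "btens C M L R A B u = rtens C M R B (ltens_rmod C M L R A B u)"

definition btens_arr :: "('c, 'd, 'k, 'y) mcat_scheme \<Rightarrow> ('o, 'm, 'k, 'z) lcat_scheme
    \<Rightarrow> ('c, 'd, 'o, 'm) laction \<Rightarrow> ('c, 'd, 'o, 'm) raction
    \<Rightarrow> ('c, 'd) algebra_obj \<Rightarrow> ('c, 'd) algebra_obj
    \<Rightarrow> 'o \<times> 'm \<times> 'm \<Rightarrow> 'o \<times> 'm \<times> 'm \<Rightarrow> 'm \<Rightarrow> 'm" where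
  "btens_arr C M L R A B = (\<lambda>(U, \<rho>, \<sigma>) (V, \<rho>', \<sigma>') f.
     rtens_arr C M R B (ltens_rmod C M L R A B (U, \<rho>, \<sigma>)) (ltens_rmod C M L R A B (V, \<rho>', \<sigma>'))
       (ltens_arr C M L A (U, \<rho>) (V, \<rho>') f))"

definition btens_lact :: "('c, 'd, 'k, 'y) mcat_scheme \<Rightarrow> ('o, 'm, 'k, 'z) lcat_scheme
    \<Rightarrow> ('c, 'd, 'o, 'm) laction \<Rightarrow> ('c, 'd, 'o, 'm) raction
    \<Rightarrow> ('c, 'd) algebra_obj \<Rightarrow> ('c, 'd) algebra_obj \<Rightarrow> 'o \<times> 'm \<times> 'm \<Rightarrow> 'm" where
  "btens_lact C M L R A B = (\<lambda>(U, \<rho>, \<sigma>).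
     let (Q, q) = btens C M L R A B (U, \<rho>, \<sigma>); a'' = ldual C (ldual C (aobj A)) in
     desc M (a'' \<rhd>\<^bsub>L\<^esub> Q) Q (Id C a'' \<triangleright>\<^bsub>L\<^esub> q)
       (q \<cdot>\<^bsub>M\<^esub> (ltens_lact C M L A (U, \<rho>) \<triangleleft>\<^bsub>R\<^esub> Id C (rdual C (aobj B)))))"

definition btens_ract :: "('c, 'd, 'k, 'y) mcat_scheme \<Rightarrow> ('o, 'm, 'k, 'z) lcat_scheme
    \<Rightarrow> ('c, 'd, 'o, 'm) laction \<Rightarrow> ('c, 'd, 'o, 'm) raction
    \<Rightarrow> ('c, 'd) algebra_obj \<Rightarrow> ('c, 'd) algebra_obj \<Rightarrow> 'o \<times> 'm \<times> 'm \<Rightarrow> 'm" where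
  "btens_ract C M L R A B u = rtens_ract C M R B (ltens_rmod C M L R A B u)"


section \<open>The actions on values of the Nakayama functor\<close>

text \<open>
  The twisted structure isomorphisms \<open>\<^sup>\<or>\<^sup>\<or>X \<rhd> N(U) \<cong> N(X \<rhd> U)\<close> and \<open>N(U) \<lhd> X\<^sup>\<or>\<^sup>\<or> \<cong> N(U \<lhd> X)\<close>, which
  come from the adjunctions \<open>X \<rhd> (-) \<stileturn> \<^sup>\<or>X \<rhd> (-) \<stileturn> \<^sup>\<or>\<^sup>\<or>X \<rhd> (-)\<close> and
  \<open>(-) \<lhd> X \<stileturn> (-) \<lhd> X\<^sup>\<or> \<stileturn> (-) \<lhd> X\<^sup>\<or>\<^sup>\<or>\<close>.
\<close>

definition ltwist :: "('c, 'd, 'k::field, 'y) mcat_scheme \<Rightarrow> ('o, 'm, 'k, 'z) lcat_scheme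
    \<Rightarrow> ('c, 'd, 'o, 'm) laction \<Rightarrow> ('o, 'm, 'o, 'm) fctr \<Rightarrow> ('o \<Rightarrow> 'o \<Rightarrow> 'm) \<Rightarrow> 'c \<Rightarrow> 'o \<Rightarrow> 'm" where
  "ltwist C M L N i X U = nak_phi M M N i N i
     (lact_by C L X) (lact_by C L (rdual C X)) (lact_by C L (rdual C (rdual C X)))
     (\<lambda>W. rev_coev C X \<triangleright>\<^bsub>L\<^esub> Id M W) (\<lambda>W. rev_ev C (rdual C X) \<triangleright>\<^bsub>L\<^esub> Id M W) U"

definition rtwist :: "('c, 'd, 'k::field, 'y) mcat_scheme \<Rightarrow> ('o, 'm, 'k, 'z) lcat_scheme
    \<Rightarrow> ('c, 'd, 'o, 'm) raction \<Rightarrow> ('o, 'm, 'o, 'm) fctr \<Rightarrow> ('o \<Rightarrow> 'o \<Rightarrow> 'm) \<Rightarrow> 'c \<Rightarrow> 'o \<Rightarrow> 'm" where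
  "rtwist C M R N i X U = nak_phi M M N i N i
     (ract_by C R X) (ract_by C R (ldual C X)) (ract_by C R (ldual C (ldual C X)))
     (\<lambda>W. Id M W \<triangleleft>\<^bsub>R\<^esub> coev C X) (\<lambda>W. Id M W \<triangleleft>\<^bsub>R\<^esub> ev C (ldual C X)) U"

text \<open>
  The left \<open>A\<close>-action on \<open>N(Q)\<close> induced by \<open>\<alpha> : A\<^sup>\<or>\<^sup>\<or> \<rhd> Q \<rightarrow> Q\<close> and the right \<open>B\<close>-action on \<open>N(Q)\<close>
  induced by \<open>\<beta> : Q \<lhd> \<^sup>\<or>\<^sup>\<or>B \<rightarrow> Q\<close>.
\<close>

definition nak_lact :: "('c, 'd, 'k::field, 'y) mcat_scheme \<Rightarrow> ('o, 'm, 'k, 'z) lcat_scheme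
    \<Rightarrow> ('c, 'd, 'o, 'm) laction \<Rightarrow> ('c, 'd) algebra_obj
    \<Rightarrow> ('o, 'm, 'o, 'm) fctr \<Rightarrow> ('o \<Rightarrow> 'o \<Rightarrow> 'm) \<Rightarrow> 'o \<Rightarrow> 'm \<Rightarrow> 'm" where
  "nak_lact C M L A N i Q \<alpha> = (let a'' = ldual C (ldual C (aobj A)) in
     Fa N (a'' \<rhd>\<^bsub>L\<^esub> Q) Q \<alpha> \<cdot>\<^bsub>M\<^esub> ltwist C M L N i a'' Q)"

definition nak_ract :: "('c, 'd, 'k::field, 'y) mcat_scheme \<Rightarrow> ('o, 'm, 'k, 'z) lcat_scheme
    \<Rightarrow> ('c, 'd, 'o, 'm) raction \<Rightarrow> ('c, 'd) algebra_obj
    \<Rightarrow> ('o, 'm, 'o, 'm) fctr \<Rightarrow> ('o \<Rightarrow> 'o \<Rightarrow> 'm) \<Rightarrow> 'o \<Rightarrow> 'm \<Rightarrow> 'm" where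
  "nak_ract C M R B N i Q \<beta> = (let b'' = rdual C (rdual C (aobj B)) in
     Fa N (Q \<lhd>\<^bsub>R\<^esub> b'') Q \<beta> \<cdot>\<^bsub>M\<^esub> rtwist C M R N i b'' Q)"

text \<open>
  The functors \<open>N(A\<^sup>\<or> \<otimes>\<^sub>A -)\<close>, \<open>N(- \<otimes>\<^sub>B \<^sup>\<or>B)\<close> and \<open>N(A\<^sup>\<or> \<otimes>\<^sub>A - \<otimes>\<^sub>B \<^sup>\<or>B)\<close> on modules and bimodules,
  where \<open>(N, i)\<close> is the Nakayama functor of \<open>M\<close>.
\<close>

definition nak_left_modules :: "('c, 'd, 'k::field, 'y) mcat_scheme \<Rightarrow> ('o, 'm, 'k, 'z) lcat_scheme
    \<Rightarrow> ('c, 'd, 'o, 'm) laction \<Rightarrow> ('c, 'd) algebra_obj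
    \<Rightarrow> ('o, 'm, 'o, 'm) fctr \<Rightarrow> ('o \<Rightarrow> 'o \<Rightarrow> 'm) \<Rightarrow> ('o \<times> 'm, 'm, 'o \<times> 'm, 'm) fctr" where
  "nak_left_modules C M L A N i = \<lparr>
     Fo = (\<lambda>u. let Q = fst (ltens C M L A u) in
       (Fo N Q, nak_lact C M L A N i Q (ltens_lact C M L A u))),
     Fa = (\<lambda>u v f. Fa N (fst (ltens C M L A u)) (fst (ltens C M L A v)) (ltens_arr C M L A u v f))\<rparr>"

definition nak_right_modules :: "('c, 'd, 'k::field, 'y) mcat_scheme \<Rightarrow> ('o, 'm, 'k, 'z) lcat_scheme
    \<Rightarrow> ('c, 'd, 'o, 'm) raction \<Rightarrow> ('c, 'd) algebra_obj
    \<Rightarrow> ('o, 'm, 'o, 'm) fctr \<Rightarrow> ('o \<Rightarrow> 'o \<Rightarrow> 'm) \<Rightarrow> ('o \<times> 'm, 'm, 'o \<times> 'm, 'm) fctr" where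
  "nak_right_modules C M R B N i = \<lparr>
     Fo = (\<lambda>u. let Q = fst (rtens C M R B u) in
       (Fo N Q, nak_ract C M R B N i Q (rtens_ract C M R B u))),
     Fa = (\<lambda>u v f. Fa N (fst (rtens C M R B u)) (fst (rtens C M R B v)) (rtens_arr C M R B u v f))\<rparr>"

definition nak_bimodules :: "('c, 'd, 'k::field, 'y) mcat_scheme \<Rightarrow> ('o, 'm, 'k, 'z) lcat_scheme
    \<Rightarrow> ('c, 'd, 'o, 'm) laction \<Rightarrow> ('c, 'd, 'o, 'm) raction
    \<Rightarrow> ('c, 'd) algebra_obj \<Rightarrow> ('c, 'd) algebra_obj
    \<Rightarrow> ('o, 'm, 'o, 'm) fctr \<Rightarrow> ('o \<Rightarrow> 'o \<Rightarrow> 'm)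
    \<Rightarrow> ('o \<times> 'm \<times> 'm, 'm, 'o \<times> 'm \<times> 'm, 'm) fctr" where
  "nak_bimodules C M L R A B N i = \<lparr>
     Fo = (\<lambda>u. let Q = fst (btens C M L R A B u) in
       (Fo N Q, nak_lact C M L A N i Q (btens_lact C M L R A B u),
                nak_ract C M R B N i Q (btens_ract C M L R A B u))),
     Fa = (\<lambda>u v f. Fa N (fst (btens C M L R A B u)) (fst (btens C M L R A B v))
                     (btens_arr C M L R A B u v f))\<rparr>"

end

theory Submission
  imports Defs
begin

text \<open>
  Let \<open>D\<close> be the category of \<open>A\<close>-modules in \<open>M\<close>. Transposition along \<open>A\<^sup>\<or> \<rhd> (-) \<stileturn> A \<rhd> (-)\<close> identifies arrows
  \<open>A\<^sup>\<or> \<otimes>\<^sub>A x \<rightarrow> Y\<close> with module maps from \<open>x\<close> to the free module \<open>A \<rhd> Y\<close>. So \<open>P = A\<^sup>\<or> \<otimes>\<^sub>A (-)\<close> is left adjoint to the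
  free module functor, which is left adjoint to the forgetful functor. For such a chain of adjoints the
  Nakayama functors satisfy \<open>forget N\<^sub>D = N\<^sub>M P\<close>; what has to be controlled is the module structure, and this is
  done by writing down the universal family.

  A dinatural transformation out of \<open>Hom(x, y)\<^sup>* \<otimes> y\<close> is the same as a family of arrows \<open>y \<rightarrow> Z\<close> indexed by functionals
  \<open>\<xi>\<close> on \<open>Hom(x, y)\<close>, linear in \<open>\<xi>\<close> and natural in \<open>y\<close> (\<open>nak_dinatural_iff_family\<close>). Let \<open>j\<close> be the universal family of
  \<open>N\<^sub>M\<close>. An arrow \<open>f : P x \<rightarrow> y\<close> gives a module map \<open>t f : x \<rightarrow> y\<close>, by transposition followed by the action on \<open>y\<close>, and
  \<open>J x y \<xi> = j (P x) y (\<xi> \<circ> t)\<close> is the universal family of \<open>N\<^sub>D\<close>. Three things make this work.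

  \<^item> \<open>J x y \<xi>\<close> is a module map for the twisted action of \<open>A\<close> on \<open>N\<^sub>M (P x)\<close>. The twist \<open>A \<rhd> N(Q) \<cong> N(A\<^sup>\<or>\<^sup>\<or> \<rhd> Q)\<close> is
    characterized by its effect on \<open>j\<close> (\<open>is_twist\<close>, \<open>nak_phi_is_twist\<close>), so that the claim becomes an
    equation for \<open>t\<close>, which is associativity of the action on \<open>y\<close> (\<open>act_comu\<close>, \<open>tt_left\<close>, \<open>J_left\<close>).

  \<^item> \<open>J x\<close> is jointly epimorphic, because through free modules it contains all of \<open>j (P x)\<close> (\<open>jt_via_J\<close>). As
    \<open>A \<rhd> (-)\<close> has a right adjoint, it preserves jointly epimorphic families. So the module axioms for
    \<open>N\<^sub>M (P x)\<close>, linearity of the induced arrows and functoriality may all be checked on \<open>J\<close>.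

  \<^item> A family on \<open>D\<close>, restricted to free modules and composed with the units \<open>Y \<rightarrow> A \<rhd> Y\<close>, is a family on \<open>M\<close>;
    the universal property of \<open>j\<close> then yields the factorization (\<open>J_factor\<close>).

  The argument takes place at the level of the functors \<open>A\<^sup>\<or>\<^sup>\<or> \<rhd> (-) \<stileturn> A\<^sup>\<or> \<rhd> (-) \<stileturn> A \<rhd> (-) \<stileturn> \<^sup>\<or>A \<rhd> (-)\<close> and the monad structure of
  \<open>A \<rhd> (-)\<close>. It is carried out for two commuting monads of this kind, which gives bimodules; left modules are the case
  in which the second monad is the identity, and right modules are left modules for the reversed
  tensor product. Copowers exist because of finite colimits and of finite-dimensional hom spaces, both of which are transported
  from modules over a finite-dimensional algebra.
\<close>


section \<open>Vector spaces with finitely many coordinates\<close>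

lemma base_ring_simps [simp]:
  "carrier base_ring = UNIV" "mult base_ring = (*)" "one base_ring = 1" "zero base_ring = 0"
  "add base_ring = (+)"
  by (simp_all add: base_ring_def)

lemma cring_base_ring: "cring (base_ring :: 'k::field ring)"
proof (rule cringI)
  show "abelian_group (base_ring :: 'k ring)"
    by (rule abelian_groupI) (auto intro: exI[of _ "- x" for x])
  show "comm_monoid (base_ring :: 'k ring)"
    by (rule comm_monoidI) auto
qed (auto simp: algebra_simps)

lemma vector_space_onI:
  fixes V :: "('k::field, 'v) module" (structure)
  assumes "\<zero> \<in> carrier V"
    and "\<And>x y. x \<in> carrier V \<Longrightarrow> y \<in> carrier V \<Longrightarrow> x \<oplus> y \<in> carrier V"
    and "\<And>a x. x \<in> carrier V \<Longrightarrow> a \<odot> x \<in> carrier V"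
    and "\<And>x y z. x \<in> carrier V \<Longrightarrow> y \<in> carrier V \<Longrightarrow> z \<in> carrier V
      \<Longrightarrow> (x \<oplus> y) \<oplus> z = x \<oplus> (y \<oplus> z)"
    and "\<And>x y. x \<in> carrier V \<Longrightarrow> y \<in> carrier V \<Longrightarrow> x \<oplus> y = y \<oplus> x"
    and "\<And>x. x \<in> carrier V \<Longrightarrow> \<zero> \<oplus> x = x"
    and "\<And>a x y. x \<in> carrier V \<Longrightarrow> y \<in> carrier V
      \<Longrightarrow> a \<odot> (x \<oplus> y) = a \<odot> x \<oplus> a \<odot> y"
    and "\<And>a b x. x \<in> carrier V \<Longrightarrow> (a + b) \<odot> x = a \<odot> x \<oplus> b \<odot> x"
    and "\<And>a b x. x \<in> carrier V \<Longrightarrow> (a * b) \<odot> x = a \<odot> (b \<odot> x)"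
    and "\<And>x. x \<in> carrier V \<Longrightarrow> 1 \<odot> x = x"
    and "\<And>x. x \<in> carrier V \<Longrightarrow> 0 \<odot> x = \<zero>"
  shows "vector_space_on V"
proof (rule moduleI)
  show "cring (base_ring :: 'k ring)" by (rule cring_base_ring)
  show "abelian_group V"
  proof (rule abelian_groupI)
    fix x assume x: "x \<in> carrier V"
    have "(-1) \<odot> x \<oplus> x = \<zero>"
      using assms(8)[OF x, of "-1" 1] assms(10,11)[OF x] by simp
    with x assms(3) show "\<exists>y\<in>carrier V. y \<oplus> x = \<zero>" by blast
  qed (use assms in auto)
qed (use assms in auto)

locale vspace = module base_ring V for V :: "('k::field, 'v) module" (structure)
begin

lemmas zero_in = M.zero_closed
lemmas add_in = M.a_closed

lemma smult_in: "x \<in> carrier V \<Longrightarrow> a \<odot> x \<in> carrier V"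
  by (rule smult_closed) auto

lemma smult_add: "x \<in> carrier V \<Longrightarrow> y \<in> carrier V \<Longrightarrow> a \<odot> (x \<oplus> y) = a \<odot> x \<oplus> a \<odot> y"
  using smult_r_distr[of a x y] by simp

lemma add_smult: "x \<in> carrier V \<Longrightarrow> (a + b) \<odot> x = a \<odot> x \<oplus> b \<odot> x"
  using smult_l_distr[of a b x] by simp

lemma smult_smult: "x \<in> carrier V \<Longrightarrow> a \<odot> (b \<odot> x) = (a * b) \<odot> x"
  using smult_assoc1[of a b x] by simp

lemma one_smult: "x \<in> carrier V \<Longrightarrow> 1 \<odot> x = x"
  using smult_one[of x] by simp

lemma zero_smult: "x \<in> carrier V \<Longrightarrow> 0 \<odot> x = \<zero>"
  using smult_l_null[of x] by simp

lemma smult_zero: "a \<odot> \<zero> = \<zero>"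
  using smult_r_null[of a] by simp

lemma add_neg:
  assumes x: "x \<in> carrier V"
  shows "x \<oplus> (-1) \<odot> x = \<zero>" "(-1) \<odot> x \<oplus> x = \<zero>"
  using add_smult[OF x, of 1 "-1"] add_smult[OF x, of "-1" 1] x
  by (simp_all add: one_smult zero_smult)

lemma diff_add:
  assumes "x \<in> carrier V" "y \<in> carrier V"
  shows "(x \<oplus> (-1) \<odot> y) \<oplus> y = x"
  using assms by (simp add: M.add.m_assoc smult_in add_neg)

lemma diff_eq_zero:
  assumes "x \<in> carrier V" "y \<in> carrier V"
  shows "x \<oplus> (-1) \<odot> y = \<zero> \<longleftrightarrow> x = y"
  using diff_add[OF assms] assms by (auto simp: add_neg)

lemmas add_ac = M.add.m_assoc M.add.m_comm M.add.m_lcomm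

end

lemma vspaceI: "vector_space_on V \<Longrightarrow> vspace V"
  by (simp add: vspace_def)

definition subspace_of :: "'v set \<Rightarrow> ('k, 'v) module \<Rightarrow> bool" where
  "subspace_of I V \<longleftrightarrow> I \<subseteq> carrier V \<and> \<zero>\<^bsub>V\<^esub> \<in> I \<and> (\<forall>x\<in>I. \<forall>y\<in>I. x \<oplus>\<^bsub>V\<^esub> y \<in> I) \<and>
     (\<forall>a. \<forall>x\<in>I. a \<odot>\<^bsub>V\<^esub> x \<in> I)"

lemma vector_space_on_subspace:
  assumes "vector_space_on V" "subspace_of I V"
  shows "vector_space_on (V\<lparr>carrier := I\<rparr>)"
proof -
  interpret vspace V using assms(1) by (rule vspaceI)
  have I: "x \<in> I \<Longrightarrow> x \<in> carrier V" for x using assms(2) by (auto simp: subspace_of_def)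
  show ?thesis
    by (rule vector_space_onI)
      (use assms(2) in \<open>auto simp: subspace_of_def I add_ac smult_add add_smult
        smult_smult one_smult zero_smult\<close>)
qed

definition functional :: "('k::field, 'v) module \<Rightarrow> ('v \<Rightarrow> 'k) \<Rightarrow> bool" where
  "functional V \<phi> \<longleftrightarrow> (\<forall>v\<in>carrier V. \<forall>w\<in>carrier V. \<phi> (v \<oplus>\<^bsub>V\<^esub> w) = \<phi> v + \<phi> w) \<and>
     (\<forall>a. \<forall>v\<in>carrier V. \<phi> (a \<odot>\<^bsub>V\<^esub> v) = a * \<phi> v)"

text \<open>
  Finite-dimensionality in its dual form. It is inherited by subspaces and along injective linear maps without
  a choice of bases, and it is self-dual.
\<close>

definition finite_coords :: "('k::field, 'v) module \<Rightarrow> bool" where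
  "finite_coords V \<longleftrightarrow> (\<exists>\<Phi>. finite \<Phi> \<and> (\<forall>\<phi>\<in>\<Phi>. functional V \<phi>) \<and>
     (\<forall>v\<in>carrier V. (\<forall>\<phi>\<in>\<Phi>. \<phi> v = 0) \<longrightarrow> v = \<zero>\<^bsub>V\<^esub>))"

lemma carrier_dual_space:
  "\<xi> \<in> carrier (dual_space V) \<longleftrightarrow> functional V \<xi> \<and> \<xi> \<in> extensional (carrier V)"
  by (auto simp: dual_space_def functional_def)

lemma dual_space_simps:
  "add (dual_space V) \<xi> \<zeta> = (\<lambda>v\<in>carrier V. \<xi> v + \<zeta> v)"
  "smult (dual_space V) a \<xi> = (\<lambda>v\<in>carrier V. a * \<xi> v)"
  "zero (dual_space V) = (\<lambda>v\<in>carrier V. 0)"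
  by (simp_all add: dual_space_def)

lemma functional_zero: "vector_space_on V \<Longrightarrow> functional V \<phi> \<Longrightarrow> \<phi> \<zero>\<^bsub>V\<^esub> = 0"
  unfolding functional_def
  by (metis vspace.zero_smult vspace.zero_in vspaceI mult_zero_left)

lemma vector_space_on_dual:
  assumes "vector_space_on V"
  shows "vector_space_on (dual_space V)"
proof -
  interpret vspace V using assms by (rule vspaceI)
  show ?thesis
  proof (rule vector_space_onI)
    fix x assume "x \<in> carrier (dual_space V)"
    then have "x \<in> extensional (carrier V)" by (simp add: carrier_dual_space)
    then show "zero (dual_space V) \<oplus>\<^bsub>dual_space V\<^esub> x = x" "1 \<odot>\<^bsub>dual_space V\<^esub> x = x"
      by (auto simp: dual_space_simps fun_eq_iff extensional_def)
  qed (simp_all add: carrier_dual_space dual_space_simps functional_def algebra_simps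
      add_in smult_in zero_in fun_eq_iff)
qed

lemma subspace_eq:
  "functional V \<phi> \<Longrightarrow> vector_space_on V \<Longrightarrow> subspace_of {v \<in> carrier V. \<phi> v = 0} V"
  unfolding subspace_of_def
  by (auto simp: functional_zero vspace.zero_in vspaceI vspace.add_in vspace.smult_in)
    (simp_all add: functional_def)

text \<open>Generation is restated by subspaces, so that the inductions below need no linear combinations.\<close>

lemma fin_dim_generators:
  fixes V (structure)
  assumes V: "vector_space_on V" and "fin_dim V"
  shows "\<exists>S. finite S \<and> S \<subseteq> carrier V \<and> (\<forall>I. subspace_of I V \<and> S \<subseteq> I \<longrightarrow> I = carrier V)"
proof -
  interpret vspace V using V by (rule vspaceI)
  obtain S where S: "finite S" "S \<subseteq> carrier V"
    "\<And>v. v \<in> carrier V \<Longrightarrow> \<exists>c. v = (\<Oplus>s\<in>S. c s \<odot> s)"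
    using assms(2) unfolding fin_dim_def by blast
  have "I = carrier V" if I: "subspace_of I V" "S \<subseteq> I" for I
  proof -
    have sum: "(\<Oplus>s\<in>T. c s \<odot> s) \<in> I" if "finite T" "T \<subseteq> S" for c T
      using that
    proof (induction rule: finite_induct)
      case empty then show ?case using I by (simp add: subspace_of_def)
    next
      case (insert x F)
      then have "(\<Oplus>s\<in>insert x F. c s \<odot> s) = c x \<odot> x \<oplus> (\<Oplus>s\<in>F. c s \<odot> s)"
        using S(2) by (subst finsum_insert) (auto intro!: smult_in)
      with insert I show ?case by (auto simp: subspace_of_def)
    qed
    show ?thesis
    proof
      show "I \<subseteq> carrier V" using I by (simp add: subspace_of_def)
      show "carrier V \<subseteq> I" using S(3) sum[OF S(1) order_refl] by auto
    qed
  qed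
  with S show ?thesis by blast
qed

lemma generators_fin_dim:
  fixes V (structure)
  assumes V: "vector_space_on V" and S: "finite S" "S \<subseteq> carrier V"
    and gen: "\<And>I. subspace_of I V \<Longrightarrow> S \<subseteq> I \<Longrightarrow> I = carrier V"
  shows "fin_dim V"
proof -
  interpret vspace V using V by (rule vspaceI)
  define I where "I = {v. \<exists>c. v = (\<Oplus>s\<in>S. c s \<odot> s)}"
  have cl: "(\<lambda>s. c s \<odot> s) \<in> S \<rightarrow> carrier V" for c
    using S by (auto intro!: smult_in)
  have "subspace_of I V"
    unfolding subspace_of_def
  proof (intro conjI ballI allI)
    show "I \<subseteq> carrier V" using cl by (auto simp: I_def)
    have "(\<Oplus>s\<in>S. 0 \<odot> s) = \<zero>"
      using S finsum_cong'[of S S "\<lambda>s. \<zero>" "\<lambda>s. 0 \<odot> s"]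
      by (auto simp: zero_smult subset_eq)
    then show "\<zero> \<in> I" by (auto simp: I_def intro!: exI[of _ "\<lambda>_. 0"])
  next
    fix x y assume "x \<in> I" "y \<in> I"
    then obtain c d where xy: "x = (\<Oplus>s\<in>S. c s \<odot> s)" "y = (\<Oplus>s\<in>S. d s \<odot> s)"
      by (auto simp: I_def)
    have "x \<oplus> y = (\<Oplus>s\<in>S. c s \<odot> s \<oplus> d s \<odot> s)"
      unfolding xy by (rule finsum_addf[symmetric]) (use cl in auto)
    also have "\<dots> = (\<Oplus>s\<in>S. (c s + d s) \<odot> s)"
      by (rule finsum_cong') (use S in \<open>auto simp: add_smult smult_in\<close>)
    finally show "x \<oplus> y \<in> I" unfolding I_def by (auto intro!: exI[of _ "\<lambda>s. c s + d s"])
  next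
    fix a x assume "x \<in> I"
    then obtain c where x: "x = (\<Oplus>s\<in>S. c s \<odot> s)" by (auto simp: I_def)
    have "a \<odot> x = (\<Oplus>s\<in>S. a \<odot> (c s \<odot> s))"
      unfolding x by (rule finsum_smult_ldistr) (use cl S in auto)
    also have "\<dots> = (\<Oplus>s\<in>S. (a * c s) \<odot> s)"
      by (rule finsum_cong') (use S in \<open>auto simp: smult_smult smult_in\<close>)
    finally show "a \<odot> x \<in> I" unfolding I_def by (auto intro!: exI[of _ "\<lambda>s. a * c s"])
  qed
  moreover have "S \<subseteq> I"
  proof
    fix t assume t: "t \<in> S"
    have "(\<Oplus>s\<in>S. (if s = t then 1 else 0) \<odot> s) = (\<Oplus>s\<in>S. if t = s then s else \<zero>)"
      by (rule finsum_cong') (use S in \<open>auto simp: one_smult zero_smult\<close>)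
    also have "\<dots> = t"
      using finsum_singleton[OF t S(1), of "\<lambda>s. s"] S by auto
    finally show "t \<in> I" unfolding I_def by (auto intro!: exI[of _ "\<lambda>s. if s = t then 1 else 0"])
  qed
  ultimately have "I = carrier V" using gen by blast
  with S show ?thesis unfolding fin_dim_def I_def by blast
qed

lemma functional_diff:
  fixes V (structure)
  assumes "functional V \<phi>" "vector_space_on V" "v \<in> carrier V" "w \<in> carrier V"
  shows "\<phi> (v \<oplus> a \<odot> w) = \<phi> v + a * \<phi> w"
  using assms vspace.smult_in[OF vspaceI[OF assms(2)]] by (simp add: functional_def)

lemma subspace_of_plus_line:
  fixes V (structure)
  assumes V: "vector_space_on V" and I: "subspace_of I V" and s: "s \<in> carrier V"
  shows "subspace_of {i \<oplus> a \<odot> s | i a. i \<in> I} V" (is "subspace_of ?J V")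
proof -
  interpret vspace V using V by (rule vspaceI)
  have I': "I \<subseteq> carrier V" "\<zero> \<in> I" "\<And>x y. x \<in> I \<Longrightarrow> y \<in> I \<Longrightarrow> x \<oplus> y \<in> I"
    "\<And>a x. x \<in> I \<Longrightarrow> a \<odot> x \<in> I"
    using I by (auto simp: subspace_of_def)
  show ?thesis
    unfolding subspace_of_def
  proof (intro conjI ballI allI)
    show "?J \<subseteq> carrier V" using I' s by (auto intro!: add_in smult_in)
    show "\<zero> \<in> ?J" using I' s by (auto intro!: exI[of _ "\<zero>"] exI[of _ 0] simp: zero_smult)
  next
    fix x y assume "x \<in> ?J" "y \<in> ?J"
    then obtain i a j b where *: "i \<in> I" "j \<in> I" "x = i \<oplus> a \<odot> s" "y = j \<oplus> b \<odot> s" by blast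
    have "i \<in> carrier V" "j \<in> carrier V" using * I' by auto
    then have "x \<oplus> y = (i \<oplus> j) \<oplus> (a + b) \<odot> s"
      using s * by (simp add: add_smult smult_in add_ac)
    then show "x \<oplus> y \<in> ?J" using * I' by blast
  next
    fix c x assume "x \<in> ?J"
    then obtain i a where *: "i \<in> I" "x = i \<oplus> a \<odot> s" by blast
    have "i \<in> carrier V" using * I' by auto
    then have "c \<odot> x = c \<odot> i \<oplus> (c * a) \<odot> s"
      using s * by (simp add: smult_add smult_smult smult_in)
    then show "c \<odot> x \<in> ?J" using * I' by blast
  qed
qed

text \<open>
  Both quotients and coordinates come from a complement of a subspace. The induction adds the
  generators to the subspace one at a time; the functional that is gained with a generator \<open>s\<close>
  reads off the coefficient of \<open>s\<close> in the error \<open>v - p v\<close> of the map \<open>p\<close> for the bigger subspace.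
\<close>

lemma projection_modulo_subspace:
  fixes V (structure)
  assumes V: "vector_space_on V" and "finite S"
    and "S \<subseteq> carrier V" and "subspace_of I V"
    and "\<And>J. subspace_of J V \<Longrightarrow> I \<union> S \<subseteq> J \<Longrightarrow> J = carrier V"
  shows "\<exists>p \<Phi>. p \<in> lin V V \<and> finite \<Phi> \<and> (\<forall>\<phi>\<in>\<Phi>. functional V \<phi>) \<and> (\<forall>v\<in>I. p v = \<zero>) \<and>
    (\<forall>v\<in>carrier V. \<exists>i\<in>I. p v \<oplus> i = v) \<and>
    (\<forall>v\<in>carrier V. (\<forall>\<phi>\<in>\<Phi>. \<phi> v = 0) \<longrightarrow> p v = \<zero>)"
  using assms(2-)
proof (induction arbitrary: I rule: finite_induct)
  case empty
  interpret vspace V using V by (rule vspaceI)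
  have "I = carrier V" using empty(3)[OF empty(2)] by auto
  then show ?case
    by (intro exI[of _ "\<lambda>_. \<zero>"] exI[of _ "{}"]) (auto simp: lin_def smult_zero)
next
  case (insert s S)
  interpret vspace V using V by (rule vspaceI)
  have s: "s \<in> carrier V" using insert.prems by auto
  have I': "I \<subseteq> carrier V" "\<zero> \<in> I" "\<And>x y. x \<in> I \<Longrightarrow> y \<in> I \<Longrightarrow> x \<oplus> y \<in> I"
    "\<And>a x. x \<in> I \<Longrightarrow> a \<odot> x \<in> I"
    using insert.prems(2) by (auto simp: subspace_of_def)
  show ?case
  proof (cases "s \<in> I")
    case True
    then have "\<And>J. subspace_of J V \<Longrightarrow> I \<union> S \<subseteq> J \<Longrightarrow> J = carrier V"
      using insert.prems(3) by auto
    with insert.IH[OF _ insert.prems(2)] insert.prems(1) show ?thesis by auto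
  next
    case False
    define I2 where "I2 = {i \<oplus> a \<odot> s | i a. i \<in> I}"
    have sub: "subspace_of I2 V"
      unfolding I2_def by (rule subspace_of_plus_line[OF V insert.prems(2) s])
    have sI2: "s \<in> I2" using I' s by (auto simp: I2_def intro!: exI[of _ "\<zero>"] exI[of _ 1] simp: one_smult)
    have II2: "I \<subseteq> I2"
    proof
      fix i assume "i \<in> I"
      then show "i \<in> I2" using I' s by (auto simp: I2_def intro!: exI[of _ i] exI[of _ 0] simp: zero_smult)
    qed
    obtain p \<Phi> where p: "p \<in> lin V V" "finite \<Phi>" "\<forall>\<phi>\<in>\<Phi>. functional V \<phi>" "\<forall>v\<in>I2. p v = \<zero>"
        "\<forall>v\<in>carrier V. \<exists>i\<in>I2. p v \<oplus> i = v"
        "\<forall>v\<in>carrier V. (\<forall>\<phi>\<in>\<Phi>. \<phi> v = 0) \<longrightarrow> p v = \<zero>"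
    proof -
      have "J = carrier V" if "subspace_of J V" "I2 \<union> S \<subseteq> J" for J
        using insert.prems(3)[OF that(1)] that(2) sI2 II2 by auto
      with insert.IH[OF _ sub] insert.prems(1) show ?thesis using that by auto
    qed
    have pin: "p v \<in> carrier V" if "v \<in> carrier V" for v using p(1) that by (auto simp: lin_def)
    have padd: "p (v \<oplus> w) = p v \<oplus> p w" if "v \<in> carrier V" "w \<in> carrier V" for v w
      using p(1) that by (auto simp: lin_def)
    have psm: "p (a \<odot> w) = a \<odot> p w" if "w \<in> carrier V" for a w
      using p(1) that by (auto simp: lin_def)
    have uniq: "a = b" if "i \<in> I" "j \<in> I" "i \<oplus> a \<odot> s = j \<oplus> b \<odot> s" for i j a b
    proof (rule ccontr)
      assume "a \<noteq> b"
      have ij: "i \<in> carrier V" "j \<in> carrier V" using that I' by auto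
      have "(a - b) \<odot> s = ((-1) \<odot> i \<oplus> (i \<oplus> a \<odot> s)) \<oplus> (-b) \<odot> s"
        using ij s add_smult[of s a "-b"] by (simp add: smult_in M.add.m_assoc[symmetric] add_neg)
      also have "\<dots> = (-1) \<odot> i \<oplus> j"
      proof -
        have "b \<odot> s \<oplus> (-b) \<odot> s = \<zero>"
          using add_smult[of s b "-b"] s by (simp add: zero_smult)
        then show ?thesis using ij s by (simp add: that(3) smult_in M.add.m_assoc)
      qed
      finally have "(a - b) \<odot> s \<in> I" using I' that by auto
      then have "inverse (a - b) \<odot> ((a - b) \<odot> s) \<in> I" using I' by blast
      then show False using False s \<open>a \<noteq> b\<close> by (simp add: smult_smult one_smult)
    qed
    have "\<exists>a. \<exists>i\<in>I. v = p v \<oplus> (i \<oplus> a \<odot> s)" if v: "v \<in> carrier V" for v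
    proof -
      obtain j where j: "j \<in> I2" "p v \<oplus> j = v" using p(5) v by blast
      from j(1) obtain i a where ia: "i \<in> I" "j = i \<oplus> a \<odot> s" by (auto simp: I2_def)
      from j(2) have "v = p v \<oplus> (i \<oplus> a \<odot> s)" unfolding ia(2) by (rule sym)
      then show ?thesis using ia(1) by blast
    qed
    then have "\<forall>v. \<exists>a. v \<in> carrier V \<longrightarrow> (\<exists>i\<in>I. v = p v \<oplus> (i \<oplus> a \<odot> s))" by blast
    then obtain c
      where c': "\<forall>v. v \<in> carrier V \<longrightarrow> (\<exists>i\<in>I. v = p v \<oplus> (i \<oplus> c v \<odot> s))"
      by (rule exE[OF choice])
    have c: "\<exists>i\<in>I. v = p v \<oplus> (i \<oplus> c v \<odot> s)" if "v \<in> carrier V" for v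
      by (rule c'[rule_format, OF that])
    have cuniq: "c v = a" if vV: "v \<in> carrier V" and iI: "i \<in> I" and vE: "v = p v \<oplus> (i \<oplus> a \<odot> s)" for v i a
    proof -
      obtain j where j: "j \<in> I" "v = p v \<oplus> (j \<oplus> c v \<odot> s)"
        using c[OF vV] by (rule bexE)
      have eq: "p v \<oplus> (i \<oplus> a \<odot> s) = p v \<oplus> (j \<oplus> c v \<odot> s)"
        by (rule trans[OF vE[symmetric] j(2)])
      have "i \<in> carrier V" "j \<in> carrier V" using iI j(1) I' by auto
      then have "i \<oplus> a \<odot> s = j \<oplus> c v \<odot> s"
        using eq s pin[OF vV] by (simp add: smult_in)
      then show ?thesis by (rule uniq[OF iI j(1), symmetric])
    qed
    have cf: "functional V c"
      unfolding functional_def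
    proof (intro conjI ballI allI)
      fix v w assume vw: "v \<in> carrier V" "w \<in> carrier V"
      obtain i j where ij: "i \<in> I" "v = p v \<oplus> (i \<oplus> c v \<odot> s)" "j \<in> I" "w = p w \<oplus> (j \<oplus> c w \<odot> s)"
        using c[OF vw(1)] c[OF vw(2)] by (elim bexE)
      have ijV: "i \<in> carrier V" "j \<in> carrier V" using ij(1,3) I' by auto
      have "v \<oplus> w = (p v \<oplus> (i \<oplus> c v \<odot> s)) \<oplus> (p w \<oplus> (j \<oplus> c w \<odot> s))"
        by (rule arg_cong2[OF ij(2,4)])
      also have "\<dots> = p (v \<oplus> w) \<oplus> ((i \<oplus> j) \<oplus> (c v + c w) \<odot> s)"
        using ijV s vw by (simp add: padd pin add_smult smult_in add_ac)
      finally show "c (v \<oplus> w) = c v + c w"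
        by (rule cuniq[rotated 2]) (use vw ij(1,3) I' in auto)
    next
      fix a v assume v: "v \<in> carrier V"
      obtain i where ij: "i \<in> I" "v = p v \<oplus> (i \<oplus> c v \<odot> s)"
        using c[OF v] by (rule bexE)
      have ijV: "i \<in> carrier V" using ij(1) I' by auto
      have "a \<odot> v = a \<odot> (p v \<oplus> (i \<oplus> c v \<odot> s))"
        by (rule arg_cong[OF ij(2)])
      also have "\<dots> = p (a \<odot> v) \<oplus> (a \<odot> i \<oplus> (a * c v) \<odot> s)"
        using ijV s v by (simp add: psm pin smult_add smult_smult smult_in)
      finally show "c (a \<odot> v) = a * c v"
        by (rule cuniq[rotated 2]) (use v ij(1) I' in \<open>auto simp: smult_in\<close>)
    qed
    have c_add: "c (v \<oplus> w) = c v + c w" if "v \<in> carrier V" "w \<in> carrier V" for v w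
      using cf that by (simp add: functional_def)
    have c_sm: "c (a \<odot> v) = a * c v" if "v \<in> carrier V" for v a
      using cf that by (simp add: functional_def)
    \<comment> \<open>\<open>v - p v = i + c v s\<close> with \<open>i \<in> I\<close>; \<open>q\<close> absorbs the part along \<open>s\<close>.\<close>
    define q where "q v = p v \<oplus> c v \<odot> s" for v
    show ?thesis
    proof (intro exI[of _ q] exI[of _ "insert c \<Phi>"] conjI ballI impI)
      show "q \<in> lin V V"
        using s unfolding lin_def q_def
        by (auto simp: padd psm pin smult_in c_add c_sm add_smult smult_add smult_smult add_ac)
      show "finite (insert c \<Phi>)" using p by simp
      show "functional V \<phi>" if "\<phi> \<in> insert c \<Phi>" for \<phi> using p cf that by auto
      show "q v = \<zero>" if v: "v \<in> I" for v
      proof -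
        have vV: "v \<in> carrier V" using v I' by auto
        have pv: "p v = \<zero>" using p(4) II2 v by auto
        have "c v = 0"
          by (rule cuniq[OF vV v]) (use vV s in \<open>simp add: pv zero_smult\<close>)
        then show ?thesis using pv s by (simp add: q_def zero_smult)
      qed
      show "\<exists>i\<in>I. q v \<oplus> i = v" if v: "v \<in> carrier V" for v
      proof -
        obtain i where i: "i \<in> I" "v = p v \<oplus> (i \<oplus> c v \<odot> s)"
          using c[OF v] by (rule bexE)
        have "i \<in> carrier V" using i(1) I' by auto
        then have "p v \<oplus> (i \<oplus> c v \<odot> s) = q v \<oplus> i"
          using s pin[OF v] by (simp add: q_def add_ac smult_in)
        with i(2) have "v = q v \<oplus> i" by (rule trans)
        then have "q v \<oplus> i = v" by (rule sym)
        then show ?thesis using i(1) by blast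
      qed
      show "q v = \<zero>" if "v \<in> carrier V" "\<forall>\<phi>\<in>insert c \<Phi>. \<phi> v = 0" for v
        using p that s by (auto simp: q_def zero_smult)
    qed
  qed
qed

lemma fin_dim_projection:
  fixes V (structure)
  assumes V: "vector_space_on V" and "fin_dim V" and I: "subspace_of I V"
  shows "\<exists>p\<in>lin V V. (\<forall>v\<in>I. p v = \<zero>) \<and> (\<forall>v\<in>carrier V. \<exists>i\<in>I. p v \<oplus> i = v)"
proof -
  obtain S where "finite S \<and> S \<subseteq> carrier V \<and> (\<forall>I. subspace_of I V \<and> S \<subseteq> I \<longrightarrow> I = carrier V)"
    using fin_dim_generators[OF assms(1,2)] by (rule exE)
  then have S: "finite S" "S \<subseteq> carrier V" "\<And>I. subspace_of I V \<Longrightarrow> S \<subseteq> I \<Longrightarrow> I = carrier V"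
    by simp_all
  have "\<And>J. subspace_of J V \<Longrightarrow> I \<union> S \<subseteq> J \<Longrightarrow> J = carrier V" by (rule S(3)) simp_all
  from projection_modulo_subspace[OF V S(1,2) I this] show ?thesis by blast
qed

lemma fin_dim_imp_finite_coords:
  fixes V (structure)
  assumes V: "vector_space_on V" and "fin_dim V"
  shows "finite_coords V"
proof -
  interpret vspace V using V by (rule vspaceI)
  obtain S where "finite S \<and> S \<subseteq> carrier V \<and> (\<forall>I. subspace_of I V \<and> S \<subseteq> I \<longrightarrow> I = carrier V)"
    using fin_dim_generators[OF assms(1,2)] by (rule exE)
  then have S: "finite S" "S \<subseteq> carrier V" "\<And>I. subspace_of I V \<Longrightarrow> S \<subseteq> I \<Longrightarrow> I = carrier V"
    by simp_all
  have z: "subspace_of {\<zero>} V" by (auto simp: subspace_of_def smult_zero)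
  have "\<And>J. subspace_of J V \<Longrightarrow> {\<zero>} \<union> S \<subseteq> J \<Longrightarrow> J = carrier V" by (rule S(3)) simp_all
  note * = projection_modulo_subspace[OF V S(1,2) z this]
  from * obtain p \<Phi> where p: "p \<in> lin V V" "finite \<Phi>" "\<forall>\<phi>\<in>\<Phi>. functional V \<phi>"
    "\<forall>v\<in>carrier V. \<exists>i\<in>{\<zero>}. p v \<oplus> i = v"
    "\<forall>v\<in>carrier V. (\<forall>\<phi>\<in>\<Phi>. \<phi> v = 0) \<longrightarrow> p v = \<zero>"
    by blast
  have "v = \<zero>" if v: "v \<in> carrier V" "\<forall>\<phi>\<in>\<Phi>. \<phi> v = 0" for v
  proof -
    have "p v = \<zero>" using p(5) v by blast
    moreover have "p v \<oplus> \<zero> = v" using p(4) v(1) by blast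
    ultimately show ?thesis by simp
  qed
  then show ?thesis unfolding finite_coords_def using p(2,3) by blast
qed

lemma finite_coords_injective:
  fixes V (structure)
  assumes "f \<in> lin V W" "finite_coords W" "\<And>v. v \<in> carrier V \<Longrightarrow> f v = \<zero>\<^bsub>W\<^esub> \<Longrightarrow> v = \<zero>"
  shows "finite_coords V"
proof -
  obtain \<Phi> where "finite \<Phi>" "\<forall>\<phi>\<in>\<Phi>. functional W \<phi>"
     "\<forall>v\<in>carrier W. (\<forall>\<phi>\<in>\<Phi>. \<phi> v = 0) \<longrightarrow> v = \<zero>\<^bsub>W\<^esub>"
    using assms(2) by (auto simp: finite_coords_def)
  note \<Phi> = this
  show ?thesis
    unfolding finite_coords_def
  proof (intro exI[of _ "(\<lambda>\<phi> v. \<phi> (f v)) ` \<Phi>"] conjI ballI impI)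
    fix v assume v: "v \<in> carrier V" "\<forall>\<phi>\<in>(\<lambda>\<phi> v. \<phi> (f v)) ` \<Phi>. \<phi> v = 0"
    have "f v \<in> carrier W" using assms(1) v(1) by (auto simp: lin_def)
    moreover have "\<forall>\<phi>\<in>\<Phi>. \<phi> (f v) = 0" using v(2) by simp
    ultimately have "f v = \<zero>\<^bsub>W\<^esub>" using \<Phi>(3) by simp
    then show "v = \<zero>" by (rule assms(3)[OF v(1)])
  qed (use \<Phi> assms(1) in \<open>auto simp: functional_def lin_def Pi_iff\<close>)
qed

lemma finite_coords_subspace:
  assumes "finite_coords V" "subspace_of I V"
  shows "finite_coords (V\<lparr>carrier := I\<rparr>)"
  by (rule finite_coords_injective[OF _ assms(1), of "\<lambda>x. x"])
    (use assms in \<open>auto simp: lin_def subspace_of_def\<close>)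

text \<open>
  A nonzero coordinate splits off a line. This is the induction step for everything about a
  space with finitely many coordinates.
\<close>

lemma finite_coords_induct [consumes 2, case_names zero line]:
  fixes V (structure)
  assumes V: "vector_space_on V" and "finite_coords V"
    and zero: "\<And>I. subspace_of I V \<Longrightarrow> I = {\<zero>} \<Longrightarrow> P I"
    and line: "\<And>I J \<phi> w. \<lbrakk>subspace_of I V; subspace_of J V; w \<in> I; functional (V\<lparr>carrier := I\<rparr>) \<phi>;
      \<phi> w = 1; J = {v \<in> I. \<phi> v = 0}; P J\<rbrakk> \<Longrightarrow> P I"
  shows "P (carrier V)"
proof -
  interpret vspace V using V by (rule vspaceI)
  have "P I" if "finite \<Phi>" "\<forall>\<phi>\<in>\<Phi>. functional V \<phi>" "subspace_of I V"
    "\<forall>v\<in>I. (\<forall>\<phi>\<in>\<Phi>. \<phi> v = 0) \<longrightarrow> v = \<zero>" for \<Phi> I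
    using that
  proof (induction arbitrary: I rule: finite_induct)
    case empty
    then have "I \<subseteq> {\<zero>}" "\<zero> \<in> I" by (blast, simp add: subspace_of_def)
    then show ?case by (intro zero[OF empty(2)]) blast
  next
    case (insert \<phi> \<Phi>)
    have I: "I \<subseteq> carrier V" "\<And>v. v \<in> I \<Longrightarrow> v \<in> carrier V" using insert.prems by (auto simp: subspace_of_def)
    show ?case
    proof (cases "\<forall>v\<in>I. \<phi> v = 0")
      case True
      then have "\<forall>v\<in>I. (\<forall>\<phi>\<in>\<Phi>. \<phi> v = 0) \<longrightarrow> v = \<zero>" using insert.prems(3) by blast
      with insert.prems(1,2) show ?thesis by (intro insert.IH) simp_all
    next
      case False
      then obtain w0 where w0: "w0 \<in> I" "\<phi> w0 \<noteq> 0" by auto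
      define w where "w = inverse (\<phi> w0) \<odot> w0"
      have w: "w \<in> I" using w0 insert.prems by (auto simp: w_def subspace_of_def)
      have "\<phi> w = inverse (\<phi> w0) * \<phi> w0"
        using insert.prems(1) w0(1) I by (auto simp: functional_def w_def)
      then have pw: "\<phi> w = 1" using w0 by simp
      define J where "J = {v \<in> I. \<phi> v = 0}"
      have fI: "functional (V\<lparr>carrier := I\<rparr>) \<phi>" using insert.prems I by (auto simp: functional_def)
      have "subspace_of J (V\<lparr>carrier := I\<rparr>)"
        using subspace_eq[OF fI vector_space_on_subspace[OF V insert.prems(2)]] by (simp add: J_def)
      then have J: "subspace_of J V" using I by (auto simp: subspace_of_def)
      have "\<forall>v\<in>J. (\<forall>\<phi>\<in>\<Phi>. \<phi> v = 0) \<longrightarrow> v = \<zero>"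
        using insert.prems(3) unfolding J_def by blast
      with insert.prems(1) J have "P J" by (intro insert.IH) simp_all
      then show ?thesis using line[OF insert.prems(2) J w fI pw] by (simp add: J_def)
    qed
  qed
  moreover have "subspace_of (carrier V) V" by (auto simp: subspace_of_def smult_in)
  ultimately show ?thesis using assms(2) unfolding finite_coords_def by (elim exE conjE)
qed

text \<open>
  The vectors \<open>w\<close> that are split off one after the other form a basis; as coordinates on the dual space they
  only have to separate functionals.
\<close>

lemma finite_coords_test_vectors:
  fixes V (structure)
  assumes V: "vector_space_on V" and "finite_coords V"
  shows "\<exists>B. finite B \<and> B \<subseteq> carrier V \<and>
    (\<forall>\<xi>. functional V \<xi> \<longrightarrow> (\<forall>b\<in>B. \<xi> b = 0) \<longrightarrow> (\<forall>v\<in>carrier V. \<xi> v = 0))"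
  using assms
proof (induction rule: finite_coords_induct)
  case (zero I)
  interpret vspace V using V by (rule vspaceI)
  show ?case using functional_zero[OF V] unfolding zero(2) by (intro exI[of _ "{}"]) simp
next
  case (line I J \<phi> w)
  interpret vspace V using V by (rule vspaceI)
  obtain B where B: "finite B" "B \<subseteq> J"
    "\<And>\<xi> v. functional V \<xi> \<Longrightarrow> (\<forall>b\<in>B. \<xi> b = 0) \<Longrightarrow> v \<in> J \<Longrightarrow> \<xi> v = 0"
    using line(7) by (elim exE conjE) (rule that, assumption+, blast)
  have I: "I \<subseteq> carrier V" using line(1) by (auto simp: subspace_of_def)
  show ?case
  proof (intro exI[of _ "insert w B"] conjI allI impI ballI)
    show "insert w B \<subseteq> I" using B(2) line(3,6) by auto
    show "finite (insert w B)" using B by simp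
    fix \<xi> v assume \<xi>: "functional V \<xi>" "\<forall>b\<in>insert w B. \<xi> b = 0" and v: "v \<in> I"
    have vI: "v \<oplus> (- \<phi> v) \<odot> w \<in> I"
      using line(1,3) v by (simp add: subspace_of_def)
    have "\<phi> (v \<oplus> (- \<phi> v) \<odot> w) = 0"
      using functional_diff[OF line(4) vector_space_on_subspace[OF V line(1)], of v w "- \<phi> v"] line(3,5) v
      by simp
    then have "\<xi> (v \<oplus> (- \<phi> v) \<odot> w) = 0" using \<xi>(2) vI line(6) by (intro B(3)[OF \<xi>(1)]) simp_all
    then show "\<xi> v = 0"
      using functional_diff[OF \<xi>(1) V, of v w "- \<phi> v"] line(3) \<xi>(2) v I by (simp add: subset_eq)
  qed
qed

lemma finite_coords_dual:
  assumes V: "vector_space_on V" and "finite_coords V"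
  shows "finite_coords (dual_space V)"
proof -
  obtain B where B: "finite B" "B \<subseteq> carrier V"
    "\<And>\<xi> v. functional V \<xi> \<Longrightarrow> (\<forall>b\<in>B. \<xi> b = 0) \<Longrightarrow> v \<in> carrier V \<Longrightarrow> \<xi> v = 0"
    using finite_coords_test_vectors[OF assms]
    by (elim exE conjE) (rule that, assumption+, blast)
  show ?thesis
    unfolding finite_coords_def
    by (intro exI[of _ "(\<lambda>b \<xi>. \<xi> b) ` B"])
      (use B in \<open>auto simp: carrier_dual_space dual_space_simps functional_def subset_eq fun_eq_iff
        extensional_def restrict_def\<close>)
qed

section \<open>Linear maps\<close>

lemma linD:
  fixes V (structure)
  assumes "f \<in> lin V W"
  shows "v \<in> carrier V \<Longrightarrow> f v \<in> carrier W"
    and "v \<in> carrier V \<Longrightarrow> w \<in> carrier V \<Longrightarrow> f (v \<oplus> w) = f v \<oplus>\<^bsub>W\<^esub> f w"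
    and "v \<in> carrier V \<Longrightarrow> f (a \<odot> v) = a \<odot>\<^bsub>W\<^esub> f v"
  using assms by (auto simp: lin_def)

lemma linI:
  fixes V (structure)
  assumes "\<And>v. v \<in> carrier V \<Longrightarrow> f v \<in> carrier W"
    and "\<And>v w. v \<in> carrier V \<Longrightarrow> w \<in> carrier V \<Longrightarrow> f (v \<oplus> w) = f v \<oplus>\<^bsub>W\<^esub> f w"
    and "\<And>a v. v \<in> carrier V \<Longrightarrow> f (a \<odot> v) = a \<odot>\<^bsub>W\<^esub> f v"
  shows "f \<in> lin V W"
  using assms by (auto simp: lin_def)

lemma lin_zero:
  fixes V (structure)
  assumes "f \<in> lin V W" "vector_space_on V" "vector_space_on W"
  shows "f \<zero> = \<zero>\<^bsub>W\<^esub>"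
proof -
  interpret V: vspace V using assms(2) by (rule vspaceI)
  interpret W: vspace W using assms(3) by (rule vspaceI)
  have "f (0 \<odot> \<zero>) = 0 \<odot>\<^bsub>W\<^esub> f \<zero>" by (rule linD(3)[OF assms(1)]) simp
  then show ?thesis by (simp add: V.smult_zero W.zero_smult linD(1)[OF assms(1)])
qed

lemma lin_comp: "f \<in> lin U V \<Longrightarrow> g \<in> lin V W \<Longrightarrow> (\<lambda>x. g (f x)) \<in> lin U W"
  by (auto simp: lin_def Pi_iff)

lemma lin_cong: "f \<in> lin V W \<Longrightarrow> (\<And>v. v \<in> carrier V \<Longrightarrow> g v = f v) \<Longrightarrow> vector_space_on V \<Longrightarrow> g \<in> lin V W"
  by (rule linI) (simp_all add: linD vspace.add_in vspace.smult_in vspaceI)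

lemma transp_lin:
  assumes "f \<in> lin V W" "vector_space_on V" "vector_space_on W"
  shows "transp V f \<in> lin (dual_space W) (dual_space V)"
proof -
  interpret V: vspace V using assms(2) by (rule vspaceI)
  interpret W: vspace W using assms(3) by (rule vspaceI)
  show ?thesis
    using linD[OF assms(1)]
    by (intro linI) (auto simp: carrier_dual_space transp_def dual_space_simps functional_def
       V.add_in V.smult_in intro!: restrict_ext)
qed

lemma transp_transp:
  assumes "f \<in> lin V W"
  shows "transp V f (transp W g \<xi>) = transp V (\<lambda>v. g (f v)) \<xi>"
  using linD(1)[OF assms] by (auto simp: transp_def)

lemma transp_cong: "(\<And>v. v \<in> carrier V \<Longrightarrow> f v = g v) \<Longrightarrow> transp V f \<xi> = transp V g \<xi>"
  by (auto simp: transp_def)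

lemma transp_ident: "\<xi> \<in> carrier (dual_space V) \<Longrightarrow> (\<And>v. v \<in> carrier V \<Longrightarrow> f v = v) \<Longrightarrow> transp V f \<xi> = \<xi>"
  by (auto simp: transp_def carrier_dual_space extensional_def fun_eq_iff)

section \<open>Zero objects, biproducts and coequalizers in finite abelian categories\<close>

definition zero_object :: "('o, 'm, 'k, 'z) lcat_scheme \<Rightarrow> 'o \<Rightarrow> bool" where
  "zero_object C Z \<longleftrightarrow> Z \<in> Obj C \<and> Id C Z = \<zero>\<^bsub>Hom C Z Z\<^esub>"

definition biproduct :: "('o, 'm, 'k, 'z) lcat_scheme \<Rightarrow> 'o \<Rightarrow> 'o \<Rightarrow> 'o
    \<Rightarrow> 'm \<Rightarrow> 'm \<Rightarrow> 'm \<Rightarrow> 'm \<Rightarrow> bool" where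
  "biproduct C X Y P i1 i2 p1 p2 \<longleftrightarrow> P \<in> Obj C \<and> i1 \<in> arr C X P \<and> i2 \<in> arr C Y P \<and>
     p1 \<in> arr C P X \<and> p2 \<in> arr C P Y \<and>
     p1 \<cdot>\<^bsub>C\<^esub> i1 = Id C X \<and> p2 \<cdot>\<^bsub>C\<^esub> i2 = Id C Y \<and>
     p1 \<cdot>\<^bsub>C\<^esub> i2 = \<zero>\<^bsub>Hom C Y X\<^esub> \<and> p2 \<cdot>\<^bsub>C\<^esub> i1 = \<zero>\<^bsub>Hom C X Y\<^esub> \<and>
     (i1 \<cdot>\<^bsub>C\<^esub> p1) \<oplus>\<^bsub>Hom C P P\<^esub> (i2 \<cdot>\<^bsub>C\<^esub> p2) = Id C P"

definition finite_homs :: "('o, 'm, 'k::field, 'z) lcat_scheme \<Rightarrow> bool" where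
  "finite_homs C \<longleftrightarrow> (\<forall>X\<in>Obj C. \<forall>Y\<in>Obj C. finite_coords (Hom C X Y))"

text \<open>
  Zero object, sums and coequalizers. Sums are biproducts because these are given by equations between arrows, which
  every linear functor preserves.
\<close>

definition has_finite_colimits :: "('o, 'm, 'k, 'z) lcat_scheme \<Rightarrow> bool" where
  "has_finite_colimits C \<longleftrightarrow> (\<exists>Z. zero_object C Z) \<and>
     (\<forall>X\<in>Obj C. \<forall>Y\<in>Obj C. \<exists>P i1 i2 p1 p2. biproduct C X Y P i1 i2 p1 p2) \<and>
     (\<forall>X\<in>Obj C. \<forall>Y\<in>Obj C. \<forall>f\<in>arr C X Y. \<forall>g\<in>arr C X Y. \<exists>Q q. is_coequalizer C X Y f g Q q)"

definition on_carrier :: "('k, 'v) module \<Rightarrow> ('v \<Rightarrow> 'w) \<Rightarrow> 'v \<Rightarrow> 'w option" where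
  "on_carrier V g = (\<lambda>v. if v \<in> carrier V then Some (g v) else None)"

definition module_map ::
  "('k, 'r) module \<Rightarrow> ('k, 'r, 'v) rmod \<Rightarrow> ('k, 'r, 'w) rmod \<Rightarrow> ('v \<Rightarrow> 'w) \<Rightarrow> bool" where
  "module_map R X Y g \<longleftrightarrow> g \<in> lin (fst X) (fst Y) \<and>
     (\<forall>x\<in>carrier R. \<forall>v\<in>carrier (fst X). g (snd X x v) = snd Y x (g v))"

context
  fixes R :: "('k::field, 'r) module"
begin

abbreviation (input) "Md \<equiv> fd_modules R"

lemma Obj_fd_modules: "X \<in> Obj (fd_modules R) \<longleftrightarrow> fd_left_module R X"
  by (simp add: fd_modules_def)

lemma on_carrier_eq: "on_carrier V g = on_carrier V h \<longleftrightarrow> (\<forall>v\<in>carrier V. g v = h v)"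
  by (auto simp: on_carrier_def fun_eq_iff)

lemma fd_left_moduleD:
  assumes "fd_left_module R X"
  shows "vector_space_on (fst X)" "fin_dim (fst X)"
    "x \<in> carrier R \<Longrightarrow> snd X x \<in> lin (fst X) (fst X)"
    "v \<in> carrier (fst X) \<Longrightarrow> (\<lambda>x. snd X x v) \<in> lin R (fst X)"
    "v \<in> carrier (fst X) \<Longrightarrow> snd X \<one>\<^bsub>R\<^esub> v = v"
    "x \<in> carrier R \<Longrightarrow> y \<in> carrier R \<Longrightarrow> v \<in> carrier (fst X) \<Longrightarrow>
      snd X (x \<otimes>\<^bsub>R\<^esub> y) v = snd X x (snd X y v)"
  using assms by (auto simp: fd_left_module_def)

lemma on_carrier_arr: 
  assumes "fd_left_module R X" 
  shows "on_carrier (fst X) g \<in> arr (fd_modules R) X Y \<longleftrightarrow> module_map R X Y g"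
proof -
  interpret vspace "fst X" using fd_left_moduleD(1)[OF assms] by (rule vspaceI)
  have "dom (on_carrier (fst X) g) = carrier (fst X)"
    by (auto simp: on_carrier_def dom_def)
  moreover have "(\<lambda>v. the (on_carrier (fst X) g v)) \<in> lin (fst X) (fst Y) \<longleftrightarrow> g \<in> lin (fst X) (fst Y)"
    by (auto simp: lin_def on_carrier_def Pi_iff add_in smult_in)
  moreover have "snd X x v \<in> carrier (fst X)" if "x \<in> carrier R" "v \<in> carrier (fst X)" for x v
    by (rule linD(1)[OF fd_left_moduleD(3)[OF assms that(1)] that(2)])
  ultimately show ?thesis
    by (auto simp: fd_modules_def module_map_def split_beta on_carrier_def)
qed

lemma fd_arrE:
  assumes "f \<in> arr (fd_modules R) X Y" "fd_left_module R X"
  obtains g where "f = on_carrier (fst X) g" "module_map R X Y g"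
proof -
  have "dom f = carrier (fst X)" using assms(1) by (simp add: fd_modules_def split_beta)
  then have "f = on_carrier (fst X) (\<lambda>v. the (f v))"
    by (force simp: on_carrier_def fun_eq_iff dom_def)
  moreover from this have "module_map R X Y (\<lambda>v. the (f v))"
    using assms on_carrier_arr[OF assms(2), of "\<lambda>v. the (f v)" Y] by simp
  ultimately show ?thesis using that by blast
qed

lemma fd_Id: "Id (fd_modules R) X = on_carrier (fst X) (\<lambda>v. v)"
  by (simp add: fd_modules_def on_carrier_def split_beta)

lemma fd_zero: "\<zero>\<^bsub>Hom (fd_modules R) X Y\<^esub> = on_carrier (fst X) (\<lambda>v. \<zero>\<^bsub>fst Y\<^esub>)"
  by (simp add: fd_modules_def on_carrier_def split_beta)

lemma fd_add: "on_carrier (fst X) g \<oplus>\<^bsub>Hom (fd_modules R) X Y\<^esub> on_carrier (fst X) h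
    = on_carrier (fst X) (\<lambda>v. g v \<oplus>\<^bsub>fst Y\<^esub> h v)"
  by (auto simp add: fd_modules_def on_carrier_def split_beta)

lemma fd_smult: "a \<odot>\<^bsub>Hom (fd_modules R) X Y\<^esub> on_carrier (fst X) g
    = on_carrier (fst X) (\<lambda>v. a \<odot>\<^bsub>fst Y\<^esub> g v)"
  by (auto simp add: fd_modules_def on_carrier_def split_beta)

lemma fd_comp:
  assumes "module_map R X Y g"
  shows "on_carrier (fst Y) h \<cdot>\<^bsub>fd_modules R\<^esub> on_carrier (fst X) g = on_carrier (fst X) (\<lambda>v. h (g v))"
proof -
  have "\<And>v. v \<in> carrier (fst X) \<Longrightarrow> g v \<in> carrier (fst Y)"
    using assms by (auto simp: module_map_def lin_def)
  then show ?thesis by (auto simp: fd_modules_def on_carrier_def map_comp_def fun_eq_iff)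
qed

text \<open>
  A module map is determined by its values on finitely many generators of the source, and the values have finitely
  many coordinates.
\<close>

lemma finite_homs_fd_modules:
  "finite_homs (fd_modules R :: (('k, 'r, 'v) rmod, 'v \<Rightarrow> 'v option, 'k) lcat)"
  unfolding finite_homs_def
proof (intro ballI)
  fix X Y :: "('k, 'r, 'v) rmod"
  assume "X \<in> Obj (fd_modules R :: (('k, 'r, 'v) rmod, 'v \<Rightarrow> 'v option, 'k) lcat)"
    "Y \<in> Obj (fd_modules R :: (('k, 'r, 'v) rmod, 'v \<Rightarrow> 'v option, 'k) lcat)"
  then have X: "fd_left_module R X" and Y: "fd_left_module R Y" by (simp_all add: Obj_fd_modules)
  note vX = fd_left_moduleD(1)[OF X] and vY = fd_left_moduleD(1)[OF Y]
  interpret X: vspace "fst X" using vX by (rule vspaceI)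
  interpret Y: vspace "fst Y" using vY by (rule vspaceI)
  obtain S where S: "finite S" "S \<subseteq> carrier (fst X)"
    and gen: "\<forall>I. subspace_of I (fst X) \<and> S \<subseteq> I \<longrightarrow> I = carrier (fst X)"
    using fin_dim_generators[OF vX fd_left_moduleD(2)[OF X]] by (elim exE conjE)
  have "finite_coords (fst Y)" by (rule fin_dim_imp_finite_coords[OF vY fd_left_moduleD(2)[OF Y]])
  then obtain \<Phi> where \<Phi>: "finite \<Phi>" "\<forall>\<phi>\<in>\<Phi>. functional (fst Y) \<phi>"
     and inj: "\<forall>v\<in>carrier (fst Y). (\<forall>\<phi>\<in>\<Phi>. \<phi> v = 0) \<longrightarrow> v = \<zero>\<^bsub>fst Y\<^esub>"
    unfolding finite_coords_def by (elim exE conjE)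
  show "finite_coords (Hom (fd_modules R) X Y)"
    unfolding finite_coords_def
  proof (intro exI[of _ "(\<lambda>(s, \<phi>) f. \<phi> (the (f s))) ` (S \<times> \<Phi>)"] conjI ballI impI)
    show "finite ((\<lambda>(s, \<phi>) f. \<phi> (the (f s))) ` (S \<times> \<Phi>))" using S \<Phi> by simp
  next
    fix \<psi> assume "\<psi> \<in> (\<lambda>(s, \<phi>) f. \<phi> (the (f s))) ` (S \<times> \<Phi>)"
    then obtain s \<phi> where s: "s \<in> S" "\<phi> \<in> \<Phi>" "\<psi> = (\<lambda>f. \<phi> (the (f s)))" by auto
    have sV: "s \<in> carrier (fst X)" using s S by auto
    have \<phi>: "functional (fst Y) \<phi>" using s \<Phi> by auto
    show "functional (Hom (fd_modules R) X Y) \<psi>"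
      unfolding functional_def s(3)
    proof (intro conjI ballI allI)
      fix f g assume f: "f \<in> arr (fd_modules R) X Y" and g: "g \<in> arr (fd_modules R) X Y"
      obtain f' where f': "f = on_carrier (fst X) f'" "module_map R X Y f'" by (rule fd_arrE[OF f X])
      obtain g' where g': "g = on_carrier (fst X) g'" "module_map R X Y g'" by (rule fd_arrE[OF g X])
      have "f' s \<in> carrier (fst Y)" "g' s \<in> carrier (fst Y)"
        using f'(2) g'(2) sV by (auto simp: module_map_def lin_def)
      then show "\<phi> (the ((f \<oplus>\<^bsub>Hom (fd_modules R) X Y\<^esub> g) s)) = \<phi> (the (f s)) + \<phi> (the (g s))"
        using \<phi> sV by (simp add: f'(1) g'(1) fd_add) (simp add: on_carrier_def functional_def)
    next
      fix a f assume f: "f \<in> arr (fd_modules R) X Y"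
      obtain f' where f': "f = on_carrier (fst X) f'" "module_map R X Y f'" by (rule fd_arrE[OF f X])
      have "f' s \<in> carrier (fst Y)"
        using f'(2) sV by (auto simp: module_map_def lin_def)
      then show "\<phi> (the ((a \<odot>\<^bsub>Hom (fd_modules R) X Y\<^esub> f) s)) = a * \<phi> (the (f s))"
        using \<phi> sV by (simp add: f'(1) fd_smult) (simp add: on_carrier_def functional_def)
    qed
  next
    fix f assume f: "f \<in> arr (fd_modules R) X Y"
      and z: "\<forall>\<psi>\<in>(\<lambda>(s, \<phi>) f. \<phi> (the (f s))) ` (S \<times> \<Phi>). \<psi> f = 0"
    obtain f' where f': "f = on_carrier (fst X) f'" "module_map R X Y f'" by (rule fd_arrE[OF f X])
    have lf: "f' \<in> lin (fst X) (fst Y)" using f'(2) by (simp add: module_map_def)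
    have "subspace_of {v \<in> carrier (fst X). f' v = \<zero>\<^bsub>fst Y\<^esub>} (fst X)"
      unfolding subspace_of_def
      by (auto simp: lin_zero[OF lf vX vY] linD[OF lf] X.add_in X.smult_in Y.smult_zero)
    moreover have "f' s = \<zero>\<^bsub>fst Y\<^esub>" if s: "s \<in> S" for s
    proof -
      have sV: "s \<in> carrier (fst X)" using s S by auto
      have "\<forall>\<phi>\<in>\<Phi>. \<phi> (f' s) = 0" using z s sV unfolding f'(1) by (auto simp: on_carrier_def)
      moreover have "f' s \<in> carrier (fst Y)" by (rule linD(1)[OF lf sV])
      ultimately show ?thesis using inj by simp
    qed
    ultimately have "{v \<in> carrier (fst X). f' v = \<zero>\<^bsub>fst Y\<^esub>} = carrier (fst X)"
      using gen S by auto
    then have "\<forall>v\<in>carrier (fst X). f' v = \<zero>\<^bsub>fst Y\<^esub>" by blast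
    then show "f = \<zero>\<^bsub>Hom (fd_modules R) X Y\<^esub>" unfolding f'(1) fd_zero on_carrier_eq .
  qed
qed

text \<open>
  The quotient of \<open>Y\<close> by the image \<open>I\<close> of \<open>f - g\<close> is realized inside \<open>Y\<close>, as the image of a linear projection \<open>p\<close>
  along \<open>I\<close> with the action followed by \<open>p\<close>. So it stays within the type of the carrier of \<open>Y\<close>.
\<close>

lemma coequalizer_fd_modules:
  assumes "X \<in> Obj (fd_modules R)" "Y \<in> Obj (fd_modules R)"
    and f: "f \<in> arr (fd_modules R) X Y" and g: "g \<in> arr (fd_modules R) X Y"
  shows "\<exists>Q q. is_coequalizer (fd_modules R) X Y f g Q q"
proof -
  have X: "fd_left_module R X" and Y: "fd_left_module R Y" using assms by (simp_all add: Obj_fd_modules)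
  note vX = fd_left_moduleD(1)[OF X] and vY = fd_left_moduleD(1)[OF Y]
  interpret X: vspace "fst X" using vX by (rule vspaceI)
  interpret Y: vspace "fst Y" using vY by (rule vspaceI)
  obtain f' where f': "f = on_carrier (fst X) f'" "module_map R X Y f'" by (rule fd_arrE[OF f X])
  obtain g' where g': "g = on_carrier (fst X) g'" "module_map R X Y g'" by (rule fd_arrE[OF g X])
  have lf: "f' \<in> lin (fst X) (fst Y)" and lg: "g' \<in> lin (fst X) (fst Y)"
    using f'(2) g'(2) by (simp_all add: module_map_def)
  define d where "d v = f' v \<oplus>\<^bsub>fst Y\<^esub> (-1) \<odot>\<^bsub>fst Y\<^esub> g' v" for v
  have ld: "d \<in> lin (fst X) (fst Y)"
    by (rule linI) (auto simp: d_def linD[OF lf] linD[OF lg] Y.smult_add Y.smult_smult Y.add_ac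
      Y.smult_in Y.add_in)
  have dact: "d (snd X x v) = snd Y x (d v)" if x: "x \<in> carrier R" and v: "v \<in> carrier (fst X)" for x v
    using f'(2) g'(2) x v linD(2,3)[OF fd_left_moduleD(3)[OF Y x]] linD(1)[OF lf v] linD(1)[OF lg v]
    by (simp add: d_def module_map_def Y.smult_in)
  have actX: "snd X x v \<in> carrier (fst X)" if x: "x \<in> carrier R" and v: "v \<in> carrier (fst X)" for x v
    by (rule linD(1)[OF fd_left_moduleD(3)[OF X x] v])
  have actY: "snd Y x v \<in> carrier (fst Y)" if x: "x \<in> carrier R" and v: "v \<in> carrier (fst Y)" for x v
    by (rule linD(1)[OF fd_left_moduleD(3)[OF Y x] v])
  define I where "I = d ` carrier (fst X)"
  have I: "subspace_of I (fst Y)"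
    unfolding subspace_of_def
  proof (intro conjI ballI allI)
    show "I \<subseteq> carrier (fst Y)" using linD(1)[OF ld] by (auto simp: I_def)
    show "\<zero>\<^bsub>fst Y\<^esub> \<in> I" using lin_zero[OF ld vX vY] X.zero_in unfolding I_def by (metis image_eqI)
    show "x \<oplus>\<^bsub>fst Y\<^esub> y \<in> I" if xy: "x \<in> I" "y \<in> I" for x y
    proof -
      obtain v w where "v \<in> carrier (fst X)" "w \<in> carrier (fst X)" "x = d v" "y = d w"
        using xy unfolding I_def by (elim imageE)
      then show ?thesis using linD(2)[OF ld, of v w] X.add_in unfolding I_def by (metis image_eqI)
    qed
    show "a \<odot>\<^bsub>fst Y\<^esub> x \<in> I" if x: "x \<in> I" for a x
    proof -
      obtain v where "v \<in> carrier (fst X)" "x = d v"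
        using x unfolding I_def by (elim imageE)
      then show ?thesis using linD(3)[OF ld, of v a] X.smult_in unfolding I_def by (metis image_eqI)
    qed
  qed
  obtain p where lp: "p \<in> lin (fst Y) (fst Y)" and pI: "\<forall>v\<in>I. p v = \<zero>\<^bsub>fst Y\<^esub>"
      and pdec: "\<forall>v\<in>carrier (fst Y). \<exists>i\<in>I. p v \<oplus>\<^bsub>fst Y\<^esub> i = v"
    using fin_dim_projection[OF vY fd_left_moduleD(2)[OF Y] I] by (elim bexE conjE)
  note p = linD[OF lp]
  have Iin: "i \<in> carrier (fst Y)" if "i \<in> I" for i using I that by (auto simp: subspace_of_def)
  have kills: "h (p v) = h v" if h: "h \<in> lin (fst Y) W" "vector_space_on W" "\<forall>i\<in>I. h i = \<zero>\<^bsub>W\<^esub>"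
      and v: "v \<in> carrier (fst Y)" for h :: "_ \<Rightarrow> 'w" and W v
  proof -
    interpret W: vspace W using h(2) by (rule vspaceI)
    obtain i where i: "i \<in> I" "p v \<oplus>\<^bsub>fst Y\<^esub> i = v" using pdec v by auto
    have "h v = h (p v \<oplus>\<^bsub>fst Y\<^esub> i)" using i by simp
    also have "\<dots> = h (p v) \<oplus>\<^bsub>W\<^esub> h i" by (rule linD(2)[OF h(1) p(1)[OF v] Iin[OF i(1)]])
    finally show ?thesis using h(3) i(1) linD(1)[OF h(1) p(1)[OF v]] by simp
  qed
  have actI: "snd Y x i \<in> I" if x: "x \<in> carrier R" and i: "i \<in> I" for x i
  proof -
    obtain v where v: "v \<in> carrier (fst X)" "i = d v" using i unfolding I_def by (elim imageE)
    have "snd Y x i = d (snd X x v)" using dact[OF x v(1)] v(2) by simp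
    then show ?thesis using actX[OF x v(1)] unfolding I_def by blast
  qed
  have pp: "p (p v) = p v" if "v \<in> carrier (fst Y)" for v by (rule kills[OF lp vY pI that])
  have pact: "p (snd Y x (p v)) = p (snd Y x v)" if x: "x \<in> carrier R" and v: "v \<in> carrier (fst Y)" for x v
    by (rule kills[OF lin_comp[OF fd_left_moduleD(3)[OF Y x] lp] vY _ v]) (use pI actI x in auto)
  define PV where "PV = p ` carrier (fst Y)"
  define Q where "Q = ((fst Y)\<lparr>carrier := PV\<rparr>, \<lambda>x v. p (snd Y x v))"
  have PVY: "v \<in> carrier (fst Y)" if "v \<in> PV" for v
    using that p(1) unfolding PV_def by (elim imageE) simp
  have pPV: "p v = v" if "v \<in> PV" for v
    using that pp unfolding PV_def by (elim imageE) simp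
  have PVI: "p v \<in> PV" if "v \<in> carrier (fst Y)" for v using that by (simp add: PV_def)
  have subP: "subspace_of PV (fst Y)"
    unfolding subspace_of_def
  proof (intro conjI ballI allI subsetI)
    show "x \<in> carrier (fst Y)" if "x \<in> PV" for x by (rule PVY[OF that])
    show "\<zero>\<^bsub>fst Y\<^esub> \<in> PV" using PVI[OF Y.zero_in] lin_zero[OF lp vY vY] by simp
    show "x \<oplus>\<^bsub>fst Y\<^esub> y \<in> PV" if "x \<in> PV" "y \<in> PV" for x y
      using PVI[of "x \<oplus>\<^bsub>fst Y\<^esub> y"] that by (simp add: PVY p pPV)
    show "a \<odot>\<^bsub>fst Y\<^esub> x \<in> PV" if "x \<in> PV" for a x
      using PVI[of "a \<odot>\<^bsub>fst Y\<^esub> x"] that by (simp add: PVY p pPV Y.smult_in)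
  qed
  have vQ: "vector_space_on (fst Q)"
    using vector_space_on_subspace[OF vY subP] by (simp add: Q_def)
  have fQ: "fin_dim (fst Q)"
  proof -
    obtain S where S: "finite S" "S \<subseteq> carrier (fst Y)"
      and gen: "\<forall>I. subspace_of I (fst Y) \<and> S \<subseteq> I \<longrightarrow> I = carrier (fst Y)"
      using fin_dim_generators[OF vY fd_left_moduleD(2)[OF Y]] by (elim exE conjE)
    show ?thesis
    proof (rule generators_fin_dim[OF vQ, of "p ` S"])
      show "finite (p ` S)" "p ` S \<subseteq> carrier (fst Q)" using S PVI by (auto simp: Q_def)
      fix J assume J: "subspace_of J (fst Q)" "p ` S \<subseteq> J"
      have "subspace_of {v \<in> carrier (fst Y). p v \<in> J} (fst Y)"
        unfolding subspace_of_def
      proof (intro conjI ballI allI subsetI)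
        show "\<zero>\<^bsub>fst Y\<^esub> \<in> {v \<in> carrier (fst Y). p v \<in> J}"
          using J lin_zero[OF lp vY vY] by (simp add: subspace_of_def Q_def)
      qed (use J in \<open>auto simp: subspace_of_def Q_def p Y.smult_in\<close>)
      moreover have "S \<subseteq> {v \<in> carrier (fst Y). p v \<in> J}" using S J by auto
      ultimately have "{v \<in> carrier (fst Y). p v \<in> J} = carrier (fst Y)"
        by (rule gen[rule_format, OF conjI])
      then have "\<forall>v\<in>carrier (fst Y). p v \<in> J" by blast
      then have "PV \<subseteq> J" by (auto simp: PV_def)
      moreover have "J \<subseteq> PV" using J by (simp add: subspace_of_def Q_def)
      ultimately show "J = carrier (fst Q)" by (simp add: Q_def)
    qed
  qed
  have Q: "fd_left_module R Q"
  proof -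
    have "(\<lambda>v. p (snd Y x v)) \<in> lin (fst Q) (fst Q)" if x: "x \<in> carrier R" for x
      using linD[OF fd_left_moduleD(3)[OF Y x]] by (auto simp: Q_def lin_def PVY PVI p)
    moreover have "(\<lambda>x. p (snd Y x v)) \<in> lin R (fst Q)" if "v \<in> PV" for v
      using linD[OF fd_left_moduleD(4)[OF Y PVY[OF that]]] by (auto simp: Q_def lin_def PVI p)
    moreover have "p (snd Y \<one>\<^bsub>R\<^esub> v) = v" if "v \<in> PV" for v
      using that by (simp add: fd_left_moduleD(5)[OF Y] PVY pPV)
    moreover have "p (snd Y (x \<otimes>\<^bsub>R\<^esub> y) v) = p (snd Y x (p (snd Y y v)))"
      if "x \<in> carrier R" "y \<in> carrier R" "v \<in> PV" for x y v
      using that by (simp add: fd_left_moduleD(6)[OF Y] PVY pact actY)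
    ultimately show ?thesis using vQ fQ by (simp add: fd_left_module_def Q_def)
  qed
  have mp: "module_map R Y Q p"
    unfolding module_map_def by (auto simp: Q_def lin_def p PVI pact)
  have pd: "p (f' v) = p (g' v)" if v: "v \<in> carrier (fst X)" for v
  proof -
    have "p (d v) = \<zero>\<^bsub>fst Y\<^esub>" using pI v by (simp add: I_def)
    moreover have "p (d v) = p (f' v) \<oplus>\<^bsub>fst Y\<^esub> (-1) \<odot>\<^bsub>fst Y\<^esub> p (g' v)"
      using linD(1)[OF lf v] linD(1)[OF lg v] by (simp add: d_def p Y.smult_in)
    ultimately show ?thesis
      using Y.diff_eq_zero[of "p (f' v)" "p (g' v)"] p(1)[OF linD(1)[OF lf v]] p(1)[OF linD(1)[OF lg v]]
      by simp
  qed
  have "is_coequalizer (fd_modules R) X Y f g Q (on_carrier (fst Y) p)"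
    unfolding is_coequalizer_def
  proof (intro conjI ballI impI)
    show "Q \<in> Obj (fd_modules R)" using Q by (simp add: Obj_fd_modules)
    show "on_carrier (fst Y) p \<in> arr (fd_modules R) Y Q" by (simp add: on_carrier_arr[OF Y] mp)
    show "on_carrier (fst Y) p \<cdot>\<^bsub>fd_modules R\<^esub> f = on_carrier (fst Y) p \<cdot>\<^bsub>fd_modules R\<^esub> g"
      unfolding f'(1) g'(1) fd_comp[OF f'(2)] fd_comp[OF g'(2)] on_carrier_eq using pd by simp
  next
    fix Z h assume "Z \<in> Obj (fd_modules R)" and h: "h \<in> arr (fd_modules R) Y Z"
      and hfg: "h \<cdot>\<^bsub>fd_modules R\<^esub> f = h \<cdot>\<^bsub>fd_modules R\<^esub> g"
    then have Z: "fd_left_module R Z" by (simp add: Obj_fd_modules)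
    note vZ = fd_left_moduleD(1)[OF Z]
    interpret Z: vspace "fst Z" using vZ by (rule vspaceI)
    obtain h' where h': "h = on_carrier (fst Y) h'" "module_map R Y Z h'" by (rule fd_arrE[OF h Y])
    have lh: "h' \<in> lin (fst Y) (fst Z)" using h'(2) by (simp add: module_map_def)
    have "h' (f' v) = h' (g' v)" if "v \<in> carrier (fst X)" for v
      using hfg that unfolding h'(1) f'(1) g'(1) fd_comp[OF f'(2)] fd_comp[OF g'(2)] on_carrier_eq by simp
    then have hd: "h' (d v) = \<zero>\<^bsub>fst Z\<^esub>" if "v \<in> carrier (fst X)" for v
      using that linD(1)[OF lf that] linD(1)[OF lg that]
      by (simp add: d_def linD[OF lh] Y.smult_in Z.add_neg)
    have hp: "h' (p v) = h' v" if "v \<in> carrier (fst Y)" for v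
      by (rule kills[OF lh vZ _ that]) (simp add: I_def hd)
    have mh: "module_map R Q Z h'"
      unfolding module_map_def
    proof (intro conjI ballI)
      show "h' \<in> lin (fst Q) (fst Z)" using linD[OF lh] by (auto simp: Q_def lin_def PVY)
      fix x v assume x: "x \<in> carrier R" and "v \<in> carrier (fst Q)"
      then have v: "v \<in> carrier (fst Y)" by (simp add: Q_def PVY)
      have "h' (p (snd Y x v)) = h' (snd Y x v)" by (rule hp[OF actY[OF x v]])
      then show "h' (snd Q x v) = snd Z x (h' v)"
        using h'(2) x v by (simp add: Q_def module_map_def)
    qed
    show "\<exists>!k. k \<in> arr (fd_modules R) Q Z \<and> k \<cdot>\<^bsub>fd_modules R\<^esub> on_carrier (fst Y) p = h"
    proof (rule ex1I[of _ "on_carrier (fst Q) h'"], intro conjI)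
      show "on_carrier (fst Q) h' \<in> arr (fd_modules R) Q Z" by (simp add: on_carrier_arr[OF Q] mh)
      show "on_carrier (fst Q) h' \<cdot>\<^bsub>fd_modules R\<^esub> on_carrier (fst Y) p = h"
        unfolding fd_comp[OF mp] h'(1) on_carrier_eq using hp by simp
    next
      fix k assume k: "k \<in> arr (fd_modules R) Q Z \<and> k \<cdot>\<^bsub>fd_modules R\<^esub> on_carrier (fst Y) p = h"
      then obtain k' where k': "k = on_carrier (fst Q) k'" "module_map R Q Z k'"
        using fd_arrE[OF _ Q] by blast
      have "\<forall>v\<in>carrier (fst Y). k' (p v) = h' v"
        using k unfolding k'(1) h'(1) fd_comp[OF mp] on_carrier_eq by simp
      then have "\<forall>v\<in>carrier (fst Q). k' v = h' v"
        using PVY pPV by (simp add: Q_def) metis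
      then show "k = on_carrier (fst Q) h'" unfolding k'(1) on_carrier_eq .
    qed
  qed
  then show ?thesis by blast
qed

end

lemma zero_object_fd_modules:
  fixes R :: "('k::field, 'r) module"
  shows "\<exists>Z. zero_object (fd_modules R :: (('k, 'r, 'v) rmod, 'v \<Rightarrow> 'v option, 'k) lcat) Z"
proof -
  define z :: 'v where "z = undefined"
  define V :: "('k, 'v) module" where "V = \<lparr>carrier = {z}, mult = undefined, one = undefined, zero = z,
    add = (\<lambda>_ _. z), smult = (\<lambda>_ _. z)\<rparr>"
  define Z :: "('k, 'r, 'v) rmod" where "Z = (V, \<lambda>_ _. z)"
  have V: "vector_space_on V" by (rule vector_space_onI) (simp_all add: V_def)
  have "fin_dim V"
    by (rule generators_fin_dim[OF V, of "{z}"]) (auto simp: V_def subspace_of_def)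
  with V have "fd_left_module R Z" by (simp add: fd_left_module_def Z_def lin_def V_def)
  moreover have "Id (fd_modules R) Z = \<zero>\<^bsub>Hom (fd_modules R) Z Z\<^esub>"
    unfolding fd_Id fd_zero on_carrier_eq by (simp add: Z_def V_def)
  ultimately show ?thesis unfolding zero_object_def Obj_fd_modules by blast
qed

text \<open>Interleaving makes room for two vectors in one sequence of scalars, so that the sum of two modules whose carriers
  consist of sequences is again one.\<close>

definition interleave :: "(nat \<Rightarrow> 'k) \<Rightarrow> (nat \<Rightarrow> 'k) \<Rightarrow> nat \<Rightarrow> 'k" where
  "interleave v w = (\<lambda>n. if even n then v (n div 2) else w (n div 2))"

definition evens :: "(nat \<Rightarrow> 'k) \<Rightarrow> nat \<Rightarrow> 'k" where "evens x = (\<lambda>n. x (2 * n))"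

definition odds :: "(nat \<Rightarrow> 'k) \<Rightarrow> nat \<Rightarrow> 'k" where "odds x = (\<lambda>n. x (2 * n + 1))"

lemma interleave_simps [simp]:
  "evens (interleave v w) = v" "odds (interleave v w) = w" "interleave (evens x) (odds x) = x"
  by (auto simp: interleave_def evens_def odds_def fun_eq_iff)

lemma biproduct_fd_modules:
  fixes R :: "('k::field, 'r) module" and X Y :: "('k, 'r, nat \<Rightarrow> 'k) rmod"
  assumes "X \<in> Obj (fd_modules R :: (('k, 'r, nat \<Rightarrow> 'k) rmod, (nat \<Rightarrow> 'k) \<Rightarrow> (nat \<Rightarrow> 'k) option, 'k) lcat)"
    and "Y \<in> Obj (fd_modules R :: (('k, 'r, nat \<Rightarrow> 'k) rmod, (nat \<Rightarrow> 'k) \<Rightarrow> (nat \<Rightarrow> 'k) option, 'k) lcat)"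
  shows "\<exists>P i1 i2 p1 p2. biproduct (fd_modules R) X Y P i1 i2 p1 p2"
proof -
  have X: "fd_left_module R X" and Y: "fd_left_module R Y" using assms by (simp_all add: Obj_fd_modules)
  note vX = fd_left_moduleD(1)[OF X] and vY = fd_left_moduleD(1)[OF Y]
  interpret X: vspace "fst X" using vX by (rule vspaceI)
  interpret Y: vspace "fst Y" using vY by (rule vspaceI)
  have actX: "snd X x v \<in> carrier (fst X)" if x: "x \<in> carrier R" and v: "v \<in> carrier (fst X)" for x v
    by (rule linD(1)[OF fd_left_moduleD(3)[OF X x] v])
  have actY: "snd Y x v \<in> carrier (fst Y)" if x: "x \<in> carrier R" and v: "v \<in> carrier (fst Y)" for x v
    by (rule linD(1)[OF fd_left_moduleD(3)[OF Y x] v])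
  define V :: "('k, nat \<Rightarrow> 'k) module" where "V = \<lparr>carrier = {x. evens x \<in> carrier (fst X) \<and> odds x \<in> carrier (fst Y)},
    mult = undefined, one = undefined, zero = interleave \<zero>\<^bsub>fst X\<^esub> \<zero>\<^bsub>fst Y\<^esub>,
    add = (\<lambda>x y. interleave (evens x \<oplus>\<^bsub>fst X\<^esub> evens y) (odds x \<oplus>\<^bsub>fst Y\<^esub> odds y)),
    smult = (\<lambda>a x. interleave (a \<odot>\<^bsub>fst X\<^esub> evens x) (a \<odot>\<^bsub>fst Y\<^esub> odds x))\<rparr>"
  have V_simps: "x \<in> carrier V \<longleftrightarrow> evens x \<in> carrier (fst X) \<and> odds x \<in> carrier (fst Y)"
    "\<zero>\<^bsub>V\<^esub> = interleave \<zero>\<^bsub>fst X\<^esub> \<zero>\<^bsub>fst Y\<^esub>"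
    "x \<oplus>\<^bsub>V\<^esub> y = interleave (evens x \<oplus>\<^bsub>fst X\<^esub> evens y) (odds x \<oplus>\<^bsub>fst Y\<^esub> odds y)"
    "a \<odot>\<^bsub>V\<^esub> x = interleave (a \<odot>\<^bsub>fst X\<^esub> evens x) (a \<odot>\<^bsub>fst Y\<^esub> odds x)" for x y a
    by (simp_all add: V_def)
  define P where "P = (V, \<lambda>r x. interleave (snd X r (evens x)) (snd Y r (odds x)))"
  have fP: "fst P = V" by (simp add: P_def)
  have V: "vector_space_on V"
    by (rule vector_space_onI)
      (simp_all add: V_simps X.smult_in Y.smult_in X.smult_add Y.smult_add
        X.add_smult Y.add_smult X.smult_smult Y.smult_smult X.one_smult Y.one_smult X.zero_smult
        Y.zero_smult X.add_ac Y.add_ac)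
  have "fin_dim V"
  proof -
    obtain S where S: "finite S" "S \<subseteq> carrier (fst X)"
      and genX: "\<forall>I. subspace_of I (fst X) \<and> S \<subseteq> I \<longrightarrow> I = carrier (fst X)"
      using fin_dim_generators[OF vX fd_left_moduleD(2)[OF X]] by (elim exE conjE)
    obtain T where T: "finite T" "T \<subseteq> carrier (fst Y)"
      and genY: "\<forall>I. subspace_of I (fst Y) \<and> T \<subseteq> I \<longrightarrow> I = carrier (fst Y)"
      using fin_dim_generators[OF vY fd_left_moduleD(2)[OF Y]] by (elim exE conjE)
    let ?U = "(\<lambda>s. interleave s \<zero>\<^bsub>fst Y\<^esub>) ` S \<union> (\<lambda>t. interleave \<zero>\<^bsub>fst X\<^esub> t) ` T"
    show ?thesis
    proof (rule generators_fin_dim[OF V, of ?U])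
      show "finite ?U" "?U \<subseteq> carrier V" using S T by (auto simp: V_simps)
      fix I assume I: "subspace_of I V" "?U \<subseteq> I"
      have I0: "interleave \<zero>\<^bsub>fst X\<^esub> \<zero>\<^bsub>fst Y\<^esub> \<in> I" using I(1) by (simp add: subspace_of_def V_simps)
      have Ia: "interleave (evens x \<oplus>\<^bsub>fst X\<^esub> evens y) (odds x \<oplus>\<^bsub>fst Y\<^esub> odds y) \<in> I"
        if "x \<in> I" "y \<in> I" for x y using I(1) that by (simp add: subspace_of_def V_simps)
      have Is: "interleave (a \<odot>\<^bsub>fst X\<^esub> evens x) (a \<odot>\<^bsub>fst Y\<^esub> odds x) \<in> I"
        if "x \<in> I" for x a using I(1) that by (simp add: subspace_of_def V_simps)
      have "subspace_of {v \<in> carrier (fst X). interleave v \<zero>\<^bsub>fst Y\<^esub> \<in> I} (fst X)"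
        using I0 Ia[of "interleave v \<zero>\<^bsub>fst Y\<^esub>" "interleave w \<zero>\<^bsub>fst Y\<^esub>" for v w]
          Is[of "interleave v \<zero>\<^bsub>fst Y\<^esub>" for v]
        by (simp add: subspace_of_def X.smult_in Y.smult_zero subset_eq)
      moreover have "S \<subseteq> {v \<in> carrier (fst X). interleave v \<zero>\<^bsub>fst Y\<^esub> \<in> I}" using S I(2) by auto
      ultimately have "{v \<in> carrier (fst X). interleave v \<zero>\<^bsub>fst Y\<^esub> \<in> I} = carrier (fst X)"
        by (rule genX[rule_format, OF conjI])
      then have IX: "\<forall>v\<in>carrier (fst X). interleave v \<zero>\<^bsub>fst Y\<^esub> \<in> I" by blast
      have "subspace_of {v \<in> carrier (fst Y). interleave \<zero>\<^bsub>fst X\<^esub> v \<in> I} (fst Y)"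
        using I0 Ia[of "interleave \<zero>\<^bsub>fst X\<^esub> v" "interleave \<zero>\<^bsub>fst X\<^esub> w" for v w]
          Is[of "interleave \<zero>\<^bsub>fst X\<^esub> v" for v]
        by (simp add: subspace_of_def Y.smult_in X.smult_zero subset_eq)
      moreover have "T \<subseteq> {v \<in> carrier (fst Y). interleave \<zero>\<^bsub>fst X\<^esub> v \<in> I}" using T I(2) by auto
      ultimately have "{v \<in> carrier (fst Y). interleave \<zero>\<^bsub>fst X\<^esub> v \<in> I} = carrier (fst Y)"
        by (rule genY[rule_format, OF conjI])
      then have IY: "\<forall>v\<in>carrier (fst Y). interleave \<zero>\<^bsub>fst X\<^esub> v \<in> I" by blast
      have "x \<in> I" if "x \<in> carrier V" for x
        using Ia[OF IX[rule_format, of "evens x"] IY[rule_format, of "odds x"]] that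
        by (simp add: V_simps)
      then show "I = carrier V" using I(1) unfolding subspace_of_def by blast
    qed
  qed
  with V have P: "fd_left_module R P"
    using linD[OF fd_left_moduleD(3)[OF X]] linD[OF fd_left_moduleD(3)[OF Y]]
      linD[OF fd_left_moduleD(4)[OF X]] linD[OF fd_left_moduleD(4)[OF Y]]
    by (simp add: fd_left_module_def P_def lin_def V_simps Pi_iff
        fd_left_moduleD(5,6)[OF X] fd_left_moduleD(5,6)[OF Y])
  let ?i1 = "\<lambda>v. interleave v \<zero>\<^bsub>fst Y\<^esub>" and ?i2 = "\<lambda>v. interleave \<zero>\<^bsub>fst X\<^esub> v"
  have "module_map R X P ?i1" "module_map R Y P ?i2" "module_map R P X evens" "module_map R P Y odds"
    using lin_zero[OF fd_left_moduleD(3)[OF X] vX vX] lin_zero[OF fd_left_moduleD(3)[OF Y] vY vY]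
    by (simp_all add: module_map_def P_def lin_def V_simps X.smult_zero Y.smult_zero)
  note m = this
  have "biproduct (fd_modules R) X Y P (on_carrier (fst X) ?i1) (on_carrier (fst Y) ?i2)
    (on_carrier (fst P) evens) (on_carrier (fst P) odds)"
    unfolding biproduct_def Obj_fd_modules on_carrier_arr[OF X] on_carrier_arr[OF Y] on_carrier_arr[OF P]
      fd_comp[OF m(1)] fd_comp[OF m(2)] fd_comp[OF m(3)] fd_comp[OF m(4)] fd_add fd_Id fd_zero on_carrier_eq
    using P m by (simp add: fP V_simps)
  then show ?thesis by blast
qed

lemma has_finite_colimits_fd_modules:
  "has_finite_colimits (fd_modules R ::
     (('k::field, 'r, nat \<Rightarrow> 'k) rmod, (nat \<Rightarrow> 'k) \<Rightarrow> (nat \<Rightarrow> 'k) option, 'k) lcat)"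
  unfolding has_finite_colimits_def
  using zero_object_fd_modules biproduct_fd_modules coequalizer_fd_modules by blast

section \<open>Transport along an equivalence\<close>

context lin_category
begin

lemma comp_zero_left:
  assumes "X \<in> Obj C" "Y \<in> Obj C" "Z \<in> Obj C" "f \<in> arr C X Y"
  shows "\<zero>\<^bsub>Hom C Y Z\<^esub> \<cdot> f = \<zero>\<^bsub>Hom C X Z\<^esub>"
  using lin_zero[OF comp_lin_left[OF assms] hom_space[OF assms(2,3)] hom_space[OF assms(1,3)]] .

lemma comp_zero_right:
  assumes "X \<in> Obj C" "Y \<in> Obj C" "Z \<in> Obj C" "g \<in> arr C Y Z"
  shows "g \<cdot> \<zero>\<^bsub>Hom C X Y\<^esub> = \<zero>\<^bsub>Hom C X Z\<^esub>"
  using lin_zero[OF comp_lin_right[OF assms] hom_space[OF assms(1,2)] hom_space[OF assms(1,3)]] .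

lemma add_arr: "X \<in> Obj C \<Longrightarrow> Y \<in> Obj C \<Longrightarrow> f \<in> arr C X Y \<Longrightarrow> g \<in> arr C X Y
    \<Longrightarrow> f \<oplus>\<^bsub>Hom C X Y\<^esub> g \<in> arr C X Y"
  by (rule vspace.add_in[OF vspaceI[OF hom_space]])

lemma zero_arr: "X \<in> Obj C \<Longrightarrow> Y \<in> Obj C \<Longrightarrow> \<zero>\<^bsub>Hom C X Y\<^esub> \<in> arr C X Y"
  by (rule vspace.zero_in[OF vspaceI[OF hom_space]])

end

lemma ex1_eq: "\<exists>!x. P x \<Longrightarrow> P a \<Longrightarrow> P b \<Longrightarrow> a = b"
  by blast

locale cat_equivalence = F: lin_functor C D F + G: lin_functor D C G
  for C :: "('o, 'm, 'k::field, 'y) lcat_scheme" (structure) and D :: "('p, 'n, 'k, 'z) lcat_scheme"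
    and F :: "('o, 'm, 'p, 'n) fctr" and G :: "('p, 'n, 'o, 'm) fctr" +
  fixes \<theta> \<theta>' :: "'o \<Rightarrow> 'm" and \<epsilon> \<epsilon>' :: "'p \<Rightarrow> 'n"
  assumes \<theta>: "X \<in> Obj C \<Longrightarrow> \<theta> X \<in> arr C (Fo G (Fo F X)) X"
      "X \<in> Obj C \<Longrightarrow> \<theta>' X \<in> arr C X (Fo G (Fo F X))"
      "X \<in> Obj C \<Longrightarrow> \<theta> X \<cdot> \<theta>' X = Id C X"
      "X \<in> Obj C \<Longrightarrow> \<theta>' X \<cdot> \<theta> X = Id C (Fo G (Fo F X))"
      "\<lbrakk>X \<in> Obj C; Y \<in> Obj C; f \<in> arr C X Y\<rbrakk>
        \<Longrightarrow> \<theta> Y \<cdot> Fa G (Fo F X) (Fo F Y) (Fa F X Y f) = f \<cdot> \<theta> X"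
    and \<epsilon>: "U \<in> Obj D \<Longrightarrow> \<epsilon> U \<in> arr D (Fo F (Fo G U)) U"
      "U \<in> Obj D \<Longrightarrow> \<epsilon>' U \<in> arr D U (Fo F (Fo G U))"
      "U \<in> Obj D \<Longrightarrow> \<epsilon> U \<cdot>\<^bsub>D\<^esub> \<epsilon>' U = Id D U"
      "U \<in> Obj D \<Longrightarrow> \<epsilon>' U \<cdot>\<^bsub>D\<^esub> \<epsilon> U = Id D (Fo F (Fo G U))"
      "\<lbrakk>U \<in> Obj D; W \<in> Obj D; g \<in> arr D U W\<rbrakk>
        \<Longrightarrow> \<epsilon> W \<cdot>\<^bsub>D\<^esub> Fa F (Fo G U) (Fo G W) (Fa G U W g) = g \<cdot>\<^bsub>D\<^esub> \<epsilon> U"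
begin

lemma inverse_equivalence: "cat_equivalence D C G F \<epsilon> \<epsilon>' \<theta> \<theta>'"
  by (intro cat_equivalence.intro cat_equivalence_axioms.intro F.lin_functor_axioms G.lin_functor_axioms \<theta> \<epsilon>)

abbreviation dcomp (infixr "\<star>" 55) where "g \<star> f \<equiv> g \<cdot>\<^bsub>D\<^esub> f"

text \<open>The isomorphism \<open>\<theta> : G F \<cong> 1\<close> recovers an arrow from its image.\<close>

lemma faithful:
  assumes X: "X \<in> Obj C" and Y: "Y \<in> Obj C" and f: "f \<in> arr C X Y" and g: "g \<in> arr C X Y"
    and eq: "Fa F X Y f = Fa F X Y g"
  shows "f = g"
proof -
  have X': "Fo G (Fo F X) \<in> Obj C" using X by (simp add: F.obj G.obj)
  have "h = (\<theta> Y \<cdot> Fa G (Fo F X) (Fo F Y) (Fa F X Y h)) \<cdot> \<theta>' X" if h: "h \<in> arr C X Y" for h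
    unfolding \<theta>(5)[OF X Y h] F.dom.comp_assoc[OF X X' X Y \<theta>(2)[OF X] \<theta>(1)[OF X] h] \<theta>(3)[OF X]
    by (rule F.dom.id_right[OF X Y h, symmetric])
  from this[OF f] this[OF g] eq show ?thesis by simp
qed

lemma full:
  assumes X: "X \<in> Obj C" and Y: "Y \<in> Obj C" and g: "g \<in> arr D (Fo F X) (Fo F Y)"
  obtains f where "f \<in> arr C X Y" "Fa F X Y f = g"
proof -
  note o = F.obj[OF X] F.obj[OF Y] G.obj[OF F.obj[OF X]] G.obj[OF F.obj[OF Y]]
  have Gg: "Fa G (Fo F X) (Fo F Y) g \<in> arr C (Fo G (Fo F X)) (Fo G (Fo F Y))" (is "?G \<in> _")
    by (rule linD(1)[OF G.arrow[OF o(1,2)] g])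
  have tg: "\<theta> Y \<cdot> ?G \<in> arr C (Fo G (Fo F X)) Y" by (rule F.dom.comp_arr[OF o(3,4) Y Gg \<theta>(1)[OF Y]])
  let ?f = "(\<theta> Y \<cdot> ?G) \<cdot> \<theta>' X"
  have f: "?f \<in> arr C X Y" by (rule F.dom.comp_arr[OF X o(3) Y \<theta>(2)[OF X] tg])
  have GF: "Fa G (Fo F X) (Fo F Y) (Fa F X Y ?f) \<in> arr C (Fo G (Fo F X)) (Fo G (Fo F Y))" (is "?GF \<in> _")
    by (rule linD(1)[OF G.arrow[OF o(1,2)] linD(1)[OF F.arrow[OF X Y] f]])
  have "\<theta> Y \<cdot> ?GF = \<theta> Y \<cdot> ?G"
    unfolding \<theta>(5)[OF X Y f] F.dom.comp_assoc[OF o(3) X o(3) Y \<theta>(1)[OF X] \<theta>(2)[OF X] tg] \<theta>(4)[OF X]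
    by (rule F.dom.id_right[OF o(3) Y tg])
  then have "\<theta>' Y \<cdot> (\<theta> Y \<cdot> ?GF) = \<theta>' Y \<cdot> (\<theta> Y \<cdot> ?G)" by (rule arg_cong)
  then have "?GF = ?G"
    by (simp add: F.dom.comp_assoc[OF o(3,4) Y o(4) _ \<theta>(1)[OF Y] \<theta>(2)[OF Y], symmetric] GF Gg \<theta>(4)[OF Y]
      F.dom.id_left[OF o(3,4)])
  then have "Fa F X Y ?f = g"
    by (rule cat_equivalence.faithful[OF inverse_equivalence o(1,2) linD(1)[OF F.arrow[OF X Y] f] g])
  with f show ?thesis by (rule that)
qed

text \<open>
  \<open>F\<close> reflects colimits because it is fully faithful, and every colimit in \<open>D\<close> is isomorphic to one whose
  vertex is in the image of \<open>F\<close>.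
\<close>

lemma coequalizer_transport:
  assumes X: "X \<in> Obj C" and Y: "Y \<in> Obj C" and f: "f \<in> arr C X Y" and g: "g \<in> arr C X Y"
    and Q: "is_coequalizer D (Fo F X) (Fo F Y) (Fa F X Y f) (Fa F X Y g) Q q"
  shows "\<exists>Q q. is_coequalizer C X Y f g Q q"
proof -
  have Q: "Q \<in> Obj D" "q \<in> arr D (Fo F Y) Q" "q \<star> Fa F X Y f = q \<star> Fa F X Y g"
    and un: "\<And>Z h. Z \<in> Obj D \<Longrightarrow> h \<in> arr D (Fo F Y) Z \<Longrightarrow> h \<star> Fa F X Y f = h \<star> Fa F X Y g \<Longrightarrow>
       \<exists>!k. k \<in> arr D Q Z \<and> k \<star> q = h"
    using Q by (simp_all add: is_coequalizer_def)
  note GQ = G.obj[OF Q(1)] and o = F.obj[OF X] F.obj[OF Y]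
  note FGQ = F.obj[OF GQ] and Fa = linD(1)[OF F.arrow]
  obtain p where p: "p \<in> arr C Y (Fo G Q)" "Fa F Y (Fo G Q) p = \<epsilon>' Q \<star> q"
    by (rule full[OF Y GQ F.cod.comp_arr[OF o(2) Q(1) FGQ Q(2) \<epsilon>(2)[OF Q(1)]]])
  have "is_coequalizer C X Y f g (Fo G Q) p"
    unfolding is_coequalizer_def
  proof (intro conjI ballI impI)
    show "Fo G Q \<in> Obj C" "p \<in> arr C Y (Fo G Q)" by (rule GQ, rule p)
    show "p \<cdot> f = p \<cdot> g"
      by (rule faithful[OF X GQ F.dom.comp_arr[OF X Y GQ f p(1)] F.dom.comp_arr[OF X Y GQ g p(1)]])
        (simp add: F.comp[OF X Y GQ _ p(1)] f g p(2) Q(3)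
          F.cod.comp_assoc[OF o Q(1) FGQ Fa[OF X Y] Q(2) \<epsilon>(2)[OF Q(1)]])
    fix Z h assume Z: "Z \<in> Obj C" and h: "h \<in> arr C Y Z" and hfg: "h \<cdot> f = h \<cdot> g"
    note FZ = F.obj[OF Z]
    have "Fa F Y Z h \<star> Fa F X Y f = Fa F Y Z h \<star> Fa F X Y g"
      using F.comp[OF X Y Z f h] F.comp[OF X Y Z g h] hfg by simp
    note un = un[OF FZ Fa[OF Y Z h] this]
    then obtain k where k: "k \<in> arr D Q (Fo F Z)" "k \<star> q = Fa F Y Z h" by blast
    obtain m where m: "m \<in> arr C (Fo G Q) Z" "Fa F (Fo G Q) Z m = k \<star> \<epsilon> Q"
      by (rule full[OF GQ Z F.cod.comp_arr[OF FGQ Q(1) FZ \<epsilon>(1)[OF Q(1)] k(1)]])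
    have cancel: "(Fa F (Fo G Q) Z l \<star> \<epsilon>' Q) \<star> q = Fa F Y Z (l \<cdot> p)" "Fa F (Fo G Q) Z l \<star> \<epsilon>' Q \<in> arr D Q (Fo F Z)"
      if l: "l \<in> arr C (Fo G Q) Z" for l
      using F.comp[OF Y GQ Z p(1) l] F.cod.comp_assoc[OF o(2) Q(1) FGQ FZ Q(2) \<epsilon>(2)[OF Q(1)] Fa[OF GQ Z l]]
        F.cod.comp_arr[OF Q(1) FGQ FZ \<epsilon>(2)[OF Q(1)] Fa[OF GQ Z l]] by (simp_all add: p(2))
    have mk: "Fa F (Fo G Q) Z m \<star> \<epsilon>' Q = k"
      unfolding m(2) F.cod.comp_assoc[OF Q(1) FGQ Q(1) FZ \<epsilon>(2)[OF Q(1)] \<epsilon>(1)[OF Q(1)] k(1)] \<epsilon>(3)[OF Q(1)]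
      by (rule F.cod.id_right[OF Q(1) FZ k(1)])
    show "\<exists>!k. k \<in> arr C (Fo G Q) Z \<and> k \<cdot> p = h"
    proof (rule ex1I[of _ m], rule conjI)
      show "m \<in> arr C (Fo G Q) Z" by (rule m)
      show "m \<cdot> p = h"
        by (rule faithful[OF Y Z F.dom.comp_arr[OF Y GQ Z p(1) m(1)] h]) (use cancel(1)[OF m(1)] mk k(2) in simp)
      fix l assume "l \<in> arr C (Fo G Q) Z \<and> l \<cdot> p = h"
      then have l: "l \<in> arr C (Fo G Q) Z" "l \<cdot> p = h" by simp_all
      have lk: "Fa F (Fo G Q) Z l \<star> \<epsilon>' Q = k"
        by (rule ex1_eq[OF un]) (use cancel[OF l(1)] l(2) k in simp_all)
      show "l = m"
      proof (rule faithful[OF GQ Z l(1) m(1)])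
        show "Fa F (Fo G Q) Z l = Fa F (Fo G Q) Z m"
          using F.cod.comp_assoc[OF FGQ Q(1) FGQ FZ \<epsilon>(1)[OF Q(1)] \<epsilon>(2)[OF Q(1)] Fa[OF GQ Z l(1)]]
            F.cod.id_right[OF FGQ FZ Fa[OF GQ Z l(1)]] by (simp add: lk m(2) \<epsilon>(4)[OF Q(1)])
      qed
    qed
  qed
  then show ?thesis by blast
qed

lemma biproduct_transport:
  assumes X: "X \<in> Obj C" and Y: "Y \<in> Obj C" and P: "biproduct D (Fo F X) (Fo F Y) P i1 i2 p1 p2"
  shows "\<exists>P i1 i2 p1 p2. biproduct C X Y P i1 i2 p1 p2"
proof -
  note o = F.obj[OF X] F.obj[OF Y]
  have P: "P \<in> Obj D" "i1 \<in> arr D (Fo F X) P" "i2 \<in> arr D (Fo F Y) P" "p1 \<in> arr D P (Fo F X)" "p2 \<in> arr D P (Fo F Y)"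
    "p1 \<star> i1 = Id D (Fo F X)" "p2 \<star> i2 = Id D (Fo F Y)" "p1 \<star> i2 = \<zero>\<^bsub>Hom D (Fo F Y) (Fo F X)\<^esub>"
    "p2 \<star> i1 = \<zero>\<^bsub>Hom D (Fo F X) (Fo F Y)\<^esub>" "(i1 \<star> p1) \<oplus>\<^bsub>Hom D P P\<^esub> (i2 \<star> p2) = Id D P"
    using P by (simp_all add: biproduct_def)
  note GP = G.obj[OF P(1)] and e = \<epsilon>[OF P(1)]
  note FGP = F.obj[OF GP] and Fa = linD(1)[OF F.arrow]
  have i: "\<exists>f. f \<in> arr C Z (Fo G P) \<and> Fa F Z (Fo G P) f = \<epsilon>' P \<star> h" if "Z \<in> Obj C" "h \<in> arr D (Fo F Z) P" for Z h
    using full[OF that(1) GP F.cod.comp_arr[OF F.obj[OF that(1)] P(1) FGP that(2) e(2)]] by blast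
  have p: "\<exists>f. f \<in> arr C (Fo G P) Z \<and> Fa F (Fo G P) Z f = h \<star> \<epsilon> P" if "Z \<in> Obj C" "h \<in> arr D P (Fo F Z)" for Z h
    using full[OF GP that(1) F.cod.comp_arr[OF FGP P(1) F.obj[OF that(1)] e(1) that(2)]] by blast
  obtain j1 j2 q1 q2 where j: "j1 \<in> arr C X (Fo G P)" "Fa F X (Fo G P) j1 = \<epsilon>' P \<star> i1"
      "j2 \<in> arr C Y (Fo G P)" "Fa F Y (Fo G P) j2 = \<epsilon>' P \<star> i2"
    and q: "q1 \<in> arr C (Fo G P) X" "Fa F (Fo G P) X q1 = p1 \<star> \<epsilon> P" "q2 \<in> arr C (Fo G P) Y" "Fa F (Fo G P) Y q2 = p2 \<star> \<epsilon> P"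
    using i[OF X P(2)] i[OF Y P(3)] p[OF X P(4)] p[OF Y P(5)] by blast
  have qj: "Fa F Z W (q \<cdot> j) = b \<star> a" "q \<cdot> j \<in> arr C Z W"
    if Z: "Z \<in> Obj C" and W: "W \<in> Obj C" and a: "a \<in> arr D (Fo F Z) P" and b: "b \<in> arr D P (Fo F W)"
      and j: "j \<in> arr C Z (Fo G P)" "Fa F Z (Fo G P) j = \<epsilon>' P \<star> a"
      and q: "q \<in> arr C (Fo G P) W" "Fa F (Fo G P) W q = b \<star> \<epsilon> P" for Z W a b j q
  proof -
    note oo = F.obj[OF Z] F.obj[OF W]
    show "q \<cdot> j \<in> arr C Z W" by (rule F.dom.comp_arr[OF Z GP W j(1) q(1)])
    have "Fa F Z W (q \<cdot> j) = b \<star> (\<epsilon> P \<star> (\<epsilon>' P \<star> a))"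
      unfolding F.comp[OF Z GP W j(1) q(1)] j(2) q(2)
      by (rule F.cod.comp_assoc[OF oo(1) FGP P(1) oo(2) F.cod.comp_arr[OF oo(1) P(1) FGP a e(2)] e(1) b])
    also have "\<epsilon> P \<star> (\<epsilon>' P \<star> a) = a"
      using F.cod.comp_assoc[OF oo(1) P(1) FGP P(1) a e(2,1)] F.cod.id_left[OF oo(1) P(1) a] by (simp add: e(3))
    finally show "Fa F Z W (q \<cdot> j) = b \<star> a" .
  qed
  have z: "Fa F Z W \<zero>\<^bsub>Hom C Z W\<^esub> = \<zero>\<^bsub>Hom D (Fo F Z) (Fo F W)\<^esub>" if "Z \<in> Obj C" "W \<in> Obj C" for Z W
    by (rule lin_zero[OF F.arrow[OF that] F.dom.hom_space[OF that] F.cod.hom_space[OF F.obj[OF that(1)] F.obj[OF that(2)]]])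
  have jq: "Fa F (Fo G P) (Fo G P) (j \<cdot> q) = \<epsilon>' P \<star> ((a \<star> b) \<star> \<epsilon> P)" "j \<cdot> q \<in> arr C (Fo G P) (Fo G P)"
    if Z: "Z \<in> Obj C" and a: "a \<in> arr D (Fo F Z) P" and b: "b \<in> arr D P (Fo F Z)"
      and j: "j \<in> arr C Z (Fo G P)" "Fa F Z (Fo G P) j = \<epsilon>' P \<star> a"
      and q: "q \<in> arr C (Fo G P) Z" "Fa F (Fo G P) Z q = b \<star> \<epsilon> P" for Z a b j q
  proof -
    note FZ = F.obj[OF Z]
    note be = F.cod.comp_arr[OF FGP P(1) FZ e(1) b]
    show "j \<cdot> q \<in> arr C (Fo G P) (Fo G P)" by (rule F.dom.comp_arr[OF GP Z GP q(1) j(1)])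
    show "Fa F (Fo G P) (Fo G P) (j \<cdot> q) = \<epsilon>' P \<star> ((a \<star> b) \<star> \<epsilon> P)"
      using F.comp[OF GP Z GP q(1) j(1)] F.cod.comp_assoc[OF FGP FZ P(1) FGP be a e(2)]
        F.cod.comp_assoc[OF FGP P(1) FZ P(1) e(1) b a] by (simp add: j(2) q(2))
  qed
  note jq1 = jq[OF X P(2,4) j(1,2) q(1,2)] and jq2 = jq[OF Y P(3,5) j(3,4) q(3,4)]
  have ab: "i1 \<star> p1 \<in> arr D P P" "i2 \<star> p2 \<in> arr D P P"
    using F.cod.comp_arr[OF P(1) o(1) P(1) P(4,2)] F.cod.comp_arr[OF P(1) o(2) P(1) P(5,3)] by simp_all
  interpret H: vspace "Hom C (Fo G P) (Fo G P)" by (rule vspaceI[OF F.dom.hom_space[OF GP GP]])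
  have "(j1 \<cdot> q1) \<oplus>\<^bsub>Hom C (Fo G P) (Fo G P)\<^esub> (j2 \<cdot> q2) = Id C (Fo G P)"
  proof (rule faithful[OF GP GP H.add_in[OF jq1(2) jq2(2)] F.dom.id_arr[OF GP]])
    note l = lin_comp[OF F.cod.comp_lin_left[OF FGP P(1,1) e(1)] F.cod.comp_lin_right[OF FGP P(1) FGP e(2)]]
    have "\<epsilon>' P \<star> (Id D P \<star> \<epsilon> P) = Id D (Fo F (Fo G P))" using F.cod.id_left[OF FGP P(1) e(1)] e(4) by simp
    then show "Fa F (Fo G P) (Fo G P) ((j1 \<cdot> q1) \<oplus>\<^bsub>Hom C (Fo G P) (Fo G P)\<^esub> (j2 \<cdot> q2)) = Fa F (Fo G P) (Fo G P) (Id C (Fo G P))"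
      using linD(2)[OF F.arrow[OF GP GP] jq1(2) jq2(2)] linD(2)[OF l ab] by (simp add: jq1(1) jq2(1) P(10) F.ident[OF GP])
  qed
  moreover have "q1 \<cdot> j1 = Id C X" "q2 \<cdot> j2 = Id C Y" "q1 \<cdot> j2 = \<zero>\<^bsub>Hom C Y X\<^esub>" "q2 \<cdot> j1 = \<zero>\<^bsub>Hom C X Y\<^esub>"
    using qj[OF X X P(2,4) j(1,2) q(1,2)] qj[OF Y Y P(3,5) j(3,4) q(3,4)] qj[OF Y X P(3,4) j(3,4) q(1,2)]
      qj[OF X Y P(2,5) j(1,2) q(3,4)] P(6-9) z[OF X Y] z[OF Y X] F.ident[OF X] F.ident[OF Y]
      faithful[OF X X _ F.dom.id_arr[OF X]] faithful[OF Y Y _ F.dom.id_arr[OF Y]]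
      faithful[OF X Y _ F.dom.zero_arr[OF X Y]] faithful[OF Y X _ F.dom.zero_arr[OF Y X]] by simp_all
  ultimately show ?thesis using GP j q unfolding biproduct_def by blast
qed

lemma has_finite_colimits_transport:
  assumes "has_finite_colimits D"
  shows "has_finite_colimits C"
  unfolding has_finite_colimits_def
proof (intro conjI ballI)
  obtain Z where Z: "zero_object D Z" using assms by (auto simp: has_finite_colimits_def)
  then have Z': "Z \<in> Obj D" "Id D Z = \<zero>\<^bsub>Hom D Z Z\<^esub>" by (simp_all add: zero_object_def)
  have "Id C (Fo G Z) = \<zero>\<^bsub>Hom C (Fo G Z) (Fo G Z)\<^esub>"
    using G.ident[OF Z'(1)] Z'(2)
      lin_zero[OF G.arrow[OF Z'(1,1)] F.cod.hom_space[OF Z'(1,1)] F.dom.hom_space[OF G.obj[OF Z'(1)] G.obj[OF Z'(1)]]]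
    by simp
  then show "\<exists>Z. zero_object C Z" using G.obj[OF Z'(1)] unfolding zero_object_def by blast
next
  fix X Y assume XY: "X \<in> Obj C" "Y \<in> Obj C"
  obtain P i1 i2 p1 p2 where "biproduct D (Fo F X) (Fo F Y) P i1 i2 p1 p2"
    using assms F.obj[OF XY(1)] F.obj[OF XY(2)] unfolding has_finite_colimits_def by blast
  from biproduct_transport[OF XY this] show "\<exists>P i1 i2 p1 p2. biproduct C X Y P i1 i2 p1 p2" .
next
  fix X Y f g assume XY: "X \<in> Obj C" "Y \<in> Obj C" and f: "f \<in> arr C X Y" and g: "g \<in> arr C X Y"
  obtain Q q where "is_coequalizer D (Fo F X) (Fo F Y) (Fa F X Y f) (Fa F X Y g) Q q"
    using assms F.obj[OF XY(1)] F.obj[OF XY(2)] linD(1)[OF F.arrow[OF XY] f] linD(1)[OF F.arrow[OF XY] g]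
    unfolding has_finite_colimits_def by blast
  from coequalizer_transport[OF XY f g this] show "\<exists>Q q. is_coequalizer C X Y f g Q q" .
qed

lemma finite_homs_transport:
  assumes "finite_homs D"
  shows "finite_homs C"
  unfolding finite_homs_def
proof (intro ballI)
  fix X Y assume XY: "X \<in> Obj C" "Y \<in> Obj C"
  note l = F.arrow[OF XY]
  have z: "Fa F X Y \<zero>\<^bsub>Hom C X Y\<^esub> = \<zero>\<^bsub>Hom D (Fo F X) (Fo F Y)\<^esub>"
    by (rule lin_zero[OF l F.dom.hom_space[OF XY] F.cod.hom_space[OF F.obj[OF XY(1)] F.obj[OF XY(2)]]])
  show "finite_coords (Hom C X Y)"
  proof (rule finite_coords_injective[OF l])
    show "finite_coords (Hom D (Fo F X) (Fo F Y))"
      using assms F.obj XY by (simp add: finite_homs_def)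
    fix v assume "v \<in> arr C X Y" "Fa F X Y v = \<zero>\<^bsub>Hom D (Fo F X) (Fo F Y)\<^esub>"
    then show "v = \<zero>\<^bsub>Hom C X Y\<^esub>" using faithful[OF XY _ F.dom.zero_arr[OF XY]] z by simp
  qed
qed

end

lemma equivalent_catsE:
  assumes "equivalent_cats C D"
  obtains F G \<theta> \<theta>' \<epsilon> \<epsilon>' where "cat_equivalence C D F G \<theta> \<theta>' \<epsilon> \<epsilon>'"
proof -
  obtain F G where F: "lin_functor C D F" and G: "lin_functor D C G"
    and GF: "nat_iso C C (fcomp G F) fid" and FG: "nat_iso D D (fcomp F G) fid"
    using assms unfolding equivalent_cats_def by blast
  obtain \<theta> where \<theta>: "\<forall>X\<in>Obj C. is_iso C (Fo G (Fo F X)) X (\<theta> X)"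
    "\<forall>X\<in>Obj C. \<forall>Y\<in>Obj C. \<forall>f\<in>arr C X Y. \<theta> Y \<cdot>\<^bsub>C\<^esub> Fa G (Fo F X) (Fo F Y) (Fa F X Y f) = f \<cdot>\<^bsub>C\<^esub> \<theta> X"
    using GF unfolding nat_iso_def fid_def fcomp_def by auto
  obtain \<epsilon> where \<epsilon>: "\<forall>X\<in>Obj D. is_iso D (Fo F (Fo G X)) X (\<epsilon> X)"
    "\<forall>X\<in>Obj D. \<forall>Y\<in>Obj D. \<forall>f\<in>arr D X Y. \<epsilon> Y \<cdot>\<^bsub>D\<^esub> Fa F (Fo G X) (Fo G Y) (Fa G X Y f) = f \<cdot>\<^bsub>D\<^esub> \<epsilon> X"
    using FG unfolding nat_iso_def fid_def fcomp_def by auto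
  have "\<forall>X\<in>Obj C. \<exists>g. g \<in> arr C X (Fo G (Fo F X)) \<and> g \<cdot>\<^bsub>C\<^esub> \<theta> X = Id C (Fo G (Fo F X)) \<and> \<theta> X \<cdot>\<^bsub>C\<^esub> g = Id C X"
    using \<theta>(1) unfolding is_iso_def by blast
  then obtain \<theta>' where \<theta>': "\<forall>X\<in>Obj C. \<theta>' X \<in> arr C X (Fo G (Fo F X)) \<and>
      \<theta>' X \<cdot>\<^bsub>C\<^esub> \<theta> X = Id C (Fo G (Fo F X)) \<and> \<theta> X \<cdot>\<^bsub>C\<^esub> \<theta>' X = Id C X"
    by (rule exE[OF bchoice])
  have "\<forall>X\<in>Obj D. \<exists>g. g \<in> arr D X (Fo F (Fo G X)) \<and> g \<cdot>\<^bsub>D\<^esub> \<epsilon> X = Id D (Fo F (Fo G X)) \<and> \<epsilon> X \<cdot>\<^bsub>D\<^esub> g = Id D X"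
    using \<epsilon>(1) unfolding is_iso_def by blast
  then obtain \<epsilon>' where \<epsilon>': "\<forall>X\<in>Obj D. \<epsilon>' X \<in> arr D X (Fo F (Fo G X)) \<and>
      \<epsilon>' X \<cdot>\<^bsub>D\<^esub> \<epsilon> X = Id D (Fo F (Fo G X)) \<and> \<epsilon> X \<cdot>\<^bsub>D\<^esub> \<epsilon>' X = Id D X"
    by (rule exE[OF bchoice])
  have "cat_equivalence_axioms C D F G \<theta> \<theta>' \<epsilon> \<epsilon>'"
    by unfold_locales (use \<theta> \<theta>' \<epsilon> \<epsilon>' in \<open>auto simp: is_iso_def\<close>)
  then show ?thesis using that F G by (simp add: cat_equivalence_def)
qed

theorem finite_abelian_colimits:
  fixes C :: "('o, 'm, 'k::field, 'z) lcat_scheme"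
  assumes "finite_abelian C"
  shows "lin_category C" "has_finite_colimits C" "finite_homs C"
proof -
  obtain R :: "('k, nat \<Rightarrow> 'k) module" where "equivalent_cats C (fd_modules R ::
       (('k, nat \<Rightarrow> 'k, nat \<Rightarrow> 'k) rmod, (nat \<Rightarrow> 'k) \<Rightarrow> (nat \<Rightarrow> 'k) option, 'k) lcat)"
    using assms unfolding finite_abelian_def by blast
  then obtain F G \<theta> \<theta>' \<epsilon> \<epsilon>' where "cat_equivalence C (fd_modules R ::
       (('k, nat \<Rightarrow> 'k, nat \<Rightarrow> 'k) rmod, (nat \<Rightarrow> 'k) \<Rightarrow> (nat \<Rightarrow> 'k) option, 'k) lcat) F G \<theta> \<theta>' \<epsilon> \<epsilon>'"
    by (rule equivalent_catsE)
  then interpret cat_equivalence C "fd_modules R ::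
       (('k, nat \<Rightarrow> 'k, nat \<Rightarrow> 'k) rmod, (nat \<Rightarrow> 'k) \<Rightarrow> (nat \<Rightarrow> 'k) option, 'k) lcat" F G \<theta> \<theta>' \<epsilon> \<epsilon>' .
  show "lin_category C" by (rule F.dom.lin_category_axioms)
  show "has_finite_colimits C" by (rule has_finite_colimits_transport[OF has_finite_colimits_fd_modules])
  show "finite_homs C" by (rule finite_homs_transport[OF finite_homs_fd_modules])
qed

section \<open>Copowers\<close>

lemma (in lin_category) biproduct_coproduct:
  assumes P: "biproduct C X Y P i1 i2 p1 p2" and obj: "X \<in> Obj C" "Y \<in> Obj C" "Z \<in> Obj C"
  shows "f \<in> arr C X Z \<Longrightarrow> g \<in> arr C Y Z \<Longrightarrow> \<exists>h. h \<in> arr C P Z \<and> h \<cdot> i1 = f \<and> h \<cdot> i2 = g"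
    and "h \<in> arr C P Z \<Longrightarrow> k \<in> arr C P Z \<Longrightarrow> h \<cdot> i1 = k \<cdot> i1 \<Longrightarrow> h \<cdot> i2 = k \<cdot> i2 \<Longrightarrow> h = k"
proof -
  have P: "P \<in> Obj C" "i1 \<in> arr C X P" "i2 \<in> arr C Y P" "p1 \<in> arr C P X" "p2 \<in> arr C P Y"
    "p1 \<cdot> i1 = Id C X" "p2 \<cdot> i2 = Id C Y"
    "p1 \<cdot> i2 = \<zero>\<^bsub>Hom C Y X\<^esub>" "p2 \<cdot> i1 = \<zero>\<^bsub>Hom C X Y\<^esub>"
    "(i1 \<cdot> p1) \<oplus>\<^bsub>Hom C P P\<^esub> (i2 \<cdot> p2) = Id C P"
    using P by (simp_all add: biproduct_def)
  interpret XZ: vspace "Hom C X Z" by (rule vspaceI[OF hom_space[OF obj(1,3)]])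
  interpret YZ: vspace "Hom C Y Z" by (rule vspaceI[OF hom_space[OF obj(2,3)]])
  {
    assume f: "f \<in> arr C X Z" and g: "g \<in> arr C Y Z"
    let ?h = "(f \<cdot> p1) \<oplus>\<^bsub>Hom C P Z\<^esub> (g \<cdot> p2)"
    have fp: "f \<cdot> p1 \<in> arr C P Z" by (rule comp_arr[OF P(1) obj(1,3) P(4) f])
    have gp: "g \<cdot> p2 \<in> arr C P Z" by (rule comp_arr[OF P(1) obj(2,3) P(5) g])
    have "?h \<in> arr C P Z" by (rule add_arr[OF P(1) obj(3) fp gp])
    moreover have "?h \<cdot> i1 = f"
      using linD(2)[OF comp_lin_left[OF obj(1) P(1) obj(3) P(2)] fp gp] f
      by (simp add: comp_assoc[OF obj(1) P(1) obj(1,3) P(2,4) f] comp_assoc[OF obj(1) P(1) obj(2,3) P(2,5) g]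
        P(6,9) id_right[OF obj(1,3) f] comp_zero_right[OF obj g])
    moreover have "?h \<cdot> i2 = g"
      using linD(2)[OF comp_lin_left[OF obj(2) P(1) obj(3) P(3)] fp gp] g
      by (simp add: comp_assoc[OF obj(2) P(1) obj(1,3) P(3,4) f] comp_assoc[OF obj(2) P(1) obj(2,3) P(3,5) g]
        P(7,8) id_right[OF obj(2,3) g] comp_zero_right[OF obj(2,1,3) f])
    ultimately show "\<exists>h. h \<in> arr C P Z \<and> h \<cdot> i1 = f \<and> h \<cdot> i2 = g" by blast
  next
    have *: "l = ((l \<cdot> i1) \<cdot> p1) \<oplus>\<^bsub>Hom C P Z\<^esub> ((l \<cdot> i2) \<cdot> p2)" if l: "l \<in> arr C P Z" for l
    proof -
      have "l = l \<cdot> ((i1 \<cdot> p1) \<oplus>\<^bsub>Hom C P P\<^esub> (i2 \<cdot> p2))" by (simp add: P(10) id_right[OF P(1) obj(3) l])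
      also have "\<dots> = (l \<cdot> (i1 \<cdot> p1)) \<oplus>\<^bsub>Hom C P Z\<^esub> (l \<cdot> (i2 \<cdot> p2))"
        by (rule linD(2)[OF comp_lin_right[OF P(1,1) obj(3) l]])
          (rule comp_arr[OF P(1) obj(1) P(1) P(4,2)] comp_arr[OF P(1) obj(2) P(1) P(5,3)])+
      finally show ?thesis
        by (simp add: comp_assoc[OF P(1) obj(1) P(1) obj(3) P(4,2) l] comp_assoc[OF P(1) obj(2) P(1) obj(3) P(5,3) l])
    qed
    assume "h \<in> arr C P Z" "k \<in> arr C P Z" "h \<cdot> i1 = k \<cdot> i1" "h \<cdot> i2 = k \<cdot> i2"
    then show "h = k" using *[of h] *[of k] by simp
  }
qed

text \<open>
  Splitting off a line from \<open>V\<close> adds a copy of \<open>X\<close> to \<open>V \<otimes> X\<close>, so a space with finitely many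
  coordinates has a copower as soon as there are a zero object and binary coproducts.
\<close>

lemma (in lin_category) copower_exists:
  assumes colim: "has_finite_colimits C" and V: "vector_space_on V" and fin: "finite_coords V"
    and X: "X \<in> Obj C"
  shows "\<exists>P u. is_copower C V X P u"
proof -
  interpret V: vspace V by (rule vspaceI[OF V])
  have "\<exists>P u. is_copower C (V\<lparr>carrier := carrier V\<rparr>) X P u"
    using V fin
  proof (induction rule: finite_coords_induct)
    case (zero I)
    obtain Z where Z: "Z \<in> Obj C" "Id C Z = \<zero>\<^bsub>Hom C Z Z\<^esub>"
      using colim by (auto simp: has_finite_colimits_def zero_object_def)
    interpret XZ: vspace "Hom C X Z" by (rule vspaceI[OF hom_space[OF X Z(1)]])
    have "is_copower C (V\<lparr>carrier := I\<rparr>) X Z (\<lambda>_. \<zero>\<^bsub>Hom C X Z\<^esub>)"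
      unfolding is_copower_def
    proof (intro conjI ballI)
      show "Z \<in> Obj C" by (rule Z)
      show "(\<lambda>_. \<zero>\<^bsub>Hom C X Z\<^esub>) \<in> lin (V\<lparr>carrier := I\<rparr>) (Hom C X Z)"
        by (rule linI) (simp_all add: XZ.smult_zero)
      fix Y g assume Y: "Y \<in> Obj C" and g: "g \<in> lin (V\<lparr>carrier := I\<rparr>) (Hom C X Y)"
      have g0: "g \<zero>\<^bsub>V\<^esub> = \<zero>\<^bsub>Hom C X Y\<^esub>"
        using lin_zero[OF g vector_space_on_subspace[OF V zero(1)] hom_space[OF X Y]] by simp
      show "\<exists>!h. h \<in> arr C Z Y \<and> (\<forall>v\<in>carrier (V\<lparr>carrier := I\<rparr>). h \<cdot> \<zero>\<^bsub>Hom C X Z\<^esub> = g v)"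
      proof (rule ex1I, rule conjI)
        show "\<zero>\<^bsub>Hom C Z Y\<^esub> \<in> arr C Z Y" by (rule zero_arr[OF Z(1) Y])
        show "\<forall>v\<in>carrier (V\<lparr>carrier := I\<rparr>). \<zero>\<^bsub>Hom C Z Y\<^esub> \<cdot> \<zero>\<^bsub>Hom C X Z\<^esub> = g v"
          using zero(2) g0 by (simp add: comp_zero_left[OF X Z(1) Y zero_arr[OF X Z(1)]])
        fix h assume "h \<in> arr C Z Y \<and> (\<forall>v\<in>carrier (V\<lparr>carrier := I\<rparr>). h \<cdot> \<zero>\<^bsub>Hom C X Z\<^esub> = g v)"
        then have h: "h \<in> arr C Z Y" ..
        then show "h = \<zero>\<^bsub>Hom C Z Y\<^esub>"
          using id_right[OF Z(1) Y h] comp_zero_right[OF Z(1,1) Y h] Z(2) by simp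
      qed
    qed
    then show ?case by blast
  next
    case (line I J \<phi> w)
    obtain P u where "is_copower C (V\<lparr>carrier := J\<rparr>) X P u" using line by blast
    then have P: "P \<in> Obj C" and u: "u \<in> lin (V\<lparr>carrier := J\<rparr>) (Hom C X P)"
      and univ: "\<And>Y g. Y \<in> Obj C \<Longrightarrow> g \<in> lin (V\<lparr>carrier := J\<rparr>) (Hom C X Y) \<Longrightarrow>
        \<exists>!h. h \<in> arr C P Y \<and> (\<forall>v\<in>J. h \<cdot> u v = g v)"
      by (simp_all add: is_copower_def)
    obtain Q i1 i2 p1 p2 where Q: "biproduct C X P Q i1 i2 p1 p2"
      using colim X P unfolding has_finite_colimits_def by blast
    then have QO: "Q \<in> Obj C" and i1: "i1 \<in> arr C X Q" and i2: "i2 \<in> arr C P Q"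
      by (simp_all add: biproduct_def)
    note VI = vector_space_on_subspace[OF V line(1)] and VJ = vector_space_on_subspace[OF V line(2)]
    interpret XP: vspace "Hom C X P" by (rule vspaceI[OF hom_space[OF X P]])
    interpret XQ: vspace "Hom C X Q" by (rule vspaceI[OF hom_space[OF X QO]])
    have IV: "v \<in> carrier V" if "v \<in> I" for v using line(1) that by (auto simp: subspace_of_def)
    have Ia: "v \<oplus>\<^bsub>V\<^esub> v' \<in> I" if "v \<in> I" "v' \<in> I" for v v' using line(1) that by (auto simp: subspace_of_def)
    have Is: "a \<odot>\<^bsub>V\<^esub> v \<in> I" if "v \<in> I" for a v using line(1) that by (auto simp: subspace_of_def)
    have wI: "w \<in> I" and \<phi>w: "\<phi> w = 1" by fact+
    have \<phi>: "\<phi> (v \<oplus>\<^bsub>V\<^esub> v') = \<phi> v + \<phi> v'" "\<phi> (a \<odot>\<^bsub>V\<^esub> v) = a * \<phi> v" if "v \<in> I" "v' \<in> I" for v v' a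
      using line(4) that by (simp_all add: functional_def)
    \<comment> \<open>the projection to \<open>J\<close> along \<open>w\<close>\<close>
    define r where "r v = v \<oplus>\<^bsub>V\<^esub> (- \<phi> v) \<odot>\<^bsub>V\<^esub> w" for v
    have rJ: "r v \<in> J" if "v \<in> I" for v
      using that wI by (simp add: r_def line(6) Ia Is \<phi> \<phi>w)
    have r_lin: "r \<in> lin (V\<lparr>carrier := I\<rparr>) (V\<lparr>carrier := J\<rparr>)"
    proof (rule linI)
      fix v v' assume "v \<in> carrier (V\<lparr>carrier := I\<rparr>)" "v' \<in> carrier (V\<lparr>carrier := I\<rparr>)"
      then show "r (v \<oplus>\<^bsub>V\<lparr>carrier := I\<rparr>\<^esub> v') = r v \<oplus>\<^bsub>V\<lparr>carrier := J\<rparr>\<^esub> r v'"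
        using V.add_smult[of w "- \<phi> v'" "- \<phi> v"]
        by (simp add: r_def \<phi> IV wI V.smult_in V.add_ac)
    next
      fix a v assume "v \<in> carrier (V\<lparr>carrier := I\<rparr>)"
      then show "r (a \<odot>\<^bsub>V\<lparr>carrier := I\<rparr>\<^esub> v) = a \<odot>\<^bsub>V\<lparr>carrier := J\<rparr>\<^esub> r v"
        by (simp add: r_def \<phi> IV wI V.smult_in V.smult_add V.smult_smult)
    qed (simp add: rJ)
    have ur: "(\<lambda>v. u (r v)) \<in> lin (V\<lparr>carrier := I\<rparr>) (Hom C X P)" by (rule lin_comp[OF r_lin u])
    have iur: "(\<lambda>v. i2 \<cdot> u (r v)) \<in> lin (V\<lparr>carrier := I\<rparr>) (Hom C X Q)"
      by (rule lin_comp[OF ur comp_lin_right[OF X P QO i2]])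
    \<comment> \<open>\<open>w\<close> goes to the new copy of \<open>X\<close>, and \<open>J\<close> to its own copower\<close>
    define u' where "u' v = \<phi> v \<odot>\<^bsub>Hom C X Q\<^esub> i1 \<oplus>\<^bsub>Hom C X Q\<^esub> (i2 \<cdot> u (r v))" for v
    have iur': "i2 \<cdot> u (r v) \<in> arr C X Q" if "v \<in> I" for v
      using linD(1)[OF iur, of v] that by simp
    have u'_lin: "u' \<in> lin (V\<lparr>carrier := I\<rparr>) (Hom C X Q)"
    proof (rule linI)
      fix v v' assume v: "v \<in> carrier (V\<lparr>carrier := I\<rparr>)" "v' \<in> carrier (V\<lparr>carrier := I\<rparr>)"
      then show "u' (v \<oplus>\<^bsub>V\<lparr>carrier := I\<rparr>\<^esub> v') = u' v \<oplus>\<^bsub>Hom C X Q\<^esub> u' v'"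
        using linD(2)[OF iur v] i1
        by (simp add: u'_def \<phi> XQ.add_smult XQ.smult_in iur' XQ.add_ac)
    next
      fix a v assume v: "v \<in> carrier (V\<lparr>carrier := I\<rparr>)"
      then show "u' (a \<odot>\<^bsub>V\<lparr>carrier := I\<rparr>\<^esub> v) = a \<odot>\<^bsub>Hom C X Q\<^esub> u' v"
        using linD(3)[OF iur v] i1
        by (simp add: u'_def \<phi> XQ.smult_smult XQ.smult_add XQ.smult_in iur')
    qed (simp add: u'_def XQ.smult_in i1 iur')
    have u0: "u \<zero>\<^bsub>V\<^esub> = \<zero>\<^bsub>Hom C X P\<^esub>" using lin_zero[OF u VJ hom_space[OF X P]] by simp
    have uJ: "u v \<in> arr C X P" if "v \<in> J" for v using linD(1)[OF u, of v] that by simp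
    have rw: "r w = \<zero>\<^bsub>V\<^esub>" using wI by (simp add: r_def \<phi>w V.add_neg IV)
    have u'w: "u' w = i1"
      using i1 by (simp add: u'_def \<phi>w rw u0 XQ.one_smult comp_zero_right[OF X P QO i2])
    have u'J: "u' v = i2 \<cdot> u v" if "v \<in> J" for v
      using that i1 iur'[of v] line(6) wI
      by (simp add: u'_def r_def XQ.zero_smult V.zero_smult IV)
    have "is_copower C (V\<lparr>carrier := I\<rparr>) X Q u'"
      unfolding is_copower_def
    proof (intro conjI ballI)
      show "Q \<in> Obj C" by (rule QO)
      show "u' \<in> lin (V\<lparr>carrier := I\<rparr>) (Hom C X Q)" by (rule u'_lin)
      fix Y g assume Y: "Y \<in> Obj C" and g: "g \<in> lin (V\<lparr>carrier := I\<rparr>) (Hom C X Y)"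
      interpret XY: vspace "Hom C X Y" by (rule vspaceI[OF hom_space[OF X Y]])
      have gJ: "g \<in> lin (V\<lparr>carrier := J\<rparr>) (Hom C X Y)"
        using g by (auto simp: lin_def line(6))
      obtain h0 where h0: "h0 \<in> arr C P Y" "\<forall>v\<in>J. h0 \<cdot> u v = g v" using univ[OF Y gJ] by blast
      have gI: "g v \<in> arr C X Y" if "v \<in> I" for v using linD(1)[OF g, of v] that by simp
      obtain h where h: "h \<in> arr C Q Y" "h \<cdot> i1 = g w" "h \<cdot> i2 = h0"
        using biproduct_coproduct(1)[OF Q X P Y gI[OF wI] h0(1)] by blast
      have hu: "h \<cdot> u' v = g v" if v: "v \<in> I" for v
      proof -
        have "h \<cdot> u' v = (h \<cdot> \<phi> v \<odot>\<^bsub>Hom C X Q\<^esub> i1) \<oplus>\<^bsub>Hom C X Y\<^esub> (h \<cdot> (i2 \<cdot> u (r v)))"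
          unfolding u'_def
          by (rule linD(2)[OF comp_lin_right[OF X QO Y h(1)]]) (simp_all add: XQ.smult_in i1 iur' v)
        also have "h \<cdot> \<phi> v \<odot>\<^bsub>Hom C X Q\<^esub> i1 = \<phi> v \<odot>\<^bsub>Hom C X Y\<^esub> g w"
          using linD(3)[OF comp_lin_right[OF X QO Y h(1)] i1] h(2) by simp
        also have "h \<cdot> (i2 \<cdot> u (r v)) = g (r v)"
          using comp_assoc[OF X P QO Y uJ[OF rJ[OF v]] i2 h(1)] h(3) h0(2) rJ[OF v] by simp
        also have "g (r v) = g v \<oplus>\<^bsub>Hom C X Y\<^esub> (- \<phi> v) \<odot>\<^bsub>Hom C X Y\<^esub> g w"
          using linD(2)[OF g, of v "(- \<phi> v) \<odot>\<^bsub>V\<^esub> w"] linD(3)[OF g, of w "- \<phi> v"] v wI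
          by (simp add: r_def Is)
        also have "\<phi> v \<odot>\<^bsub>Hom C X Y\<^esub> g w \<oplus>\<^bsub>Hom C X Y\<^esub> (g v \<oplus>\<^bsub>Hom C X Y\<^esub> (- \<phi> v) \<odot>\<^bsub>Hom C X Y\<^esub> g w)
          = g v \<oplus>\<^bsub>Hom C X Y\<^esub> (\<phi> v \<odot>\<^bsub>Hom C X Y\<^esub> g w \<oplus>\<^bsub>Hom C X Y\<^esub> (- \<phi> v) \<odot>\<^bsub>Hom C X Y\<^esub> g w)"
          using gI[OF v] gI[OF wI] by (simp add: XY.smult_in XY.add_ac)
        also have "\<dots> = g v"
          using XY.add_smult[of "g w" "\<phi> v" "- \<phi> v"] gI[OF v] gI[OF wI] by (simp add: XY.zero_smult)
        finally show ?thesis .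
      qed
      show "\<exists>!h. h \<in> arr C Q Y \<and> (\<forall>v\<in>carrier (V\<lparr>carrier := I\<rparr>). h \<cdot> u' v = g v)"
      proof (rule ex1I[of _ h])
        show "h \<in> arr C Q Y \<and> (\<forall>v\<in>carrier (V\<lparr>carrier := I\<rparr>). h \<cdot> u' v = g v)" using h(1) hu by simp
        fix k assume "k \<in> arr C Q Y \<and> (\<forall>v\<in>carrier (V\<lparr>carrier := I\<rparr>). k \<cdot> u' v = g v)"
        then have k: "k \<in> arr C Q Y" "\<And>v. v \<in> I \<Longrightarrow> k \<cdot> u' v = g v" by simp_all
        have ki1: "k \<cdot> i1 = g w" using k(2)[OF wI] u'w by simp
        have "k \<cdot> i2 \<in> arr C P Y" by (rule comp_arr[OF P QO Y i2 k(1)])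
        moreover have "\<forall>v\<in>J. (k \<cdot> i2) \<cdot> u v = g v"
        proof
          fix v assume v: "v \<in> J"
          then have "v \<in> I" by (simp add: line(6))
          then show "(k \<cdot> i2) \<cdot> u v = g v"
            using k(2)[of v] u'J[OF v] comp_assoc[OF X P QO Y uJ[OF v] i2 k(1)] by simp
        qed
        ultimately have ki2: "k \<cdot> i2 = h0"
          using h0 by (intro ex1_eq[OF univ[OF Y gJ]] conjI)
        show "k = h"
          by (rule biproduct_coproduct(2)[OF Q X P Y k(1) h(1)]) (simp_all add: ki1 ki2 h)
      qed
    qed
    then show ?case by blast
  qed
  then show ?thesis by simp
qed

section \<open>Nakayama functors by elements\<close>

abbreviation "fnl C M X \<equiv> carrier (hom_dual C M X)"

text \<open>
  A dinatural transformation out of \<open>Hom(M, X)\<^sup>* \<otimes> X\<close> is a family of arrows \<open>X \<rightarrow> Z\<close> indexed by the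
  functionals \<open>\<xi>\<close> on \<open>Hom(M, X)\<close>, linear in \<open>\<xi>\<close> and natural in \<open>X\<close>. In this form copowers disappear
  from the universal property of the coend.
\<close>

definition nak_family :: "('o, 'm, 'k::field, 'z) lcat_scheme \<Rightarrow> 'o \<Rightarrow> 'o
    \<Rightarrow> ('o \<Rightarrow> ('m \<Rightarrow> 'k) \<Rightarrow> 'm) \<Rightarrow> bool" where
  "nak_family C M Z \<alpha> \<longleftrightarrow> (\<forall>X\<in>Obj C. \<alpha> X \<in> lin (hom_dual C M X) (Hom C X Z)) \<and>
     (\<forall>X\<in>Obj C. \<forall>Y\<in>Obj C. \<forall>f\<in>arr C X Y. \<forall>\<xi>\<in>fnl C M Y.
        \<alpha> Y \<xi> \<cdot>\<^bsub>C\<^esub> f = \<alpha> X (transp (Hom C M X) (\<lambda>h. f \<cdot>\<^bsub>C\<^esub> h) \<xi>))"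

definition nak_universal :: "('o, 'm, 'k::field, 'z) lcat_scheme \<Rightarrow> 'o \<Rightarrow> 'o
    \<Rightarrow> ('o \<Rightarrow> ('m \<Rightarrow> 'k) \<Rightarrow> 'm) \<Rightarrow> bool" where
  "nak_universal C M N j \<longleftrightarrow> N \<in> Obj C \<and> nak_family C M N j \<and>
     (\<forall>Z\<in>Obj C. \<forall>\<alpha>. nak_family C M Z \<alpha> \<longrightarrow>
        (\<exists>!h. h \<in> arr C N Z \<and> (\<forall>X\<in>Obj C. \<forall>\<xi>\<in>fnl C M X. h \<cdot>\<^bsub>C\<^esub> j X \<xi> = \<alpha> X \<xi>)))"

definition nak_functor :: "('o, 'm, 'k::field, 'z) lcat_scheme \<Rightarrow> ('o, 'm, 'o, 'm) fctr
    \<Rightarrow> ('o \<Rightarrow> 'o \<Rightarrow> ('m \<Rightarrow> 'k) \<Rightarrow> 'm) \<Rightarrow> bool" where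
  "nak_functor C N j \<longleftrightarrow> lin_functor C C N \<and> (\<forall>M\<in>Obj C. nak_universal C M (Fo N M) (j M)) \<and>
     (\<forall>M\<in>Obj C. \<forall>M'\<in>Obj C. \<forall>g\<in>arr C M M'. \<forall>X\<in>Obj C. \<forall>\<xi>\<in>fnl C M X.
        Fa N M M' g \<cdot>\<^bsub>C\<^esub> j M X \<xi> = j M' X (transp (Hom C M' X) (\<lambda>h. h \<cdot>\<^bsub>C\<^esub> g) \<xi>))"

lemma nak_familyD:
  assumes "nak_family C M Z \<alpha>"
  shows "X \<in> Obj C \<Longrightarrow> \<alpha> X \<in> lin (hom_dual C M X) (Hom C X Z)"
    and "X \<in> Obj C \<Longrightarrow> Y \<in> Obj C \<Longrightarrow> f \<in> arr C X Y \<Longrightarrow> \<xi> \<in> fnl C M Y \<Longrightarrow>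
      \<alpha> Y \<xi> \<cdot>\<^bsub>C\<^esub> f = \<alpha> X (transp (Hom C M X) (\<lambda>h. f \<cdot>\<^bsub>C\<^esub> h) \<xi>)"
  using assms by (simp_all add: nak_family_def)

lemma nak_universalD:
  assumes "nak_universal C M N j"
  shows "N \<in> Obj C" "nak_family C M N j"
    and "Z \<in> Obj C \<Longrightarrow> nak_family C M Z \<alpha> \<Longrightarrow>
      \<exists>h. h \<in> arr C N Z \<and> (\<forall>X\<in>Obj C. \<forall>\<xi>\<in>fnl C M X. h \<cdot>\<^bsub>C\<^esub> j X \<xi> = \<alpha> X \<xi>)"
  using assms by (simp_all add: nak_universal_def) (meson ex1_implies_ex)

lemma (in lin_category) nak_family_comp:
  assumes "nak_family C M Z \<alpha>" "M \<in> Obj C" "Z \<in> Obj C" "W \<in> Obj C" "h \<in> arr C Z W"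
  shows "nak_family C M W (\<lambda>X \<xi>. h \<cdot> \<alpha> X \<xi>)"
  unfolding nak_family_def
proof (intro conjI ballI)
  fix X assume X: "X \<in> Obj C"
  show "(\<lambda>\<xi>. h \<cdot> \<alpha> X \<xi>) \<in> lin (hom_dual C M X) (Hom C X W)"
    by (rule lin_comp[OF nak_familyD(1)[OF assms(1) X] comp_lin_right[OF X assms(3-5)]])
  fix Y f \<xi> assume Y: "Y \<in> Obj C" and f: "f \<in> arr C X Y" and \<xi>: "\<xi> \<in> fnl C M Y"
  show "(h \<cdot> \<alpha> Y \<xi>) \<cdot> f = h \<cdot> \<alpha> X (transp (Hom C M X) (\<lambda>h. f \<cdot> h) \<xi>)"
    using comp_assoc[OF X Y assms(3,4) f linD(1)[OF nak_familyD(1)[OF assms(1) Y] \<xi>] assms(5)]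
    by (simp add: nak_familyD(2)[OF assms(1) X Y f \<xi>])
qed

lemma (in lin_category) nak_universal_ext:
  assumes "nak_universal C M N j" "M \<in> Obj C" "Z \<in> Obj C" "h \<in> arr C N Z" "k \<in> arr C N Z"
    and "\<And>X \<xi>. X \<in> Obj C \<Longrightarrow> \<xi> \<in> fnl C M X \<Longrightarrow> h \<cdot> j X \<xi> = k \<cdot> j X \<xi>"
  shows "h = k"
proof -
  have "nak_family C M Z (\<lambda>X \<xi>. k \<cdot> j X \<xi>)"
    by (rule nak_family_comp) (use assms nak_universalD[OF assms(1)] in auto)
  then have "\<exists>!h. h \<in> arr C N Z \<and> (\<forall>X\<in>Obj C. \<forall>\<xi>\<in>fnl C M X. h \<cdot> j X \<xi> = k \<cdot> j X \<xi>)"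
    using assms(1,3) by (simp add: nak_universal_def)
  then show ?thesis by (rule ex1_eq) (use assms in simp_all)
qed

text \<open>
  Both values have the same universal property, and the comparison is natural because naturality may be checked
  on the universal family.
\<close>

lemma (in lin_category) nak_functor_unique:
  assumes N: "nak_functor C N j" and N': "nak_functor C N' j'"
  shows "nat_iso C C N N'"
proof -
  have fN: "lin_functor C C N" and fN': "lin_functor C C N'" using N N' by (simp_all add: nak_functor_def)
  interpret N: lin_functor C C N by (rule fN)
  interpret N': lin_functor C C N' by (rule fN')
  have u: "nak_universal C M (Fo N M) (j M)" and u': "nak_universal C M (Fo N' M) (j' M)"
    if "M \<in> Obj C" for M
    using N N' that by (simp_all add: nak_functor_def)
  have "\<forall>M\<in>Obj C. \<exists>h. h \<in> arr C (Fo N M) (Fo N' M) \<and>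
      (\<forall>X\<in>Obj C. \<forall>\<xi>\<in>fnl C M X. h \<cdot> j M X \<xi> = j' M X \<xi>)"
    using nak_universalD(3)[OF u nak_universalD(1,2)[OF u']] by blast
  then obtain \<theta> where \<theta>: "\<forall>M\<in>Obj C. \<theta> M \<in> arr C (Fo N M) (Fo N' M) \<and>
      (\<forall>X\<in>Obj C. \<forall>\<xi>\<in>fnl C M X. \<theta> M \<cdot> j M X \<xi> = j' M X \<xi>)" by (rule exE[OF bchoice])
  have "\<forall>M\<in>Obj C. \<exists>h. h \<in> arr C (Fo N' M) (Fo N M) \<and>
      (\<forall>X\<in>Obj C. \<forall>\<xi>\<in>fnl C M X. h \<cdot> j' M X \<xi> = j M X \<xi>)"
    using nak_universalD(3)[OF u' nak_universalD(1,2)[OF u]] by blast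
  then obtain \<theta>' where \<theta>': "\<forall>M\<in>Obj C. \<theta>' M \<in> arr C (Fo N' M) (Fo N M) \<and>
      (\<forall>X\<in>Obj C. \<forall>\<xi>\<in>fnl C M X. \<theta>' M \<cdot> j' M X \<xi> = j M X \<xi>)" by (rule exE[OF bchoice])
  have ja: "j M X \<xi> \<in> arr C X (Fo N M)" "j' M X \<xi> \<in> arr C X (Fo N' M)"
    if "M \<in> Obj C" "X \<in> Obj C" "\<xi> \<in> fnl C M X" for M X \<xi>
    using linD(1)[OF nak_familyD(1)[OF nak_universalD(2)[OF u]]]
      linD(1)[OF nak_familyD(1)[OF nak_universalD(2)[OF u']]] that by blast+
  have iso: "is_iso C (Fo N M) (Fo N' M) (\<theta> M)" if M: "M \<in> Obj C" for M
  proof -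
    note o = N.obj[OF M] N'.obj[OF M]
    have t: "\<theta> M \<in> arr C (Fo N M) (Fo N' M)" and t': "\<theta>' M \<in> arr C (Fo N' M) (Fo N M)"
      using \<theta> \<theta>' M by simp_all
    have "\<theta>' M \<cdot> \<theta> M = Id C (Fo N M)"
      by (rule nak_universal_ext[OF u[OF M] M o(1)])
        (use \<theta> \<theta>' M in \<open>simp_all add: comp_arr[OF o(1,2,1) t t'] id_arr o
          comp_assoc[OF _ o(1,2,1) _ t t'] ja id_left[OF _ o(1)]\<close>)
    moreover have "\<theta> M \<cdot> \<theta>' M = Id C (Fo N' M)"
      by (rule nak_universal_ext[OF u'[OF M] M o(2)])
        (use \<theta> \<theta>' M in \<open>simp_all add: comp_arr[OF o(2,1,2) t' t] id_arr o
          comp_assoc[OF _ o(2,1,2) _ t' t] ja id_left[OF _ o(2)]\<close>)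
    ultimately show ?thesis using t t' unfolding is_iso_def by blast
  qed
  have nat: "\<theta> M' \<cdot> Fa N M M' g = Fa N' M M' g \<cdot> \<theta> M"
    if M: "M \<in> Obj C" and M': "M' \<in> Obj C" and g: "g \<in> arr C M M'" for M M' g
  proof (rule nak_universal_ext[OF u[OF M] M N'.obj[OF M']])
    note o = N.obj[OF M] N'.obj[OF M] N.obj[OF M'] N'.obj[OF M']
    have t: "\<theta> M \<in> arr C (Fo N M) (Fo N' M)" and t': "\<theta> M' \<in> arr C (Fo N M') (Fo N' M')"
      using \<theta> M M' by simp_all
    have Ng: "Fa N M M' g \<in> arr C (Fo N M) (Fo N M')" by (rule linD(1)[OF N.arrow[OF M M'] g])
    have N'g: "Fa N' M M' g \<in> arr C (Fo N' M) (Fo N' M')" by (rule linD(1)[OF N'.arrow[OF M M'] g])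
    show "\<theta> M' \<cdot> Fa N M M' g \<in> arr C (Fo N M) (Fo N' M')" by (rule comp_arr[OF o(1,3,4) Ng t'])
    show "Fa N' M M' g \<cdot> \<theta> M \<in> arr C (Fo N M) (Fo N' M')" by (rule comp_arr[OF o(1,2,4) t N'g])
    fix X \<xi> assume X: "X \<in> Obj C" and \<xi>: "\<xi> \<in> fnl C M X"
    have \<xi>': "transp (Hom C M' X) (\<lambda>h. h \<cdot> g) \<xi> \<in> fnl C M' X"
      by (rule linD(1)[OF transp_lin[OF comp_lin_left[OF M M' X g] hom_space[OF M' X] hom_space[OF M X]] \<xi>])
    have "(\<theta> M' \<cdot> Fa N M M' g) \<cdot> j M X \<xi> = \<theta> M' \<cdot> j M' X (transp (Hom C M' X) (\<lambda>h. h \<cdot> g) \<xi>)"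
      using N M M' g X \<xi> by (simp add: comp_assoc[OF X o(1,3,4) ja(1)[OF M X \<xi>] Ng t'] nak_functor_def)
    also have "\<dots> = j' M' X (transp (Hom C M' X) (\<lambda>h. h \<cdot> g) \<xi>)" using \<theta> M' X \<xi>' by simp
    also have "\<dots> = Fa N' M M' g \<cdot> (\<theta> M \<cdot> j M X \<xi>)"
      using N' M M' g X \<xi> \<theta> by (simp add: nak_functor_def)
    also have "\<dots> = (Fa N' M M' g \<cdot> \<theta> M) \<cdot> j M X \<xi>"
      by (rule comp_assoc[OF X o(1,2,4) ja(1)[OF M X \<xi>] t N'g, symmetric])
    finally show "(\<theta> M' \<cdot> Fa N M M' g) \<cdot> j M X \<xi> = (Fa N' M M' g \<cdot> \<theta> M) \<cdot> j M X \<xi>" .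
  qed
  show ?thesis unfolding nat_iso_def using fN fN' iso nat by blast
qed

text \<open>
  Arrows out of \<open>N(M)\<close> are determined by their composites with the universal family, so that
  functoriality and linearity are consequences of naturality.
\<close>

lemma (in lin_category) nak_functorI:
  assumes u: "\<And>M. M \<in> Obj C \<Longrightarrow> nak_universal C M (Fo N M) (j M)"
    and a: "\<And>M M' g. \<lbrakk>M \<in> Obj C; M' \<in> Obj C; g \<in> arr C M M'\<rbrakk> \<Longrightarrow> Fa N M M' g \<in> arr C (Fo N M) (Fo N M')"
    and n: "\<And>M M' g X \<xi>. \<lbrakk>M \<in> Obj C; M' \<in> Obj C; g \<in> arr C M M'; X \<in> Obj C; \<xi> \<in> fnl C M X\<rbrakk>
      \<Longrightarrow> Fa N M M' g \<cdot> j M X \<xi> = j M' X (transp (Hom C M' X) (\<lambda>h. h \<cdot> g) \<xi>)"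
  shows "nak_functor C N j"
proof -
  note N = nak_universalD(1)[OF u] and j = nak_familyD(1)[OF nak_universalD(2)[OF u]]
  have jl: "(\<lambda>h. h \<cdot> j M X \<xi>) \<in> lin (Hom C (Fo N M) Z) (Hom C X Z)"
    if "M \<in> Obj C" "X \<in> Obj C" "Z \<in> Obj C" "\<xi> \<in> fnl C M X" for M X Z \<xi>
    by (rule comp_lin_left[OF that(2) N[OF that(1)] that(3) linD(1)[OF j[OF that(1,2)] that(4)]])
  have pre: "(\<lambda>g. transp (Hom C M' X) (\<lambda>h. h \<cdot> g) \<xi>) \<in> lin (Hom C M M') (hom_dual C M' X)"
    if M: "M \<in> Obj C" "M' \<in> Obj C" and X: "X \<in> Obj C" and \<xi>: "\<xi> \<in> fnl C M X" for M M' X \<xi>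
  proof (rule linI)
    show "transp (Hom C M' X) (\<lambda>h. h \<cdot> g) \<xi> \<in> fnl C M' X" if "g \<in> arr C M M'" for g
      by (rule linD(1)[OF transp_lin[OF comp_lin_left[OF M X that] hom_space[OF M(2) X] hom_space[OF M(1) X]] \<xi>])
  qed (use \<xi> linD[OF comp_lin_right[OF M X]] in
      \<open>auto simp: carrier_dual_space functional_def transp_def dual_space_simps intro!: restrict_ext\<close>)
  have lin: "Fa N M M' \<in> lin (Hom C M M') (Hom C (Fo N M) (Fo N M'))" if M: "M \<in> Obj C" "M' \<in> Obj C" for M M'
  proof -
    interpret H: vspace "Hom C M M'" by (rule vspaceI[OF hom_space[OF M]])
    interpret K: vspace "Hom C (Fo N M) (Fo N M')" by (rule vspaceI[OF hom_space[OF N[OF M(1)] N[OF M(2)]]])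
    have L: "(\<lambda>g. Fa N M M' g \<cdot> j M X \<xi>) \<in> lin (Hom C M M') (Hom C X (Fo N M'))"
      if X: "X \<in> Obj C" and \<xi>: "\<xi> \<in> fnl C M X" for X \<xi>
      by (rule lin_cong[OF lin_comp[OF pre[OF M X \<xi>] j[OF M(2) X]] n[OF M _ X \<xi>] hom_space[OF M]])
    note ext = nak_universal_ext[OF u[OF M(1)] M(1) N[OF M(2)]] and JL = jl[OF M(1) _ N[OF M(2)]]
    show ?thesis
    proof (rule linI)
      show "Fa N M M' (g \<oplus>\<^bsub>Hom C M M'\<^esub> h) = Fa N M M' g \<oplus>\<^bsub>Hom C (Fo N M) (Fo N M')\<^esub> Fa N M M' h"
        if "g \<in> arr C M M'" "h \<in> arr C M M'" for g h
        by (rule ext) (use that in \<open>simp_all add: a M H.add_in K.add_in linD(2)[OF L] linD(2)[OF JL]\<close>)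
      show "Fa N M M' (c \<odot>\<^bsub>Hom C M M'\<^esub> g) = c \<odot>\<^bsub>Hom C (Fo N M) (Fo N M')\<^esub> Fa N M M' g"
        if "g \<in> arr C M M'" for c g
        by (rule ext) (use that in \<open>simp_all add: a M H.smult_in K.smult_in linD(3)[OF L] linD(3)[OF JL]\<close>)
    qed (rule a[OF M])
  qed
  have ident: "Fa N M M (Id C M) = Id C (Fo N M)" if M: "M \<in> Obj C" for M
  proof (rule nak_universal_ext[OF u[OF M] M N[OF M]])
    show "Fa N M M (Id C M) \<cdot> j M X \<xi> = Id C (Fo N M) \<cdot> j M X \<xi>" if X: "X \<in> Obj C" and \<xi>: "\<xi> \<in> fnl C M X" for X \<xi>
      using n[OF M M id_arr[OF M] X \<xi>] transp_ident[OF \<xi>, of "\<lambda>h. h \<cdot> Id C M"] id_right[OF M X]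
        id_left[OF X N[OF M] linD(1)[OF j[OF M X] \<xi>]] by simp
  qed (use a M N id_arr in simp_all)
  have comp: "Fa N K M (g \<cdot> f) = Fa N L M g \<cdot> Fa N K L f"
    if K: "K \<in> Obj C" and L: "L \<in> Obj C" and M: "M \<in> Obj C" and f: "f \<in> arr C K L" and g: "g \<in> arr C L M" for K L M f g
  proof (rule nak_universal_ext[OF u[OF K] K N[OF M] a[OF K M comp_arr[OF K L M f g]]])
    show "Fa N L M g \<cdot> Fa N K L f \<in> arr C (Fo N K) (Fo N M)"
      by (rule comp_arr[OF N[OF K] N[OF L] N[OF M] a[OF K L f] a[OF L M g]])
    fix X \<xi> assume X: "X \<in> Obj C" and \<xi>: "\<xi> \<in> fnl C K X"
    have "transp (Hom C M X) (\<lambda>h. h \<cdot> (g \<cdot> f)) \<xi>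
        = transp (Hom C M X) (\<lambda>h. h \<cdot> g) (transp (Hom C L X) (\<lambda>h. h \<cdot> f) \<xi>)"
      unfolding transp_transp[OF comp_lin_left[OF L M X g]]
      by (rule transp_cong) (rule comp_assoc[OF K L M X f g, symmetric])
    then show "Fa N K M (g \<cdot> f) \<cdot> j K X \<xi> = (Fa N L M g \<cdot> Fa N K L f) \<cdot> j K X \<xi>"
      using comp_assoc[OF X N[OF K] N[OF L] N[OF M] linD(1)[OF j[OF K X] \<xi>] a[OF K L f] a[OF L M g]]
        n[OF K M comp_arr[OF K L M f g] X \<xi>] n[OF K L f X \<xi>] n[OF L M g X linD(1)[OF pre[OF K L X \<xi>] f]] by simp
  qed
  have "lin_functor C C N"
    by (intro lin_functor.intro lin_functor_axioms.intro lin_category_axioms N lin ident comp)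
  then show ?thesis using u n by (simp add: nak_functor_def)
qed

locale copowered_category = lin_category +
  assumes hom_dual_copower: "\<lbrakk>M \<in> Obj C; X \<in> Obj C; Y \<in> Obj C\<rbrakk>
    \<Longrightarrow> \<exists>P u. is_copower C (hom_dual C M X) Y P u"
begin

abbreviation "cw M X \<equiv> cpu C (hom_dual C M X)"
abbreviation "co M X \<equiv> cpo C (hom_dual C M X)"

lemma cp: "M \<in> Obj C \<Longrightarrow> X \<in> Obj C \<Longrightarrow> Y \<in> Obj C \<Longrightarrow>
    is_copower C (hom_dual C M X) Y (co M X Y) (cw M X Y)"
  using someI_ex[of "\<lambda>z. case z of (P, u) \<Rightarrow> is_copower C (hom_dual C M X) Y P u"] hom_dual_copower[of M X Y]
  by (simp add: cpo_def cpu_def copower_def case_prod_beta')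

lemma cpo_obj: "M \<in> Obj C \<Longrightarrow> X \<in> Obj C \<Longrightarrow> Y \<in> Obj C \<Longrightarrow> co M X Y \<in> Obj C"
  using cp by (auto simp: is_copower_def)

lemma cpu_lin: "M \<in> Obj C \<Longrightarrow> X \<in> Obj C \<Longrightarrow> Y \<in> Obj C \<Longrightarrow>
    cw M X Y \<in> lin (hom_dual C M X) (Hom C Y (co M X Y))"
  using cp by (auto simp: is_copower_def)

lemma cp_desc:
  assumes "M \<in> Obj C" "X \<in> Obj C" "Y \<in> Obj C" "Z \<in> Obj C" "g \<in> lin (hom_dual C M X) (Hom C Y Z)"
  shows "cp_desc C (hom_dual C M X) Y Z g \<in> arr C (co M X Y) Z"
    and "\<xi> \<in> fnl C M X \<Longrightarrow>
      cp_desc C (hom_dual C M X) Y Z g \<cdot> cw M X Y \<xi> = g \<xi>"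
proof -
  have "\<exists>!h. h \<in> arr C (co M X Y) Z \<and>
      (\<forall>v\<in>fnl C M X. h \<cdot> cw M X Y v = g v)"
    using cp[OF assms(1-3)] assms(4,5) by (simp add: is_copower_def)
  from theI'[OF this]
  show "cp_desc C (hom_dual C M X) Y Z g \<in> arr C (co M X Y) Z"
    and "\<xi> \<in> fnl C M X \<Longrightarrow>
      cp_desc C (hom_dual C M X) Y Z g \<cdot> cw M X Y \<xi> = g \<xi>"
    unfolding cp_desc_def by blast+
qed

lemma cp_ext:
  assumes "M \<in> Obj C" "X \<in> Obj C" "Y \<in> Obj C" "Z \<in> Obj C"
    "h \<in> arr C (co M X Y) Z" "k \<in> arr C (co M X Y) Z"
    "\<And>\<xi>. \<xi> \<in> fnl C M X \<Longrightarrow> h \<cdot> cw M X Y \<xi> = k \<cdot> cw M X Y \<xi>"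
  shows "h = k"
proof -
  have "(\<lambda>\<xi>. k \<cdot> cw M X Y \<xi>) \<in> lin (hom_dual C M X) (Hom C Y Z)"
    by (rule lin_comp[OF cpu_lin[OF assms(1-3)] comp_lin_right[OF assms(3) cpo_obj[OF assms(1-3)] assms(4,6)]])
  then have "\<exists>!h. h \<in> arr C (co M X Y) Z \<and>
      (\<forall>v\<in>fnl C M X. h \<cdot> cw M X Y v = k \<cdot> cw M X Y v)"
    using cp[OF assms(1-3)] assms(4) by (simp add: is_copower_def)
  then show ?thesis by (rule ex1_eq) (use assms in simp_all)
qed

lemma cp_map:
  assumes M: "M \<in> Obj C" "X \<in> Obj C" and M': "M' \<in> Obj C" "X' \<in> Obj C" and Y: "Y \<in> Obj C" "Y' \<in> Obj C"
    and \<phi>: "\<phi> \<in> lin (hom_dual C M X) (hom_dual C M' X')" and f: "f \<in> arr C Y Y'"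
  shows "cp_map C (hom_dual C M X) (hom_dual C M' X') \<phi> Y Y' f
      \<in> arr C (co M X Y) (co M' X' Y')"
    and "\<xi> \<in> fnl C M X \<Longrightarrow>
      cp_map C (hom_dual C M X) (hom_dual C M' X') \<phi> Y Y' f \<cdot> cw M X Y \<xi>
        = cw M' X' Y' (\<phi> \<xi>) \<cdot> f"
proof -
  note o = cpo_obj[OF M' Y(2)]
  have l: "(\<lambda>v. cw M' X' Y' (\<phi> v) \<cdot> f) \<in> lin (hom_dual C M X) (Hom C Y (co M' X' Y'))"
    by (rule lin_comp[OF lin_comp[OF \<phi> cpu_lin[OF M' Y(2)]] comp_lin_left[OF Y o f]])
  show "cp_map C (hom_dual C M X) (hom_dual C M' X') \<phi> Y Y' f
      \<in> arr C (co M X Y) (co M' X' Y')"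
    unfolding cp_map_def by (rule cp_desc(1)[OF M Y(1) o l])
  show "cp_map C (hom_dual C M X) (hom_dual C M' X') \<phi> Y Y' f \<cdot> cw M X Y \<xi>
        = cw M' X' Y' (\<phi> \<xi>) \<cdot> f" if "\<xi> \<in> fnl C M X"
    unfolding cp_map_def by (rule cp_desc(2)[OF M Y(1) o l that])
qed

lemma comp_cp_map:
  assumes M: "M \<in> Obj C" "X \<in> Obj C" and M': "M' \<in> Obj C" "X' \<in> Obj C" and Y: "Y \<in> Obj C" "Y' \<in> Obj C"
    and \<phi>: "\<phi> \<in> lin (hom_dual C M X) (hom_dual C M' X')" and f: "f \<in> arr C Y Y'"
    and Z: "Z \<in> Obj C" and a: "a \<in> arr C (co M' X' Y') Z" and \<xi>: "\<xi> \<in> fnl C M X"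
  shows "(a \<cdot> cp_map C (hom_dual C M X) (hom_dual C M' X') \<phi> Y Y' f) \<cdot> cw M X Y \<xi>
    = (a \<cdot> cw M' X' Y' (\<phi> \<xi>)) \<cdot> f"
proof -
  note m = cp_map[OF M M' Y \<phi> f] and o = cpo_obj[OF M Y(1)] cpo_obj[OF M' Y(2)]
  have "cw M' X' Y' (\<phi> \<xi>) \<in> arr C Y' (co M' X' Y')"
    by (rule linD(1)[OF cpu_lin[OF M' Y(2)] linD(1)[OF \<phi> \<xi>]])
  from comp_assoc[OF Y o(2) Z f this a]
    comp_assoc[OF Y(1) o Z linD(1)[OF cpu_lin[OF M Y(1)] \<xi>] m(1) a] m(2)[OF \<xi>]
  show ?thesis by simp
qed

text \<open>
  Arrows out of a copower may be compared on generators, and on the generator \<open>\<xi>\<close> the dinaturality square for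
  \<open>f\<close> is naturality of the family at \<open>f\<close>.
\<close>

lemma nak_dinatural_iff_family:
  assumes M: "M \<in> Obj C" and Z: "Z \<in> Obj C"
    and \<alpha>: "\<And>X. X \<in> Obj C \<Longrightarrow> \<alpha> X \<in> arr C (co M X X) Z"
  shows "nak_dinatural C M Z \<alpha> \<longleftrightarrow> nak_family C M Z (\<lambda>X \<xi>. \<alpha> X \<cdot> cw M X X \<xi>)"
proof -
  have "(\<alpha> X \<cdot> cp_map C (hom_dual C M Y) (hom_dual C M X) (transp (Hom C M X) (\<lambda>h. f \<cdot> h)) X X (Id C X)
        = \<alpha> Y \<cdot> cp_map C (hom_dual C M Y) (hom_dual C M Y) (\<lambda>\<xi>. \<xi>) X Y f) \<longleftrightarrow>
     (\<forall>\<xi>\<in>fnl C M Y. (\<alpha> Y \<cdot> cw M Y Y \<xi>) \<cdot> f =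
        \<alpha> X \<cdot> cw M X X (transp (Hom C M X) (\<lambda>h. f \<cdot> h) \<xi>))" (is "?a = ?b \<longleftrightarrow> ?R")
    if X: "X \<in> Obj C" and Y: "Y \<in> Obj C" and f: "f \<in> arr C X Y" for X Y f
  proof -
    have t: "transp (Hom C M X) (\<lambda>h. f \<cdot> h) \<in> lin (hom_dual C M Y) (hom_dual C M X)"
      by (rule transp_lin[OF comp_lin_right[OF M X Y f] hom_space[OF M X] hom_space[OF M Y]])
    have i: "(\<lambda>\<xi>. \<xi>) \<in> lin (hom_dual C M Y) (hom_dual C M Y)" by (rule linI) simp_all
    have a: "?a \<in> arr C (co M Y X) Z"
      by (rule comp_arr[OF cpo_obj[OF M Y X] cpo_obj[OF M X X] Z cp_map(1)[OF M Y M X X X t id_arr[OF X]] \<alpha>[OF X]])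
    have b: "?b \<in> arr C (co M Y X) Z"
      by (rule comp_arr[OF cpo_obj[OF M Y X] cpo_obj[OF M Y Y] Z cp_map(1)[OF M Y M Y X Y i f] \<alpha>[OF Y]])
    have *: "?a \<cdot> cw M Y X \<xi> = \<alpha> X \<cdot> cw M X X (transp (Hom C M X) (\<lambda>h. f \<cdot> h) \<xi>)"
      "?b \<cdot> cw M Y X \<xi> = (\<alpha> Y \<cdot> cw M Y Y \<xi>) \<cdot> f"
      if \<xi>: "\<xi> \<in> fnl C M Y" for \<xi>
      unfolding comp_cp_map[OF M Y M X X X t id_arr[OF X] Z \<alpha>[OF X] \<xi>]
        comp_cp_map[OF M Y M Y X Y i f Z \<alpha>[OF Y] \<xi>]
      by (auto intro!: id_right[OF X Z] comp_arr[OF X cpo_obj[OF M X X] Z _ \<alpha>[OF X]]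
        linD(1)[OF cpu_lin[OF M X X]] linD(1)[OF t] \<xi>)
    show ?thesis
    proof
      assume "?a = ?b" then show ?R using * by force
    next
      assume ?R then show "?a = ?b" by (intro cp_ext[OF M Y X Z a b]) (simp add: *)
    qed
  qed
  moreover have "(\<lambda>\<xi>. \<alpha> X \<cdot> cw M X X \<xi>) \<in> lin (hom_dual C M X) (Hom C X Z)"
    if X: "X \<in> Obj C" for X
    by (rule lin_comp[OF cpu_lin[OF M X X] comp_lin_right[OF X cpo_obj[OF M X X] Z \<alpha>[OF X]]])
  ultimately show ?thesis unfolding nak_dinatural_def nak_family_def using \<alpha> by simp
qed

lemma nak_dinatural_cp_desc:
  assumes M: "M \<in> Obj C" and Z: "Z \<in> Obj C" and \<alpha>: "nak_family C M Z \<alpha>"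
  shows "nak_dinatural C M Z (\<lambda>X. cp_desc C (hom_dual C M X) X Z (\<alpha> X))"
proof -
  have d: "cp_desc C (hom_dual C M X) X Z (\<alpha> X) \<in> arr C (co M X X) Z"
    "\<And>\<xi>. \<xi> \<in> fnl C M X \<Longrightarrow>
      cp_desc C (hom_dual C M X) X Z (\<alpha> X) \<cdot> cw M X X \<xi> = \<alpha> X \<xi>" if X: "X \<in> Obj C" for X
    using cp_desc[OF M X X Z nak_familyD(1)[OF \<alpha> X]] by blast+
  have "nak_family C M Z (\<lambda>X \<xi>. cp_desc C (hom_dual C M X) X Z (\<alpha> X) \<cdot> cw M X X \<xi>)"
    unfolding nak_family_def
  proof (intro conjI ballI)
    fix X assume X: "X \<in> Obj C"
    show "(\<lambda>\<xi>. cp_desc C (hom_dual C M X) X Z (\<alpha> X) \<cdot> cw M X X \<xi>)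
        \<in> lin (hom_dual C M X) (Hom C X Z)"
      by (rule lin_cong[OF nak_familyD(1)[OF \<alpha> X] _ vector_space_on_dual[OF hom_space[OF M X]]])
        (rule d(2)[OF X])
    fix Y f \<xi> assume Y: "Y \<in> Obj C" and f: "f \<in> arr C X Y" and \<xi>: "\<xi> \<in> fnl C M Y"
    have "transp (Hom C M X) (\<lambda>h. f \<cdot> h) \<xi> \<in> fnl C M X"
      by (rule linD(1)[OF transp_lin[OF comp_lin_right[OF M X Y f] hom_space[OF M X] hom_space[OF M Y]] \<xi>])
    then show "(cp_desc C (hom_dual C M Y) Y Z (\<alpha> Y) \<cdot> cw M Y Y \<xi>) \<cdot> f
      = cp_desc C (hom_dual C M X) X Z (\<alpha> X) \<cdot> cw M X X (transp (Hom C M X) (\<lambda>h. f \<cdot> h) \<xi>)"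
      by (simp add: d(2) X Y \<xi> nak_familyD(2)[OF \<alpha> X Y f \<xi>])
  qed
  then show ?thesis using nak_dinatural_iff_family[OF M Z] d(1) by simp
qed

lemma nak_coend_universal:
  assumes M: "M \<in> Obj C" and i: "is_nak_coend C M N i"
  shows "nak_universal C M N (\<lambda>X \<xi>. i X \<cdot> cw M X X \<xi>)"
proof -
  have N: "N \<in> Obj C" and di: "nak_dinatural C M N i"
    and univ: "\<And>Z \<alpha>. Z \<in> Obj C \<Longrightarrow> nak_dinatural C M Z \<alpha> \<Longrightarrow>
      \<exists>!h. h \<in> arr C N Z \<and> (\<forall>X\<in>Obj C. h \<cdot> i X = \<alpha> X)"
    using i by (simp_all add: is_nak_coend_def)
  have ia: "i X \<in> arr C (co M X X) N" if "X \<in> Obj C" for X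
    using di that by (simp add: nak_dinatural_def)
  show ?thesis
    unfolding nak_universal_def
  proof (intro conjI ballI allI impI)
    show "N \<in> Obj C" by (rule N)
    show "nak_family C M N (\<lambda>X \<xi>. i X \<cdot> cw M X X \<xi>)"
      using nak_dinatural_iff_family[OF M N ia] di by simp
    fix Z \<alpha> assume Z: "Z \<in> Obj C" and \<alpha>: "nak_family C M Z \<alpha>"
    have *: "(h \<cdot> i X = cp_desc C (hom_dual C M X) X Z (\<alpha> X)) \<longleftrightarrow>
      (\<forall>\<xi>\<in>fnl C M X. h \<cdot> (i X \<cdot> cw M X X \<xi>) = \<alpha> X \<xi>)"
      if h: "h \<in> arr C N Z" and X: "X \<in> Obj C" for h X
    proof -
      note d = cp_desc[OF M X X Z nak_familyD(1)[OF \<alpha> X]] and o = cpo_obj[OF M X X]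
      have as: "(h \<cdot> i X) \<cdot> cw M X X \<xi> = h \<cdot> (i X \<cdot> cw M X X \<xi>)"
        if "\<xi> \<in> fnl C M X" for \<xi>
        by (rule comp_assoc[OF X o N Z linD(1)[OF cpu_lin[OF M X X] that] ia[OF X] h])
      show ?thesis
      proof
        assume "h \<cdot> i X = cp_desc C (hom_dual C M X) X Z (\<alpha> X)"
        then show "\<forall>\<xi>\<in>fnl C M X. h \<cdot> (i X \<cdot> cw M X X \<xi>) = \<alpha> X \<xi>"
          using as d(2) by force
      next
        assume "\<forall>\<xi>\<in>fnl C M X. h \<cdot> (i X \<cdot> cw M X X \<xi>) = \<alpha> X \<xi>"
        then show "h \<cdot> i X = cp_desc C (hom_dual C M X) X Z (\<alpha> X)"
          by (intro cp_ext[OF M X X Z comp_arr[OF o N Z ia[OF X] h] d(1)]) (simp add: as d(2))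
      qed
    qed
    from univ[OF Z nak_dinatural_cp_desc[OF M Z \<alpha>]]
    show "\<exists>!h. h \<in> arr C N Z \<and> (\<forall>X\<in>Obj C. \<forall>\<xi>\<in>fnl C M X.
        h \<cdot> (i X \<cdot> cw M X X \<xi>) = \<alpha> X \<xi>)"
      using * by (simp cong: conj_cong)
  qed
qed

lemma nak_universal_coend:
  assumes M: "M \<in> Obj C" and j: "nak_universal C M N j"
  shows "is_nak_coend C M N (\<lambda>X. cp_desc C (hom_dual C M X) X N (j X))"
proof -
  note N = nak_universalD(1)[OF j] and jf = nak_universalD(2)[OF j]
  show ?thesis
    unfolding is_nak_coend_def
  proof (intro conjI ballI allI impI)
    show "N \<in> Obj C" by (rule N)
    show "nak_dinatural C M N (\<lambda>X. cp_desc C (hom_dual C M X) X N (j X))"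
      by (rule nak_dinatural_cp_desc[OF M N jf])
    fix Z \<alpha> assume Z: "Z \<in> Obj C" and \<alpha>: "nak_dinatural C M Z \<alpha>"
    have \<alpha>a: "\<alpha> X \<in> arr C (co M X X) Z" if "X \<in> Obj C" for X
      using \<alpha> that by (simp add: nak_dinatural_def)
    have *: "(h \<cdot> cp_desc C (hom_dual C M X) X N (j X) = \<alpha> X) \<longleftrightarrow>
      (\<forall>\<xi>\<in>fnl C M X. h \<cdot> j X \<xi> = \<alpha> X \<cdot> cw M X X \<xi>)"
      if h: "h \<in> arr C N Z" and X: "X \<in> Obj C" for h X
    proof -
      note d = cp_desc[OF M X X N nak_familyD(1)[OF jf X]] and o = cpo_obj[OF M X X]
      have as: "(h \<cdot> cp_desc C (hom_dual C M X) X N (j X)) \<cdot> cw M X X \<xi> = h \<cdot> j X \<xi>"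
        if "\<xi> \<in> fnl C M X" for \<xi>
        using comp_assoc[OF X o N Z linD(1)[OF cpu_lin[OF M X X] that] d(1) h] d(2)[OF that] by simp
      show ?thesis
      proof
        assume "h \<cdot> cp_desc C (hom_dual C M X) X N (j X) = \<alpha> X"
        then show "\<forall>\<xi>\<in>fnl C M X. h \<cdot> j X \<xi> = \<alpha> X \<cdot> cw M X X \<xi>"
          using as by force
      next
        assume "\<forall>\<xi>\<in>fnl C M X. h \<cdot> j X \<xi> = \<alpha> X \<cdot> cw M X X \<xi>"
        then show "h \<cdot> cp_desc C (hom_dual C M X) X N (j X) = \<alpha> X"
          by (intro cp_ext[OF M X X Z comp_arr[OF o N Z d(1) h] \<alpha>a[OF X]]) (simp add: as)
      qed
    qed
    have "nak_family C M Z (\<lambda>X \<xi>. \<alpha> X \<cdot> cw M X X \<xi>)"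
      using nak_dinatural_iff_family[OF M Z \<alpha>a] \<alpha> by simp
    with j Z have "\<exists>!h. h \<in> arr C N Z \<and> (\<forall>X\<in>Obj C. \<forall>\<xi>\<in>fnl C M X.
        h \<cdot> j X \<xi> = \<alpha> X \<cdot> cw M X X \<xi>)" by (simp add: nak_universal_def)
    then show "\<exists>!h. h \<in> arr C N Z \<and> (\<forall>X\<in>Obj C. h \<cdot> cp_desc C (hom_dual C M X) X N (j X) = \<alpha> X)"
      using * by (simp cong: conj_cong)
  qed
qed

lemma is_nakayama_nak_functor:
  assumes "is_nakayama C N i"
  shows "nak_functor C N (\<lambda>M X \<xi>. i M X \<cdot> cw M X X \<xi>)"
proof -
  interpret N: lin_functor C C N using assms by (simp add: is_nakayama_def)
  have co: "is_nak_coend C M (Fo N M) (i M)" if "M \<in> Obj C" for M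
    using assms that by (simp add: is_nakayama_def)
  have ia: "i M X \<in> arr C (co M X X) (Fo N M)" if "M \<in> Obj C" "X \<in> Obj C" for M X
    using co[OF that(1)] that by (simp add: is_nak_coend_def nak_dinatural_def)
  show ?thesis
    unfolding nak_functor_def
  proof (intro conjI ballI)
    show "lin_functor C C N" by (rule N.lin_functor_axioms)
    show "nak_universal C M (Fo N M) (\<lambda>X \<xi>. i M X \<cdot> cw M X X \<xi>)" if "M \<in> Obj C" for M
      by (rule nak_coend_universal[OF that co[OF that]])
    fix M M' g X \<xi> assume M: "M \<in> Obj C" and M': "M' \<in> Obj C" and g: "g \<in> arr C M M'" and X: "X \<in> Obj C"
      and \<xi>: "\<xi> \<in> fnl C M X"
    have t: "transp (Hom C M' X) (\<lambda>h. h \<cdot> g) \<in> lin (hom_dual C M X) (hom_dual C M' X)"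
      by (rule transp_lin[OF comp_lin_left[OF M M' X g] hom_space[OF M' X] hom_space[OF M X]])
    have "Fa N M M' g \<cdot> i M X = i M' X \<cdot> cp_map C (hom_dual C M X) (hom_dual C M' X)
            (transp (Hom C M' X) (\<lambda>h. h \<cdot> g)) X X (Id C X)"
      using assms M M' g X by (simp add: is_nakayama_def)
    then have "(Fa N M M' g \<cdot> i M X) \<cdot> cw M X X \<xi> =
        (i M' X \<cdot> cw M' X X (transp (Hom C M' X) (\<lambda>h. h \<cdot> g) \<xi>)) \<cdot> Id C X"
      using comp_cp_map[OF M X M' X X X t id_arr[OF X] N.obj[OF M'] ia[OF M' X] \<xi>] by simp
    then show "Fa N M M' g \<cdot> (i M X \<cdot> cw M X X \<xi>) =
        i M' X \<cdot> cw M' X X (transp (Hom C M' X) (\<lambda>h. h \<cdot> g) \<xi>)"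
      using comp_assoc[OF X cpo_obj[OF M X X] N.obj[OF M] N.obj[OF M'] linD(1)[OF cpu_lin[OF M X X] \<xi>] ia[OF M X]
          linD(1)[OF N.arrow[OF M M'] g]]
        id_right[OF X N.obj[OF M'] comp_arr[OF X cpo_obj[OF M' X X] N.obj[OF M']
          linD(1)[OF cpu_lin[OF M' X X] linD(1)[OF t \<xi>]] ia[OF M' X]]]
      by simp
  qed
qed

lemma nak_functor_is_nakayama:
  assumes "nak_functor C N j"
  shows "is_nakayama C N (\<lambda>M X. cp_desc C (hom_dual C M X) X (Fo N M) (j M X))"
proof -
  interpret N: lin_functor C C N using assms by (simp add: nak_functor_def)
  have u: "nak_universal C M (Fo N M) (j M)" if "M \<in> Obj C" for M
    using assms that by (simp add: nak_functor_def)
  have d: "cp_desc C (hom_dual C M X) X (Fo N M) (j M X) \<in> arr C (co M X X) (Fo N M)"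
    "\<And>\<xi>. \<xi> \<in> fnl C M X \<Longrightarrow>
      cp_desc C (hom_dual C M X) X (Fo N M) (j M X) \<cdot> cw M X X \<xi> = j M X \<xi>"
    if "M \<in> Obj C" "X \<in> Obj C" for M X
    using cp_desc[OF that that(2) N.obj[OF that(1)] nak_familyD(1)[OF nak_universalD(2)[OF u[OF that(1)]] that(2)]]
    by blast+
  show ?thesis
    unfolding is_nakayama_def
  proof (intro conjI ballI)
    show "lin_functor C C N" by (rule N.lin_functor_axioms)
    show "is_nak_coend C M (Fo N M) (\<lambda>X. cp_desc C (hom_dual C M X) X (Fo N M) (j M X))" if "M \<in> Obj C" for M
      by (rule nak_universal_coend[OF that u[OF that]])
    fix M M' g X assume M: "M \<in> Obj C" and M': "M' \<in> Obj C" and g: "g \<in> arr C M M'" and X: "X \<in> Obj C"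
    have t: "transp (Hom C M' X) (\<lambda>h. h \<cdot> g) \<in> lin (hom_dual C M X) (hom_dual C M' X)"
      by (rule transp_lin[OF comp_lin_left[OF M M' X g] hom_space[OF M' X] hom_space[OF M X]])
    have Ng: "Fa N M M' g \<in> arr C (Fo N M) (Fo N M')" by (rule linD(1)[OF N.arrow[OF M M'] g])
    note o = cpo_obj[OF M X X] cpo_obj[OF M' X X] and NM = N.obj[OF M] N.obj[OF M']
    show "Fa N M M' g \<cdot> cp_desc C (hom_dual C M X) X (Fo N M) (j M X) =
      cp_desc C (hom_dual C M' X) X (Fo N M') (j M' X) \<cdot> cp_map C (hom_dual C M X) (hom_dual C M' X)
        (transp (Hom C M' X) (\<lambda>h. h \<cdot> g)) X X (Id C X)" (is "?a = ?b")
    proof (rule cp_ext[OF M X X NM(2)])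
      show "?a \<in> arr C (co M X X) (Fo N M')" by (rule comp_arr[OF o(1) NM d(1)[OF M X] Ng])
      show "?b \<in> arr C (co M X X) (Fo N M')"
        by (rule comp_arr[OF o NM(2) cp_map(1)[OF M X M' X X X t id_arr[OF X]] d(1)[OF M' X]])
      fix \<xi> assume \<xi>: "\<xi> \<in> fnl C M X"
      note t\<xi> = linD(1)[OF t \<xi>]
      have "?a \<cdot> cw M X X \<xi> = Fa N M M' g \<cdot> j M X \<xi>"
        using comp_assoc[OF X o(1) NM linD(1)[OF cpu_lin[OF M X X] \<xi>] d(1)[OF M X] Ng] d(2)[OF M X \<xi>] by simp
      also have "\<dots> = j M' X (transp (Hom C M' X) (\<lambda>h. h \<cdot> g) \<xi>)"
        using assms M M' g X \<xi> by (simp add: nak_functor_def)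
      also have "\<dots> = ?b \<cdot> cw M X X \<xi>"
        unfolding comp_cp_map[OF M X M' X X X t id_arr[OF X] NM(2) d(1)[OF M' X] \<xi>] d(2)[OF M' X t\<xi>]
        by (rule id_right[OF X NM(2) linD(1)[OF nak_familyD(1)[OF nak_universalD(2)[OF u[OF M']] X] t\<xi>], symmetric])
      finally show "?a \<cdot> cw M X X \<xi> = ?b \<cdot> cw M X X \<xi>" .
    qed
  qed
qed

text \<open>
  A Nakayama functor can thus be exhibited by a universal natural family of arrows, without computing copowers.
\<close>

lemma nakayama_given_byI:
  assumes "nak_functor C F j"
  shows "nakayama_given_by C F"
  unfolding nakayama_given_by_def
  using nak_functor_is_nakayama[OF assms] nak_functor_unique[OF is_nakayama_nak_functor assms] by blast

end

section \<open>Arrows with source and target\<close>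

text \<open>
  Hom spaces need not be disjoint, so source and target of an arrow are recorded with it. Then they can be computed by
  rewriting, and composites associate to the right without further side conditions than composability.
\<close>

type_synonym ('o, 'm) tarr = "'o \<times> 'm \<times> 'o"

definition src :: "('o, 'm) tarr \<Rightarrow> 'o" where "src f = fst f"
definition tgt :: "('o, 'm) tarr \<Rightarrow> 'o" where "tgt f = snd (snd f)"
definition raw :: "('o, 'm) tarr \<Rightarrow> 'm" where "raw f = fst (snd f)"

lemma typed_simps [simp]: "src (X, f, Y) = X" "tgt (X, f, Y) = Y" "raw (X, f, Y) = f"
  by (simp_all add: src_def tgt_def raw_def)

lemma typed_collapse: "src f = X \<Longrightarrow> tgt f = Y \<Longrightarrow> (X, raw f, Y) = f"
  by (auto simp: src_def tgt_def raw_def)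

context lin_category
begin

definition ok :: "('o, 'm) tarr \<Rightarrow> bool" where
  "ok f \<longleftrightarrow> src f \<in> Obj C \<and> tgt f \<in> Obj C \<and> raw f \<in> arr C (src f) (tgt f)"

definition tcomp :: "('o, 'm) tarr \<Rightarrow> ('o, 'm) tarr \<Rightarrow> ('o, 'm) tarr"  (infixr "**" 55) where
  "g ** f = (src f, raw g \<cdot> raw f, tgt g)"

definition tid :: "'o \<Rightarrow> ('o, 'm) tarr" where
  "tid X = (X, Id C X, X)"

lemma ok_typed: "ok (X, f, Y) \<longleftrightarrow> X \<in> Obj C \<and> Y \<in> Obj C \<and> f \<in> arr C X Y"
  by (simp add: ok_def)

lemma okD: "ok f \<Longrightarrow> src f \<in> Obj C" "ok f \<Longrightarrow> tgt f \<in> Obj C" "ok f \<Longrightarrow> raw f \<in> arr C (src f) (tgt f)"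
  by (simp_all add: ok_def)

lemma tcomp_simps [simp]: "src (g ** f) = src f" "tgt (g ** f) = tgt g" "raw (g ** f) = raw g \<cdot> raw f"
  by (simp_all add: tcomp_def)

lemma tid_simps [simp]: "src (tid X) = X" "tgt (tid X) = X" "raw (tid X) = Id C X"
  by (simp_all add: tid_def)

lemma ok_tid [simp]: "X \<in> Obj C \<Longrightarrow> ok (tid X)"
  by (simp add: ok_def id_arr)

lemma ok_tcomp [simp]: "ok f \<Longrightarrow> ok g \<Longrightarrow> tgt f = src g \<Longrightarrow> ok (g ** f)"
  unfolding ok_def using comp_arr by auto

lemma tassoc [simp]:
  "ok f \<Longrightarrow> ok g \<Longrightarrow> ok h \<Longrightarrow> tgt f = src g \<Longrightarrow> tgt g = src h \<Longrightarrow> (h ** g) ** f = h ** (g ** f)"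
  using comp_assoc[of "src f" "tgt f" "tgt g" "tgt h" "raw f" "raw g" "raw h"]
  by (simp add: ok_def tcomp_def)

lemma tid_left [simp]: "ok f \<Longrightarrow> X = tgt f \<Longrightarrow> tid X ** f = f"
  using id_left[of "src f" "tgt f" "raw f"] by (simp add: ok_def tcomp_def typed_collapse)

lemma tid_right [simp]: "ok f \<Longrightarrow> X = src f \<Longrightarrow> f ** tid X = f"
  using id_right[of "src f" "tgt f" "raw f"] by (simp add: ok_def tcomp_def typed_collapse)

text \<open>An equation between composites may be used inside a longer composite.\<close>

lemma precomp:
  "a ** b = c \<Longrightarrow> ok a \<Longrightarrow> ok b \<Longrightarrow> ok x \<Longrightarrow> tgt b = src a \<Longrightarrow> tgt x = src b \<Longrightarrow> a ** (b ** x) = c ** x"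
  using tassoc[of x b a] by auto

lemma precomp2:
  assumes "a ** b = d ** f" "ok a" "ok b" "ok d" "ok f" "ok x" "tgt b = src a" "tgt f = src d" "tgt x = src b"
  shows "a ** (b ** x) = d ** (f ** x)"
proof -
  have "src b = src f" using arg_cong[OF assms(1), of src] by simp
  then have "(d ** f) ** x = d ** (f ** x)" using assms(4-6,8,9) by (intro tassoc) simp_all
  moreover have "(a ** b) ** x = a ** (b ** x)" using assms(2,3,6,7,9) by (intro tassoc) simp_all
  ultimately show ?thesis using assms(1) by simp
qed

lemma typed_eqI: "src f = src g \<Longrightarrow> tgt f = tgt g \<Longrightarrow> raw f = raw g \<Longrightarrow> f = g"
  by (cases f; cases g) simp

text \<open>
  Coequalizers of a set of parallel pairs, since the relative tensor product of a bimodule on both sides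
  coequalizes two pairs with different sources.
\<close>

definition joint_coeq :: "(('o, 'm) tarr \<times> ('o, 'm) tarr) set \<Rightarrow> ('o, 'm) tarr \<Rightarrow> bool" where
  "joint_coeq E q \<longleftrightarrow> ok q \<and>
     (\<forall>(f, g)\<in>E. ok f \<and> ok g \<and> src f = src g \<and> tgt f = src q \<and> tgt g = src q \<and> q ** f = q ** g) \<and>
     (\<forall>h. ok h \<and> src h = src q \<and> (\<forall>(f, g)\<in>E. h ** f = h ** g) \<longrightarrow>
        (\<exists>k. ok k \<and> src k = tgt q \<and> tgt k = tgt h \<and> k ** q = h)) \<and>
     (\<forall>k l. ok k \<and> ok l \<and> src k = tgt q \<and> src l = tgt q \<and> tgt k = tgt l \<and> k ** q = l ** q \<longrightarrow> k = l)"

lemma joint_coeqD: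
  assumes "joint_coeq E q"
  shows "ok q"
    and "(f, g) \<in> E \<Longrightarrow> ok f \<and> ok g \<and> src f = src g \<and> tgt f = src q \<and> tgt g = src q \<and> q ** f = q ** g"
    and "ok h \<Longrightarrow> src h = src q \<Longrightarrow> (\<And>f g. (f, g) \<in> E \<Longrightarrow> h ** f = h ** g) \<Longrightarrow>
      \<exists>k. ok k \<and> src k = tgt q \<and> tgt k = tgt h \<and> k ** q = h"
    and "ok k \<Longrightarrow> ok l \<Longrightarrow> src k = tgt q \<Longrightarrow> src l = tgt q \<Longrightarrow> tgt k = tgt l \<Longrightarrow> k ** q = l ** q \<Longrightarrow> k = l"
proof -
  note d = assms[unfolded joint_coeq_def]
  note q = d[THEN conjunct1] and E = d[THEN conjunct2, THEN conjunct1]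
    and ex = d[THEN conjunct2, THEN conjunct2, THEN conjunct1]
    and un = d[THEN conjunct2, THEN conjunct2, THEN conjunct2]
  show "ok q" by (rule q)
  show "ok f \<and> ok g \<and> src f = src g \<and> tgt f = src q \<and> tgt g = src q \<and> q ** f = q ** g" if "(f, g) \<in> E"
    using bspec[OF E that] by simp
  show "\<exists>k. ok k \<and> src k = tgt q \<and> tgt k = tgt h \<and> k ** q = h"
    if "ok h" "src h = src q" "\<And>f g. (f, g) \<in> E \<Longrightarrow> h ** f = h ** g"
  proof (rule ex[rule_format], intro conjI ballI)
    fix z assume "z \<in> E" then show "case z of (f, g) \<Rightarrow> h ** f = h ** g" using that(3) by (cases z) simp
  qed (use that in simp_all)
  show "k = l" if "ok k" "ok l" "src k = tgt q" "src l = tgt q" "tgt k = tgt l" "k ** q = l ** q"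
    by (rule un[rule_format]) (use that in simp)
qed

lemma joint_coeq_is_coequalizer:
  assumes "X \<in> Obj C" "Y \<in> Obj C" "f \<in> arr C X Y" "g \<in> arr C X Y"
  shows "is_coequalizer C X Y f g Q q \<longleftrightarrow> joint_coeq {((X, f, Y), (X, g, Y))} (Y, q, Q)"
proof
  assume a: "is_coequalizer C X Y f g Q q"
  then have Q: "Q \<in> Obj C" "q \<in> arr C Y Q" "q \<cdot> f = q \<cdot> g"
    and un: "\<And>Z h. Z \<in> Obj C \<Longrightarrow> h \<in> arr C Y Z \<Longrightarrow> h \<cdot> f = h \<cdot> g \<Longrightarrow> \<exists>!k. k \<in> arr C Q Z \<and> k \<cdot> q = h"
    by (simp_all add: is_coequalizer_def)
  show "joint_coeq {((X, f, Y), (X, g, Y))} (Y, q, Q)"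
    unfolding joint_coeq_def
  proof (intro conjI allI impI)
    fix h assume h: "ok h \<and> src h = src (Y, q, Q) \<and>
      (\<forall>(f, g)\<in>{((X, f, Y), (X, g, Y))}. h ** f = h ** g)"
    then have "tgt h \<in> Obj C" "raw h \<in> arr C Y (tgt h)" "raw h \<cdot> f = raw h \<cdot> g"
      by (auto simp: ok_def tcomp_def)
    from un[OF this] obtain k where "k \<in> arr C Q (tgt h)" "k \<cdot> q = raw h" by blast
    then show "\<exists>k. ok k \<and> src k = tgt (Y, q, Q) \<and> tgt k = tgt h \<and> k ** (Y, q, Q) = h"
      using h Q by (intro exI[of _ "(Q, k, tgt h)"]) (simp add: ok_def tcomp_def typed_collapse)
  next
    fix k l assume kl: "ok k \<and> ok l \<and> src k = tgt (Y, q, Q) \<and> src l = tgt (Y, q, Q) \<and> tgt k = tgt l \<and>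
      k ** (Y, q, Q) = l ** (Y, q, Q)"
    then have k: "raw k \<in> arr C Q (tgt k)" "raw l \<in> arr C Q (tgt k)" "tgt k \<in> Obj C" "raw k \<cdot> q = raw l \<cdot> q"
      by (auto simp: ok_def tcomp_def)
    have "(raw k \<cdot> q) \<cdot> f = (raw k \<cdot> q) \<cdot> g"
      using comp_assoc[OF assms(1,2) Q(1) k(3) assms(3) Q(2) k(1)]
        comp_assoc[OF assms(1,2) Q(1) k(3) assms(4) Q(2) k(1)] Q(3) by simp
    from un[OF k(3) comp_arr[OF assms(2) Q(1) k(3) Q(2) k(1)] this]
    have "raw k = raw l" by (rule ex1_eq) (use k in simp_all)
    then show "k = l" using kl by (intro typed_eqI) simp_all
  qed (use Q assms in \<open>simp_all add: ok_def tcomp_def\<close>)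
next
  assume a: "joint_coeq {((X, f, Y), (X, g, Y))} (Y, q, Q)"
  note d = joint_coeqD[OF a]
  show "is_coequalizer C X Y f g Q q"
    unfolding is_coequalizer_def
  proof (intro conjI ballI impI)
    show "Q \<in> Obj C" "q \<in> arr C Y Q" using d(1) by (simp_all add: ok_def)
    show "q \<cdot> f = q \<cdot> g" using d(2)[of "(X, f, Y)" "(X, g, Y)"] by (simp add: tcomp_def)
    fix Z h assume Z: "Z \<in> Obj C" and h: "h \<in> arr C Y Z" and hfg: "h \<cdot> f = h \<cdot> g"
    obtain k where k: "ok k \<and> src k = Q \<and> tgt k = Z \<and> k ** (Y, q, Q) = (Y, h, Z)"
      using d(3)[of "(Y, h, Z)"] Z h hfg assms(2) by (auto simp: ok_def tcomp_def)
    show "\<exists>!k. k \<in> arr C Q Z \<and> k \<cdot> q = h"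
    proof (rule ex1I[of _ "raw k"])
      show "raw k \<in> arr C Q Z \<and> raw k \<cdot> q = h" using k by (auto simp: ok_def tcomp_def)
      fix l assume l: "l \<in> arr C Q Z \<and> l \<cdot> q = h"
      have "(Q, l, Z) = k"
        by (rule d(4)) (use l k Z d(1) in \<open>auto simp: ok_def tcomp_def\<close>)
      then show "l = raw k" by auto
    qed
  qed
qed

end

section \<open>Endofunctors and adjunctions\<close>

record ('o, 'm) endo =
  eo :: "'o \<Rightarrow> 'o"
  ea :: "'m \<Rightarrow> 'm"

definition ap :: "('o, 'm) endo \<Rightarrow> ('o, 'm) tarr \<Rightarrow> ('o, 'm) tarr" where
  "ap F f = (eo F (src f), ea F (raw f), eo F (tgt f))"

lemma ap_simps [simp]: "src (ap F f) = eo F (src f)" "tgt (ap F f) = eo F (tgt f)" "raw (ap F f) = ea F (raw f)"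
  by (simp_all add: ap_def)

locale endofunctor = lin_category C
  for C :: "('o, 'm, 'k::field, 'z) lcat_scheme" (structure) and F :: "('o, 'm) endo" +
  assumes eo_obj: "X \<in> Obj C \<Longrightarrow> eo F X \<in> Obj C"
    and ea_lin: "X \<in> Obj C \<Longrightarrow> Y \<in> Obj C \<Longrightarrow> ea F \<in> lin (Hom C X Y) (Hom C (eo F X) (eo F Y))"
    and ea_id: "X \<in> Obj C \<Longrightarrow> ea F (Id C X) = Id C (eo F X)"
    and ea_comp: "\<lbrakk>X \<in> Obj C; Y \<in> Obj C; Z \<in> Obj C; f \<in> arr C X Y; g \<in> arr C Y Z\<rbrakk>
      \<Longrightarrow> ea F (g \<cdot> f) = ea F g \<cdot> ea F f"
begin

lemma ok_ap: "ok f \<Longrightarrow> ok (ap F f)"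
  by (simp add: ok_def eo_obj linD(1)[OF ea_lin])

lemma ap_tid: "X \<in> Obj C \<Longrightarrow> ap F (tid X) = tid (eo F X)"
  by (simp add: ap_def tid_def ea_id)

lemma ap_tcomp: "ok f \<Longrightarrow> ok g \<Longrightarrow> tgt f = src g \<Longrightarrow> ap F (g ** f) = ap F g ** ap F f"
  using ea_comp[of "src f" "tgt f" "tgt g" "raw f" "raw g"] by (simp add: ok_def ap_def tcomp_def)

lemma ap_square:
  assumes "a ** b = d ** f" "ok a" "ok b" "ok d" "ok f" "tgt b = src a" "tgt f = src d"
  shows "ap F a ** ap F b = ap F d ** ap F f"
  using ap_tcomp[of b a] ap_tcomp[of f d] assms by simp

end

locale adjunction = lin_category C + L: endofunctor C L + R: endofunctor C R
  for C :: "('o, 'm, 'k::field, 'z) lcat_scheme" (structure) and L R :: "('o, 'm) endo" +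
  fixes c e :: "'o \<Rightarrow> 'm"
  assumes c_arr: "X \<in> Obj C \<Longrightarrow> c X \<in> arr C X (eo R (eo L X))"
    and e_arr: "X \<in> Obj C \<Longrightarrow> e X \<in> arr C (eo L (eo R X)) X"
    and c_nat: "\<lbrakk>X \<in> Obj C; Y \<in> Obj C; f \<in> arr C X Y\<rbrakk> \<Longrightarrow> c Y \<cdot> f = ea R (ea L f) \<cdot> c X"
    and e_nat: "\<lbrakk>X \<in> Obj C; Y \<in> Obj C; f \<in> arr C X Y\<rbrakk> \<Longrightarrow> e Y \<cdot> ea L (ea R f) = f \<cdot> e X"
    and zig_R: "X \<in> Obj C \<Longrightarrow> ea R (e X) \<cdot> c (eo R X) = Id C (eo R X)"
    and zig_L: "X \<in> Obj C \<Longrightarrow> e (eo L X) \<cdot> ea L (c X) = Id C (eo L X)"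
begin

definition unit :: "'o \<Rightarrow> ('o, 'm) tarr" where "unit X = (X, c X, eo R (eo L X))"
definition counit :: "'o \<Rightarrow> ('o, 'm) tarr" where "counit X = (eo L (eo R X), e X, X)"

lemma unit_simps [simp]: "src (unit X) = X" "tgt (unit X) = eo R (eo L X)" "raw (unit X) = c X"
  by (simp_all add: unit_def)

lemma counit_simps [simp]: "src (counit X) = eo L (eo R X)" "tgt (counit X) = X" "raw (counit X) = e X"
  by (simp_all add: counit_def)

lemmas objs [simp] = L.eo_obj R.eo_obj

lemmas oks [simp] = L.ok_ap R.ok_ap

lemma ok_unit [simp]: "X \<in> Obj C \<Longrightarrow> ok (unit X)"
  by (simp add: ok_def c_arr)

lemma ok_counit [simp]: "X \<in> Obj C \<Longrightarrow> ok (counit X)"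
  by (simp add: ok_def e_arr)

lemma unit_nat: "ok f \<Longrightarrow> X = tgt f \<Longrightarrow> unit X ** f = ap R (ap L f) ** unit (src f)"
  by (simp add: unit_def ap_def tcomp_def c_nat ok_def)

lemma counit_nat: "ok f \<Longrightarrow> X = tgt f \<Longrightarrow> counit X ** ap L (ap R f) = f ** counit (src f)"
  by (simp add: counit_def ap_def tcomp_def e_nat ok_def)

lemma zigzag_R: "X \<in> Obj C \<Longrightarrow> ap R (counit X) ** unit (eo R X) = tid (eo R X)"
  by (simp add: counit_def unit_def ap_def tcomp_def tid_def zig_R)

lemma zigzag_L: "X \<in> Obj C \<Longrightarrow> counit (eo L X) ** ap L (unit X) = tid (eo L X)"
  by (simp add: counit_def unit_def ap_def tcomp_def tid_def zig_L)

lemma counit_nat':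
  assumes "ok f" "X = tgt f" "ok x" "tgt x = eo L (eo R (src f))"
  shows "counit X ** (ap L (ap R f) ** x) = f ** (counit (src f) ** x)"
  by (rule precomp2[OF counit_nat[OF assms(1,2)]]) (use assms okD[OF assms(1)] in simp_all)

text \<open>The two mutually inverse transpositions.\<close>

lemma transpose_back:
  assumes "ok g" "tgt g = eo R Y" "Y \<in> Obj C"
  shows "ap R (counit Y ** ap L g) ** unit (src g) = g"
proof -
  have X: "src g \<in> Obj C" using assms(1) by (rule okD)
  have "ap R (counit Y ** ap L g) ** unit (src g) = ap R (counit Y) ** (ap R (ap L g) ** unit (src g))"
    using assms X by (simp add: R.ap_tcomp)
  also have "\<dots> = ap R (counit Y) ** (unit (eo R Y) ** g)"
    using assms by (simp add: unit_nat)
  also have "\<dots> = g"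
    using assms precomp[OF zigzag_R[OF assms(3)], of g] by simp
  finally show ?thesis .
qed

lemma transpose_forth:
  assumes "ok f" "src f = eo L X" "X \<in> Obj C"
  shows "counit (tgt f) ** ap L (ap R f ** unit X) = f"
proof -
  have Y: "tgt f \<in> Obj C" using assms(1) by (rule okD)
  have "counit (tgt f) ** ap L (ap R f ** unit X) = (counit (tgt f) ** ap L (ap R f)) ** ap L (unit X)"
    using assms Y by (simp add: L.ap_tcomp)
  also have "\<dots> = f ** (counit (eo L X) ** ap L (unit X))"
    using assms by (simp add: counit_nat)
  also have "\<dots> = f"
    using assms by (simp add: zigzag_L)
  finally show ?thesis .
qed

lemma transpose_inj:
  assumes "ok f" "ok g" "src f = eo L X" "src g = eo L X" "tgt f = tgt g" "X \<in> Obj C"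
    "ap R f ** unit X = ap R g ** unit X"
  shows "f = g"
proof -
  have "f = counit (tgt f) ** ap L (ap R f ** unit X)"
    by (rule transpose_forth[OF assms(1,3,6), symmetric])
  also have "\<dots> = counit (tgt g) ** ap L (ap R g ** unit X)" by (simp only: assms(5,7))
  also have "\<dots> = g" by (rule transpose_forth[OF assms(2,4,6)])
  finally show ?thesis .
qed

lemma transpose_precomp:
  assumes "ok f" "ok g" "src f = eo L Y" "tgt g = Y"
  shows "ap R (f ** ap L g) ** unit (src g) = (ap R f ** unit Y) ** g"
  using assms okD[OF assms(2)] by (simp add: R.ap_tcomp unit_nat)

text \<open>Left adjoints preserve colimits.\<close>

lemma left_adjoint_joint_coeq:
  assumes q: "joint_coeq E q"
  shows "joint_coeq ((\<lambda>(f, g). (ap L f, ap L g)) ` E) (ap L q)"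
proof -
  note d = joint_coeqD[OF q]
  have oq: "ok q" "src q \<in> Obj C" "tgt q \<in> Obj C" using d(1) okD by auto
  show ?thesis
    unfolding joint_coeq_def
  proof (intro conjI allI impI ballI)
    show "ok (ap L q)" using oq by simp
    fix z assume "z \<in> (\<lambda>(f, g). (ap L f, ap L g)) ` E"
    then obtain f g where z: "(f, g) \<in> E" "z = (ap L f, ap L g)" by auto
    show "case z of (f, g) \<Rightarrow> ok f \<and> ok g \<and> src f = src g \<and> tgt f = src (ap L q) \<and> tgt g = src (ap L q) \<and>
        ap L q ** f = ap L q ** g"
      using d(2)[OF z(1)] oq by (simp add: z(2) L.ap_tcomp[symmetric])
  next
    fix h assume "ok h \<and> src h = src (ap L q) \<and>
      (\<forall>(f, g)\<in>(\<lambda>(f, g). (ap L f, ap L g)) ` E. h ** f = h ** g)"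
    then have h: "ok h" "src h = eo L (src q)" and hE: "\<And>f g. (f, g) \<in> E \<Longrightarrow> h ** ap L f = h ** ap L g" by auto
    have Z: "tgt h \<in> Obj C" using h(1) by (rule okD)
    have "\<exists>k. ok k \<and> src k = tgt q \<and> tgt k = tgt (ap R h ** unit (src q)) \<and> k ** q = ap R h ** unit (src q)"
    proof (rule d(3))
      fix f g assume fg: "(f, g) \<in> E"
      note e = d(2)[OF fg]
      have "(ap R h ** unit (src q)) ** f = ap R (h ** ap L f) ** unit (src f)"
        using h e by (simp add: transpose_precomp[symmetric])
      also have "\<dots> = (ap R h ** unit (src q)) ** g"
        using h e hE[OF fg] by (simp add: transpose_precomp[symmetric])
      finally show "(ap R h ** unit (src q)) ** f = (ap R h ** unit (src q)) ** g" .
    qed (use h oq in simp_all)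
    then obtain k where k: "ok k" "src k = tgt q" "tgt k = eo R (tgt h)" "k ** q = ap R h ** unit (src q)" by auto
    have "(counit (tgt h) ** ap L k) ** ap L q = h"
      using k oq Z transpose_forth[OF h oq(2)] by (simp add: L.ap_tcomp[symmetric])
    then show "\<exists>k. ok k \<and> src k = tgt (ap L q) \<and> tgt k = tgt h \<and> k ** ap L q = h"
      using k Z by (intro exI[of _ "counit (tgt h) ** ap L k"]) simp
  next
    fix k l assume kl: "ok k \<and> ok l \<and> src k = tgt (ap L q) \<and> src l = tgt (ap L q) \<and> tgt k = tgt l \<and>
       k ** ap L q = l ** ap L q"
    then have kl': "ok k" "ok l" "src k = eo L (tgt q)" "src l = eo L (tgt q)" "k ** ap L q = l ** ap L q" by simp_all
    have "(ap R k ** unit (tgt q)) ** q = (ap R l ** unit (tgt q)) ** q"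
      using transpose_precomp[OF kl'(1) oq(1) kl'(3) refl] transpose_precomp[OF kl'(2) oq(1) kl'(4) refl] kl'(5)
      by simp
    then have "ap R k ** unit (tgt q) = ap R l ** unit (tgt q)"
      by (rule d(4)[rotated 5]) (simp_all add: kl' kl oq)
    then show "k = l" by (rule transpose_inj[rotated 6]) (simp_all add: kl' kl oq)
  qed
qed

end

section \<open>Monads with adjoints on both sides\<close>

text \<open>
  The functors of the action by an algebra \<open>A\<close> and its duals: \<open>T = A \<rhd> (-)\<close> with \<open>L = A\<^sup>\<or> \<rhd> (-)\<close>,
  \<open>S = A\<^sup>\<or>\<^sup>\<or> \<rhd> (-)\<close>, \<open>R = \<^sup>\<or>A \<rhd> (-)\<close> and \<open>S \<stileturn> L \<stileturn> T \<stileturn> R\<close>.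
\<close>

locale adjoint_monad = lin_category C + LT: adjunction C L T c e + SL: adjunction C S L c1 e1
    + TR: adjunction C T R c2 e2
  for C :: "('o, 'm, 'k::field, 'z) lcat_scheme" (structure) and T L S R :: "('o, 'm) endo"
    and c e c1 e1 c2 e2 :: "'o \<Rightarrow> 'm" +
  fixes m u :: "'o \<Rightarrow> 'm"
  assumes m_arr: "X \<in> Obj C \<Longrightarrow> m X \<in> arr C (eo T (eo T X)) (eo T X)"
    and u_arr: "X \<in> Obj C \<Longrightarrow> u X \<in> arr C X (eo T X)"
    and m_nat: "\<lbrakk>X \<in> Obj C; Y \<in> Obj C; f \<in> arr C X Y\<rbrakk> \<Longrightarrow> m Y \<cdot> ea T (ea T f) = ea T f \<cdot> m X"
    and u_nat: "\<lbrakk>X \<in> Obj C; Y \<in> Obj C; f \<in> arr C X Y\<rbrakk> \<Longrightarrow> u Y \<cdot> f = ea T f \<cdot> u X"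
    and m_assoc: "X \<in> Obj C \<Longrightarrow> m X \<cdot> ea T (m X) = m X \<cdot> m (eo T X)"
    and m_u_left: "X \<in> Obj C \<Longrightarrow> m X \<cdot> u (eo T X) = Id C (eo T X)"
    and m_u_right: "X \<in> Obj C \<Longrightarrow> m X \<cdot> ea T (u X) = Id C (eo T X)"
begin

definition mu :: "'o \<Rightarrow> ('o, 'm) tarr" where "mu X = (eo T (eo T X), m X, eo T X)"
definition eta :: "'o \<Rightarrow> ('o, 'm) tarr" where "eta X = (X, u X, eo T X)"

lemma mu_simps [simp]: "src (mu X) = eo T (eo T X)" "tgt (mu X) = eo T X" "raw (mu X) = m X"
  by (simp_all add: mu_def)

lemma eta_simps [simp]: "src (eta X) = X" "tgt (eta X) = eo T X" "raw (eta X) = u X"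
  by (simp_all add: eta_def)

lemma ok_mu [simp]: "X \<in> Obj C \<Longrightarrow> ok (mu X)"
  by (simp add: ok_def m_arr)

lemma ok_eta [simp]: "X \<in> Obj C \<Longrightarrow> ok (eta X)"
  by (simp add: ok_def u_arr)

lemma mu_nat: "ok f \<Longrightarrow> X = tgt f \<Longrightarrow> mu X ** ap T (ap T f) = ap T f ** mu (src f)"
  by (simp add: mu_def ap_def tcomp_def m_nat ok_def)

lemma mu_nat':
  assumes "ok f" "X = tgt f" "ok x" "tgt x = eo T (eo T (src f))"
  shows "mu X ** (ap T (ap T f) ** x) = ap T f ** (mu (src f) ** x)"
  by (rule precomp2[OF mu_nat[OF assms(1,2)]]) (use assms okD[OF assms(1)] in simp_all)

lemma eta_nat: "ok f \<Longrightarrow> X = tgt f \<Longrightarrow> eta X ** f = ap T f ** eta (src f)"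
  by (simp add: eta_def ap_def tcomp_def u_nat ok_def)

lemma mu_assoc: "X \<in> Obj C \<Longrightarrow> mu X ** ap T (mu X) = mu X ** mu (eo T X)"
  by (simp add: mu_def ap_def tcomp_def m_assoc)

lemma mu_eta: "X \<in> Obj C \<Longrightarrow> mu X ** eta (eo T X) = tid (eo T X)"
  "X \<in> Obj C \<Longrightarrow> mu X ** ap T (eta X) = tid (eo T X)"
  by (simp_all add: mu_def eta_def ap_def tcomp_def tid_def m_u_left m_u_right)

text \<open>
  \<open>ract\<close> is the right action of the monad on \<open>L\<close>, \<open>comu\<close> is the dual of the multiplication, a comultiplication \<open>L \<rightarrow> L L\<close>, and \<open>lact\<close> is the left
  action of the monad \<open>S\<close> on \<open>L\<close>. Their transposes under \<open>L \<stileturn> T\<close> and \<open>S \<stileturn> L\<close> are simple,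
  and an equation between arrows out of \<open>L X\<close> may be checked on transposes.
\<close>

definition ract :: "'o \<Rightarrow> ('o, 'm) tarr" where
  "ract X = LT.counit (eo L X) ** ap L (mu (eo L X) ** ap T (LT.unit X))"

definition comu :: "'o \<Rightarrow> ('o, 'm) tarr" where
  "comu X = LT.counit (eo L (eo L X)) **
     ap L (mu (eo L (eo L X)) ** (ap T (LT.unit (eo L X)) ** LT.unit X))"

definition lact :: "'o \<Rightarrow> ('o, 'm) tarr" where
  "lact X = SL.counit (eo L X) ** ap S (comu X)"

lemma ract_simps [simp]: "src (ract X) = eo L (eo T X)" "tgt (ract X) = eo L X" "X \<in> Obj C \<Longrightarrow> ok (ract X)"
  by (simp_all add: ract_def)

lemma comu_simps [simp]: "src (comu X) = eo L X" "tgt (comu X) = eo L (eo L X)" "X \<in> Obj C \<Longrightarrow> ok (comu X)"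
  by (simp_all add: comu_def)

lemma lact_simps [simp]: "src (lact X) = eo S (eo L X)" "tgt (lact X) = eo L X" "X \<in> Obj C \<Longrightarrow> ok (lact X)"
  by (simp_all add: lact_def)

lemma ract_transp: "X \<in> Obj C \<Longrightarrow> ap T (ract X) ** LT.unit (eo T X) = mu (eo L X) ** ap T (LT.unit X)"
  using LT.transpose_back[of "mu (eo L X) ** ap T (LT.unit X)" "eo L X"] by (simp add: ract_def)

lemma comu_transp: "X \<in> Obj C \<Longrightarrow>
    ap T (comu X) ** LT.unit X = mu (eo L (eo L X)) ** (ap T (LT.unit (eo L X)) ** LT.unit X)"
  using LT.transpose_back[of "mu (eo L (eo L X)) ** (ap T (LT.unit (eo L X)) ** LT.unit X)" "eo L (eo L X)"]
  by (simp add: comu_def)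

lemma lact_transp: "X \<in> Obj C \<Longrightarrow> ap L (lact X) ** SL.unit (eo L X) = comu X"
  using SL.transpose_back[of "comu X" "eo L X"] by (simp add: lact_def)

lemma T_unit_square:
  assumes "ok f"
  shows "ap T (LT.unit (tgt f)) ** ap T f = ap T (ap T (ap L f)) ** ap T (LT.unit (src f))"
  using assms okD[OF assms] LT.unit_nat[OF assms refl] by (intro LT.R.ap_square) simp_all

lemma T_unit_square':
  assumes "ok f" "X = tgt f" "ok x" "tgt x = eo T (src f)"
  shows "ap T (LT.unit X) ** (ap T f ** x) = ap T (ap T (ap L f)) ** (ap T (LT.unit (src f)) ** x)"
  unfolding assms(2)
  by (rule precomp2[OF T_unit_square[OF assms(1)]]) (use assms okD[OF assms(1)] in simp_all)

lemma ract_nat: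
  assumes f: "ok f"
  shows "ract (tgt f) ** ap L (ap T f) = ap L f ** ract (src f)"
proof (rule LT.transpose_inj)
  note o = okD[OF f]
  have "ap T (ract (tgt f) ** ap L (ap T f)) ** LT.unit (eo T (src f))
    = (ap T (ract (tgt f)) ** LT.unit (eo T (tgt f))) ** ap T f"
    using LT.transpose_precomp[of "ract (tgt f)" "ap T f" "eo T (tgt f)"] f o by simp
  also have "\<dots> = ap T (ap L f) ** (mu (eo L (src f)) ** ap T (LT.unit (src f)))"
    using f o by (simp add: ract_transp T_unit_square mu_nat')
  also have "\<dots> = ap T (ap L f ** ract (src f)) ** LT.unit (eo T (src f))"
    using f o by (simp add: LT.R.ap_tcomp ract_transp)
  finally show "ap T (ract (tgt f) ** ap L (ap T f)) ** LT.unit (eo T (src f))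
    = ap T (ap L f ** ract (src f)) ** LT.unit (eo T (src f))" .
qed (use f okD[OF f] in simp_all)

lemma comu_nat:
  assumes f: "ok f"
  shows "comu (tgt f) ** ap L f = ap L (ap L f) ** comu (src f)"
proof (rule LT.transpose_inj)
  note o = okD[OF f]
  have "ap T (comu (tgt f) ** ap L f) ** LT.unit (src f) = (ap T (comu (tgt f)) ** LT.unit (tgt f)) ** f"
    using LT.transpose_precomp[of "comu (tgt f)" f "tgt f"] f o by simp
  also have "\<dots> = ap T (ap L (ap L f)) ** (mu (eo L (eo L (src f))) **
      (ap T (LT.unit (eo L (src f))) ** LT.unit (src f)))"
    using f o by (simp add: comu_transp LT.unit_nat T_unit_square' mu_nat')
  also have "\<dots> = ap T (ap L (ap L f) ** comu (src f)) ** LT.unit (src f)"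
    using f o by (simp add: LT.R.ap_tcomp comu_transp)
  finally show "ap T (comu (tgt f) ** ap L f) ** LT.unit (src f)
    = ap T (ap L (ap L f) ** comu (src f)) ** LT.unit (src f)" .
qed (use f okD[OF f] in simp_all)

lemma lact_nat:
  assumes f: "ok f"
  shows "lact (tgt f) ** ap S (ap L f) = ap L f ** lact (src f)"
proof -
  note o = okD[OF f]
  have "lact (tgt f) ** ap S (ap L f) = SL.counit (eo L (tgt f)) ** ap S (comu (tgt f) ** ap L f)"
    using f o by (simp add: lact_def SL.L.ap_tcomp)
  also have "\<dots> = SL.counit (eo L (tgt f)) ** (ap S (ap L (ap L f)) ** ap S (comu (src f)))"
    using f o by (simp add: comu_nat SL.L.ap_tcomp)
  also have "\<dots> = ap L f ** lact (src f)"
    using f o by (simp add: lact_def SL.counit_nat')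
  finally show ?thesis .
qed

text \<open>Both sides transpose to the threefold multiplication, by associativity.\<close>

lemma comu_ract:
  assumes X: "X \<in> Obj C"
  shows "comu X ** ract X = ap L (ract X) ** comu (eo T X)"
proof (rule LT.transpose_inj)
  let ?L = "eo L X" and ?LL = "eo L (eo L X)"
  have "ap T (comu X ** ract X) ** LT.unit (eo T X) = ap T (comu X) ** (mu ?L ** ap T (LT.unit X))"
    using X by (simp add: LT.R.ap_tcomp ract_transp)
  also have "\<dots> = mu ?LL ** ap T (ap T (comu X) ** LT.unit X)"
    using X by (simp add: LT.R.ap_tcomp mu_nat')
  also have "\<dots> = (mu ?LL ** ap T (mu ?LL)) ** (ap T (ap T (LT.unit ?L)) ** ap T (LT.unit X))"
    using X by (simp add: LT.R.ap_tcomp comu_transp)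
  also have "\<dots> = mu ?LL ** (ap T (LT.unit ?L) ** (mu ?L ** ap T (LT.unit X)))"
    using X by (simp add: mu_assoc mu_nat')
  also have "\<dots> = mu ?LL ** ap T (LT.unit ?L) ** ap T (ract X) ** LT.unit (eo T X)"
    using X by (simp add: ract_transp)
  also have "\<dots> = mu ?LL ** ap T (ap T (ap L (ract X))) ** (ap T (LT.unit (eo L (eo T X))) ** LT.unit (eo T X))"
    using X by (simp add: T_unit_square')
  also have "\<dots> = ap T (ap L (ract X) ** comu (eo T X)) ** LT.unit (eo T X)"
    using X by (simp add: LT.R.ap_tcomp comu_transp mu_nat')
  finally show "ap T (comu X ** ract X) ** LT.unit (eo T X)
    = ap T (ap L (ract X) ** comu (eo T X)) ** LT.unit (eo T X)" .
qed (use X in simp_all)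

lemma lact_ract:
  assumes X: "X \<in> Obj C"
  shows "lact X ** ap S (ract X) = ract X ** lact (eo T X)"
proof -
  have "lact X ** ap S (ract X) = SL.counit (eo L X) ** ap S (ap L (ract X) ** comu (eo T X))"
    using X by (simp add: lact_def comu_ract[symmetric] SL.L.ap_tcomp)
  also have "\<dots> = ract X ** lact (eo T X)"
    using X by (simp add: lact_def SL.counit_nat' SL.L.ap_tcomp)
  finally show ?thesis .
qed

definition is_act :: "('o, 'm) tarr \<Rightarrow> bool" where
  "is_act r \<longleftrightarrow> ok r \<and> src r = eo T (tgt r)"

definition is_mod :: "('o, 'm) tarr \<Rightarrow> bool" where
  "is_mod r \<longleftrightarrow> is_act r \<and> r ** mu (tgt r) = r ** ap T r \<and> r ** eta (tgt r) = tid (tgt r)"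

lemma is_modD:
  assumes "is_mod r"
  shows "ok r" "src r = eo T (tgt r)" "tgt r \<in> Obj C" "r ** mu (tgt r) = r ** ap T r"
    "r ** eta (tgt r) = tid (tgt r)"
  using assms okD by (auto simp: is_mod_def is_act_def)

lemma mod_assoc':
  assumes "is_mod r" "X = tgt r" "ok x" "tgt x = eo T (eo T X)"
  shows "r ** (mu X ** x) = r ** (ap T r ** x)"
  unfolding assms(2)
  by (rule precomp2[OF is_modD(4)[OF assms(1)]]) (use assms is_modD(1-3)[OF assms(1)] in simp_all)

text \<open>Arrows out of \<open>L \<otimes>\<^sub>T U\<close> are module maps from \<open>U\<close> to a free module.\<close>

lemma balanced_iff_linear:
  assumes r: "ok r" "src r = eo T (tgt r)" and G: "ok G" "src G = eo L (tgt r)"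
  shows "G ** ap L r = G ** ract (tgt r) \<longleftrightarrow>
    (ap T G ** LT.unit (tgt r)) ** r = mu (tgt G) ** ap T (ap T G ** LT.unit (tgt r))" (is "?l = ?r \<longleftrightarrow> ?l' = ?r'")
proof -
  note o = okD[OF r(1)] okD[OF G(1)]
  have l: "ap T ?l ** LT.unit (eo T (tgt r)) = ?l'"
    using LT.transpose_precomp[OF G(1) r(1) G(2) refl] r by simp
  have rr: "ap T ?r ** LT.unit (eo T (tgt r)) = ?r'"
    using r G o by (simp add: LT.R.ap_tcomp ract_transp mu_nat')
  have "?l = ?r" if "?l' = ?r'"
    by (rule LT.transpose_inj[of _ _ "eo T (tgt r)"]) (use that l rr r G o in simp_all)
  then show ?thesis using l rr by auto
qed

text \<open>
  The comparison behind the action on \<open>N(L \<otimes>\<^sub>T U)\<close>: in terms of elements, \<open>a (b x) = (a b) x\<close>, where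
  \<open>comu\<close> splits a functional along the product \<open>a b\<close>.
\<close>

lemma act_comu:
  assumes r: "is_mod r" and G: "ok G" "src G = eo L U" "tgt G = eo T (tgt r)" and U: "U \<in> Obj C"
  shows "r ** (ap T (LT.counit (tgt r) ** (ap L G ** comu U)) ** LT.unit U) = r ** (ap T r ** (ap T G ** LT.unit U))"
proof -
  let ?X = "tgt r" and ?L = "eo L U" and ?LL = "eo L (eo L U)"
  note o = is_modD[OF r] and oG = okD[OF G(1)]
  have "ap T (LT.counit ?X ** (ap L G ** comu U)) ** LT.unit U
    = ap T (LT.counit ?X) ** (ap T (ap L G) ** (mu ?LL ** (ap T (LT.unit ?L) ** LT.unit U)))"
    using o oG G U by (simp add: LT.R.ap_tcomp comu_transp)
  also have "\<dots> = ap T (LT.counit ?X) ** (mu (eo L (tgt G)) ** (ap T (ap T (ap L G)) ** (ap T (LT.unit ?L) ** LT.unit U)))"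
    using o oG G U by (simp add: mu_nat')
  also have "\<dots> = ap T (LT.counit ?X) ** (mu (eo L (tgt G)) ** (ap T (LT.unit (tgt G)) ** (ap T G ** LT.unit U)))"
    using o oG G U by (simp add: T_unit_square')
  also have "\<dots> = mu ?X ** (ap T (ap T (LT.counit ?X)) ** (ap T (LT.unit (eo T ?X)) ** (ap T G ** LT.unit U)))"
    using o oG G U by (simp add: mu_nat')
  also have "\<dots> = mu ?X ** (ap T (ap T (LT.counit ?X) ** LT.unit (eo T ?X)) ** (ap T G ** LT.unit U))"
    using o oG G U by (simp add: LT.R.ap_tcomp)
  also have "\<dots> = mu ?X ** (ap T G ** LT.unit U)"
    using o oG G U by (simp add: LT.zigzag_R LT.R.ap_tid)
  finally show ?thesis using o oG G U r by (simp add: mod_assoc')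
qed

text \<open>
  \<open>S\<close> preserves the coequalizer, and \<open>lact\<close> commutes with the two arrows that are coequalized.
\<close>

lemma lact_descends:
  assumes r: "ok r" "src r = eo T U" "tgt r = U" and q: "joint_coeq {(ract U, ap L r)} q" "src q = eo L U"
  shows "\<exists>k. ok k \<and> src k = eo S (tgt q) \<and> tgt k = tgt q \<and> k ** ap S q = q ** lact U"
proof -
  have U: "U \<in> Obj C" using okD(2)[OF r(1)] r(3) by simp
  note d = joint_coeqD[OF q(1)]
  note oq = okD[OF d(1)]
  have bal: "q ** ract U = q ** ap L r" using d(2)[of "ract U" "ap L r"] by simp
  have "(q ** lact U) ** ap S (ract U) = (q ** ract U) ** lact (eo T U)"
    using U d(1) q(2) by (simp add: lact_ract)
  also have "\<dots> = q ** (ap L r ** lact (eo T U))"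
    using U d(1) q(2) r by (simp add: bal)
  also have "\<dots> = (q ** lact U) ** ap S (ap L r)"
    using U d(1) q(2) r lact_nat[OF r(1)] by simp
  finally have "(q ** lact U) ** ap S (ract U) = (q ** lact U) ** ap S (ap L r)" .
  then have "\<exists>k. ok k \<and> src k = tgt (ap S q) \<and> tgt k = tgt (q ** lact U) \<and> k ** ap S q = q ** lact U"
    using U d(1) q(2) by (intro joint_coeqD(3)[OF SL.left_adjoint_joint_coeq[OF q(1)]]) auto
  then show ?thesis by simp
qed

end

section \<open>Jointly epimorphic families\<close>

context lin_category
begin

definition joint_epi :: "('o, 'm) tarr set \<Rightarrow> 'o \<Rightarrow> bool" where
  "joint_epi \<F> P \<longleftrightarrow> P \<in> Obj C \<and> (\<forall>f\<in>\<F>. ok f \<and> tgt f = P) \<and>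
     (\<forall>k l. ok k \<and> ok l \<and> src k = P \<and> src l = P \<and> tgt k = tgt l \<and> (\<forall>f\<in>\<F>. k ** f = l ** f) \<longrightarrow> k = l)"

lemma joint_epiD:
  assumes "joint_epi \<F> P"
  shows "P \<in> Obj C" "f \<in> \<F> \<Longrightarrow> ok f" "f \<in> \<F> \<Longrightarrow> tgt f = P" "f \<in> \<F> \<Longrightarrow> src f \<in> Obj C"
  using assms okD by (auto simp: joint_epi_def)

lemma joint_epi_ext:
  assumes "joint_epi \<F> P" "ok k" "ok l" "src k = P" "src l = P" "tgt k = tgt l"
    and "\<And>f. f \<in> \<F> \<Longrightarrow> k ** f = l ** f"
  shows "k = l"
proof -
  note d = assms(1)[unfolded joint_epi_def, THEN conjunct2, THEN conjunct2, rule_format]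
  show ?thesis by (rule d) (use assms(2-) in simp)
qed

text \<open>
  The generators of a copower are one of the two families on which module axioms will be checked; the other one is
  the universal family of a Nakayama functor.
\<close>

lemma copower_joint_epi:
  assumes "is_copower C V X P w" "X \<in> Obj C"
  shows "joint_epi ((\<lambda>v. (X, w v, P)) ` carrier V) P"
proof -
  have P: "P \<in> Obj C" and w: "w \<in> lin V (Hom C X P)"
    and un: "\<And>Y g. Y \<in> Obj C \<Longrightarrow> g \<in> lin V (Hom C X Y) \<Longrightarrow>
      \<exists>!h. h \<in> arr C P Y \<and> (\<forall>v\<in>carrier V. h \<cdot> w v = g v)"
    using assms(1) by (simp_all add: is_copower_def)
  show ?thesis
    unfolding joint_epi_def
  proof (intro conjI allI impI ballI)
    show "P \<in> Obj C" by (rule P)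
    fix f assume "f \<in> (\<lambda>v. (X, w v, P)) ` carrier V"
    then obtain v where v: "v \<in> carrier V" "f = (X, w v, P)" by (rule imageE)
    show "ok f" using linD(1)[OF w v(1)] P assms(2) by (simp add: v(2) ok_typed)
    show "tgt f = P" by (simp add: v(2))
  next
    fix k l assume "ok k \<and> ok l \<and> src k = P \<and> src l = P \<and> tgt k = tgt l \<and>
      (\<forall>f\<in>(\<lambda>v. (X, w v, P)) ` carrier V. k ** f = l ** f)"
    then have kl: "ok k" "ok l" "src k = P" "src l = P" "tgt k = tgt l"
      and eq: "\<And>v. v \<in> carrier V \<Longrightarrow> raw k \<cdot> w v = raw l \<cdot> w v"
      by (auto simp: tcomp_def)
    have Y: "tgt l \<in> Obj C" and ka: "raw k \<in> arr C P (tgt l)" and la: "raw l \<in> arr C P (tgt l)"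
      using okD[OF kl(1)] okD[OF kl(2)] kl by simp_all
    have "(\<lambda>v. raw l \<cdot> w v) \<in> lin V (Hom C X (tgt l))"
      by (rule lin_comp[OF w comp_lin_right[OF assms(2) P Y la]])
    from un[OF Y this] have "raw k = raw l" by (rule ex1_eq) (use ka la eq in simp_all)
    then show "k = l" using kl by (intro typed_eqI) simp_all
  qed
qed

end

context adjunction
begin

text \<open>
  Transposition turns an equation between arrows out of \<open>L P\<close> into one between arrows out of \<open>P\<close>. The case \<open>T \<stileturn> R\<close> is
  what the right adjoint of the monad is for.
\<close>

lemma joint_epi_left_adjoint:
  assumes "joint_epi \<F> P"
  shows "joint_epi (ap L ` \<F>) (eo L P)"
  unfolding joint_epi_def
proof (intro conjI allI impI ballI)
  note d = joint_epiD[OF assms]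
  show "eo L P \<in> Obj C" using d(1) by simp
  fix g assume "g \<in> ap L ` \<F>"
  then show "ok g" "tgt g = eo L P" using d by auto
next
  note d = joint_epiD[OF assms]
  fix k l assume "ok k \<and> ok l \<and> src k = eo L P \<and> src l = eo L P \<and> tgt k = tgt l \<and>
      (\<forall>f\<in>ap L ` \<F>. k ** f = l ** f)"
  then have kl: "ok k" "ok l" "src k = eo L P" "src l = eo L P" "tgt k = tgt l"
    and eq: "\<And>f. f \<in> \<F> \<Longrightarrow> k ** ap L f = l ** ap L f" by auto
  have "ap R k ** unit P = ap R l ** unit P"
  proof (rule joint_epi_ext[OF assms])
    fix f assume f: "f \<in> \<F>"
    show "(ap R k ** unit P) ** f = (ap R l ** unit P) ** f"
      using transpose_precomp[OF kl(1) d(2)[OF f] kl(3) d(3)[OF f]]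
        transpose_precomp[OF kl(2) d(2)[OF f] kl(4) d(3)[OF f]] eq[OF f] by simp
  qed (use kl d(1) in simp_all)
  then show "k = l" by (rule transpose_inj[rotated 6]) (simp_all add: kl d(1))
qed

lemma copower_left_adjoint:
  assumes cp: "is_copower C V X P w" and X: "X \<in> Obj C" and Y: "Y \<in> Obj C"
    and g: "g \<in> lin V (Hom C (eo L X) Y)"
  shows "\<exists>h. h \<in> arr C (eo L P) Y \<and> (\<forall>v\<in>carrier V. h \<cdot> ea L (w v) = g v)"
proof -
  have P: "P \<in> Obj C" and w: "w \<in> lin V (Hom C X P)"
    and un: "\<And>Y g. Y \<in> Obj C \<Longrightarrow> g \<in> lin V (Hom C X Y) \<Longrightarrow>
      \<exists>!h. h \<in> arr C P Y \<and> (\<forall>v\<in>carrier V. h \<cdot> w v = g v)"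
    using cp by (simp_all add: is_copower_def)
  have "(\<lambda>v. ea R (g v) \<cdot> c X) \<in> lin V (Hom C X (eo R Y))"
    by (rule lin_comp[OF lin_comp[OF g R.ea_lin] comp_lin_left]) (simp_all add: X Y c_arr)
  from un[OF _ this] Y obtain h where h: "h \<in> arr C P (eo R Y)" "\<forall>v\<in>carrier V. h \<cdot> w v = ea R (g v) \<cdot> c X"
    by auto
  let ?h = "(P, h, eo R Y)"
  have okh: "ok ?h" using h P Y by (simp add: ok_typed)
  have "raw (counit Y ** ap L ?h) \<cdot> ea L (w v) = g v" if v: "v \<in> carrier V" for v
  proof -
    let ?w = "(X, w v, P)" and ?g = "(eo L X, g v, Y)"
    have okw: "ok ?w" and okg: "ok ?g"
      using linD(1)[OF w v] linD(1)[OF g v] X P Y by (simp_all add: ok_typed)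
    have "?h ** ?w = ap R ?g ** unit X" using h(2) v by (simp add: tcomp_def)
    then have "counit Y ** (ap L ?h ** ap L ?w) = ?g"
      using transpose_forth[OF okg _ X] okh okw Y by (simp add: L.ap_tcomp[symmetric])
    from arg_cong[OF this, of raw] show ?thesis
      using okh okw Y by (simp add: tcomp_def comp_assoc[of "eo L X" "eo L P" "eo L (eo R Y)" Y] ok_typed
        L.eo_obj linD(1)[OF L.ea_lin] e_arr)
  qed
  moreover have "raw (counit Y ** ap L ?h) \<in> arr C (eo L P) Y"
    using okD(3)[of "counit Y ** ap L ?h"] okh Y by simp
  ultimately show ?thesis by blast
qed

end

section \<open>The twist of a Nakayama functor\<close>

context adjoint_monad
begin

lemma is_mod_of_joint_epi:
  assumes epi: "joint_epi (f ` I) P" and b: "\<And>i. i \<in> I \<Longrightarrow> is_mod (r i)" "\<And>i. i \<in> I \<Longrightarrow> src (f i) = tgt (r i)"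
    and a: "ok a" "src a = eo T P" "tgt a = P" and l: "\<And>i. i \<in> I \<Longrightarrow> a ** ap T (f i) = f i ** r i"
  shows "is_mod a"
proof -
  note ej = joint_epiD[OF epi]
  have P: "P \<in> Obj C" by (rule ej(1))
  have f: "ok (f i)" "tgt (f i) = P" if "i \<in> I" for i using ej(2,3) that by auto
  have "a ** mu P = a ** ap T a"
  proof (rule joint_epi_ext[OF TR.joint_epi_left_adjoint[OF TR.joint_epi_left_adjoint[OF epi]]])
    fix g assume "g \<in> ap T ` ap T ` f ` I"
    then obtain i where i: "i \<in> I" "g = ap T (ap T (f i))" by blast
    note bb = is_modD[OF b(1)[OF i(1)]] and ff = f[OF i(1)] b(2)[OF i(1)]
    have "(a ** mu P) ** g = a ** (ap T (f i) ** mu (src (f i)))" using a P ff i by (simp add: mu_nat)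
    also have "\<dots> = f i ** (r i ** mu (src (f i)))" by (rule precomp2[OF l[OF i(1)]]) (use a bb ff in simp_all)
    also have "\<dots> = f i ** (r i ** ap T (r i))" using ff bb(4) by simp
    also have "\<dots> = a ** (ap T (f i) ** ap T (r i))"
      by (rule precomp2[OF l[OF i(1)], symmetric]) (use a bb ff in simp_all)
    also have "\<dots> = a ** (ap T a ** ap T (ap T (f i)))"
      by (subst LT.R.ap_square[OF l[OF i(1)]]) (use a bb ff in simp_all)
    finally show "(a ** mu P) ** g = (a ** ap T a) ** g" using a ff i P by simp
  qed (use a P in simp_all)
  moreover have "a ** eta P = tid P"
  proof (rule joint_epi_ext[OF epi])
    fix g assume "g \<in> f ` I"
    then obtain i where i: "i \<in> I" "g = f i" by blast
    note bb = is_modD[OF b(1)[OF i(1)]] and ff = f[OF i(1)] b(2)[OF i(1)]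
    have "(a ** eta P) ** g = a ** (ap T (f i) ** eta (src (f i)))" using a P ff i by (simp add: eta_nat)
    also have "\<dots> = f i ** (r i ** eta (src (f i)))" by (rule precomp2[OF l[OF i(1)]]) (use a bb ff in simp_all)
    finally show "(a ** eta P) ** g = tid P ** g" using ff i bb(5) by simp
  qed (use a P in simp_all)
  ultimately show ?thesis using a by (simp add: is_mod_def is_act_def)
qed

lemma linear_of_joint_epi:
  assumes epi: "joint_epi (f ` I) P" and b: "\<And>i. i \<in> I \<Longrightarrow> is_mod (r i)" "\<And>i. i \<in> I \<Longrightarrow> src (f i) = tgt (r i)"
    and a: "ok a" "src a = eo T P" "tgt a = P" and l: "\<And>i. i \<in> I \<Longrightarrow> a ** ap T (f i) = f i ** r i"
    and h: "ok h" "src h = P" "tgt h = tgt r'" and r': "is_mod r'"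
    and hf: "\<And>i. i \<in> I \<Longrightarrow> (h ** f i) ** r i = r' ** ap T (h ** f i)"
  shows "h ** a = r' ** ap T h"
proof (rule joint_epi_ext[OF TR.joint_epi_left_adjoint[OF epi]])
  fix g assume "g \<in> ap T ` f ` I"
  then obtain i where i: "i \<in> I" "g = ap T (f i)" by blast
  note bb = is_modD[OF b(1)[OF i(1)]] and ff = joint_epiD(2,3)[OF epi, of "f i"] i b(2)[OF i(1)]
  have "(h ** a) ** g = (h ** f i) ** r i" using a h bb ff l[OF i(1)] by simp
  then show "(h ** a) ** g = (r' ** ap T h) ** g" using h ff is_modD[OF r'] hf[OF i(1)] by (simp add: LT.R.ap_tcomp)
qed (use a h is_modD[OF r'] joint_epiD(1)[OF epi] in simp_all)

end

locale nakayama_category = lin_category C for C :: "('o, 'm, 'k::field, 'z) lcat_scheme" (structure) +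
  fixes N :: "('o, 'm, 'o, 'm) fctr" and j :: "'o \<Rightarrow> 'o \<Rightarrow> ('m \<Rightarrow> 'k) \<Rightarrow> 'm"
  assumes nak: "nak_functor C N j"
begin

definition jt :: "'o \<Rightarrow> 'o \<Rightarrow> ('m \<Rightarrow> 'k) \<Rightarrow> ('o, 'm) tarr" where
  "jt Q X \<xi> = (X, j Q X \<xi>, Fo N Q)"

definition Nt :: "('o, 'm) tarr \<Rightarrow> ('o, 'm) tarr" where
  "Nt f = (Fo N (src f), Fa N (src f) (tgt f) (raw f), Fo N (tgt f))"

lemma jt_simps [simp]: "src (jt Q X \<xi>) = X" "tgt (jt Q X \<xi>) = Fo N Q" "raw (jt Q X \<xi>) = j Q X \<xi>"
  by (simp_all add: jt_def)

lemma Nt_simps [simp]: "src (Nt f) = Fo N (src f)" "tgt (Nt f) = Fo N (tgt f)"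
    "raw (Nt f) = Fa N (src f) (tgt f) (raw f)"
  by (simp_all add: Nt_def)

lemma N_functor: "lin_functor C C N"
  using nak by (simp add: nak_functor_def)

lemma j_universal: "Q \<in> Obj C \<Longrightarrow> nak_universal C Q (Fo N Q) (j Q)"
  using nak by (simp add: nak_functor_def)

lemma N_obj [simp]: "X \<in> Obj C \<Longrightarrow> Fo N X \<in> Obj C"
  by (rule nak_universalD(1)[OF j_universal])

lemma ok_Nt [simp]: "ok f \<Longrightarrow> ok (Nt f)"
  using linD(1)[OF lin_functor.arrow[OF N_functor]] by (simp add: ok_def)

lemma j_lin: "Q \<in> Obj C \<Longrightarrow> X \<in> Obj C \<Longrightarrow> j Q X \<in> lin (hom_dual C Q X) (Hom C X (Fo N Q))"
  by (rule nak_familyD(1)[OF nak_universalD(2)[OF j_universal]])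

lemma ok_jt [simp]: "Q \<in> Obj C \<Longrightarrow> X \<in> Obj C \<Longrightarrow> \<xi> \<in> fnl C Q X \<Longrightarrow> ok (jt Q X \<xi>)"
  by (simp add: ok_def linD(1)[OF j_lin])

lemma jt_nat:
  assumes "Q \<in> Obj C" "ok f" "Y = tgt f" "\<xi> \<in> fnl C Q Y"
  shows "jt Q Y \<xi> ** f = jt Q (src f) (transp (Hom C Q (src f)) (\<lambda>h. raw f \<cdot> h) \<xi>)"
  using nak_familyD(2)[OF nak_universalD(2)[OF j_universal[OF assms(1)]], of "src f" "tgt f" "raw f" \<xi>] assms
  by (simp add: jt_def tcomp_def ok_def)

lemma Nt_jt:
  assumes "ok g" "Q = src g" "X \<in> Obj C" "\<xi> \<in> fnl C Q X"
  shows "Nt g ** jt Q X \<xi> = jt (tgt g) X (transp (Hom C (tgt g) X) (\<lambda>h. h \<cdot> raw g) \<xi>)"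
  using nak assms by (simp add: nak_functor_def jt_def tcomp_def ok_def)

lemma jt_joint_epi:
  assumes Q: "Q \<in> Obj C"
  shows "joint_epi {jt Q X \<xi> | X \<xi>. X \<in> Obj C \<and> \<xi> \<in> fnl C Q X} (Fo N Q)"
  unfolding joint_epi_def
proof (intro conjI allI impI ballI)
  show "Fo N Q \<in> Obj C" using Q by simp
  fix f assume "f \<in> {jt Q X \<xi> | X \<xi>. X \<in> Obj C \<and> \<xi> \<in> fnl C Q X}"
  then show "ok f" "tgt f = Fo N Q" using Q by auto
next
  fix k l assume "ok k \<and> ok l \<and> src k = Fo N Q \<and> src l = Fo N Q \<and> tgt k = tgt l \<and>
    (\<forall>f\<in>{jt Q X \<xi> | X \<xi>. X \<in> Obj C \<and> \<xi> \<in> fnl C Q X}. k ** f = l ** f)"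
  then have kl: "ok k" "ok l" "src k = Fo N Q" "src l = Fo N Q" "tgt k = tgt l"
    and eq: "\<And>X \<xi>. X \<in> Obj C \<Longrightarrow> \<xi> \<in> fnl C Q X \<Longrightarrow> k ** jt Q X \<xi> = l ** jt Q X \<xi>" by blast+
  have "raw k = raw l"
  proof (rule nak_universal_ext[OF j_universal[OF Q] Q])
    show "tgt l \<in> Obj C" "raw k \<in> arr C (Fo N Q) (tgt l)" "raw l \<in> arr C (Fo N Q) (tgt l)"
      using okD[OF kl(1)] okD[OF kl(2)] kl(3-5) by simp_all
    fix X \<xi> assume "X \<in> Obj C" "\<xi> \<in> fnl C Q X"
    from arg_cong[OF eq[OF this], of raw] show "raw k \<cdot> j Q X \<xi> = raw l \<cdot> j Q X \<xi>" by simp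
  qed
  then show "k = l" using kl by (intro typed_eqI) simp_all
qed

lemma jt_factor:
  assumes Q: "Q \<in> Obj C" and Z: "Z \<in> Obj C" and \<alpha>: "nak_family C Q Z \<alpha>"
  shows "\<exists>h. ok h \<and> src h = Fo N Q \<and> tgt h = Z \<and>
    (\<forall>X\<in>Obj C. \<forall>\<xi>\<in>fnl C Q X. h ** jt Q X \<xi> = (X, \<alpha> X \<xi>, Z))"
proof -
  obtain h where "h \<in> arr C (Fo N Q) Z" "\<forall>X\<in>Obj C. \<forall>\<xi>\<in>fnl C Q X. h \<cdot> j Q X \<xi> = \<alpha> X \<xi>"
    using nak_universalD(3)[OF j_universal[OF Q] Z \<alpha>] by blast
  then show ?thesis using Q Z by (intro exI[of _ "(Fo N Q, h, Z)"]) (simp add: ok_typed jt_def tcomp_def)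
qed

end

locale monad_nakayama = adjoint_monad C T L S R c e c1 e1 c2 e2 m u + nakayama_category C N j
  for C :: "('o, 'm, 'k::field, 'z) lcat_scheme" (structure) and T L S R :: "('o, 'm) endo"
    and c e c1 e1 c2 e2 m u :: "'o \<Rightarrow> 'm" and N j
begin

text \<open>\<open>ttw Q X\<close> is the map \<open>Hom(S Q, T X) \<rightarrow> Hom(Q, X)\<close> along which the twist is transposed, and
  \<open>stw Y\<close> is transposition \<open>Hom(Q, L Y) \<rightarrow> Hom(S Q, Y)\<close>, which defines its inverse.\<close>

definition ttw :: "'o \<Rightarrow> 'o \<Rightarrow> 'm \<Rightarrow> 'm" where
  "ttw Q X f = e X \<cdot> (ea L f \<cdot> c1 Q)"

definition stw :: "'o \<Rightarrow> 'm \<Rightarrow> 'm" where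
  "stw Y f = e1 Y \<cdot> ea S f"

lemma ttw_lin:
  assumes "Q \<in> Obj C" "X \<in> Obj C"
  shows "ttw Q X \<in> lin (Hom C (eo S Q) (eo T X)) (Hom C Q X)"
  unfolding ttw_def using assms
  by (intro lin_comp[OF lin_comp[OF LT.L.ea_lin comp_lin_left] comp_lin_right])
    (simp_all add: LT.e_arr SL.c_arr)

lemma stw_lin:
  assumes "Q \<in> Obj C" "Y \<in> Obj C"
  shows "stw Y \<in> lin (Hom C Q (eo L Y)) (Hom C (eo S Q) Y)"
  unfolding stw_def using assms
  by (intro lin_comp[OF SL.L.ea_lin comp_lin_right]) (simp_all add: SL.e_arr)

lemma ttw_dual:
  assumes "Q \<in> Obj C" "X \<in> Obj C" "\<xi> \<in> fnl C Q X"
  shows "transp (Hom C (eo S Q) (eo T X)) (ttw Q X) \<xi> \<in> fnl C (eo S Q) (eo T X)"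
  using linD(1)[OF transp_lin[OF ttw_lin[OF assms(1,2)]] assms(3)] assms hom_space by simp

lemma stw_dual:
  assumes "Q \<in> Obj C" "Y \<in> Obj C" "\<xi> \<in> fnl C (eo S Q) Y"
  shows "transp (Hom C Q (eo L Y)) (stw Y) \<xi> \<in> fnl C Q (eo L Y)"
  using linD(1)[OF transp_lin[OF stw_lin[OF assms(1,2)]] assms(3)] assms hom_space by simp

text \<open>
  The twisted structure isomorphism \<open>T N(Q) \<cong> N(S Q)\<close>, characterized on the universal family.
\<close>

definition is_twist :: "'o \<Rightarrow> ('o, 'm) tarr \<Rightarrow> bool" where
  "is_twist Q p \<longleftrightarrow> ok p \<and> src p = eo T (Fo N Q) \<and> tgt p = Fo N (eo S Q) \<and>
    (\<forall>X\<in>Obj C. \<forall>\<xi>\<in>fnl C Q X.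
      p ** ap T (jt Q X \<xi>) = jt (eo S Q) (eo T X) (transp (Hom C (eo S Q) (eo T X)) (ttw Q X) \<xi>))"

text \<open>
  The action \<open>N(k) ** p\<close> on \<open>N(Q)\<close> that is induced by \<open>k : S Q \<rightarrow> Q\<close> is compatible with an action \<open>r\<close> on \<open>X\<close>
  along the arrow indexed by \<open>\<zeta>\<close> as soon as \<open>\<zeta>\<close> does not distinguish the two ways of acting on \<open>Hom(Q, T X)\<close>.
\<close>

lemma nak_act_jt:
  assumes Q: "Q \<in> Obj C" and p: "is_twist Q p" and k: "ok k" "src k = eo S Q" "tgt k = Q"
    and r: "ok r" "src r = eo T X" "tgt r = X" and \<zeta>: "\<zeta> \<in> fnl C Q X"
    and key: "\<And>g. g \<in> arr C Q (eo T X) \<Longrightarrow> \<zeta> (ttw Q X (g \<cdot> raw k)) = \<zeta> (raw r \<cdot> g)"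
  shows "(Nt k ** p) ** ap T (jt Q X \<zeta>) = jt Q X \<zeta> ** r"
proof -
  have X: "X \<in> Obj C" using okD(2)[OF r(1)] r(3) by simp
  let ?\<zeta> = "transp (Hom C (eo S Q) (eo T X)) (ttw Q X) \<zeta>"
  note \<zeta>' = ttw_dual[OF Q X \<zeta>]
  have p': "ok p" "src p = eo T (Fo N Q)" "tgt p = Fo N (eo S Q)" "p ** ap T (jt Q X \<zeta>) = jt (eo S Q) (eo T X) ?\<zeta>"
    using p X \<zeta> by (simp_all add: is_twist_def)
  have "(Nt k ** p) ** ap T (jt Q X \<zeta>) = Nt k ** jt (eo S Q) (eo T X) ?\<zeta>" using p' k Q X \<zeta> by simp
  also have "\<dots> = jt Q (eo T X) (transp (Hom C Q (eo T X)) (\<lambda>h. h \<cdot> raw k) ?\<zeta>)"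
    using Nt_jt[of k "eo S Q" "eo T X", OF _ _ _ \<zeta>'] k X by simp
  also have "transp (Hom C Q (eo T X)) (\<lambda>h. h \<cdot> raw k) ?\<zeta> = transp (Hom C Q (eo T X)) (\<lambda>h. raw r \<cdot> h) \<zeta>"
  proof -
    have l: "(\<lambda>h. h \<cdot> raw k) \<in> lin (Hom C Q (eo T X)) (Hom C (eo S Q) (eo T X))"
      by (rule comp_lin_left) (use Q X k okD(3)[of k] in simp_all)
    show ?thesis unfolding transp_transp[OF l] unfolding transp_def by (rule restrict_ext) (rule key)
  qed
  also have "jt Q (eo T X) \<dots> = jt Q X \<zeta> ** r" using jt_nat[OF Q r(1) r(3)[symmetric] \<zeta>] r(2) by simp
  finally show ?thesis .
qed

lemma T_jt_joint_epi:
  assumes Q: "Q \<in> Obj C"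
  shows "joint_epi (ap T ` {jt Q X \<xi> | X \<xi>. X \<in> Obj C \<and> \<xi> \<in> fnl C Q X}) (eo T (Fo N Q))"
  by (rule TR.joint_epi_left_adjoint[OF jt_joint_epi[OF Q]])

text \<open>
  \<open>T\<close> has the right adjoint \<open>R\<close>, so an arrow out of \<open>T N(Q)\<close> is an arrow out of \<open>N(Q)\<close>, where the universal property
  applies.
\<close>

lemma twist_exists:
  assumes Q: "Q \<in> Obj C"
  shows "\<exists>p. is_twist Q p"
proof -
  let ?\<tau> = "\<lambda>X. transp (Hom C (eo S Q) (eo T X)) (ttw Q X)"
  \<comment> \<open>the transpose of the value that \<open>p ** ap T (jt Q X \<xi>)\<close> is to have\<close>
  define \<alpha> where "\<alpha> X \<xi> = ea R (j (eo S Q) (eo T X) (?\<tau> X \<xi>)) \<cdot> c2 X" for X \<xi>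
  have SQ: "eo S Q \<in> Obj C" using Q by simp
  have \<alpha>_typed: "(X, \<alpha> X \<xi>, eo R (Fo N (eo S Q))) = ap R (jt (eo S Q) (eo T X) (?\<tau> X \<xi>)) ** TR.unit X" for X \<xi>
    by (simp add: \<alpha>_def tcomp_def)
  have "nak_family C Q (eo R (Fo N (eo S Q))) \<alpha>"
    unfolding nak_family_def
  proof (intro conjI ballI)
    fix X assume X: "X \<in> Obj C"
    have t: "?\<tau> X \<in> lin (hom_dual C Q X) (hom_dual C (eo S Q) (eo T X))"
      by (rule transp_lin[OF ttw_lin[OF Q X]]) (use Q X hom_space in simp_all)
    show "\<alpha> X \<in> lin (hom_dual C Q X) (Hom C X (eo R (Fo N (eo S Q))))"
      unfolding \<alpha>_def
      by (rule lin_comp[OF lin_comp[OF lin_comp[OF t j_lin] TR.R.ea_lin] comp_lin_left])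
        (use Q X in \<open>simp_all add: TR.c_arr\<close>)
    fix Y f \<xi> assume Y: "Y \<in> Obj C" and f: "f \<in> arr C X Y" and \<xi>: "\<xi> \<in> fnl C Q Y"
    let ?f = "(X, f, Y)"
    have okf: "ok ?f" using X Y f by (simp add: ok_typed)
    have \<xi>': "?\<tau> Y \<xi> \<in> fnl C (eo S Q) (eo T Y)" by (rule ttw_dual[OF Q Y \<xi>])
    have key: "ttw Q Y (ea T f \<cdot> g) = f \<cdot> ttw Q X g" if g: "g \<in> arr C (eo S Q) (eo T X)" for g
    proof -
      let ?g = "(eo S Q, g, eo T X)"
      have okg: "ok ?g" using g Q X by (simp add: ok_typed)
      have "LT.counit Y ** (ap L (ap T ?f ** ?g) ** SL.unit Q) = ?f ** (LT.counit X ** (ap L ?g ** SL.unit Q))"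
        using okf okg X Y Q by (simp add: LT.L.ap_tcomp LT.counit_nat')
      from arg_cong[OF this, of raw] show ?thesis by (simp add: ttw_def)
    qed
    have eq: "transp (Hom C (eo S Q) (eo T X)) (\<lambda>h. ea T f \<cdot> h) (?\<tau> Y \<xi>)
      = ?\<tau> X (transp (Hom C Q X) (\<lambda>h. f \<cdot> h) \<xi>)"
      using transp_transp[OF comp_lin_right[of "eo S Q" "eo T X" "eo T Y" "ea T f"], of "ttw Q Y" \<xi>]
        transp_transp[OF ttw_lin[OF Q X], of "\<lambda>h. f \<cdot> h" \<xi>]
        linD(1)[OF LT.R.ea_lin[OF X Y] f] Q X Y
      by (simp add: key cong: transp_cong)
    have "ap R (jt (eo S Q) (eo T Y) (?\<tau> Y \<xi>)) ** TR.unit Y ** ?f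
      = ap R (jt (eo S Q) (eo T Y) (?\<tau> Y \<xi>) ** ap T ?f) ** TR.unit X"
      using okf X Y Q \<xi>' SQ by (simp add: TR.unit_nat TR.R.ap_tcomp)
    also have "jt (eo S Q) (eo T Y) (?\<tau> Y \<xi>) ** ap T ?f = jt (eo S Q) (eo T X) (?\<tau> X (transp (Hom C Q X) (\<lambda>h. f \<cdot> h) \<xi>))"
      using jt_nat[OF SQ _ _ \<xi>', of "ap T ?f"] okf by (simp add: eq)
    finally have "ap R (jt (eo S Q) (eo T Y) (?\<tau> Y \<xi>)) ** TR.unit Y ** ?f
      = ap R (jt (eo S Q) (eo T X) (?\<tau> X (transp (Hom C Q X) (\<lambda>h. f \<cdot> h) \<xi>))) ** TR.unit X" .
    moreover have "ap R (jt (eo S Q) (eo T Y) (?\<tau> Y \<xi>)) ** TR.unit Y ** ?f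
      = (ap R (jt (eo S Q) (eo T Y) (?\<tau> Y \<xi>)) ** TR.unit Y) ** ?f"
      using okf X Y Q \<xi>' SQ by simp
    ultimately have "(Y, \<alpha> Y \<xi>, eo R (Fo N (eo S Q))) ** ?f
      = (X, \<alpha> X (transp (Hom C Q X) (\<lambda>h. f \<cdot> h) \<xi>), eo R (Fo N (eo S Q)))"
      by (simp add: \<alpha>_typed)
    from arg_cong[OF this, of raw]
    show "\<alpha> Y \<xi> \<cdot> f = \<alpha> X (transp (Hom C Q X) (\<lambda>h. f \<cdot> h) \<xi>)" by simp
  qed
  from jt_factor[OF Q _ this] Q obtain h where h: "ok h" "src h = Fo N Q" "tgt h = eo R (Fo N (eo S Q))"
    "\<forall>X\<in>Obj C. \<forall>\<xi>\<in>fnl C Q X. h ** jt Q X \<xi> = (X, \<alpha> X \<xi>, eo R (Fo N (eo S Q)))"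
    by auto
  have "is_twist Q (TR.counit (Fo N (eo S Q)) ** ap T h)"
    unfolding is_twist_def
  proof (intro conjI ballI)
    fix X \<xi> assume X: "X \<in> Obj C" and \<xi>: "\<xi> \<in> fnl C Q X"
    have \<xi>': "?\<tau> X \<xi> \<in> fnl C (eo S Q) (eo T X)" by (rule ttw_dual[OF Q X \<xi>])
    have "(TR.counit (Fo N (eo S Q)) ** ap T h) ** ap T (jt Q X \<xi>)
      = TR.counit (Fo N (eo S Q)) ** ap T (h ** jt Q X \<xi>)"
      using h(1-3) Q X \<xi> by (simp add: LT.R.ap_tcomp)
    also have "\<dots> = jt (eo S Q) (eo T X) (?\<tau> X \<xi>)"
      using h(4) X \<xi> TR.transpose_forth[of "jt (eo S Q) (eo T X) (?\<tau> X \<xi>)" X] Q \<xi>' by (simp add: \<alpha>_typed)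
    finally show "(TR.counit (Fo N (eo S Q)) ** ap T h) ** ap T (jt Q X \<xi>) = jt (eo S Q) (eo T X) (?\<tau> X \<xi>)" .
  qed (use h Q in simp_all)
  then show ?thesis by blast
qed

lemma twist_unique:
  assumes "is_twist Q p" "is_twist Q q" "Q \<in> Obj C"
  shows "p = q"
  by (rule joint_epi_ext[OF T_jt_joint_epi[OF assms(3)]]) (use assms in \<open>auto simp: is_twist_def\<close>)

text \<open>
  The inverse comes from the universal property of \<open>N(S Q)\<close> and transposition \<open>Hom(Q, L Y) \<cong> Hom(S Q, Y)\<close>. Both
  composites are identities because they fix jointly epimorphic families.
\<close>

lemma twist_inverse:
  assumes Q: "Q \<in> Obj C" and p: "is_twist Q p"
  shows "\<exists>q. ok q \<and> src q = tgt p \<and> tgt q = src p \<and> p ** q = tid (tgt p) \<and> q ** p = tid (src p)"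
proof -
  let ?\<tau> = "\<lambda>X. transp (Hom C (eo S Q) (eo T X)) (ttw Q X)"
  let ?\<sigma> = "\<lambda>Y. transp (Hom C Q (eo L Y)) (stw Y)"
  have SQ: "eo S Q \<in> Obj C" using Q by simp
  have p': "ok p" "src p = eo T (Fo N Q)" "tgt p = Fo N (eo S Q)"
    "\<And>X \<xi>. X \<in> Obj C \<Longrightarrow> \<xi> \<in> fnl C Q X \<Longrightarrow> p ** ap T (jt Q X \<xi>) = jt (eo S Q) (eo T X) (?\<tau> X \<xi>)"
    using p by (simp_all add: is_twist_def)
  define \<beta> where "\<beta> Y \<zeta> = ea T (j Q (eo L Y) (?\<sigma> Y \<zeta>)) \<cdot> c Y" for Y \<zeta>
  have \<beta>_typed: "(Y, \<beta> Y \<zeta>, eo T (Fo N Q)) = ap T (jt Q (eo L Y) (?\<sigma> Y \<zeta>)) ** LT.unit Y" for Y \<zeta>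
    by (simp add: \<beta>_def tcomp_def)
  have "nak_family C (eo S Q) (eo T (Fo N Q)) \<beta>"
    unfolding nak_family_def
  proof (intro conjI ballI)
    fix X assume X: "X \<in> Obj C"
    have t: "?\<sigma> X \<in> lin (hom_dual C (eo S Q) X) (hom_dual C Q (eo L X))"
      by (rule transp_lin[OF stw_lin[OF Q X]]) (use Q X hom_space in simp_all)
    show "\<beta> X \<in> lin (hom_dual C (eo S Q) X) (Hom C X (eo T (Fo N Q)))"
      unfolding \<beta>_def
      by (rule lin_comp[OF lin_comp[OF lin_comp[OF t j_lin] LT.R.ea_lin] comp_lin_left])
        (use Q X in \<open>simp_all add: LT.c_arr\<close>)
    fix Y f \<zeta> assume Y: "Y \<in> Obj C" and f: "f \<in> arr C X Y" and \<zeta>: "\<zeta> \<in> fnl C (eo S Q) Y"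
    let ?f = "(X, f, Y)"
    have okf: "ok ?f" using X Y f by (simp add: ok_typed)
    have \<zeta>': "?\<sigma> Y \<zeta> \<in> fnl C Q (eo L Y)" by (rule stw_dual[OF Q Y \<zeta>])
    have key: "stw Y (ea L f \<cdot> g) = f \<cdot> stw X g" if g: "g \<in> arr C Q (eo L X)" for g
    proof -
      let ?g = "(Q, g, eo L X)"
      have okg: "ok ?g" using g Q X by (simp add: ok_typed)
      have "SL.counit Y ** ap S (ap L ?f ** ?g) = ?f ** (SL.counit X ** ap S ?g)"
        using okf okg X Y Q by (simp add: SL.L.ap_tcomp SL.counit_nat')
      from arg_cong[OF this, of raw] show ?thesis by (simp add: stw_def)
    qed
    have eq: "transp (Hom C Q (eo L X)) (\<lambda>h. ea L f \<cdot> h) (?\<sigma> Y \<zeta>)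
      = ?\<sigma> X (transp (Hom C (eo S Q) X) (\<lambda>h. f \<cdot> h) \<zeta>)"
      using transp_transp[OF comp_lin_right[of Q "eo L X" "eo L Y" "ea L f"], of "stw Y" \<zeta>]
        transp_transp[OF stw_lin[OF Q X], of "\<lambda>h. f \<cdot> h" \<zeta>]
        linD(1)[OF LT.L.ea_lin[OF X Y] f] Q X Y
      by (simp add: key cong: transp_cong)
    have "(ap T (jt Q (eo L Y) (?\<sigma> Y \<zeta>)) ** LT.unit Y) ** ?f
      = ap T (jt Q (eo L Y) (?\<sigma> Y \<zeta>) ** ap L ?f) ** LT.unit X"
      using okf X Y Q \<zeta>' by (simp add: LT.unit_nat LT.R.ap_tcomp)
    also have "jt Q (eo L Y) (?\<sigma> Y \<zeta>) ** ap L ?f = jt Q (eo L X) (?\<sigma> X (transp (Hom C (eo S Q) X) (\<lambda>h. f \<cdot> h) \<zeta>))"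
      using jt_nat[OF Q _ _ \<zeta>', of "ap L ?f"] okf by (simp add: eq)
    finally have "(Y, \<beta> Y \<zeta>, eo T (Fo N Q)) ** ?f
      = (X, \<beta> X (transp (Hom C (eo S Q) X) (\<lambda>h. f \<cdot> h) \<zeta>), eo T (Fo N Q))"
      by (simp only: \<beta>_typed)
    from arg_cong[OF this, of raw]
    show "\<beta> Y \<zeta> \<cdot> f = \<beta> X (transp (Hom C (eo S Q) X) (\<lambda>h. f \<cdot> h) \<zeta>)" by simp
  qed
  from jt_factor[OF SQ _ this] Q obtain q where q: "ok q" "src q = Fo N (eo S Q)" "tgt q = eo T (Fo N Q)"
    "\<And>Y \<zeta>. Y \<in> Obj C \<Longrightarrow> \<zeta> \<in> fnl C (eo S Q) Y \<Longrightarrow>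
      q ** jt (eo S Q) Y \<zeta> = ap T (jt Q (eo L Y) (?\<sigma> Y \<zeta>)) ** LT.unit Y"
    by (auto simp: \<beta>_typed)
  have "p ** q = tid (Fo N (eo S Q))"
  proof (rule joint_epi_ext[OF jt_joint_epi[OF SQ]])
    fix f assume "f \<in> {jt (eo S Q) X \<xi> |X \<xi>. X \<in> Obj C \<and> \<xi> \<in> fnl C (eo S Q) X}"
    then obtain Y \<zeta> where f: "f = jt (eo S Q) Y \<zeta>" and Y: "Y \<in> Obj C" and \<zeta>: "\<zeta> \<in> fnl C (eo S Q) Y"
      by blast
    have LY: "eo L Y \<in> Obj C" using Y by simp
    note s = stw_dual[OF Q Y \<zeta>]
    note st = ttw_dual[OF Q LY s]
    have key: "stw Y (ttw Q (eo L Y) (c Y \<cdot> g)) = g" if g: "g \<in> arr C (eo S Q) Y" for g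
    proof -
      let ?g = "(eo S Q, g, Y)"
      have okg: "ok ?g" using g Q Y by (simp add: ok_typed)
      have "SL.counit Y ** ap S (LT.counit (eo L Y) ** (ap L (LT.unit Y ** ?g) ** SL.unit Q))
        = SL.counit Y ** ap S ((LT.counit (eo L Y) ** ap L (LT.unit Y)) ** (ap L ?g ** SL.unit Q))"
        using okg Y Q by (simp add: LT.L.ap_tcomp)
      also have "\<dots> = ?g"
        using okg Y Q SL.transpose_forth[OF okg _ Q] by (simp add: LT.zigzag_L)
      finally have "SL.counit Y ** ap S (LT.counit (eo L Y) ** (ap L (LT.unit Y ** ?g) ** SL.unit Q)) = ?g" .
      from arg_cong[OF this, of raw] show ?thesis by (simp add: stw_def ttw_def)
    qed
    have "(p ** q) ** f = p ** (ap T (jt Q (eo L Y) (?\<sigma> Y \<zeta>)) ** LT.unit Y)"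
      using f p' q Y \<zeta> SQ by simp
    also have "\<dots> = jt (eo S Q) (eo T (eo L Y)) (?\<tau> (eo L Y) (?\<sigma> Y \<zeta>)) ** LT.unit Y"
      by (rule precomp[OF p'(4)[OF LY s]]) (use p' Y s Q in simp_all)
    also have "\<dots> = jt (eo S Q) Y (transp (Hom C (eo S Q) Y) (\<lambda>h. c Y \<cdot> h) (?\<tau> (eo L Y) (?\<sigma> Y \<zeta>)))"
      using jt_nat[OF SQ _ _ st, of "LT.unit Y"] Y by simp
    also have "transp (Hom C (eo S Q) Y) (\<lambda>h. c Y \<cdot> h) (?\<tau> (eo L Y) (?\<sigma> Y \<zeta>)) = \<zeta>"
    proof -
      have l: "(\<lambda>h. c Y \<cdot> h) \<in> lin (Hom C (eo S Q) Y) (Hom C (eo S Q) (eo T (eo L Y)))"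
        by (rule comp_lin_right) (use Y Q LT.c_arr in simp_all)
      show ?thesis
        unfolding transp_transp[OF ttw_lin[OF Q LY]] transp_transp[OF l]
        by (rule transp_ident[OF \<zeta>]) (rule key)
    qed
    finally show "(p ** q) ** f = tid (Fo N (eo S Q)) ** f" using f Y \<zeta> Q by simp
  qed (use p' q Q in simp_all)
  moreover have "q ** p = tid (eo T (Fo N Q))"
  proof (rule joint_epi_ext[OF T_jt_joint_epi[OF Q]])
    fix f assume "f \<in> ap T ` {jt Q X \<xi> |X \<xi>. X \<in> Obj C \<and> \<xi> \<in> fnl C Q X}"
    then obtain X \<xi> where f: "f = ap T (jt Q X \<xi>)" and X: "X \<in> Obj C" and \<xi>: "\<xi> \<in> fnl C Q X"
      by blast
    have TX: "eo T X \<in> Obj C" using X by simp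
    note t = ttw_dual[OF Q X \<xi>]
    note ts = stw_dual[OF Q TX t]
    have key: "ttw Q X (stw (eo T X) g) = e X \<cdot> g" if g: "g \<in> arr C Q (eo L (eo T X))" for g
    proof -
      let ?g = "(Q, g, eo L (eo T X))"
      have okg: "ok ?g" using g Q X by (simp add: ok_typed)
      have "LT.counit X ** (ap L (SL.counit (eo T X) ** ap S ?g) ** SL.unit Q) = LT.counit X ** ?g"
        using okg X Q SL.transpose_back[of ?g "eo T X"] by simp
      from arg_cong[OF this, of raw] show ?thesis by (simp add: stw_def ttw_def)
    qed
    have eq: "?\<sigma> (eo T X) (?\<tau> X \<xi>) = transp (Hom C Q (eo L (eo T X))) (\<lambda>h. e X \<cdot> h) \<xi>"
      unfolding transp_transp[OF stw_lin[OF Q TX]] by (rule transp_cong) (rule key)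
    have "(q ** p) ** f = q ** jt (eo S Q) (eo T X) (?\<tau> X \<xi>)"
      using f p' q X \<xi> Q by simp
    also have "\<dots> = ap T (jt Q (eo L (eo T X)) (?\<sigma> (eo T X) (?\<tau> X \<xi>))) ** LT.unit (eo T X)"
      by (rule q(4)[OF TX t])
    also have "jt Q (eo L (eo T X)) (?\<sigma> (eo T X) (?\<tau> X \<xi>)) = jt Q X \<xi> ** LT.counit X"
      using jt_nat[OF Q _ _ \<xi>, of "LT.counit X"] X by (simp add: eq)
    also have "ap T (jt Q X \<xi> ** LT.counit X) ** LT.unit (eo T X) = ap T (jt Q X \<xi>)"
      using X Q \<xi> by (simp add: LT.R.ap_tcomp LT.zigzag_R)
    finally show "(q ** p) ** f = tid (eo T (Fo N Q)) ** f" using f X \<xi> Q by simp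
  qed (use p' q Q in simp_all)
  ultimately show ?thesis using p' q(1-3) by (intro exI[of _ q]) simp
qed

end

section \<open>Commuting monads and their bimodules\<close>

definition commute_endo :: "('o, 'm, 'k, 'z) lcat_scheme \<Rightarrow> ('o, 'm) endo \<Rightarrow> ('o, 'm) endo \<Rightarrow> bool" where
  "commute_endo C F G \<longleftrightarrow> (\<forall>X\<in>Obj C. eo G (eo F X) = eo F (eo G X)) \<and>
     (\<forall>X\<in>Obj C. \<forall>Y\<in>Obj C. \<forall>f\<in>arr C X Y. ea G (ea F f) = ea F (ea G f))"

text \<open>
  \<open>A\<close> acts from the left and \<open>B\<close> from the right. Strictness of the module category makes the actions commute on the
  nose, and makes the structure maps of one action invariant under the other.
\<close>

locale commuting_monads = lin_category C
    + A: adjoint_monad C T L S R c e c1 e1 c2 e2 m u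
    + B: adjoint_monad C T' L' S' R' c' e' c1' e1' c2' e2' m' u'
  for C :: "('o, 'm, 'k::field, 'z) lcat_scheme" (structure)
    and T L S R :: "('o, 'm) endo" and c e c1 e1 c2 e2 m u :: "'o \<Rightarrow> 'm"
    and T' L' S' R' :: "('o, 'm) endo" and c' e' c1' e1' c2' e2' m' u' :: "'o \<Rightarrow> 'm" +
  assumes commute: "F \<in> {T, L, S} \<Longrightarrow> G \<in> {T', L', S'} \<Longrightarrow> commute_endo C F G"
    and A_strict: "G \<in> {T', L'} \<Longrightarrow> X \<in> Obj C \<Longrightarrow> ea G (c X) = c (eo G X) \<and> ea G (e X) = e (eo G X) \<and>
       ea G (c1 X) = c1 (eo G X) \<and> ea G (m X) = m (eo G X) \<and> ea G (u X) = u (eo G X)"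
    and B_strict: "F \<in> {T, L} \<Longrightarrow> X \<in> Obj C \<Longrightarrow>
       ea F (c' X) = c' (eo F X) \<and> ea F (m' X) = m' (eo F X) \<and> ea F (u' X) = u' (eo F X)"
begin

lemma swap_obj [simp]:
  "X \<in> Obj C \<Longrightarrow> eo T' (eo T X) = eo T (eo T' X)" "X \<in> Obj C \<Longrightarrow> eo T' (eo L X) = eo L (eo T' X)"
  "X \<in> Obj C \<Longrightarrow> eo T' (eo S X) = eo S (eo T' X)" "X \<in> Obj C \<Longrightarrow> eo L' (eo T X) = eo T (eo L' X)"
  "X \<in> Obj C \<Longrightarrow> eo L' (eo L X) = eo L (eo L' X)" "X \<in> Obj C \<Longrightarrow> eo L' (eo S X) = eo S (eo L' X)"
  "X \<in> Obj C \<Longrightarrow> eo S' (eo T X) = eo T (eo S' X)" "X \<in> Obj C \<Longrightarrow> eo S' (eo L X) = eo L (eo S' X)"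
  using commute[of T T'] commute[of L T'] commute[of S T'] commute[of T L'] commute[of L L'] commute[of S L']
    commute[of T S'] commute[of L S']
  by (simp_all add: commute_endo_def)

lemma swap_arr:
  "ok f \<Longrightarrow> ap T' (ap T f) = ap T (ap T' f)" "ok f \<Longrightarrow> ap T' (ap L f) = ap L (ap T' f)"
  "ok f \<Longrightarrow> ap L' (ap L f) = ap L (ap L' f)" "ok f \<Longrightarrow> ap L' (ap S f) = ap S (ap L' f)"
  using commute[of T T'] commute[of L T'] commute[of L L'] commute[of S L']
  by (auto simp add: commute_endo_def ap_def ok_def)

lemma A_unit_swap: "X \<in> Obj C \<Longrightarrow> ap T' (A.LT.unit X) = A.LT.unit (eo T' X)"
    "X \<in> Obj C \<Longrightarrow> ap T' (A.LT.counit X) = A.LT.counit (eo T' X)"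
    "X \<in> Obj C \<Longrightarrow> ap T' (A.mu X) = A.mu (eo T' X)" "X \<in> Obj C \<Longrightarrow> ap T' (A.eta X) = A.eta (eo T' X)"
    "X \<in> Obj C \<Longrightarrow> ap L' (A.SL.unit X) = A.SL.unit (eo L' X)"
  using A_strict[of T'] A_strict[of L']
  by (simp_all add: A.LT.unit_def A.LT.counit_def A.SL.unit_def A.mu_def A.eta_def ap_def)

lemma B_unit_swap: "X \<in> Obj C \<Longrightarrow> ap L (B.LT.unit X) = B.LT.unit (eo L X)"
    "X \<in> Obj C \<Longrightarrow> ap T (B.mu X) = B.mu (eo T X)" "X \<in> Obj C \<Longrightarrow> ap T (B.eta X) = B.eta (eo T X)"
  using B_strict[of T] B_strict[of L]
  by (simp_all add: B.LT.unit_def B.mu_def B.eta_def ap_def)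

definition bimod :: "('o, 'm) tarr \<Rightarrow> ('o, 'm) tarr \<Rightarrow> bool" where
  "bimod r s \<longleftrightarrow> A.is_mod r \<and> B.is_mod s \<and> tgt s = tgt r \<and> s ** ap T' r = r ** ap T s"

definition bilin :: "('o, 'm) tarr \<Rightarrow> ('o, 'm) tarr \<Rightarrow> ('o, 'm) tarr \<Rightarrow> ('o, 'm) tarr \<Rightarrow> ('o, 'm) tarr \<Rightarrow> bool" where
  "bilin r s r' s' f \<longleftrightarrow> ok f \<and> src f = tgt r \<and> tgt f = tgt r' \<and> f ** r = r' ** ap T f \<and> f ** s = s' ** ap T' f"

lemma bimodD:
  assumes "bimod r s"
  shows "A.is_mod r" "B.is_mod s" "tgt s = tgt r" "s ** ap T' r = r ** ap T s"
    "ok r" "ok s" "src r = eo T (tgt r)" "src s = eo T' (tgt r)" "tgt r \<in> Obj C"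
  using assms A.is_modD[of r] B.is_modD[of s] by (simp_all add: bimod_def)

lemma bilinD:
  assumes "bilin r s r' s' f"
  shows "ok f" "src f = tgt r" "tgt f = tgt r'" "f ** r = r' ** ap T f" "f ** s = s' ** ap T' f"
  using assms by (simp_all add: bilin_def)

lemma bilin_comp:
  assumes f: "bilin r s r' s' f" and g: "bilin r' s' r'' s'' g" and r: "bimod r s" "bimod r' s'" "bimod r'' s''"
  shows "bilin r s r'' s'' (g ** f)"
proof -
  note f' = bilinD[OF f] and g' = bilinD[OF g]
  note b = bimodD(5-9)[OF r(1)] bimodD(5-9)[OF r(2)] bimodD(5-9)[OF r(3)]
    bimodD(3)[OF r(1)] bimodD(3)[OF r(2)] bimodD(3)[OF r(3)]
  have "(g ** f) ** r = g ** (r' ** ap T f)" using f' g' b by simp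
  also have "\<dots> = r'' ** (ap T g ** ap T f)" by (rule precomp2[OF g'(4)]) (use f' g' b in simp_all)
  finally have 1: "(g ** f) ** r = r'' ** ap T (g ** f)" using f' g' b by (simp add: A.LT.R.ap_tcomp)
  have "(g ** f) ** s = g ** (s' ** ap T' f)" using f' g' b by simp
  also have "\<dots> = s'' ** (ap T' g ** ap T' f)" by (rule precomp2[OF g'(5)]) (use f' g' b in simp_all)
  finally have 2: "(g ** f) ** s = s'' ** ap T' (g ** f)" using f' g' b by (simp add: B.LT.R.ap_tcomp)
  show ?thesis using 1 2 f' g' by (simp add: bilin_def)
qed

text \<open>
  Actions for which a jointly epimorphic family out of bimodules is bilinear are bimodule actions,
  because \<open>T\<close> and \<open>T'\<close> are left adjoints and preserve such families.
\<close>

lemma bimod_of_joint_epi: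
  assumes epi: "joint_epi (f ` I) P"
    and b: "\<And>i. i \<in> I \<Longrightarrow> bimod (r i) (s i)" "\<And>i. i \<in> I \<Longrightarrow> src (f i) = tgt (r i)"
    and a: "ok a" "src a = eo T P" "tgt a = P" "ok a'" "src a' = eo T' P" "tgt a' = P"
    and l: "\<And>i. i \<in> I \<Longrightarrow> a ** ap T (f i) = f i ** r i" "\<And>i. i \<in> I \<Longrightarrow> a' ** ap T' (f i) = f i ** s i"
  shows "bimod a a'"
proof -
  note ej = joint_epiD[OF epi]
  have P: "P \<in> Obj C" by (rule ej(1))
  have f: "ok (f i)" "tgt (f i) = P" if "i \<in> I" for i using ej(2,3) that by auto
  note eTT2 = B.TR.joint_epi_left_adjoint[OF A.TR.joint_epi_left_adjoint[OF epi]]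
  have "A.is_mod a"
    by (rule A.is_mod_of_joint_epi[OF epi, of r]) (use a l bimodD(1)[OF b(1)] b(2) in simp_all)
  moreover have "B.is_mod a'"
    by (rule B.is_mod_of_joint_epi[OF epi, of s]) (use a l bimodD(2,3)[OF b(1)] b(2) in simp_all)
  moreover have "a' ** ap T' a = a ** ap T a'"
  proof (rule joint_epi_ext[OF eTT2])
    fix g assume "g \<in> ap T' ` ap T ` f ` I"
    then obtain i where i: "i \<in> I" "g = ap T' (ap T (f i))" by blast
    note bb = bimodD[OF b(1)[OF i(1)]] and ff = f[OF i(1)] b(2)[OF i(1)]
    have "(a' ** ap T' a) ** g = a' ** (ap T' a ** ap T' (ap T (f i)))"
      using a P ff i by simp
    also have "\<dots> = a' ** (ap T' (f i) ** ap T' (r i))"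
      by (subst B.LT.R.ap_square[OF l(1)[OF i(1)]]) (use a bb ff in simp_all)
    also have "\<dots> = f i ** (s i ** ap T' (r i))"
      by (rule precomp2[OF l(2)[OF i(1)]]) (use a bb ff in simp_all)
    also have "\<dots> = f i ** (r i ** ap T (s i))"
      using bb(4) by simp
    also have "\<dots> = a ** (ap T (f i) ** ap T (s i))"
      by (rule precomp2[OF l(1)[OF i(1)], symmetric]) (use a bb ff in simp_all)
    also have "\<dots> = a ** (ap T a' ** ap T (ap T' (f i)))"
      by (subst A.LT.R.ap_square[OF l(2)[OF i(1)]]) (use a bb ff in simp_all)
    finally show "(a' ** ap T' a) ** g = (a ** ap T a') ** g" using a ff i P by (simp add: swap_arr)
  qed (use a P in simp_all)
  ultimately show ?thesis
    using a by (simp add: bimod_def)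
qed

lemma bilin_of_joint_epi:
  assumes epi: "joint_epi (f ` I) P"
    and b: "\<And>i. i \<in> I \<Longrightarrow> bimod (r i) (s i)" "\<And>i. i \<in> I \<Longrightarrow> src (f i) = tgt (r i)"
    and a: "ok a" "src a = eo T P" "tgt a = P" "ok a'" "src a' = eo T' P" "tgt a' = P"
    and l: "\<And>i. i \<in> I \<Longrightarrow> a ** ap T (f i) = f i ** r i" "\<And>i. i \<in> I \<Longrightarrow> a' ** ap T' (f i) = f i ** s i"
    and h: "ok h" "src h = P" "tgt h = tgt r'" and b': "bimod r' s'"
    and hf: "\<And>i. i \<in> I \<Longrightarrow> bilin (r i) (s i) r' s' (h ** f i)"
  shows "bilin a a' r' s' h"
proof -
  note bb' = bimodD[OF b']
  have "h ** a = r' ** ap T h"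
    by (rule A.linear_of_joint_epi[OF epi _ _ a(1-3) l(1) h])
      (use bimodD(1)[OF b(1)] b(2) bb'(1) bilinD(4)[OF hf] in simp_all)
  moreover have "h ** a' = s' ** ap T' h"
    by (rule B.linear_of_joint_epi[OF epi _ _ a(4-6) l(2) h(1,2)])
      (use bimodD(2,3)[OF b(1)] b(2) bb'(2,3) h(3) bilinD(5)[OF hf] in simp_all)
  ultimately show ?thesis using h a by (simp add: bilin_def)
qed

text \<open>The free bimodule \<open>T T' Y\<close>, with the unit \<open>free_unit\<close> and the counit \<open>act2\<close> of the adjunction.\<close>

abbreviation "free_l Y \<equiv> A.mu (eo T' Y)"
abbreviation "free_r Y \<equiv> B.mu (eo T Y)"

definition free_unit :: "'o \<Rightarrow> ('o, 'm) tarr" where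
  "free_unit Y = ap T (B.eta Y) ** A.eta Y"

definition act2 :: "('o, 'm) tarr \<Rightarrow> ('o, 'm) tarr \<Rightarrow> ('o, 'm) tarr" where
  "act2 r s = r ** ap T s"

lemma free_unit_simps [simp]: "src (free_unit Y) = Y" "tgt (free_unit Y) = eo T (eo T' Y)"
    "Y \<in> Obj C \<Longrightarrow> ok (free_unit Y)"
  by (simp_all add: free_unit_def)

lemma act2_simps:
  assumes "bimod r s"
  shows "src (act2 r s) = eo T (eo T' (tgt r))" "tgt (act2 r s) = tgt r" "ok (act2 r s)"
  using bimodD[OF assms] by (simp_all add: act2_def)

lemma bimod_free:
  assumes Y: "Y \<in> Obj C"
  shows "bimod (free_l Y) (free_r Y)"
proof -
  have "B.mu (eo T Y) ** ap T' (A.mu (eo T' Y)) = A.mu (eo T' Y) ** ap T (B.mu (eo T Y))"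
    using Y A.mu_nat[of "B.mu Y"] by (simp add: A_unit_swap B_unit_swap[symmetric])
  then show ?thesis
    using Y B.mu_eta(1)[of "eo T Y"] by (simp add: bimod_def A.is_mod_def A.is_act_def B.is_mod_def B.is_act_def
      A.mu_assoc B.mu_assoc A.mu_eta B.mu_eta)
qed

lemma bilin_free:
  assumes h: "ok h"
  shows "bilin (free_l (src h)) (free_r (src h)) (free_l (tgt h)) (free_r (tgt h)) (ap T (ap T' h))"
proof -
  note o = okD[OF h]
  have "ap T (ap T' h) ** B.mu (eo T (src h)) = B.mu (eo T (tgt h)) ** ap T' (ap T (ap T' h))"
    using h o B.mu_nat[of "ap T h"] by (simp add: swap_arr)
  then show ?thesis using h o by (simp add: bilin_def A.mu_nat)
qed

lemma bilin_act2:
  assumes b: "bimod r s"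
  shows "bilin (free_l (tgt r)) (free_r (tgt r)) r s (act2 r s)"
proof -
  note bb = bimodD[OF b] note mA = A.is_modD[OF bb(1)] and mB = B.is_modD[OF bb(2)]
  have "act2 r s ** A.mu (eo T' (tgt r)) = r ** (A.mu (tgt r) ** ap T (ap T s))"
    using bb A.mu_nat[of s] by (simp add: act2_def)
  also have "\<dots> = r ** ap T (act2 r s)"
    using bb by (simp add: act2_def A.mod_assoc' A.LT.R.ap_tcomp)
  finally have 1: "act2 r s ** A.mu (eo T' (tgt r)) = r ** ap T (act2 r s)" .
  have "act2 r s ** B.mu (eo T (tgt r)) = r ** ap T (s ** B.mu (tgt r))"
    using bb by (simp add: act2_def B_unit_swap[symmetric] A.LT.R.ap_tcomp)
  also have "\<dots> = r ** (ap T s ** ap T (ap T' s))"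
    using bb mB by (simp add: A.LT.R.ap_tcomp)
  also have "\<dots> = s ** (ap T' r ** ap T (ap T' s))"
    by (rule precomp2[OF bb(4), symmetric]) (use bb in simp_all)
  also have "\<dots> = s ** ap T' (act2 r s)"
    using bb by (simp add: act2_def B.LT.R.ap_tcomp swap_arr)
  finally have 2: "act2 r s ** B.mu (eo T (tgt r)) = s ** ap T' (act2 r s)" .
  show ?thesis using 1 2 bb by (simp add: bilin_def act2_simps[OF b])
qed

lemma act2_free_unit:
  assumes b: "bimod r s"
  shows "act2 r s ** free_unit (tgt r) = tid (tgt r)"
proof -
  note bb = bimodD[OF b] note mA = A.is_modD[OF bb(1)] and mB = B.is_modD[OF bb(2)]
  have "act2 r s ** free_unit (tgt r) = r ** (ap T (s ** B.eta (tgt r)) ** A.eta (tgt r))"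
    using bb by (simp add: act2_def free_unit_def A.LT.R.ap_tcomp)
  then show ?thesis using bb mA mB by (simp add: A.LT.R.ap_tid)
qed

lemma act2_free:
  assumes Y: "Y \<in> Obj C"
  shows "act2 (free_l Y) (free_r Y) ** ap T (ap T' (free_unit Y)) = tid (eo T (eo T' Y))"
proof -
  have "act2 (free_l Y) (free_r Y) ** ap T (ap T' (free_unit Y))
    = A.mu (eo T' Y) ** ap T (B.mu (eo T Y) ** ap T' (free_unit Y))"
    using Y by (simp add: act2_def A.LT.R.ap_tcomp)
  also have "B.mu (eo T Y) ** ap T' (free_unit Y) = A.eta (eo T' Y)"
  proof -
    have "ap T' (free_unit Y) = ap T' (B.eta (eo T Y)) ** A.eta (eo T' Y)"
      using Y by (simp add: free_unit_def B_unit_swap B.LT.R.ap_tcomp A_unit_swap)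
    then show ?thesis
      using Y precomp[OF B.mu_eta(2)[of "eo T Y"], of "A.eta (eo T' Y)"] by simp
  qed
  also have "A.mu (eo T' Y) ** ap T (A.eta (eo T' Y)) = tid (eo T (eo T' Y))"
    using Y by (simp add: A.mu_eta)
  finally show ?thesis .
qed

section \<open>The universal property of the relative tensor product\<close>

text \<open>
  \<open>q : L' L U \<rightarrow> Q\<close> exhibits \<open>Q\<close> as the tensor product of \<open>L\<close>, the bimodule \<open>U\<close> and \<open>L'\<close> over the
  two monads.
\<close>

definition is_tensor :: "('o, 'm) tarr \<Rightarrow> ('o, 'm) tarr \<Rightarrow> ('o, 'm) tarr \<Rightarrow> bool" where
  "is_tensor r s q \<longleftrightarrow> src q = eo L' (eo L (tgt r)) \<and>
     joint_coeq {(ap L' (A.ract (tgt r)), ap L' (ap L r)), (B.ract (eo L (tgt r)), ap L' (ap L s))} q"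

lemma is_tensorD:
  assumes "is_tensor r s q"
  shows "src q = eo L' (eo L (tgt r))" "ok q" "tgt q \<in> Obj C"
    "q ** ap L' (A.ract (tgt r)) = q ** ap L' (ap L r)"
    "q ** B.ract (eo L (tgt r)) = q ** ap L' (ap L s)"
proof -
  have s: "src q = eo L' (eo L (tgt r))"
    and q: "joint_coeq {(ap L' (A.ract (tgt r)), ap L' (ap L r)), (B.ract (eo L (tgt r)), ap L' (ap L s))} q"
    using assms by (simp_all only: is_tensor_def)
  note d = joint_coeqD[OF q]
  show "src q = eo L' (eo L (tgt r))" by (rule s)
  show "ok q" by (rule d(1))
  then show "tgt q \<in> Obj C" by (rule okD)
  show "q ** ap L' (A.ract (tgt r)) = q ** ap L' (ap L r)"
    using d(2)[of "ap L' (A.ract (tgt r))" "ap L' (ap L r)"] by blast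
  show "q ** B.ract (eo L (tgt r)) = q ** ap L' (ap L s)"
    using d(2)[of "B.ract (eo L (tgt r))" "ap L' (ap L s)"] by blast
qed

lemma is_tensor_factor:
  assumes q: "is_tensor r s q" and h: "ok h" "src h = eo L' (eo L (tgt r))"
    and 1: "h ** ap L' (A.ract (tgt r)) = h ** ap L' (ap L r)" and 2: "h ** B.ract (eo L (tgt r)) = h ** ap L' (ap L s)"
  shows "\<exists>k. ok k \<and> src k = tgt q \<and> tgt k = tgt h \<and> k ** q = h"
proof -
  have s: "src q = eo L' (eo L (tgt r))"
    and qq: "joint_coeq {(ap L' (A.ract (tgt r)), ap L' (ap L r)), (B.ract (eo L (tgt r)), ap L' (ap L s))} q"
    using q by (simp_all only: is_tensor_def)
  show ?thesis
  proof (rule joint_coeqD(3)[OF qq h(1)])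
    show "src h = src q" using h(2) s by simp
    fix f g assume "(f, g) \<in> {(ap L' (A.ract (tgt r)), ap L' (ap L r)), (B.ract (eo L (tgt r)), ap L' (ap L s))}"
    then show "h ** f = h ** g" using 1 2 by (elim insertE emptyE) simp_all
  qed
qed

lemma is_tensor_ext:
  assumes q: "is_tensor r s q"
    and "ok k" "ok l" "src k = tgt q" "src l = tgt q" "tgt k = tgt l" "k ** q = l ** q"
  shows "k = l"
proof -
  have qq: "joint_coeq {(ap L' (A.ract (tgt r)), ap L' (ap L r)), (B.ract (eo L (tgt r)), ap L' (ap L s))} q"
    using q by (simp only: is_tensor_def)
  show ?thesis by (rule joint_coeqD(4)[OF qq]) (use assms in simp_all)
qed

text \<open>
  Transposing \<open>f q : L' L U \<rightarrow> Y\<close> once gives \<open>half : L U \<rightarrow> T' Y\<close>, and a second time \<open>tau : U \<rightarrow> T T' Y\<close>. That \<open>f q\<close> is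
  balanced turns into bilinearity of \<open>tau\<close>.
\<close>

definition half :: "'o \<Rightarrow> ('o, 'm) tarr \<Rightarrow> ('o, 'm) tarr \<Rightarrow> ('o, 'm) tarr" where
  "half U q f = ap T' (f ** q) ** B.LT.unit (eo L U)"

definition tau :: "'o \<Rightarrow> ('o, 'm) tarr \<Rightarrow> ('o, 'm) tarr \<Rightarrow> ('o, 'm) tarr" where
  "tau U q f = ap T (half U q f) ** A.LT.unit U"

lemma half_simps [simp]: "src (half U q f) = eo L U" "tgt (half U q f) = eo T' (tgt f)"
  by (simp_all add: half_def)

lemma tau_simps [simp]: "src (tau U q f) = U" "tgt (tau U q f) = eo T (eo T' (tgt f))"
  by (simp_all add: tau_def)

lemma half_facts:
  assumes b: "bimod r s" and q: "is_tensor r s q" and f: "ok f" "src f = tgt q"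
  shows "ok (half (tgt r) q f)" "ok (tau (tgt r) q f)"
    "half (tgt r) q f ** ap L r = half (tgt r) q f ** A.ract (tgt r)"
    "half (tgt r) q f ** ap L s = B.mu (tgt f) ** ap T' (half (tgt r) q f)"
proof -
  note bb = bimodD[OF b] and qq = is_tensorD[OF q]
  let ?U = "tgt r"
  have o: "tgt f \<in> Obj C" using f by (simp add: okD)
  show h: "ok (half ?U q f)" using f qq bb by (simp add: half_def)
  show "ok (tau ?U q f)" using h bb by (simp add: tau_def)
  have "half ?U q f ** ap L r = ap T' ((f ** q) ** ap L' (ap L r)) ** B.LT.unit (eo L (eo T ?U))"
    using f qq bb B.LT.transpose_precomp[of "f ** q" "ap L r" "eo L ?U"] by (simp add: half_def)
  also have "(f ** q) ** ap L' (ap L r) = (f ** q) ** ap L' (A.ract ?U)"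
    using f qq bb by simp
  also have "ap T' ((f ** q) ** ap L' (A.ract ?U)) ** B.LT.unit (eo L (eo T ?U)) = half ?U q f ** A.ract ?U"
    using f qq(1-3) bb B.LT.transpose_precomp[of "f ** q" "A.ract ?U" "eo L ?U"] by (simp add: half_def)
  finally show "half ?U q f ** ap L r = half ?U q f ** A.ract ?U" .
  have "(f ** q) ** ap L' (ap L s) = (f ** q) ** B.ract (eo L ?U)"
    using f qq bb by simp
  then show "half ?U q f ** ap L s = B.mu (tgt f) ** ap T' (half ?U q f)"
    using B.balanced_iff_linear[of "ap L s" "f ** q"] f qq(1-3) bb by (simp add: half_def)
qed

lemma tau_bilin:
  assumes b: "bimod r s" and q: "is_tensor r s q" and f: "ok f" "src f = tgt q"
  shows "bilin r s (free_l (tgt f)) (free_r (tgt f)) (tau (tgt r) q f)"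
proof -
  note bb = bimodD[OF b] and hh = half_facts[OF b q f]
  let ?U = "tgt r" and ?Y = "tgt f"
  have o: "?Y \<in> Obj C" using f by (simp add: okD)
  have 1: "tau ?U q f ** r = A.mu (eo T' ?Y) ** ap T (tau ?U q f)"
    using A.balanced_iff_linear[of r "half ?U q f"] hh bb by (simp add: tau_def)
  have "tau ?U q f ** s = ap T (half ?U q f ** ap L s) ** A.LT.unit (eo T' ?U)"
    using A.LT.transpose_precomp[of "half ?U q f" s ?U] hh(1) bb by (simp add: tau_def)
  also have "\<dots> = B.mu (eo T ?Y) ** ap T' (tau ?U q f)"
    using hh(1,4) bb o
    by (simp add: A.LT.R.ap_tcomp B.LT.R.ap_tcomp tau_def B_unit_swap A_unit_swap swap_arr)
  finally show ?thesis using 1 hh(2) bb o by (simp add: bilin_def)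
qed

lemma tau_inj:
  assumes b: "bimod r s" and q: "is_tensor r s q" and f: "ok f" "src f = tgt q" and g: "ok g" "src g = tgt q"
    and eq: "tgt f = tgt g" "tau (tgt r) q f = tau (tgt r) q g"
  shows "f = g"
proof -
  note bb = bimodD[OF b] and qq = is_tensorD[OF q] and hf = half_facts[OF b q f] and hg = half_facts[OF b q g]
  have "ap T (half (tgt r) q f) ** A.LT.unit (tgt r) = ap T (half (tgt r) q g) ** A.LT.unit (tgt r)"
    using eq(2) by (simp only: tau_def)
  then have "half (tgt r) q f = half (tgt r) q g"
    by (rule A.LT.transpose_inj[rotated 6]) (simp_all add: hf(1) hg(1) bb(9) eq(1))
  then have "ap T' (f ** q) ** B.LT.unit (eo L (tgt r)) = ap T' (g ** q) ** B.LT.unit (eo L (tgt r))"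
    by (simp only: half_def)
  then have "f ** q = g ** q"
    by (rule B.LT.transpose_inj[rotated 6]) (simp_all add: f g qq(1-3) bb(9) eq(1))
  then show ?thesis by (rule is_tensor_ext[OF q f(1) g(1) f(2) g(2) eq(1)])
qed

text \<open>
  A bilinear map \<open>U \<rightarrow> T T' Y\<close> transposes to an arrow \<open>L' L U \<rightarrow> Y\<close>, which is balanced for both actions and thus
  factors through \<open>q\<close>.
\<close>

lemma tau_surj:
  assumes b: "bimod r s" and q: "is_tensor r s q" and Y: "Y \<in> Obj C"
    and g: "bilin r s (free_l Y) (free_r Y) g"
  shows "\<exists>f. ok f \<and> src f = tgt q \<and> tgt f = Y \<and> tau (tgt r) q f = g"
proof -
  note bb = bimodD[OF b] and qq = is_tensorD[OF q] and gg = bilinD[OF g]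
  let ?U = "tgt r"
  have tg: "tgt g = eo T (eo T' Y)" using gg(3) Y by simp
  define g1 where "g1 = A.LT.counit (eo T' Y) ** ap L g"
  have g1: "ok g1" "src g1 = eo L ?U" "tgt g1 = eo T' Y"
    using gg(1,2) tg Y by (simp_all add: g1_def)
  have t1: "ap T g1 ** A.LT.unit ?U = g"
    using A.LT.transpose_back[of g "eo T' Y"] gg(1,2) tg Y by (simp add: g1_def)
  have bal1: "g1 ** ap L r = g1 ** A.ract ?U"
    using A.balanced_iff_linear[of r g1] g1 t1 gg(4) bb by simp
  have "g1 ** ap L s = A.LT.counit (eo T' Y) ** ap L (g ** s)"
    using gg(1,2) tg Y bb by (simp add: g1_def A.LT.L.ap_tcomp)
  also have "\<dots> = A.LT.counit (eo T' Y) ** (ap L (ap T (B.mu Y)) ** ap L (ap T' g))"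
    using gg(1,2,5) tg Y by (simp add: B_unit_swap[symmetric] A.LT.L.ap_tcomp)
  also have "\<dots> = B.mu Y ** (A.LT.counit (eo T' (eo T' Y)) ** ap L (ap T' g))"
    using gg(1,2) tg Y by (simp add: A.LT.counit_nat')
  also have "\<dots> = B.mu Y ** ap T' g1"
    using gg(1,2) tg Y by (simp add: g1_def B.LT.R.ap_tcomp A_unit_swap swap_arr)
  finally have lin1: "g1 ** ap L s = B.mu Y ** ap T' g1" .
  define g2 where "g2 = B.LT.counit Y ** ap L' g1"
  have g2: "ok g2" "src g2 = eo L' (eo L ?U)" "tgt g2 = Y"
    using g1 Y by (simp_all add: g2_def)
  have t2: "ap T' g2 ** B.LT.unit (eo L ?U) = g1"
    using B.LT.transpose_back[of g1 Y] g1 Y by (simp add: g2_def)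
  have bal2: "g2 ** B.ract (eo L ?U) = g2 ** ap L' (ap L s)"
    using B.balanced_iff_linear[of "ap L s" g2] g2 t2 lin1 bb by simp
  have "g2 ** ap L' (A.ract ?U) = B.LT.counit Y ** ap L' (g1 ** A.ract ?U)"
    using g1 Y bb by (simp add: g2_def B.LT.L.ap_tcomp)
  also have "\<dots> = B.LT.counit Y ** ap L' (g1 ** ap L r)" by (simp only: bal1)
  also have "\<dots> = g2 ** ap L' (ap L r)"
    using g1 Y bb by (simp add: g2_def B.LT.L.ap_tcomp)
  finally have "g2 ** ap L' (A.ract ?U) = g2 ** ap L' (ap L r)" .
  from is_tensor_factor[OF q g2(1,2) this bal2] obtain f where
    f: "ok f" "src f = tgt q" "tgt f = Y" "f ** q = g2" using g2 by auto
  have "tau ?U q f = g" using f t1 t2 by (simp add: tau_def half_def)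
  then show ?thesis using f by blast
qed

lemma tau_nat:
  assumes b: "bimod r s" and q: "is_tensor r s q" and f: "ok f" "src f = tgt q" and h: "ok h" "src h = tgt f"
  shows "tau (tgt r) q (h ** f) = ap T (ap T' h) ** tau (tgt r) q f"
  using bimodD[OF b] is_tensorD(1-3)[OF q] f h half_facts(1)[OF b q f]
  by (simp add: tau_def half_def B.LT.R.ap_tcomp A.LT.R.ap_tcomp)

text \<open>
  The natural map \<open>Hom(Q, X) \<rightarrow> Hom(U, X)\<close> to bilinear maps: transpose, then act on the bimodule \<open>X\<close>.
  Functionals on bilinear maps are pulled back along it.
\<close>

definition tt :: "('o, 'm) tarr \<Rightarrow> ('o, 'm) tarr \<Rightarrow> 'o \<Rightarrow> ('o, 'm) tarr \<Rightarrow> ('o, 'm) tarr \<Rightarrow> ('o, 'm) tarr" where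
  "tt r' s' U q f = act2 r' s' ** tau U q f"

lemma tt_bilin:
  assumes b: "bimod r s" and q: "is_tensor r s q" and f: "ok f" "src f = tgt q" and b': "bimod r' s'" "tgt f = tgt r'"
  shows "bilin r s r' s' (tt r' s' (tgt r) q f)"
  unfolding tt_def
  using bilin_comp[OF tau_bilin[OF b q f] _ b _ b'(1)] bilin_act2[OF b'(1)] bimod_free[of "tgt f"] b'(2) bimodD(9)[OF b'(1)]
  by simp

lemma tt_half:
  assumes b: "bimod r s" and q: "is_tensor r s q" and f: "ok f" "src f = tgt q" and b': "bimod r' s'" "tgt f = tgt r'"
  shows "tt r' s' (tgt r) q f = r' ** (ap T (s' ** half (tgt r) q f) ** A.LT.unit (tgt r))"
  using bimodD[OF b] bimodD[OF b'(1)] half_facts(1)[OF b q f] b'(2)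
  by (simp add: tt_def tau_def act2_def A.LT.R.ap_tcomp)

text \<open>
  The two compatibilities that make the universal family of the Nakayama functor linear for the
  twisted actions. Both are \<open>act_comu\<close>, i.e. associativity of the actions on the target.
\<close>

lemma tt_left:
  assumes b: "bimod r s" and q: "is_tensor r s q" and b': "bimod r' s'"
    and g: "ok g" "src g = tgt q" "tgt g = eo T (tgt r')"
    and lam: "ok lam" "src lam = eo S (tgt q)" "tgt lam = tgt q" "lam ** ap S q = q ** ap L' (A.lact (tgt r))"
  shows "tt r' s' (tgt r) q (A.LT.counit (tgt r') ** (ap L (g ** lam) ** A.SL.unit (tgt q)))
    = tt r' s' (tgt r) q (r' ** g)"
proof -
  note bb = bimodD[OF b] and bb' = bimodD[OF b'] and qq = is_tensorD[OF q]
  let ?U = "tgt r" and ?X = "tgt r'"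
  define f where "f = A.LT.counit ?X ** (ap L (g ** lam) ** A.SL.unit (tgt q))"
  define G where "G = half ?U q g"
  have f: "ok f" "src f = tgt q" "tgt f = ?X" using g lam bb' qq by (simp_all add: f_def)
  have G: "ok G" "src G = eo L ?U" "tgt G = eo T (eo T' ?X)"
    using half_facts(1)[OF b q g(1,2)] g bb' by (simp_all add: G_def)
  have "f ** q = A.LT.counit ?X ** (ap L (g ** (lam ** ap S q)) ** A.SL.unit (eo L (eo L' ?U)))"
    using g lam(1-3) bb bb' qq(1-3) by (simp add: f_def A.SL.unit_nat A.LT.L.ap_tcomp)
  also have "\<dots> = A.LT.counit ?X ** (ap L (g ** q) ** (ap L (ap L' (A.lact ?U)) ** A.SL.unit (eo L (eo L' ?U))))"
    using g bb bb' qq(1-3) by (simp add: lam(4) A.LT.L.ap_tcomp)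
  also have "ap L (ap L' (A.lact ?U)) ** A.SL.unit (eo L (eo L' ?U)) = ap L' (ap L (A.lact ?U) ** A.SL.unit (eo L ?U))"
    using bb by (simp add: B.LT.L.ap_tcomp A_unit_swap swap_arr)
  also have "\<dots> = ap L' (A.comu ?U)" using bb by (simp add: A.lact_transp)
  finally have fq: "f ** q = A.LT.counit ?X ** (ap L (g ** q) ** ap L' (A.comu ?U))" .
  have "half ?U q f = ap T' (A.LT.counit ?X ** (ap L (g ** q) ** ap L' (A.comu ?U))) ** B.LT.unit (eo L ?U)"
    by (simp add: half_def fq)
  also have "\<dots> = ap T' (A.LT.counit ?X) ** (ap T' (ap L (g ** q)) ** (ap T' (ap L' (A.comu ?U)) ** B.LT.unit (eo L ?U)))"
    using g bb bb' qq(1-3) by (simp add: B.LT.R.ap_tcomp)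
  also have "ap T' (ap L' (A.comu ?U)) ** B.LT.unit (eo L ?U) = B.LT.unit (eo L (eo L ?U)) ** A.comu ?U"
    using bb by (simp add: B.LT.unit_nat)
  also have "ap T' (A.LT.counit ?X) ** (ap T' (ap L (g ** q)) ** (B.LT.unit (eo L (eo L ?U)) ** A.comu ?U))
    = A.LT.counit (eo T' ?X) ** (ap L G ** A.comu ?U)"
  proof -
    have 3: "ap T' (ap L (g ** q)) = ap L (ap T' (g ** q))"
      by (rule swap_arr) (use g bb qq(1-3) in simp)
    have 4: "B.LT.unit (eo L (eo L ?U)) = ap L (B.LT.unit (eo L ?U))" using bb by (simp add: B_unit_swap)
    show ?thesis
      unfolding 3 4 using g bb bb' qq(1-3) by (simp add: A_unit_swap G_def half_def A.LT.L.ap_tcomp)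
  qed
  finally have hf: "half ?U q f = A.LT.counit (eo T' ?X) ** (ap L G ** A.comu ?U)" .
  define G' where "G' = ap T s' ** G"
  have G': "ok G'" "src G' = eo L ?U" "tgt G' = eo T ?X" using G bb' by (simp_all add: G'_def)
  have "s' ** half ?U q f = A.LT.counit ?X ** (ap L G' ** A.comu ?U)"
    using G bb bb' A.LT.counit_nat'[of s' ?X "ap L G ** A.comu ?U"]
    by (simp add: hf G'_def A.LT.L.ap_tcomp)
  then have "tt r' s' ?U q f = r' ** (ap T (A.LT.counit ?X ** (ap L G' ** A.comu ?U)) ** A.LT.unit ?U)"
    by (simp add: tt_half[OF b q f(1,2) b' f(3)])
  also have "\<dots> = r' ** (ap T r' ** (ap T G' ** A.LT.unit ?U))"
    by (rule A.act_comu[OF bb'(1) G' bb(9)])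
  also have "\<dots> = r' ** (ap T (s' ** half ?U q (r' ** g)) ** A.LT.unit ?U)"
  proof -
    have "s' ** half ?U q (r' ** g) = s' ** (ap T' r' ** G)"
      using g bb bb' qq(1-3) by (simp add: half_def G_def B.LT.R.ap_tcomp)
    also have "\<dots> = r' ** G'"
      unfolding G'_def by (rule precomp2[OF bb'(4)]) (use G bb' in simp_all)
    finally show ?thesis using G' bb bb' by (simp add: A.LT.R.ap_tcomp)
  qed
  also have "\<dots> = tt r' s' ?U q (r' ** g)"
    using tt_half[OF b q _ _ b', of "r' ** g"] g bb' by simp
  finally show ?thesis by (simp add: f_def)
qed

lemma tt_right:
  assumes b: "bimod r s" and q: "is_tensor r s q" and b': "bimod r' s'"
    and g: "ok g" "src g = tgt q" "tgt g = eo T' (tgt r')"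
    and lam: "ok lam" "src lam = eo S' (tgt q)" "tgt lam = tgt q" "lam ** ap S' q = q ** B.lact (eo L (tgt r))"
  shows "tt r' s' (tgt r) q (B.LT.counit (tgt r') ** (ap L' (g ** lam) ** B.SL.unit (tgt q)))
    = tt r' s' (tgt r) q (s' ** g)"
proof -
  note bb = bimodD[OF b] and bb' = bimodD[OF b'] and qq = is_tensorD[OF q]
  let ?U = "tgt r" and ?X = "tgt r'"
  define f where "f = B.LT.counit ?X ** (ap L' (g ** lam) ** B.SL.unit (tgt q))"
  have f: "ok f" "src f = tgt q" "tgt f = ?X" using g lam bb' qq by (simp_all add: f_def)
  have "f ** q = B.LT.counit ?X ** (ap L' (g ** (lam ** ap S' q)) ** B.SL.unit (eo L' (eo L ?U)))"
    using g lam(1-3) bb bb' qq(1-3) by (simp add: f_def B.SL.unit_nat B.LT.L.ap_tcomp)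
  also have "\<dots> = B.LT.counit ?X ** (ap L' (g ** q) ** (ap L' (B.lact (eo L ?U)) ** B.SL.unit (eo L' (eo L ?U))))"
    using g bb bb' qq(1-3) by (simp add: lam(4) B.LT.L.ap_tcomp)
  also have "\<dots> = B.LT.counit ?X ** (ap L' (g ** q) ** B.comu (eo L ?U))"
    using bb B.lact_transp[of "eo L ?U"] by simp
  finally have fq: "f ** q = B.LT.counit ?X ** (ap L' (g ** q) ** B.comu (eo L ?U))" .
  have "s' ** half ?U q f = s' ** (ap T' s' ** (ap T' (g ** q) ** B.LT.unit (eo L ?U)))"
    using B.act_comu[OF bb'(2), of "g ** q" "eo L ?U"] g bb bb' qq(1-3) by (simp add: half_def fq)
  also have "\<dots> = s' ** half ?U q (s' ** g)"
    using g bb bb' qq(1-3) by (simp add: half_def B.LT.R.ap_tcomp)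
  finally show ?thesis
    using tt_half[OF b q f(1,2) b' f(3)] tt_half[OF b q _ _ b', of "s' ** g"] g bb' by (simp add: f_def)
qed

lemma tt_pre:
  assumes b: "bimod r s" and q: "is_tensor r s q" and b1: "bimod r1 s1" and q1: "is_tensor r1 s1 q1"
    and b': "bimod r' s'" and f: "bilin r s r1 s1 f" and k: "ok k" "src k = tgt q" "tgt k = tgt q1"
      "k ** q = q1 ** ap L' (ap L f)"
    and h: "ok h" "src h = tgt q1" "tgt h = tgt r'"
  shows "tt r' s' (tgt r) q (h ** k) = tt r' s' (tgt r1) q1 h ** f"
proof -
  note bb = bimodD[OF b] and bb1 = bimodD[OF b1] and bb' = bimodD[OF b'] and ff = bilinD[OF f]
  note qq = is_tensorD(1-3)[OF q] and qq1 = is_tensorD(1-3)[OF q1]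
  note hh = half_facts(1)[OF b1 q1 h(1,2)]
  have "half (tgt r) q (h ** k) = ap T' ((h ** q1) ** ap L' (ap L f)) ** B.LT.unit (eo L (tgt r))"
    using k h qq qq1 ff by (simp add: half_def)
  also have "\<dots> = half (tgt r1) q1 h ** ap L f"
    using B.LT.transpose_precomp[of "h ** q1" "ap L f" "eo L (tgt r1)"] h qq1 ff(1-3) by (simp add: half_def)
  finally have 1: "half (tgt r) q (h ** k) = half (tgt r1) q1 h ** ap L f" .
  have "tau (tgt r) q (h ** k) = tau (tgt r1) q1 h ** f"
    using A.LT.transpose_precomp[of "half (tgt r1) q1 h" f "tgt r1"] hh ff(1-3) by (simp add: tau_def 1)
  then show ?thesis
    using ff(1-3) h act2_simps[OF b'] half_facts(2)[OF b1 q1 h(1,2)] bb' by (simp add: tt_def)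
qed

lemma tensor_map:
  assumes b: "bimod r s" and q: "is_tensor r s q" and b1: "bimod r1 s1" and q1: "is_tensor r1 s1 q1"
    and f: "bilin r s r1 s1 f"
  shows "\<exists>k. ok k \<and> src k = tgt q \<and> tgt k = tgt q1 \<and> k ** q = q1 ** ap L' (ap L f)"
proof -
  note bb = bimodD[OF b] and bb1 = bimodD[OF b1] and ff = bilinD[OF f]
  note qq = is_tensorD[OF q] and qq1 = is_tensorD[OF q1]
  let ?h = "q1 ** ap L' (ap L f)"
  have "?h ** ap L' (A.ract (tgt r)) = q1 ** ap L' (ap L f ** A.ract (tgt r))"
    using qq1(1-3) ff(1-3) bb by (simp add: B.LT.L.ap_tcomp)
  also have "\<dots> = (q1 ** ap L' (A.ract (tgt r1))) ** ap L' (ap L (ap T f))"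
    using qq1(1-3) ff(1-3) bb bb1 A.ract_nat[OF ff(1), symmetric] by (simp add: B.LT.L.ap_tcomp)
  also have "\<dots> = q1 ** ap L' (ap L (r1 ** ap T f))"
    using qq1 ff(1-3) bb bb1 by (simp add: B.LT.L.ap_tcomp A.LT.L.ap_tcomp)
  also have "\<dots> = ?h ** ap L' (ap L r)"
    using qq1(1-3) ff(1-3) bb bb1 by (simp add: B.LT.L.ap_tcomp A.LT.L.ap_tcomp ff(4)[symmetric])
  finally have 1: "?h ** ap L' (A.ract (tgt r)) = ?h ** ap L' (ap L r)" .
  have "?h ** B.ract (eo L (tgt r)) = (q1 ** B.ract (eo L (tgt r1))) ** ap L' (ap T' (ap L f))"
    using qq1(1-3) ff(1-3) bb bb1 B.ract_nat[of "ap L f"] by simp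
  also have "\<dots> = q1 ** ap L' (ap L (s1 ** ap T' f))"
    using qq1 ff(1-3) bb bb1 by (simp add: B.LT.L.ap_tcomp A.LT.L.ap_tcomp swap_arr)
  also have "\<dots> = ?h ** ap L' (ap L s)"
    using qq1(1-3) ff(1-3) bb bb1 by (simp add: B.LT.L.ap_tcomp A.LT.L.ap_tcomp ff(5)[symmetric])
  finally have 2: "?h ** B.ract (eo L (tgt r)) = ?h ** ap L' (ap L s)" .
  show ?thesis
    using is_tensor_factor[OF q _ _ 1 2] qq1(1-3) ff(1-3) by simp
qed

end

section \<open>The Nakayama functor of a category of bimodules\<close>

lemma lin_inv_into:
  assumes f: "f \<in> lin V W" and inj: "inj_on f (carrier V)" and surj: "f ` carrier V = carrier W"
    and V: "vector_space_on V"
  shows "inv_into (carrier V) f \<in> lin W V"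
proof (rule linI)
  interpret vspace V by (rule vspaceI[OF V])
  let ?g = "inv_into (carrier V) f"
  have g: "?g w \<in> carrier V" "f (?g w) = w" if "w \<in> carrier W" for w
    using that surj by (auto intro: inv_into_into f_inv_into_f)
  show "?g w \<in> carrier V" if "w \<in> carrier W" for w by (rule g(1)[OF that])
  show "?g (v \<oplus>\<^bsub>W\<^esub> w) = ?g v \<oplus>\<^bsub>V\<^esub> ?g w" if v: "v \<in> carrier W" and w: "w \<in> carrier W" for v w
  proof -
    have "f (?g v \<oplus>\<^bsub>V\<^esub> ?g w) = v \<oplus>\<^bsub>W\<^esub> w" using linD(2)[OF f g(1)[OF v] g(1)[OF w]] g(2) v w by simp
    then show ?thesis using inv_into_f_f[OF inj, of "?g v \<oplus>\<^bsub>V\<^esub> ?g w"] g v w by simp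
  qed
  show "?g (a \<odot>\<^bsub>W\<^esub> w) = a \<odot>\<^bsub>V\<^esub> ?g w" if w: "w \<in> carrier W" for a w
  proof -
    have "f (a \<odot>\<^bsub>V\<^esub> ?g w) = a \<odot>\<^bsub>W\<^esub> w" using linD(3)[OF f g(1)[OF w]] g(2) w by simp
    then show ?thesis using inv_into_f_f[OF inj, of "a \<odot>\<^bsub>V\<^esub> ?g w"] g w by (simp add: smult_in)
  qed
qed

context commuting_monads
begin

lemma act2_nat:
  assumes b: "bimod r s" "bimod r' s'" and f: "bilin r s r' s' f"
  shows "act2 r' s' ** ap T (ap T' f) = f ** act2 r s"
proof -
  note bb = bimodD[OF b(1)] and bb' = bimodD[OF b(2)] and ff = bilinD[OF f]
  have "act2 r' s' ** ap T (ap T' f) = r' ** ap T (s' ** ap T' f)"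
    using bb' ff(1-3) by (simp add: act2_def A.LT.R.ap_tcomp)
  also have "\<dots> = r' ** (ap T f ** ap T s)"
    using bb bb' ff(1-3) by (simp add: ff(5)[symmetric] A.LT.R.ap_tcomp)
  also have "\<dots> = f ** (r ** ap T s)"
    by (rule precomp2[OF ff(4), symmetric]) (use bb bb' ff(1-3) in simp_all)
  finally show ?thesis by (simp add: act2_def)
qed

lemma free_unit_nat:
  assumes h: "ok h"
  shows "free_unit (tgt h) ** h = ap T (ap T' h) ** free_unit (src h)"
proof -
  have "ap T (B.eta (tgt h)) ** ap T h = ap T (ap T' h) ** ap T (B.eta (src h))"
    by (rule A.LT.R.ap_square[OF B.eta_nat[OF h refl]]) (use h okD[OF h] in simp_all)
  then have "ap T (B.eta (tgt h)) ** (ap T h ** A.eta (src h)) = ap T (ap T' h) ** (ap T (B.eta (src h)) ** A.eta (src h))"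
    by (rule precomp2) (use h okD[OF h] in simp_all)
  then show ?thesis using h okD[OF h] by (simp add: free_unit_def A.eta_nat)
qed

end

text \<open>
  A category \<open>D\<close> of bimodules in some encoding: an object has an underlying object \<open>und\<close> and actions \<open>lac\<close>,
  \<open>rac\<close>, and \<open>mk\<close> builds an object from these. One-sided modules are the case in which the other monad is the identity.
\<close>

locale bimodule_category = commuting_monads C T L S R c e c1 e1 c2 e2 m u T' L' S' R' c' e' c1' e1' c2' e2' m' u'
  for C :: "('o, 'm, 'k::field, 'z) lcat_scheme" (structure)
    and T L S R :: "('o, 'm) endo" and c e c1 e1 c2 e2 m u :: "'o \<Rightarrow> 'm"
    and T' L' S' R' :: "('o, 'm) endo" and c' e' c1' e1' c2' e2' m' u' :: "'o \<Rightarrow> 'm" +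
  fixes D :: "('p, 'm, 'k, 'w) lcat_scheme" and und :: "'p \<Rightarrow> 'o" and lac rac :: "'p \<Rightarrow> 'm"
    and mk :: "'o \<Rightarrow> 'm \<Rightarrow> 'm \<Rightarrow> 'p"
  assumes D_obj: "x \<in> Obj D \<Longrightarrow> bimod (eo T (und x), lac x, und x) (eo T' (und x), rac x, und x)"
    and D_mk: "bimod r s \<Longrightarrow> mk (tgt r) (raw r) (raw s) \<in> Obj D \<and> und (mk (tgt r) (raw r) (raw s)) = tgt r \<and>
      lac (mk (tgt r) (raw r) (raw s)) = raw r \<and> rac (mk (tgt r) (raw r) (raw s)) = raw s"
    and D_hom: "\<lbrakk>x \<in> Obj D; y \<in> Obj D\<rbrakk> \<Longrightarrow> Hom D x y = (Hom C (und x) (und y))\<lparr>carrier :=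
      {f \<in> arr C (und x) (und y). f \<cdot> lac x = lac y \<cdot> ea T f \<and> f \<cdot> rac x = rac y \<cdot> ea T' f}\<rparr>"
    and D_id: "x \<in> Obj D \<Longrightarrow> Id D x = Id C (und x)"
    and D_comp: "Comp D = Comp C"
begin

definition lt :: "'p \<Rightarrow> ('o, 'm) tarr" where "lt x = (eo T (und x), lac x, und x)"
definition rt :: "'p \<Rightarrow> ('o, 'm) tarr" where "rt x = (eo T' (und x), rac x, und x)"

lemma lt_simps [simp]: "src (lt x) = eo T (und x)" "tgt (lt x) = und x" "raw (lt x) = lac x"
    "src (rt x) = eo T' (und x)" "tgt (rt x) = und x" "raw (rt x) = rac x"
  by (simp_all add: lt_def rt_def)

lemma bm: "x \<in> Obj D \<Longrightarrow> bimod (lt x) (rt x)"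
  using D_obj by (simp add: lt_def rt_def)

lemma und_obj [simp]: "x \<in> Obj D \<Longrightarrow> und x \<in> Obj C"
  using bimodD(9)[OF bm] by simp

lemma ok_lt [simp]: "x \<in> Obj D \<Longrightarrow> ok (lt x)" "x \<in> Obj D \<Longrightarrow> ok (rt x)"
  using bimodD(5,6)[OF bm] by simp_all

lemma mk_facts:
  assumes b: "bimod r s"
  shows "mk (tgt r) (raw r) (raw s) \<in> Obj D" "und (mk (tgt r) (raw r) (raw s)) = tgt r"
    "lt (mk (tgt r) (raw r) (raw s)) = r" "rt (mk (tgt r) (raw r) (raw s)) = s"
  using D_mk[OF b] bimodD(3,7,8)[OF b] by (simp_all add: lt_def rt_def typed_collapse)

lemma arr_D:
  assumes "x \<in> Obj D" "y \<in> Obj D"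
  shows "f \<in> arr D x y \<longleftrightarrow> bilin (lt x) (rt x) (lt y) (rt y) (und x, f, und y)"
  using assms by (auto simp: D_hom bilin_def ok_typed tcomp_def)

lemma arr_D_C: "x \<in> Obj D \<Longrightarrow> y \<in> Obj D \<Longrightarrow> f \<in> arr D x y \<Longrightarrow> f \<in> arr C (und x) (und y)"
  by (simp add: D_hom)

lemma subspace_D:
  assumes x: "x \<in> Obj D" and y: "y \<in> Obj D"
  shows "subspace_of (arr D x y) (Hom C (und x) (und y))"
proof -
  note o = und_obj[OF x] und_obj[OF y]
  have lx: "lac x \<in> arr C (eo T (und x)) (und x)" "rac x \<in> arr C (eo T' (und x)) (und x)"
    and ly: "lac y \<in> arr C (eo T (und y)) (und y)" "rac y \<in> arr C (eo T' (und y)) (und y)"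
    using okD(3)[OF ok_lt(1)[OF x]] okD(3)[OF ok_lt(2)[OF x]] okD(3)[OF ok_lt(1)[OF y]] okD(3)[OF ok_lt(2)[OF y]]
    by simp_all
  have To: "eo T (und x) \<in> Obj C" "eo T (und y) \<in> Obj C" "eo T' (und x) \<in> Obj C" "eo T' (und y) \<in> Obj C"
    using o by simp_all
  note l1 = comp_lin_left[OF To(1) o(1) o(2) lx(1)] and l2 = comp_lin_left[OF To(3) o(1) o(2) lx(2)]
    and l3 = lin_comp[OF A.LT.R.ea_lin[OF o] comp_lin_right[OF To(1,2) o(2) ly(1)]]
    and l4 = lin_comp[OF B.LT.R.ea_lin[OF o] comp_lin_right[OF To(3,4) o(2) ly(2)]]
  interpret H: vspace "Hom C (und x) (und y)" by (rule vspaceI[OF hom_space[OF o]])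
  note z = lin_zero[OF l1 hom_space[OF o] hom_space[OF To(1) o(2)]]
    lin_zero[OF l2 hom_space[OF o] hom_space[OF To(3) o(2)]]
    lin_zero[OF l3 hom_space[OF o] hom_space[OF To(1) o(2)]]
    lin_zero[OF l4 hom_space[OF o] hom_space[OF To(3) o(2)]]
  show ?thesis
    unfolding subspace_of_def
    using z linD(2,3)[OF l1] linD(2,3)[OF l2] linD(2,3)[OF l3] linD(2,3)[OF l4]
    by (simp add: D_hom x y H.smult_in subset_eq)
qed

lemma Hom_D: "x \<in> Obj D \<Longrightarrow> y \<in> Obj D \<Longrightarrow> Hom D x y = (Hom C (und x) (und y))\<lparr>carrier := arr D x y\<rparr>"
  by (simp add: D_hom)

lemma lin_to_D:
  assumes "x \<in> Obj D" "y \<in> Obj D" "g \<in> lin V (Hom C (und x) (und y))" "\<And>v. v \<in> carrier V \<Longrightarrow> g v \<in> arr D x y"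
  shows "g \<in> lin V (Hom D x y)"
  using assms(3,4) by (subst Hom_D[OF assms(1,2)]) (simp add: lin_def Pi_iff)

lemma lin_of_D:
  assumes "x \<in> Obj D" "y \<in> Obj D" "g \<in> lin V (Hom D x y)"
  shows "g \<in> lin V (Hom C (und x) (und y))"
  using assms(3) arr_D_C[OF assms(1,2)] by (subst (asm) Hom_D[OF assms(1,2)]) (simp add: lin_def Pi_iff)

lemma lin_on_D:
  assumes "x \<in> Obj D" "y \<in> Obj D" "g \<in> lin (Hom C (und x) (und y)) W"
  shows "g \<in> lin (Hom D x y) W"
  using assms(3) arr_D_C[OF assms(1,2)] by (subst Hom_D[OF assms(1,2)]) (simp add: lin_def Pi_iff)

lemma lin_category_D: "lin_category D"
proof (rule lin_category.intro)
  show "vector_space_on (Hom D x y)" if "x \<in> Obj D" "y \<in> Obj D" for x y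
    by (subst Hom_D[OF that], rule vector_space_on_subspace[OF hom_space subspace_D[OF that]])
      (use that in simp_all)
  show "Id D x \<in> arr D x x" if x: "x \<in> Obj D" for x
  proof -
    have "bilin (lt x) (rt x) (lt x) (rt x) (tid (und x))"
      using ok_lt[OF x] und_obj[OF x] by (simp add: bilin_def A.LT.R.ap_tid B.LT.R.ap_tid)
    then show ?thesis unfolding arr_D[OF x x] D_id[OF x] tid_def .
  qed
  fix x y z assume x: "x \<in> Obj D" and y: "y \<in> Obj D" and z: "z \<in> Obj D"
  have comp: "g \<cdot> f \<in> arr D x z" if f: "f \<in> arr D x y" and g: "g \<in> arr D y z" for f g
    using bilin_comp[OF f[unfolded arr_D[OF x y]] g[unfolded arr_D[OF y z]] bm[OF x] bm[OF y] bm[OF z]]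
    unfolding arr_D[OF x z] by (simp add: tcomp_def)
  show "Comp D g f \<in> arr D x z" if "f \<in> arr D x y" "g \<in> arr D y z" for f g
    unfolding D_comp by (rule comp[OF that])
  show "(\<lambda>g. Comp D g f) \<in> lin (Hom D y z) (Hom D x z)" if f: "f \<in> arr D x y" for f
    unfolding D_comp
    by (rule lin_to_D[OF x z lin_on_D[OF y z comp_lin_left]]) (use x y z f comp arr_D_C in simp_all)
  show "(\<lambda>f. Comp D g f) \<in> lin (Hom D x y) (Hom D x z)" if g: "g \<in> arr D y z" for g
    unfolding D_comp
    by (rule lin_to_D[OF x z lin_on_D[OF x y comp_lin_right]]) (use x y z g comp arr_D_C in simp_all)
next
  fix x y f assume x: "x \<in> Obj D" and y: "y \<in> Obj D" and f: "f \<in> arr D x y"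
  show "Comp D (Id D y) f = f" "Comp D f (Id D x) = f"
    unfolding D_comp D_id[OF x] D_id[OF y]
    using id_left[OF und_obj[OF x] und_obj[OF y] arr_D_C[OF x y f]]
      id_right[OF und_obj[OF x] und_obj[OF y] arr_D_C[OF x y f]] by simp_all
next
  fix w x y z f g h assume "w \<in> Obj D" "x \<in> Obj D" "y \<in> Obj D" "z \<in> Obj D" "f \<in> arr D w x" "g \<in> arr D x y" "h \<in> arr D y z"
  then show "Comp D (Comp D h g) f = Comp D h (Comp D g f)"
    unfolding D_comp by (intro comp_assoc[of "und w" "und x" "und y" "und z"]) (simp_all add: arr_D_C)
qed

sublocale D: lin_category D by (rule lin_category_D)

text \<open>
  The actions on \<open>V \<otimes> z\<close> are induced because \<open>T\<close> and \<open>T'\<close>, being left adjoints, preserve copowers.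
\<close>

lemma copower_D:
  assumes z: "z \<in> Obj D" and cp: "is_copower C V (und z) P w" 
  shows "\<exists>P'. is_copower D V z P' w"
proof -
  note o = und_obj[OF z] and epi = copower_joint_epi[OF cp und_obj[OF z]]
  have P: "P \<in> Obj C" and w: "w \<in> lin V (Hom C (und z) P)"
    and un: "\<And>Y g. Y \<in> Obj C \<Longrightarrow> g \<in> lin V (Hom C (und z) Y) \<Longrightarrow>
      \<exists>!h. h \<in> arr C P Y \<and> (\<forall>v\<in>carrier V. h \<cdot> w v = g v)"
    using cp by (simp_all add: is_copower_def)
  have To: "eo T (und z) \<in> Obj C" "eo T' (und z) \<in> Obj C" using o by simp_all
  have lz: "lac z \<in> arr C (eo T (und z)) (und z)" "rac z \<in> arr C (eo T' (und z)) (und z)"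
    using okD(3)[OF ok_lt(1)[OF z]] okD(3)[OF ok_lt(2)[OF z]] by simp_all
  obtain a0 where a0: "a0 \<in> arr C (eo T P) P" "\<forall>v\<in>carrier V. a0 \<cdot> ea T (w v) = w v \<cdot> lac z"
    using A.TR.copower_left_adjoint[OF cp o P lin_comp[OF w comp_lin_left[OF To(1) o P lz(1)]]] by blast
  obtain b0 where b0: "b0 \<in> arr C (eo T' P) P" "\<forall>v\<in>carrier V. b0 \<cdot> ea T' (w v) = w v \<cdot> rac z"
    using B.TR.copower_left_adjoint[OF cp o P lin_comp[OF w comp_lin_left[OF To(2) o P lz(2)]]] by blast
  let ?f = "\<lambda>v. (und z, w v, P)" and ?a = "(eo T P, a0, P)" and ?b = "(eo T' P, b0, P)"
  have ab: "ok ?a" "ok ?b" using a0 b0 P by (simp_all add: ok_typed)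
  have la: "?a ** ap T (?f v) = ?f v ** lt z" and lb: "?b ** ap T' (?f v) = ?f v ** rt z" if "v \<in> carrier V" for v
    using a0(2) b0(2) that by (simp_all add: tcomp_def)
  have bi: "bimod ?a ?b"
    by (rule bimod_of_joint_epi[OF epi, of "\<lambda>_. lt z" "\<lambda>_. rt z"]) (use bm[OF z] ab la lb in simp_all)
  define P' where "P' = mk P a0 b0"
  have P': "P' \<in> Obj D" "und P' = P" "lt P' = ?a" "rt P' = ?b"
    using mk_facts[OF bi] by (simp_all add: P'_def)
  have "is_copower D V z P' w"
    unfolding is_copower_def
  proof (intro conjI ballI)
    show "P' \<in> Obj D" by (rule P')
    have "w v \<in> arr D z P'" if v: "v \<in> carrier V" for v
      unfolding arr_D[OF z P'(1)] using la[OF v] lb[OF v] linD(1)[OF w v] o P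
      by (simp add: bilin_def P' ok_typed)
    then show "w \<in> lin V (Hom D z P')" using w P'(2) by (intro lin_to_D[OF z P'(1)]) simp_all
    fix y g assume y: "y \<in> Obj D" and g: "g \<in> lin V (Hom D z y)"
    note gC = lin_of_D[OF z y g]
    from un[OF und_obj[OF y] gC] obtain h where h: "h \<in> arr C P (und y)" "\<forall>v\<in>carrier V. h \<cdot> w v = g v" by blast
    have "h \<in> arr D P' y"
      unfolding arr_D[OF P'(1) y] P'
    proof (rule bilin_of_joint_epi[OF epi, of "\<lambda>_. lt z" "\<lambda>_. rt z"])
      fix v assume v: "v \<in> carrier V"
      have "(P, h, und y) ** ?f v = (und z, g v, und y)" using h(2) v by (simp add: tcomp_def)
      then show "bilin (lt z) (rt z) (lt y) (rt y) ((P, h, und y) ** ?f v)"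
        using linD(1)[OF g v] unfolding arr_D[OF z y] by simp
    qed (use bm[OF z] bm[OF y] ab la lb h(1) P y in \<open>simp_all add: ok_typed\<close>)
    show "\<exists>!h. h \<in> arr D P' y \<and> (\<forall>v\<in>carrier V. Comp D h (w v) = g v)"
    proof (rule ex1I[of _ h])
      show "h \<in> arr D P' y \<and> (\<forall>v\<in>carrier V. Comp D h (w v) = g v)"
        using \<open>h \<in> arr D P' y\<close> h(2) by (simp add: D_comp)
      fix k assume "k \<in> arr D P' y \<and> (\<forall>v\<in>carrier V. Comp D k (w v) = g v)"
      then have "k \<in> arr C P (und y)" "\<forall>v\<in>carrier V. k \<cdot> w v = g v"
        using arr_D_C[OF P'(1) y] by (simp_all add: D_comp P')
      then show "k = h" using h by (intro ex1_eq[OF un[OF und_obj[OF y] gC]] conjI)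
    qed
  qed
  then show ?thesis by blast
qed

definition fr :: "'o \<Rightarrow> 'p" where
  "fr Y = mk (tgt (free_l Y)) (raw (free_l Y)) (raw (free_r Y))"

lemma fr_facts:
  assumes Y: "Y \<in> Obj C"
  shows "fr Y \<in> Obj D" "und (fr Y) = eo T (eo T' Y)" "lt (fr Y) = free_l Y" "rt (fr Y) = free_r Y"
  using mk_facts[OF bimod_free[OF Y]] by (simp_all add: fr_def)

end

text \<open>
  The functor \<open>F\<close> sends \<open>x\<close> to \<open>N\<close> of the tensor product \<open>tgt (q x)\<close>, with the actions that are induced by \<open>lam\<close>
  and \<open>lam'\<close> through the twists \<open>phi\<close> and \<open>phi'\<close>.
\<close>

locale bimodule_nakayama =
    bimodule_category C T L S R c e c1 e1 c2 e2 m u T' L' S' R' c' e' c1' e1' c2' e2' m' u' D und lac rac mk + NK: nakayama_category C N j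
    + AN: monad_nakayama C T L S R c e c1 e1 c2 e2 m u N j
    + BN: monad_nakayama C T' L' S' R' c' e' c1' e1' c2' e2' m' u' N j
  for C :: "('o, 'm, 'k::field, 'z) lcat_scheme" (structure)
    and T L S R :: "('o, 'm) endo" and c e c1 e1 c2 e2 m u :: "'o \<Rightarrow> 'm"
    and T' L' S' R' :: "('o, 'm) endo" and c' e' c1' e1' c2' e2' m' u' :: "'o \<Rightarrow> 'm"
    and D :: "('p, 'm, 'k, 'w) lcat_scheme" and und :: "'p \<Rightarrow> 'o" and lac rac :: "'p \<Rightarrow> 'm"
    and mk :: "'o \<Rightarrow> 'm \<Rightarrow> 'm \<Rightarrow> 'p"
    and N :: "('o, 'm, 'o, 'm) fctr" and j :: "'o \<Rightarrow> 'o \<Rightarrow> ('m \<Rightarrow> 'k) \<Rightarrow> 'm" +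
  fixes q lam lam' phi phi' :: "'p \<Rightarrow> ('o, 'm) tarr" and E :: "'p \<Rightarrow> 'p \<Rightarrow> 'm \<Rightarrow> ('o, 'm) tarr"
    and F :: "('p, 'm, 'p, 'm) fctr"
  assumes tens: "x \<in> Obj D \<Longrightarrow> is_tensor (lt x) (rt x) (q x)"
    and lam: "x \<in> Obj D \<Longrightarrow> ok (lam x) \<and> src (lam x) = eo S (tgt (q x)) \<and> tgt (lam x) = tgt (q x) \<and>
      lam x ** ap S (q x) = q x ** ap L' (A.lact (und x))"
    and lam': "x \<in> Obj D \<Longrightarrow> ok (lam' x) \<and> src (lam' x) = eo S' (tgt (q x)) \<and> tgt (lam' x) = tgt (q x) \<and>
      lam' x ** ap S' (q x) = q x ** B.lact (eo L (und x))"
    and phi: "x \<in> Obj D \<Longrightarrow> AN.is_twist (tgt (q x)) (phi x)"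
    and phi': "x \<in> Obj D \<Longrightarrow> BN.is_twist (tgt (q x)) (phi' x)"
    and E: "x \<in> Obj D \<Longrightarrow> y \<in> Obj D \<Longrightarrow> f \<in> arr D x y \<Longrightarrow> ok (E x y f) \<and> src (E x y f) = tgt (q x) \<and>
      tgt (E x y f) = tgt (q y) \<and> E x y f ** q x = q y ** ap L' (ap L (und x, f, und y))"
    and Fo_F: "x \<in> Obj D \<Longrightarrow> Fo F x = mk (Fo N (tgt (q x))) (raw (NK.Nt (lam x) ** phi x)) (raw (NK.Nt (lam' x) ** phi' x))"
    and Fa_F: "x \<in> Obj D \<Longrightarrow> y \<in> Obj D \<Longrightarrow> f \<in> arr D x y \<Longrightarrow> Fa F x y f = raw (NK.Nt (E x y f))"
    and copowers: "\<And>(V :: ('k, 'm \<Rightarrow> 'k) module) X. vector_space_on V \<Longrightarrow> finite_coords V \<Longrightarrow> X \<in> Obj C \<Longrightarrow>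
      \<exists>P w. is_copower C V X P w"
    and fin: "finite_homs C"
begin

abbreviation P :: "'p \<Rightarrow> 'o" where "P x \<equiv> tgt (q x)"

definition ta :: "'p \<Rightarrow> 'm \<Rightarrow> 'm" where
  "ta x f = ea T (ea T' (f \<cdot> raw (q x)) \<cdot> c' (eo L (und x))) \<cdot> c (und x)"

definition tr :: "'p \<Rightarrow> 'p \<Rightarrow> 'm \<Rightarrow> 'm" where
  "tr x y f = raw (act2 (lt y) (rt y)) \<cdot> ta x f"

lemma P_obj [simp]: "x \<in> Obj D \<Longrightarrow> P x \<in> Obj C"
  by (rule is_tensorD(3)[OF tens])

lemma ta_typed: "tau (und x) (q x) (P x, f, Y) = (und x, ta x f, eo T (eo T' Y))"
  by (rule typed_eqI) (simp_all add: ta_def tau_def half_def)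

lemma tr_typed: "y \<in> Obj D \<Longrightarrow> tt (lt y) (rt y) (und x) (q x) (P x, f, und y) = (und x, tr x y f, und y)"
  by (rule typed_eqI) (simp_all add: tr_def tt_def ta_typed act2_simps[OF bm])

lemma ok_P: "x \<in> Obj D \<Longrightarrow> Y \<in> Obj C \<Longrightarrow> f \<in> arr C (P x) Y \<Longrightarrow> ok (P x, f, Y)"
  by (simp add: ok_typed)

lemma ta_arr:
  assumes x: "x \<in> Obj D" and Y: "Y \<in> Obj C" and f: "f \<in> arr C (P x) Y"
  shows "ta x f \<in> arr D x (fr Y)"
  using tau_bilin[OF bm[OF x] tens[OF x] ok_P[OF x Y f]] fr_facts[OF Y] x
  by (simp add: arr_D ta_typed)

lemma tr_arr:
  assumes x: "x \<in> Obj D" and y: "y \<in> Obj D" and f: "f \<in> arr C (P x) (und y)"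
  shows "tr x y f \<in> arr D x y"
  using tt_bilin[OF bm[OF x] tens[OF x] ok_P[OF x und_obj[OF y] f] _ bm[OF y]] x y
  by (simp add: arr_D tr_typed)

lemma ta_lin_C:
  assumes x: "x \<in> Obj D" and Y: "Y \<in> Obj C"
  shows "ta x \<in> lin (Hom C (P x) Y) (Hom C (und x) (eo T (eo T' Y)))"
proof -
  have q: "raw (q x) \<in> arr C (eo L' (eo L (und x))) (P x)"
    using is_tensorD(1,2)[OF tens[OF x]] okD(3)[of "q x"] by simp
  have o: "eo L' (eo L (und x)) \<in> Obj C" "eo L (und x) \<in> Obj C" "eo T' Y \<in> Obj C"
    "eo T' (eo L' (eo L (und x))) \<in> Obj C" "eo T (eo L (und x)) \<in> Obj C" "eo T (eo T' Y) \<in> Obj C" "und x \<in> Obj C"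
    using x Y by simp_all
  note l1 = comp_lin_left[OF o(1) P_obj[OF x] Y q]
  note l2 = lin_comp[OF l1 B.LT.R.ea_lin[OF o(1) Y]]
  note l3 = lin_comp[OF l2 comp_lin_left[OF o(2,4,3) B.LT.c_arr[OF o(2)]]]
  note l4 = lin_comp[OF l3 A.LT.R.ea_lin[OF o(2,3)]]
  note l5 = lin_comp[OF l4 comp_lin_left[OF o(7,5,6) A.LT.c_arr[OF o(7)]]]
  show ?thesis using l5 by (simp add: ta_def[abs_def])
qed

lemma ta_lin:
  assumes x: "x \<in> Obj D" and Y: "Y \<in> Obj C"
  shows "ta x \<in> lin (Hom C (P x) Y) (Hom D x (fr Y))"
  using ta_lin_C[OF x Y] fr_facts[OF Y] x Y ta_arr by (intro lin_to_D) simp_all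

lemma tr_lin:
  assumes x: "x \<in> Obj D" and y: "y \<in> Obj D"
  shows "tr x y \<in> lin (Hom C (P x) (und y)) (Hom D x y)"
proof (rule lin_to_D[OF x y])
  have "raw (act2 (lt y) (rt y)) \<in> arr C (eo T (eo T' (und y))) (und y)"
    using okD(3)[OF act2_simps(3)[OF bm[OF y]]] act2_simps[OF bm[OF y]] by simp
  then show "tr x y \<in> lin (Hom C (P x) (und y)) (Hom C (und x) (und y))"
    unfolding tr_def[abs_def] by (intro lin_comp[OF ta_lin_C comp_lin_right]) (use x y in simp_all)
qed (rule tr_arr[OF x y])

lemma ta_inj:
  assumes x: "x \<in> Obj D" and Y: "Y \<in> Obj C"
  shows "inj_on (ta x) (arr C (P x) Y)"
proof (rule inj_onI)
  fix f g assume f: "f \<in> arr C (P x) Y" and g: "g \<in> arr C (P x) Y" and eq: "ta x f = ta x g"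
  have "(P x, f, Y) = (P x, g, Y)"
    by (rule tau_inj[OF bm[OF x] tens[OF x] ok_P[OF x Y f] _ ok_P[OF x Y g]]) (simp_all add: ta_typed eq)
  then show "f = g" by simp
qed

lemma ta_surj:
  assumes x: "x \<in> Obj D" and Y: "Y \<in> Obj C"
  shows "ta x ` arr C (P x) Y = arr D x (fr Y)"
proof (intro equalityI subsetI)
  show "g \<in> arr D x (fr Y)" if "g \<in> ta x ` arr C (P x) Y" for g using that ta_arr[OF x Y] by blast
  fix g assume "g \<in> arr D x (fr Y)"
  then have "bilin (lt x) (rt x) (free_l Y) (free_r Y) (und x, g, eo T (eo T' Y))"
    using x fr_facts[OF Y] by (simp add: arr_D)
  from tau_surj[OF bm[OF x] tens[OF x] Y this] obtain f where
    f: "ok f" "src f = P x" "tgt f = Y" "tau (und x) (q x) f = (und x, g, eo T (eo T' Y))" by auto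
  have "f = (P x, raw f, Y)" using f by (simp add: typed_collapse)
  with f(4) ta_typed[of x "raw f" Y] have "g = ta x (raw f)" by simp
  moreover have "raw f \<in> arr C (P x) Y" using okD(3)[OF f(1)] f by simp
  ultimately show "g \<in> ta x ` arr C (P x) Y" by blast
qed

text \<open>
  \<open>ta x : Hom(P x, Y) \<rightarrow> Hom\<^sub>D(x, fr Y)\<close> is bijective, i.e. \<open>P\<close> is left adjoint to the free bimodule functor \<open>fr\<close>;
  \<open>ti\<close> is its inverse.
\<close>

definition ti :: "'p \<Rightarrow> 'o \<Rightarrow> 'm \<Rightarrow> 'm" where
  "ti x Y = inv_into (arr C (P x) Y) (ta x)"

lemma ti_lin:
  assumes x: "x \<in> Obj D" and Y: "Y \<in> Obj C"
  shows "ti x Y \<in> lin (Hom D x (fr Y)) (Hom C (P x) Y)"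
  unfolding ti_def
  by (rule lin_inv_into[OF ta_lin[OF x Y] ta_inj[OF x Y] ta_surj[OF x Y] hom_space]) (use x Y in simp_all)

lemma ti_ta: "x \<in> Obj D \<Longrightarrow> Y \<in> Obj C \<Longrightarrow> f \<in> arr C (P x) Y \<Longrightarrow> ti x Y (ta x f) = f"
  unfolding ti_def by (rule inv_into_f_f[OF ta_inj])

lemma ta_ti: "x \<in> Obj D \<Longrightarrow> Y \<in> Obj C \<Longrightarrow> g \<in> arr D x (fr Y) \<Longrightarrow> ta x (ti x Y g) = g"
  unfolding ti_def by (rule f_inv_into_f) (simp add: ta_surj)

lemma ta_nat:
  assumes x: "x \<in> Obj D" and Y: "Y \<in> Obj C" and W: "W \<in> Obj C" and f: "f \<in> arr C (P x) Y" and h: "h \<in> arr C Y W"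
  shows "ta x (h \<cdot> f) = ea T (ea T' h) \<cdot> ta x f"
proof -
  have "tau (und x) (q x) ((Y, h, W) ** (P x, f, Y)) = ap T (ap T' (Y, h, W)) ** tau (und x) (q x) (P x, f, Y)"
    using tau_nat[OF bm[OF x] tens[OF x] ok_P[OF x Y f] _, of "(Y, h, W)"] h Y W by (simp add: ok_typed)
  then show ?thesis by (simp add: ta_typed tcomp_def)
qed

lemma tr_post:
  assumes x: "x \<in> Obj D" and y: "y \<in> Obj D" and z: "z \<in> Obj D" and h: "h \<in> arr D y z" and f: "f \<in> arr C (P x) (und y)"
  shows "tr x z (h \<cdot> f) = h \<cdot> tr x y f"
proof -
  let ?h = "(und y, h, und z)" and ?t = "(und x, ta x f, eo T (eo T' (und y)))"
  have bh: "bilin (lt y) (rt y) (lt z) (rt z) ?h" using h by (simp add: arr_D y z)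
  have okt: "ok ?t" using ta_arr[OF x und_obj[OF y] f] arr_D_C[OF x fr_facts(1)[OF und_obj[OF y]]]
      fr_facts(2)[OF und_obj[OF y]] x y by (simp add: ok_typed)
  have "act2 (lt z) (rt z) ** (ap T (ap T' ?h) ** ?t) = ?h ** (act2 (lt y) (rt y) ** ?t)"
    by (rule precomp2[OF act2_nat[OF bm[OF y] bm[OF z] bh]])
      (use bilinD(1-3)[OF bh] okt act2_simps[OF bm[OF y]] act2_simps[OF bm[OF z]] in simp_all)
  from arg_cong[OF this, of raw] show ?thesis
    by (simp add: tr_def ta_nat[OF x und_obj[OF y] und_obj[OF z] f arr_D_C[OF y z h]])
qed

text \<open>
  The candidate for the universal family of \<open>D\<close>: a functional on \<open>Hom\<^sub>D(x, y)\<close> is pulled back along \<open>tr x y\<close> to one on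
  \<open>Hom(P x, und y)\<close>, where the universal family \<open>j\<close> of \<open>N\<close> applies.
\<close>

definition J :: "'p \<Rightarrow> 'p \<Rightarrow> ('m \<Rightarrow> 'k) \<Rightarrow> 'm" where
  "J x y \<xi> = j (P x) (und y) (transp (Hom C (P x) (und y)) (tr x y) \<xi>)"

lemma tr_dual:
  assumes "x \<in> Obj D" "y \<in> Obj D" "\<xi> \<in> fnl D x y"
  shows "transp (Hom C (P x) (und y)) (tr x y) \<xi> \<in> fnl C (P x) (und y)"
  using linD(1)[OF transp_lin[OF tr_lin[OF assms(1,2)]] assms(3)] assms hom_space D.hom_space by simp

lemma ti_dual:
  assumes "x \<in> Obj D" "Y \<in> Obj C" "\<zeta> \<in> fnl C (P x) Y"
  shows "transp (Hom D x (fr Y)) (ti x Y) \<zeta> \<in> fnl D x (fr Y)"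
  using linD(1)[OF transp_lin[OF ti_lin[OF assms(1,2)]] assms(3)] assms hom_space D.hom_space fr_facts by simp

lemma J_typed: "(und y, J x y \<xi>, Fo N (P x)) = NK.jt (P x) (und y) (transp (Hom C (P x) (und y)) (tr x y) \<xi>)"
  by (simp add: J_def NK.jt_def)

lemma J_lin_C:
  assumes x: "x \<in> Obj D" and y: "y \<in> Obj D"
  shows "J x y \<in> lin (hom_dual D x y) (Hom C (und y) (Fo N (P x)))"
  unfolding J_def[abs_def]
  by (rule lin_comp[OF transp_lin[OF tr_lin[OF x y]] NK.j_lin]) (use x y hom_space D.hom_space in simp_all)

lemma ok_J: "x \<in> Obj D \<Longrightarrow> y \<in> Obj D \<Longrightarrow> \<xi> \<in> fnl D x y \<Longrightarrow> ok (und y, J x y \<xi>, Fo N (P x))"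
  using linD(1)[OF J_lin_C] by (simp add: ok_typed)

lemma J_post:
  assumes x: "x \<in> Obj D" and y: "y \<in> Obj D" and z: "z \<in> Obj D" and h: "h \<in> arr D y z"
    and \<xi>: "\<xi> \<in> fnl D x z"
  shows "J x z \<xi> \<cdot> h = J x y (transp (Hom D x y) (\<lambda>g. h \<cdot> g) \<xi>)"
proof -
  note hC = arr_D_C[OF y z h]
  have 1: "(\<lambda>g. h \<cdot> g) \<in> lin (Hom C (P x) (und y)) (Hom C (P x) (und z))"
    by (rule comp_lin_right) (use x y z hC in simp_all)
  have "transp (Hom C (P x) (und y)) (\<lambda>g. h \<cdot> g) (transp (Hom C (P x) (und z)) (tr x z) \<xi>)
    = transp (Hom C (P x) (und y)) (tr x y) (transp (Hom D x y) (\<lambda>g. h \<cdot> g) \<xi>)"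
    unfolding transp_transp[OF 1] transp_transp[OF tr_lin[OF x y]]
    by (rule transp_cong) (rule tr_post[OF x y z h])
  then have "NK.jt (P x) (und z) (transp (Hom C (P x) (und z)) (tr x z) \<xi>) ** (und y, h, und z)
    = (und y, J x y (transp (Hom D x y) (\<lambda>g. h \<cdot> g) \<xi>), Fo N (P x))"
    using NK.jt_nat[OF P_obj[OF x] _ _ tr_dual[OF x z \<xi>], of "(und y, h, und z)"] hC y z
    by (simp add: J_typed ok_typed)
  from arg_cong[OF this, of raw] show ?thesis by (simp add: J_def)
qed

definition act_l :: "'p \<Rightarrow> ('o, 'm) tarr" where "act_l x = NK.Nt (lam x) ** phi x"
definition act_r :: "'p \<Rightarrow> ('o, 'm) tarr" where "act_r x = NK.Nt (lam' x) ** phi' x"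

lemma act_facts:
  assumes x: "x \<in> Obj D"
  shows "ok (act_l x)" "src (act_l x) = eo T (Fo N (P x))" "tgt (act_l x) = Fo N (P x)"
    "ok (act_r x)" "src (act_r x) = eo T' (Fo N (P x))" "tgt (act_r x) = Fo N (P x)"
  using lam[OF x] lam'[OF x] phi[OF x] phi'[OF x]
  by (simp_all add: act_l_def act_r_def AN.is_twist_def BN.is_twist_def)

text \<open>
  \<open>J x y \<xi>\<close> is linear for the twisted left action. By the description of the twist this says that \<open>tr x y\<close> identifies
  the two ways in which the monad can act on an arrow, which is associativity of the action on \<open>y\<close>.
\<close>

lemma J_left:
  assumes x: "x \<in> Obj D" and y: "y \<in> Obj D" and \<xi>: "\<xi> \<in> fnl D x y"
  shows "act_l x ** ap T (und y, J x y \<xi>, Fo N (P x)) = (und y, J x y \<xi>, Fo N (P x)) ** lt y"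
  unfolding J_typed act_l_def
proof (rule AN.nak_act_jt[OF P_obj[OF x] phi[OF x] _ _ _ _ _ _ tr_dual[OF x y \<xi>]])
  fix g assume g: "g \<in> arr C (P x) (eo T (und y))"
  note l = lam[OF x] and o = und_obj[OF y] P_obj[OF x]
  let ?g = "(P x, g, eo T (und y))"
  have okg: "ok ?g" using g o by (simp add: ok_typed)
  let ?k = "A.LT.counit (und y) ** (ap L (?g ** lam x) ** A.SL.unit (P x))"
  have k: "?k = (P x, AN.ttw (P x) (und y) (g \<cdot> raw (lam x)), und y)" "lt y ** ?g = (P x, lac y \<cdot> g, und y)"
    by (intro typed_eqI; simp add: AN.ttw_def)+
  have "tt (lt y) (rt y) (und x) (q x) ?k = tt (lt y) (rt y) (und x) (q x) (lt y ** ?g)"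
    using tt_left[OF bm[OF x] tens[OF x] bm[OF y] okg _ _ _ _ _] l by simp
  then have "tr x y (AN.ttw (P x) (und y) (g \<cdot> raw (lam x))) = tr x y (lac y \<cdot> g)"
    unfolding k by (simp add: tr_typed y)
  moreover have "ok ?k" "ok (lt y ** ?g)" using l okg o y by simp_all
  then have "AN.ttw (P x) (und y) (g \<cdot> raw (lam x)) \<in> arr C (P x) (und y)" "lac y \<cdot> g \<in> arr C (P x) (und y)"
    unfolding k by (simp_all add: ok_typed)
  ultimately show "transp (Hom C (P x) (und y)) (tr x y) \<xi> (AN.ttw (P x) (und y) (g \<cdot> raw (lam x)))
      = transp (Hom C (P x) (und y)) (tr x y) \<xi> (raw (lt y) \<cdot> g)"
    by (simp add: transp_def)
qed (use lam[OF x] y in simp_all)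

lemma J_right:
  assumes x: "x \<in> Obj D" and y: "y \<in> Obj D" and \<xi>: "\<xi> \<in> fnl D x y"
  shows "act_r x ** ap T' (und y, J x y \<xi>, Fo N (P x)) = (und y, J x y \<xi>, Fo N (P x)) ** rt y"
  unfolding J_typed act_r_def
proof (rule BN.nak_act_jt[OF P_obj[OF x] phi'[OF x] _ _ _ _ _ _ tr_dual[OF x y \<xi>]])
  fix g assume g: "g \<in> arr C (P x) (eo T' (und y))"
  note l = lam'[OF x] and o = und_obj[OF y] P_obj[OF x]
  let ?g = "(P x, g, eo T' (und y))"
  have okg: "ok ?g" using g o by (simp add: ok_typed)
  let ?k = "B.LT.counit (und y) ** (ap L' (?g ** lam' x) ** B.SL.unit (P x))"
  have k: "?k = (P x, BN.ttw (P x) (und y) (g \<cdot> raw (lam' x)), und y)" "rt y ** ?g = (P x, rac y \<cdot> g, und y)"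
    by (intro typed_eqI; simp add: BN.ttw_def)+
  have "tt (lt y) (rt y) (und x) (q x) ?k = tt (lt y) (rt y) (und x) (q x) (rt y ** ?g)"
    using tt_right[OF bm[OF x] tens[OF x] bm[OF y] okg _ _ _ _ _] l by simp
  then have "tr x y (BN.ttw (P x) (und y) (g \<cdot> raw (lam' x))) = tr x y (rac y \<cdot> g)"
    unfolding k by (simp add: tr_typed y)
  moreover have "ok ?k" "ok (rt y ** ?g)" using l okg o y by simp_all
  then have "BN.ttw (P x) (und y) (g \<cdot> raw (lam' x)) \<in> arr C (P x) (und y)" "rac y \<cdot> g \<in> arr C (P x) (und y)"
    unfolding k by (simp_all add: ok_typed)
  ultimately show "transp (Hom C (P x) (und y)) (tr x y) \<xi> (BN.ttw (P x) (und y) (g \<cdot> raw (lam' x)))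
      = transp (Hom C (P x) (und y)) (tr x y) \<xi> (raw (rt y) \<cdot> g)"
    by (simp add: transp_def)
qed (use lam'[OF x] y in simp_all)

text \<open>The family \<open>J x\<close> is jointly epimorphic because it contains the universal family of \<open>N\<close>.\<close>

abbreviation "J_index x \<equiv> {(y, \<xi>). y \<in> Obj D \<and> \<xi> \<in> fnl D x y}"
abbreviation "J_arrow x \<equiv> (\<lambda>(y, \<xi>). (und y, J x y \<xi>, Fo N (P x)))"

lemma jt_via_J:
  assumes x: "x \<in> Obj D" and Y: "Y \<in> Obj C" and \<zeta>: "\<zeta> \<in> fnl C (P x) Y"
  shows "NK.jt (P x) Y \<zeta>
    = (und (fr Y), J x (fr Y) (transp (Hom D x (fr Y)) (ti x Y) \<zeta>), Fo N (P x)) ** free_unit Y"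
proof -
  let ?\<xi> = "transp (Hom D x (fr Y)) (ti x Y) \<zeta>" and ?u = "raw (free_unit Y)"
  note f = fr_facts[OF Y] and o = P_obj[OF x]
  note \<xi> = ti_dual[OF x Y \<zeta>]
  have fu: "?u \<in> arr C Y (und (fr Y))" using okD(3)[OF free_unit_simps(3)[OF Y]] by (simp add: f)
  have l: "(\<lambda>h. ?u \<cdot> h) \<in> lin (Hom C (P x) Y) (Hom C (P x) (und (fr Y)))"
    by (rule comp_lin_right[OF o Y und_obj[OF f(1)] fu])
  have key: "ti x Y (tr x (fr Y) (?u \<cdot> g)) = g" if g: "g \<in> arr C (P x) Y" for g
  proof -
    note tD = ta_arr[OF x Y g]
    let ?t = "(und x, ta x g, eo T (eo T' Y))"
    have okt: "ok ?t" using arr_D_C[OF x f(1) tD] x Y f(2) by (simp add: ok_typed)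
    have "act2 (free_l Y) (free_r Y) ** (ap T (ap T' (free_unit Y)) ** ?t) = tid (eo T (eo T' Y)) ** ?t"
      by (rule precomp[OF act2_free[OF Y]]) (use Y okt act2_simps[OF bimod_free[OF Y]] in simp_all)
    also have "\<dots> = ?t" using okt by simp
    finally have "raw (act2 (free_l Y) (free_r Y)) \<cdot> (ea T (ea T' ?u) \<cdot> ta x g) = ta x g"
      by (simp add: tcomp_def ap_def)
    then have "tr x (fr Y) (?u \<cdot> g) = ta x g"
      using ta_nat[OF x Y und_obj[OF f(1)] g fu] f by (simp add: tr_def)
    then show ?thesis using ti_ta[OF x Y g] by simp
  qed
  have "transp (Hom C (P x) Y) (\<lambda>h. ?u \<cdot> h) (transp (Hom C (P x) (und (fr Y))) (tr x (fr Y)) ?\<xi>) = \<zeta>"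
    unfolding transp_transp[OF tr_lin[OF x f(1)]] transp_transp[OF l]
    by (rule transp_ident[OF \<zeta>]) (rule key)
  then show ?thesis
    unfolding J_typed using NK.jt_nat[OF o free_unit_simps(3)[OF Y] _ tr_dual[OF x f(1) \<xi>]] f(2) by simp
qed

lemma J_joint_epi:
  assumes x: "x \<in> Obj D"
  shows "joint_epi (J_arrow x ` J_index x) (Fo N (P x))"
  unfolding joint_epi_def
proof (intro conjI allI impI ballI)
  show "Fo N (P x) \<in> Obj C" using x by simp
  fix f assume "f \<in> J_arrow x ` J_index x"
  then obtain y \<xi> where "y \<in> Obj D" "\<xi> \<in> fnl D x y" "f = (und y, J x y \<xi>, Fo N (P x))" by auto
  then show "ok f" "tgt f = Fo N (P x)" using ok_J[OF x] by simp_all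
next
  fix k l assume "ok k \<and> ok l \<and> src k = Fo N (P x) \<and> src l = Fo N (P x) \<and> tgt k = tgt l \<and>
    (\<forall>f\<in>J_arrow x ` J_index x. k ** f = l ** f)"
  then have kl: "ok k" "ok l" "src k = Fo N (P x)" "src l = Fo N (P x)" "tgt k = tgt l"
    and eq: "\<And>y \<xi>. y \<in> Obj D \<Longrightarrow> \<xi> \<in> fnl D x y \<Longrightarrow>
      k ** (und y, J x y \<xi>, Fo N (P x)) = l ** (und y, J x y \<xi>, Fo N (P x))" by auto
  show "k = l"
  proof (rule joint_epi_ext[OF NK.jt_joint_epi[OF P_obj[OF x]] kl])
    fix g assume "g \<in> {NK.jt (P x) X \<xi> |X \<xi>. X \<in> Obj C \<and> \<xi> \<in> fnl C (P x) X}"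
    then obtain Y \<zeta> where Y: "Y \<in> Obj C" and \<zeta>: "\<zeta> \<in> fnl C (P x) Y" and g: "g = NK.jt (P x) Y \<zeta>"
      by blast
    note f = fr_facts[OF Y] and \<xi> = ti_dual[OF x Y \<zeta>]
    let ?J = "(und (fr Y), J x (fr Y) (transp (Hom D x (fr Y)) (ti x Y) \<zeta>), Fo N (P x))"
    have "k ** (?J ** free_unit Y) = (l ** ?J) ** free_unit Y"
      by (rule precomp[OF eq[OF f(1) \<xi>]]) (use kl ok_J[OF x f(1) \<xi>] Y f(2) in simp_all)
    also have "\<dots> = l ** (?J ** free_unit Y)"
      using kl ok_J[OF x f(1) \<xi>] Y f(2) by simp
    finally show "k ** g = l ** g" by (simp only: g jt_via_J[OF x Y \<zeta>])
  qed
qed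

lemma F_bimod:
  assumes x: "x \<in> Obj D"
  shows "bimod (act_l x) (act_r x)"
  by (rule bimod_of_joint_epi[OF J_joint_epi[OF x], of "\<lambda>i. lt (fst i)" "\<lambda>i. rt (fst i)"])
    (use act_facts[OF x] J_left[OF x] J_right[OF x] bm in auto)

lemma F_obj:
  assumes x: "x \<in> Obj D"
  shows "Fo F x \<in> Obj D" "und (Fo F x) = Fo N (P x)" "lt (Fo F x) = act_l x" "rt (Fo F x) = act_r x"
  using mk_facts[OF F_bimod[OF x]] act_facts[OF x] Fo_F[OF x] by (simp_all add: act_l_def act_r_def)

lemma bilin_from_F:
  assumes x: "x \<in> Obj D" and z: "z \<in> Obj D" and h: "h \<in> arr C (Fo N (P x)) (und z)"
    and hJ: "\<And>y \<xi>. y \<in> Obj D \<Longrightarrow> \<xi> \<in> fnl D x y \<Longrightarrow> h \<cdot> J x y \<xi> \<in> arr D y z"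
  shows "h \<in> arr D (Fo F x) z"
  unfolding arr_D[OF F_obj(1)[OF x] z] F_obj[OF x]
proof (rule bilin_of_joint_epi[OF J_joint_epi[OF x], of "\<lambda>i. lt (fst i)" "\<lambda>i. rt (fst i)"])
  fix i assume "i \<in> J_index x"
  then obtain y \<xi> where i: "i = (y, \<xi>)" and y: "y \<in> Obj D" and \<xi>: "\<xi> \<in> fnl D x y" by blast
  have "(Fo N (P x), h, und z) ** J_arrow x i = (und y, h \<cdot> J x y \<xi>, und z)"
    by (simp add: i tcomp_def)
  then show "bilin (lt (fst i)) (rt (fst i)) (lt z) (rt z) ((Fo N (P x), h, und z) ** J_arrow x i)"
    using hJ[OF y \<xi>] by (simp add: i arr_D y z)
qed (use act_facts[OF x] J_left[OF x] J_right[OF x] bm h x z in \<open>auto simp: ok_typed\<close>)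

lemma J_arr:
  assumes x: "x \<in> Obj D" and y: "y \<in> Obj D" and \<xi>: "\<xi> \<in> fnl D x y"
  shows "J x y \<xi> \<in> arr D y (Fo F x)"
  unfolding arr_D[OF y F_obj(1)[OF x]] F_obj[OF x] bilin_def
  using ok_J[OF x y \<xi>] J_left[OF x y \<xi>] J_right[OF x y \<xi>] act_facts[OF x] by simp

lemma J_family:
  assumes x: "x \<in> Obj D"
  shows "nak_family D x (Fo F x) (J x)"
  unfolding nak_family_def
proof (intro conjI ballI)
  fix y assume y: "y \<in> Obj D"
  show "J x y \<in> lin (hom_dual D x y) (Hom D y (Fo F x))"
    by (rule lin_to_D[OF y F_obj(1)[OF x]]) (use J_lin_C[OF x y] J_arr[OF x y] F_obj(2)[OF x] in simp_all)
  fix z h \<xi> assume "z \<in> Obj D" "h \<in> arr D y z" "\<xi> \<in> fnl D x z"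
  then show "Comp D (J x z \<xi>) h = J x y (transp (Hom D x y) (Comp D h) \<xi>)"
    using J_post[OF x y] by (simp add: D_comp)
qed

text \<open>
  A family on \<open>D\<close> is restricted to free bimodules and composed with the units \<open>Y \<rightarrow> fr Y\<close>. The resulting family
  on the underlying category factors through \<open>j\<close>, and it determines the given one since every bimodule \<open>y\<close> receives the
  action \<open>fr (und y) \<rightarrow> y\<close>, which the unit splits.
\<close>

lemma J_factor:
  assumes x: "x \<in> Obj D" and z: "z \<in> Obj D" and \<alpha>: "nak_family D x z \<alpha>"
  shows "\<exists>h. h \<in> arr C (Fo N (P x)) (und z) \<and>
    (\<forall>y\<in>Obj D. \<forall>\<xi>\<in>fnl D x y. h \<cdot> J x y \<xi> = \<alpha> y \<xi>)"
proof -
  note o = P_obj[OF x] und_obj[OF z]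
  define \<beta> where "\<beta> Y \<zeta> = \<alpha> (fr Y) (transp (Hom D x (fr Y)) (ti x Y) \<zeta>) \<cdot> raw (free_unit Y)" for Y \<zeta>
  have \<alpha>_lin: "\<alpha> y \<in> lin (hom_dual D x y) (Hom C (und y) (und z))" if "y \<in> Obj D" for y
    by (rule lin_of_D[OF that z nak_familyD(1)[OF \<alpha> that]])
  have ok\<alpha>: "ok (und y, \<alpha> y \<xi>, und z)" if "y \<in> Obj D" "\<xi> \<in> fnl D x y" for y \<xi>
    using linD(1)[OF \<alpha>_lin[OF that(1)] that(2)] that(1) z by (simp add: ok_typed)
  have "nak_family C (P x) (und z) \<beta>"
    unfolding nak_family_def
  proof (intro conjI ballI)
    fix Y assume Y: "Y \<in> Obj C"
    note f = fr_facts[OF Y]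
    have fu: "raw (free_unit Y) \<in> arr C Y (und (fr Y))" using okD(3)[OF free_unit_simps(3)[OF Y]] by (simp add: f)
    have t: "transp (Hom D x (fr Y)) (ti x Y) \<in> lin (hom_dual C (P x) Y) (hom_dual D x (fr Y))"
      by (rule transp_lin[OF ti_lin[OF x Y] D.hom_space[OF x f(1)] hom_space[OF o(1) Y]])
    show "\<beta> Y \<in> lin (hom_dual C (P x) Y) (Hom C Y (und z))"
      unfolding \<beta>_def
      by (rule lin_comp[OF lin_comp[OF t \<alpha>_lin[OF f(1)]] comp_lin_left[OF Y und_obj[OF f(1)] o(2) fu]])
    fix W h \<zeta> assume W: "W \<in> Obj C" and h: "h \<in> arr C Y W" and \<zeta>: "\<zeta> \<in> fnl C (P x) W"
    note fW = fr_facts[OF W] and \<xi> = ti_dual[OF x W \<zeta>]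
    let ?h = "(Y, h, W)" and ?\<xi> = "transp (Hom D x (fr W)) (ti x W) \<zeta>"
    have okh: "ok ?h" using h Y W by (simp add: ok_typed)
    have hD: "ea T (ea T' h) \<in> arr D (fr Y) (fr W)"
      using bilin_free[OF okh] by (simp add: arr_D f fW ap_def)
    have key: "ti x W (ea T (ea T' h) \<cdot> g) = h \<cdot> ti x Y g" if g: "g \<in> arr D x (fr Y)" for g
    proof -
      have tg: "ti x Y g \<in> arr C (P x) Y" by (rule linD(1)[OF ti_lin[OF x Y] g])
      have "ta x (h \<cdot> ti x Y g) = ea T (ea T' h) \<cdot> g"
        using ta_nat[OF x Y W tg h] ta_ti[OF x Y g] by simp
      then show ?thesis using ti_ta[OF x W comp_arr[OF o(1) Y W tg h]] by simp
    qed
    have lh: "(\<lambda>g. ea T (ea T' h) \<cdot> g) \<in> lin (Hom D x (fr Y)) (Hom D x (fr W))"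
      using D.comp_lin_right[OF x f(1) fW(1) hD] by (simp add: D_comp)
    have eq: "transp (Hom D x (fr Y)) (\<lambda>g. ea T (ea T' h) \<cdot> g) ?\<xi>
      = transp (Hom D x (fr Y)) (ti x Y) (transp (Hom C (P x) Y) (\<lambda>g. h \<cdot> g) \<zeta>)"
      unfolding transp_transp[OF lh] transp_transp[OF ti_lin[OF x Y]]
      by (rule transp_cong) (rule key)
    let ?a = "(und (fr W), \<alpha> (fr W) ?\<xi>, und z)"
    have "\<alpha> (fr W) ?\<xi> \<cdot> ea T (ea T' h) = \<alpha> (fr Y) (transp (Hom D x (fr Y)) (\<lambda>g. ea T (ea T' h) \<cdot> g) ?\<xi>)"
      using nak_familyD(2)[OF \<alpha> f(1) fW(1) hD \<xi>] by (simp add: D_comp)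
    then have ah: "?a ** ap T (ap T' ?h) = (und (fr Y), \<alpha> (fr Y) (transp (Hom D x (fr Y)) (ti x Y)
        (transp (Hom C (P x) Y) (\<lambda>g. h \<cdot> g) \<zeta>)), und z)"
      using f fW by (simp add: tcomp_def eq)
    have "(?a ** free_unit W) ** ?h = ?a ** (ap T (ap T' ?h) ** free_unit Y)"
      using ok\<alpha>[OF fW(1) \<xi>] okh Y W fW free_unit_nat[OF okh] by simp
    also have "\<dots> = (?a ** ap T (ap T' ?h)) ** free_unit Y"
      using ok\<alpha>[OF fW(1) \<xi>] okh Y W fW by simp
    finally have "(?a ** free_unit W) ** ?h = (?a ** ap T (ap T' ?h)) ** free_unit Y" .
    from arg_cong[OF this[unfolded ah], of raw]
    show "\<beta> W \<zeta> \<cdot> h = \<beta> Y (transp (Hom C (P x) Y) (\<lambda>g. h \<cdot> g) \<zeta>)" by (simp add: \<beta>_def)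
  qed
  from nak_universalD(3)[OF NK.j_universal[OF o(1)] o(2) this] obtain h where
    h: "h \<in> arr C (Fo N (P x)) (und z)"
      "\<forall>X\<in>Obj C. \<forall>\<xi>\<in>fnl C (P x) X. h \<cdot> j (P x) X \<xi> = \<beta> X \<xi>" by blast
  have "h \<cdot> J x y \<xi> = \<alpha> y \<xi>" if y: "y \<in> Obj D" and \<xi>: "\<xi> \<in> fnl D x y" for y \<xi>
  proof -
    note uy = und_obj[OF y] and f = fr_facts[OF und_obj[OF y]]
    let ?k = "raw (act2 (lt y) (rt y))" and ?\<zeta> = "transp (Hom C (P x) (und y)) (tr x y) \<xi>"
    have kD: "?k \<in> arr D (fr (und y)) y"
      using bilin_act2[OF bm[OF y]] act2_simps[OF bm[OF y]]
      by (simp add: arr_D f y typed_collapse)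
    have lk: "(\<lambda>g. ?k \<cdot> g) \<in> lin (Hom D x (fr (und y))) (Hom D x y)"
      using D.comp_lin_right[OF x f(1) y kD] by (simp add: D_comp)
    have "tr x y (ti x (und y) g) = ?k \<cdot> g" if g: "g \<in> arr D x (fr (und y))" for g
      using ta_ti[OF x uy g] by (simp add: tr_def)
    then have eq: "transp (Hom D x (fr (und y))) (ti x (und y)) ?\<zeta> = transp (Hom D x (fr (und y))) (\<lambda>g. ?k \<cdot> g) \<xi>"
      unfolding transp_transp[OF ti_lin[OF x uy]] by (intro transp_cong) simp
    have "h \<cdot> J x y \<xi> = \<beta> (und y) ?\<zeta>" using h(2) uy tr_dual[OF x y \<xi>] by (simp add: J_def)
    also have "\<dots> = (\<alpha> y \<xi> \<cdot> ?k) \<cdot> raw (free_unit (und y))"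
      unfolding \<beta>_def eq using nak_familyD(2)[OF \<alpha> f(1) y kD \<xi>] by (simp add: D_comp)
    also have "\<dots> = raw (((und y, \<alpha> y \<xi>, und z) ** act2 (lt y) (rt y)) ** free_unit (und y))" by simp
    also have "((und y, \<alpha> y \<xi>, und z) ** act2 (lt y) (rt y)) ** free_unit (und y)
      = (und y, \<alpha> y \<xi>, und z) ** (act2 (lt y) (rt y) ** free_unit (und y))"
      by (rule tassoc) (use ok\<alpha>[OF y \<xi>] act2_simps[OF bm[OF y]] y in simp_all)
    also have "\<dots> = (und y, \<alpha> y \<xi>, und z)" using act2_free_unit[OF bm[OF y]] ok\<alpha>[OF y \<xi>] by simp
    finally show ?thesis by simp
  qed
  with h(1) show ?thesis by blast
qed

lemma J_ext:
  assumes x: "x \<in> Obj D" and Z: "Z \<in> Obj C" and h: "h \<in> arr C (Fo N (P x)) Z" and k: "k \<in> arr C (Fo N (P x)) Z"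
    and eq: "\<And>y \<xi>. y \<in> Obj D \<Longrightarrow> \<xi> \<in> fnl D x y \<Longrightarrow> h \<cdot> J x y \<xi> = k \<cdot> J x y \<xi>"
  shows "h = k"
proof -
  have "(Fo N (P x), h, Z) = (Fo N (P x), k, Z)"
    by (rule joint_epi_ext[OF J_joint_epi[OF x]]) (use x Z h k eq in \<open>auto simp: ok_typed tcomp_def\<close>)
  then show ?thesis by simp
qed

lemma J_universal:
  assumes x: "x \<in> Obj D"
  shows "nak_universal D x (Fo F x) (J x)"
  unfolding nak_universal_def
proof (intro conjI ballI allI impI)
  show "Fo F x \<in> Obj D" by (rule F_obj[OF x])
  show "nak_family D x (Fo F x) (J x)" by (rule J_family[OF x])
  fix z \<alpha> assume z: "z \<in> Obj D" and \<alpha>: "nak_family D x z \<alpha>"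
  obtain h where h: "h \<in> arr C (Fo N (P x)) (und z)"
    "\<And>y \<xi>. y \<in> Obj D \<Longrightarrow> \<xi> \<in> fnl D x y \<Longrightarrow> h \<cdot> J x y \<xi> = \<alpha> y \<xi>"
    using J_factor[OF x z \<alpha>] by blast
  have hD: "h \<in> arr D (Fo F x) z"
    by (rule bilin_from_F[OF x z h(1)]) (use h(2) linD(1)[OF nak_familyD(1)[OF \<alpha>]] in simp)
  show "\<exists>!h. h \<in> arr D (Fo F x) z \<and> (\<forall>y\<in>Obj D. \<forall>\<xi>\<in>fnl D x y. Comp D h (J x y \<xi>) = \<alpha> y \<xi>)"
  proof (rule ex1I[of _ h])
    show "h \<in> arr D (Fo F x) z \<and> (\<forall>y\<in>Obj D. \<forall>\<xi>\<in>fnl D x y. Comp D h (J x y \<xi>) = \<alpha> y \<xi>)"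
      using hD h(2) by (simp add: D_comp)
    fix k assume k: "k \<in> arr D (Fo F x) z \<and> (\<forall>y\<in>Obj D. \<forall>\<xi>\<in>fnl D x y. Comp D k (J x y \<xi>) = \<alpha> y \<xi>)"
    show "k = h"
      by (rule J_ext[OF x und_obj[OF z] _ h(1)])
        (use k h(2) arr_D_C[OF F_obj(1)[OF x] z] F_obj(2)[OF x] in \<open>auto simp: D_comp\<close>)
  qed
qed

text \<open>Naturality of \<open>tr\<close> in its first argument.\<close>

lemma Nt_E_J:
  assumes x: "x \<in> Obj D" and y: "y \<in> Obj D" and z: "z \<in> Obj D" and f: "f \<in> arr D x y"
    and \<xi>: "\<xi> \<in> fnl D x z"
  shows "Fa F x y f \<cdot> J x z \<xi> = J y z (transp (Hom D y z) (\<lambda>h. h \<cdot> f) \<xi>)"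
proof -
  note e = E[OF x y f] and uz = und_obj[OF z] and o = P_obj[OF x] P_obj[OF y]
  have bf: "bilin (lt x) (rt x) (lt y) (rt y) (und x, f, und y)" using f by (simp add: arr_D x y)
  have key: "tr x z (h \<cdot> raw (E x y f)) = tr y z h \<cdot> f" if h: "h \<in> arr C (P y) (und z)" for h
  proof -
    let ?h = "(P y, h, und z)"
    have "tt (lt z) (rt z) (und x) (q x) (?h ** E x y f) = tt (lt z) (rt z) (und y) (q y) ?h ** (und x, f, und y)"
      using tt_pre[OF bm[OF x] tens[OF x] bm[OF y] tens[OF y] bm[OF z] bf _ _ _ _ ok_P[OF y uz h]] e by simp
    moreover have "?h ** E x y f = (P x, h \<cdot> raw (E x y f), und z)"
      by (rule typed_eqI) (simp_all add: e)
    ultimately show ?thesis by (simp add: tr_typed z tcomp_def)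
  qed
  have lE: "(\<lambda>h. h \<cdot> raw (E x y f)) \<in> lin (Hom C (P y) (und z)) (Hom C (P x) (und z))"
    by (rule comp_lin_left[OF o uz]) (use e okD(3)[of "E x y f"] in simp)
  have "transp (Hom C (P y) (und z)) (\<lambda>h. h \<cdot> raw (E x y f)) (transp (Hom C (P x) (und z)) (tr x z) \<xi>)
    = transp (Hom C (P y) (und z)) (tr y z) (transp (Hom D y z) (\<lambda>h. h \<cdot> f) \<xi>)"
    unfolding transp_transp[OF lE] transp_transp[OF tr_lin[OF y z]]
    by (rule transp_cong) (rule key)
  then have "NK.Nt (E x y f) ** NK.jt (P x) (und z) (transp (Hom C (P x) (und z)) (tr x z) \<xi>)
    = NK.jt (P y) (und z) (transp (Hom C (P y) (und z)) (tr y z) (transp (Hom D y z) (\<lambda>h. h \<cdot> f) \<xi>))"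
    using NK.Nt_jt[of "E x y f" "P x" "und z", OF _ _ uz tr_dual[OF x z \<xi>]] e by simp
  from arg_cong[OF this, of raw] show ?thesis using e by (simp add: J_def Fa_F[OF x y f])
qed

lemma F_arr:
  assumes x: "x \<in> Obj D" and y: "y \<in> Obj D" and f: "f \<in> arr D x y"
  shows "Fa F x y f \<in> arr D (Fo F x) (Fo F y)"
proof (rule bilin_from_F[OF x F_obj(1)[OF y]])
  show "Fa F x y f \<in> arr C (Fo N (P x)) (und (Fo F y))"
    using E[OF x y f] okD(3)[OF NK.ok_Nt, of "E x y f"] by (simp add: Fa_F[OF x y f] F_obj(2)[OF y])
  fix z \<xi> assume z: "z \<in> Obj D" and \<xi>: "\<xi> \<in> fnl D x z"
  have "transp (Hom D y z) (\<lambda>h. h \<cdot> f) \<xi> \<in> fnl D y z"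
    using linD(1)[OF transp_lin[OF D.comp_lin_left[OF x y z f] D.hom_space[OF y z] D.hom_space[OF x z]] \<xi>]
    by (simp add: D_comp)
  then show "Fa F x y f \<cdot> J x z \<xi> \<in> arr D z (Fo F y)"
    unfolding Nt_E_J[OF x y z f \<xi>] by (rule J_arr[OF y z])
qed

theorem nakayama_of_bimodules: "nakayama_given_by D F"
proof -
  have co: "\<exists>P u. is_copower D (hom_dual D x y) z P u" if x: "x \<in> Obj D" and y: "y \<in> Obj D" and z: "z \<in> Obj D" for x y z
  proof -
    have "finite_coords (Hom D x y)"
      by (subst Hom_D[OF x y], rule finite_coords_subspace[OF _ subspace_D[OF x y]])
        (use fin x y in \<open>simp add: finite_homs_def\<close>)
    then have "finite_coords (hom_dual D x y)" by (rule finite_coords_dual[OF D.hom_space[OF x y]])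
    from copowers[OF vector_space_on_dual[OF D.hom_space[OF x y]] this und_obj[OF z]] copower_D[OF z]
    show ?thesis by blast
  qed
  interpret DC: copowered_category D
    by (intro copowered_category.intro copowered_category_axioms.intro lin_category_D co)
  have "nak_functor D F J"
    by (rule D.nak_functorI[OF J_universal F_arr]) (simp_all add: D_comp Nt_E_J)
  then show ?thesis by (rule DC.nakayama_given_byI)
qed

end

section \<open>Actions of monoidal categories\<close>

text \<open>
  The tensor product and the action enter as parameters, so that right module categories are
  covered as left ones over the category with the reversed tensor product.
\<close>

locale monoidal_action = lin_category M + CT: bilin_bifunctor C C C to ta + AC: bilin_bifunctor C M M lo la
  for C :: "('c, 'd, 'k::field, 'y) lcat_scheme" and M :: "('o, 'm, 'k, 'z) lcat_scheme" (structure)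
    and to :: "'c \<Rightarrow> 'c \<Rightarrow> 'c" and ta :: "'d \<Rightarrow> 'd \<Rightarrow> 'd"
    and lo :: "'c \<Rightarrow> 'o \<Rightarrow> 'o" and la :: "'d \<Rightarrow> 'm \<Rightarrow> 'm" +
  fixes I :: 'c
  assumes I_obj: "I \<in> Obj C" and to_unit: "X \<in> Obj C \<Longrightarrow> to I X = X" "X \<in> Obj C \<Longrightarrow> to X I = X"
    and to_assoc: "X \<in> Obj C \<Longrightarrow> Y \<in> Obj C \<Longrightarrow> Z \<in> Obj C \<Longrightarrow> to (to X Y) Z = to X (to Y Z)"
    and lo_unit: "U \<in> Obj M \<Longrightarrow> lo I U = U"
    and lo_to: "X \<in> Obj C \<Longrightarrow> Y \<in> Obj C \<Longrightarrow> U \<in> Obj M \<Longrightarrow> lo (to X Y) U = lo X (lo Y U)"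
    and la_unit: "U \<in> Obj M \<Longrightarrow> V \<in> Obj M \<Longrightarrow> h \<in> arr M U V \<Longrightarrow> la (Id C I) h = h"
    and la_ta: "\<lbrakk>X \<in> Obj C; X' \<in> Obj C; Y \<in> Obj C; Y' \<in> Obj C; U \<in> Obj M; V \<in> Obj M;
      f \<in> arr C X X'; g \<in> arr C Y Y'; h \<in> arr M U V\<rbrakk> \<Longrightarrow> la (ta f g) h = la f (la g h)"
begin

abbreviation ccomp (infixr "\<star>" 55) where "g \<star> f \<equiv> g \<cdot>\<^bsub>C\<^esub> f"

definition by_obj :: "'c \<Rightarrow> ('o, 'm) endo" where
  "by_obj X = \<lparr>eo = lo X, ea = la (Id C X)\<rparr>"

text \<open>
  Arrows of \<open>C\<close> act as natural transformations between the functors \<open>by_obj\<close>.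
\<close>

definition nt :: "'d \<Rightarrow> 'o \<Rightarrow> 'm" where
  "nt f U = la f (Id M U)"

lemma by_obj_simps: "eo (by_obj X) U = lo X U" "ea (by_obj X) h = la (Id C X) h"
  by (simp_all add: by_obj_def)

lemma endofunctor_by_obj:
  assumes X: "X \<in> Obj C"
  shows "endofunctor M (by_obj X)"
proof (intro endofunctor.intro endofunctor_axioms.intro lin_category_axioms)
  show "eo (by_obj X) U \<in> Obj M" if "U \<in> Obj M" for U
    using AC.bo_obj[OF X that] by (simp add: by_obj_def)
  show "ea (by_obj X) \<in> lin (Hom M U V) (Hom M (eo (by_obj X) U) (eo (by_obj X) V))"
    if "U \<in> Obj M" "V \<in> Obj M" for U V
    using AC.ba_lin_right[OF X X that CT.one.id_arr[OF X]] by (simp add: by_obj_def)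
  show "ea (by_obj X) (Id M U) = Id M (eo (by_obj X) U)" if "U \<in> Obj M" for U
    using AC.ba_id[OF X that] by (simp add: by_obj_def)
  show "ea (by_obj X) (g \<cdot> f) = ea (by_obj X) g \<cdot> ea (by_obj X) f"
    if "U \<in> Obj M" "V \<in> Obj M" "W \<in> Obj M" "f \<in> arr M U V" "g \<in> arr M V W" for U V W f g
    using AC.ba_comp[OF X X X that(1-3) CT.one.id_arr[OF X] CT.one.id_arr[OF X] that(4,5)]
      CT.one.id_left[OF X X CT.one.id_arr[OF X]] by (simp add: by_obj_def)
qed

lemma nt_arr: "X \<in> Obj C \<Longrightarrow> Y \<in> Obj C \<Longrightarrow> f \<in> arr C X Y \<Longrightarrow> U \<in> Obj M \<Longrightarrow> nt f U \<in> arr M (lo X U) (lo Y U)"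
  unfolding nt_def by (rule AC.ba_arr) (simp_all add: id_arr)

lemma nt_comp:
  assumes "X \<in> Obj C" "Y \<in> Obj C" "Z \<in> Obj C" "f \<in> arr C X Y" "g \<in> arr C Y Z" "U \<in> Obj M"
  shows "nt (g \<star> f) U = nt g U \<cdot> nt f U"
  using AC.ba_comp[OF assms(1-3) assms(6,6,6) assms(4,5) id_arr[OF assms(6)] id_arr[OF assms(6)]]
    id_left[OF assms(6,6) id_arr[OF assms(6)]] by (simp add: nt_def)

lemma nt_id: "X \<in> Obj C \<Longrightarrow> U \<in> Obj M \<Longrightarrow> nt (Id C X) U = Id M (lo X U)"
  by (simp add: nt_def AC.ba_id)

lemma nt_left:
  assumes "X \<in> Obj C" "Y \<in> Obj C" "Z \<in> Obj C" "f \<in> arr C X Y" "U \<in> Obj M"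
  shows "nt (ta f (Id C Z)) U = nt f (lo Z U)"
  using la_ta[OF assms(1,2,3,3,5,5) assms(4) CT.one.id_arr[OF assms(3)] id_arr[OF assms(5)]] assms
  by (simp add: nt_def AC.ba_id)

lemma nt_right:
  assumes "X \<in> Obj C" "Y \<in> Obj C" "Z \<in> Obj C" "f \<in> arr C X Y" "U \<in> Obj M"
  shows "nt (ta (Id C Z) f) U = ea (by_obj Z) (nt f U)"
  using la_ta[OF assms(3,3,1,2,5,5) CT.one.id_arr[OF assms(3)] assms(4) id_arr[OF assms(5)]]
  by (simp add: nt_def by_obj_def)

lemma nt_nat:
  assumes "X \<in> Obj C" "Y \<in> Obj C" "f \<in> arr C X Y" "U \<in> Obj M" "V \<in> Obj M" "h \<in> arr M U V"
  shows "nt f V \<cdot> ea (by_obj X) h = ea (by_obj Y) h \<cdot> nt f U"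
  using AC.ba_comp[OF assms(1,1,2) assms(4,5,5) CT.one.id_arr[OF assms(1)] assms(3,6) id_arr[OF assms(5)]]
    AC.ba_comp[OF assms(1,2,2) assms(4,4,5) assms(3) CT.one.id_arr[OF assms(2)] id_arr[OF assms(4)] assms(6)]
    CT.one.id_right[OF assms(1-3)] CT.one.id_left[OF assms(1-3)] id_left[OF assms(4-6)] id_right[OF assms(4-6)]
  by (simp add: nt_def by_obj_def)

lemma by_to: "X \<in> Obj C \<Longrightarrow> Y \<in> Obj C \<Longrightarrow> U \<in> Obj M \<Longrightarrow> V \<in> Obj M \<Longrightarrow> h \<in> arr M U V \<Longrightarrow>
    ea (by_obj (to X Y)) h = ea (by_obj X) (ea (by_obj Y) h)"
  using la_ta[OF _ _ _ _ _ _ CT.one.id_arr CT.one.id_arr, of X Y U V h] CT.ba_id[of X Y]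
  by (simp add: by_obj_def)

lemma by_unit: "U \<in> Obj M \<Longrightarrow> V \<in> Obj M \<Longrightarrow> h \<in> arr M U V \<Longrightarrow> ea (by_obj I) h = h"
  by (simp add: by_obj_def la_unit)

definition dual_pair :: "'c \<Rightarrow> 'c \<Rightarrow> 'd \<Rightarrow> 'd \<Rightarrow> bool" where
  "dual_pair X Y el cv \<longleftrightarrow> X \<in> Obj C \<and> Y \<in> Obj C \<and> el \<in> arr C (to Y X) I \<and> cv \<in> arr C I (to X Y) \<and>
     ta (Id C X) el \<star> ta cv (Id C X) = Id C X \<and> ta el (Id C Y) \<star> ta (Id C Y) cv = Id C Y"

lemma adjunction_dual_pair:
  assumes d: "dual_pair X Y el cv"
  shows "adjunction M (by_obj Y) (by_obj X) (nt cv) (nt el)"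
proof -
  have X: "X \<in> Obj C" and Y: "Y \<in> Obj C" and el: "el \<in> arr C (to Y X) I" and cv: "cv \<in> arr C I (to X Y)"
    and z1: "ta (Id C X) el \<star> ta cv (Id C X) = Id C X" and z2: "ta el (Id C Y) \<star> ta (Id C Y) cv = Id C Y"
    using d by (simp_all add: dual_pair_def)
  note o = CT.bo_obj[OF X Y] CT.bo_obj[OF Y X]
  have lo: "lo X U \<in> Obj M" "lo Y U \<in> Obj M" if "U \<in> Obj M" for U using AC.bo_obj X Y that by simp_all
  have a1: "ta cv (Id C X) \<in> arr C X (to X (to Y X))"
    using CT.ba_arr[OF I_obj o(1) X X cv CT.one.id_arr[OF X]] X Y by (simp add: to_unit to_assoc)
  have a2: "ta (Id C X) el \<in> arr C (to X (to Y X)) X"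
    using CT.ba_arr[OF X X o(2) I_obj CT.one.id_arr[OF X] el] X by (simp add: to_unit)
  have b1: "ta (Id C Y) cv \<in> arr C Y (to Y (to X Y))"
    using CT.ba_arr[OF Y Y I_obj o(1) CT.one.id_arr[OF Y] cv] Y by (simp add: to_unit)
  have b2: "ta el (Id C Y) \<in> arr C (to Y (to X Y)) Y"
    using CT.ba_arr[OF o(2) I_obj Y Y el CT.one.id_arr[OF Y]] X Y by (simp add: to_unit to_assoc)
  show ?thesis
  proof (intro adjunction.intro adjunction_axioms.intro lin_category_axioms endofunctor_by_obj X Y)
    fix U assume U: "U \<in> Obj M"
    show "nt cv U \<in> arr M U (eo (by_obj X) (eo (by_obj Y) U))"
      using nt_arr[OF I_obj o(1) cv U] U X Y by (simp add: lo_unit lo_to by_obj_simps)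
    show "nt el U \<in> arr M (eo (by_obj Y) (eo (by_obj X) U)) U"
      using nt_arr[OF o(2) I_obj el U] U X Y by (simp add: lo_unit lo_to by_obj_simps)
    show "ea (by_obj X) (nt el U) \<cdot> nt cv (eo (by_obj X) U) = Id M (eo (by_obj X) U)"
      using nt_comp[OF X CT.bo_obj[OF X o(2)] X a1 a2 U] nt_right[OF o(2) I_obj X el U] nt_left[OF I_obj o(1) X cv U]
        nt_id[OF X U] z1 by (simp add: by_obj_simps)
    show "nt el (eo (by_obj Y) U) \<cdot> ea (by_obj Y) (nt cv U) = Id M (eo (by_obj Y) U)"
      using nt_comp[OF Y CT.bo_obj[OF Y o(1)] Y b1 b2 U] nt_right[OF I_obj o(1) Y cv U] nt_left[OF o(2) I_obj Y el U]
        nt_id[OF Y U] z2 by (simp add: by_obj_simps)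
  next
    fix U V h assume U: "U \<in> Obj M" and V: "V \<in> Obj M" and h: "h \<in> arr M U V"
    show "nt cv V \<cdot> h = ea (by_obj X) (ea (by_obj Y) h) \<cdot> nt cv U"
      using nt_nat[OF I_obj o(1) cv U V h] by (simp add: by_unit[OF U V h] by_to[OF X Y U V h])
    show "nt el V \<cdot> ea (by_obj Y) (ea (by_obj X) h) = h \<cdot> nt el U"
      using nt_nat[OF o(2) I_obj el U V h] by (simp add: by_unit[OF U V h] by_to[OF Y X U V h])
  qed
qed

end

text \<open>
  An algebra \<open>a\<close> with \<open>a1 = a\<^sup>\<or>\<close>, \<open>a2 = a\<^sup>\<or>\<^sup>\<or>\<close> and \<open>a0 = \<^sup>\<or>a\<close> for left modules; for right modules the
  roles of left and right duals are exchanged.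
\<close>

locale dual_algebra_action = monoidal_action C M to ta lo la I
  for C :: "('c, 'd, 'k::field, 'y) lcat_scheme" and M :: "('o, 'm, 'k, 'z) lcat_scheme" (structure)
    and to :: "'c \<Rightarrow> 'c \<Rightarrow> 'c" and ta :: "'d \<Rightarrow> 'd \<Rightarrow> 'd"
    and lo :: "'c \<Rightarrow> 'o \<Rightarrow> 'o" and la :: "'d \<Rightarrow> 'm \<Rightarrow> 'm" and I :: 'c +
  fixes a a1 a2 a0 :: 'c and el cv ev1 cv1 ev0 cv0 m u :: 'd
  assumes dp: "dual_pair a a1 el cv" and dp1: "dual_pair a1 a2 ev1 cv1" and dp0: "dual_pair a0 a ev0 cv0"
    and m: "m \<in> arr C (to a a) a" and u: "u \<in> arr C I a"
    and assoc: "m \<star> ta m (Id C a) = m \<star> ta (Id C a) m"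
    and unit_l: "m \<star> ta u (Id C a) = Id C a" and unit_r: "m \<star> ta (Id C a) u = Id C a"
begin

lemma duals_in: "a \<in> Obj C" "a1 \<in> Obj C" "a2 \<in> Obj C"
    "el \<in> arr C (to a1 a) I" "cv \<in> arr C I (to a a1)" "ev1 \<in> arr C (to a2 a1) I"
  using dp dp1 by (simp_all add: dual_pair_def)

lemma adjoint_monad_act: "adjoint_monad M (by_obj a) (by_obj a1) (by_obj a2) (by_obj a0)
    (nt cv) (nt el) (nt cv1) (nt ev1) (nt cv0) (nt ev0) (nt m) (nt u)"
proof (intro adjoint_monad.intro adjoint_monad_axioms.intro lin_category_axioms
    adjunction_dual_pair dp dp1 dp0)
  note A = duals_in(1) and aa = CT.bo_obj[OF duals_in(1) duals_in(1)] and ia = CT.one.id_arr[OF duals_in(1)]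
  have m1: "ta m (Id C a) \<in> arr C (to a (to a a)) (to a a)"
    using CT.ba_arr[OF aa A A A m ia] A by (simp add: to_assoc)
  have m2: "ta (Id C a) m \<in> arr C (to a (to a a)) (to a a)" using CT.ba_arr[OF A A aa A ia m] .
  have u1: "ta u (Id C a) \<in> arr C a (to a a)" using CT.ba_arr[OF I_obj A A A u ia] A by (simp add: to_unit)
  have u2: "ta (Id C a) u \<in> arr C a (to a a)" using CT.ba_arr[OF A A I_obj A ia u] A by (simp add: to_unit)
  fix U assume U: "U \<in> Obj M"
  show "nt m U \<in> arr M (eo (by_obj a) (eo (by_obj a) U)) (eo (by_obj a) U)"
    using nt_arr[OF aa A m U] A U by (simp add: by_obj_simps lo_to)
  show "nt u U \<in> arr M U (eo (by_obj a) U)"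
    using nt_arr[OF I_obj A u U] U by (simp add: by_obj_simps lo_unit)
  show "nt m U \<cdot> ea (by_obj a) (nt m U) = nt m U \<cdot> nt m (eo (by_obj a) U)"
    using nt_comp[OF CT.bo_obj[OF A aa] aa A m1 m U] nt_comp[OF CT.bo_obj[OF A aa] aa A m2 m U]
      nt_left[OF aa A A m U] nt_right[OF aa A A m U] assoc by (simp add: by_obj_simps)
  show "nt m U \<cdot> nt u (eo (by_obj a) U) = Id M (eo (by_obj a) U)"
    using nt_comp[OF A aa A u1 m U] nt_left[OF I_obj A A u U] unit_l nt_id[OF A U] by (simp add: by_obj_simps)
  show "nt m U \<cdot> ea (by_obj a) (nt u U) = Id M (eo (by_obj a) U)"
    using nt_comp[OF A aa A u2 m U] nt_right[OF I_obj A A u U] unit_r nt_id[OF A U] by (simp add: by_obj_simps)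
next
  note A = duals_in(1) and aa = CT.bo_obj[OF duals_in(1) duals_in(1)]
  fix U V h assume U: "U \<in> Obj M" and V: "V \<in> Obj M" and h: "h \<in> arr M U V"
  show "nt m V \<cdot> ea (by_obj a) (ea (by_obj a) h) = ea (by_obj a) h \<cdot> nt m U"
    using nt_nat[OF aa A m U V h] by (simp add: by_to[OF A A U V h])
  show "nt u V \<cdot> h = ea (by_obj a) h \<cdot> nt u U"
    using nt_nat[OF I_obj A u U V h] by (simp add: by_unit[OF U V h])
qed

sublocale AM: adjoint_monad M "by_obj a" "by_obj a1" "by_obj a2" "by_obj a0"
    "nt cv" "nt el" "nt cv1" "nt ev1" "nt cv0" "nt ev0" "nt m" "nt u"
  by (rule adjoint_monad_act)

text \<open>
  The right action on \<open>a1\<close>, the dual of the multiplication, and the left action of \<open>a2\<close> on \<open>a1\<close>. On the objects of \<open>M\<close> they act as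
  \<open>AM.ract\<close>, \<open>AM.comu\<close> and \<open>AM.lact\<close>, because strictness turns each tensor factor into a functor or a natural transformation.
\<close>

definition dual_ract :: 'd where
  "dual_ract = ta el (Id C a1) \<star> (ta (Id C a1) (ta m (Id C a1)) \<star> ta (Id C a1) (ta (Id C a) cv))"

definition dual_comu :: 'd where
  "dual_comu = ta el (Id C (to a1 a1)) \<star> (ta (Id C a1) (ta m (Id C (to a1 a1))) \<star>
     ta (Id C a1) (ta (Id C a) (ta cv (Id C a1)) \<star> cv))"

definition dual_lact :: 'd where
  "dual_lact = ta ev1 (Id C a1) \<star> ta (Id C a2) dual_comu"

lemma objs: "to a a \<in> Obj C" "to a1 a \<in> Obj C" "to a a1 \<in> Obj C" "to a1 a1 \<in> Obj C" "to a2 a1 \<in> Obj C"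
  using CT.bo_obj duals_in by simp_all

lemma dual_ract:
  shows "dual_ract \<in> arr C (to a1 a) a1" and "U \<in> Obj M \<Longrightarrow> nt dual_ract U = raw (AM.ract U)"
proof -
  note A = duals_in(1-3) and i = CT.one.id_arr[OF duals_in(1)] CT.one.id_arr[OF duals_in(2)]
  have f1: "ta (Id C a) cv \<in> arr C a (to a (to a a1))"
    using CT.ba_arr[OF A(1,1) I_obj objs(3) i(1) duals_in(5)] A by (simp add: to_unit)
  have f2: "ta (Id C a1) (ta (Id C a) cv) \<in> arr C (to a1 a) (to a1 (to a (to a a1)))"
    by (rule CT.ba_arr[OF A(2,2,1) CT.bo_obj[OF A(1) objs(3)] i(2) f1])
  have g1: "ta m (Id C a1) \<in> arr C (to a (to a a1)) (to a a1)"
    using CT.ba_arr[OF objs(1) A(1,2,2) m i(2)] A by (simp add: to_assoc)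
  have g2: "ta (Id C a1) (ta m (Id C a1)) \<in> arr C (to a1 (to a (to a a1))) (to a1 (to a a1))"
    by (rule CT.ba_arr[OF A(2,2) CT.bo_obj[OF A(1) objs(3)] objs(3) i(2) g1])
  have h: "ta el (Id C a1) \<in> arr C (to a1 (to a a1)) a1"
    using CT.ba_arr[OF objs(2) I_obj A(2,2) duals_in(4) i(2)] A by (simp add: to_assoc to_unit)
  note o = CT.bo_obj[OF A(2) CT.bo_obj[OF A(1) objs(3)]] CT.bo_obj[OF A(2) objs(3)]
  have gf: "ta (Id C a1) (ta m (Id C a1)) \<star> ta (Id C a1) (ta (Id C a) cv) \<in> arr C (to a1 a) (to a1 (to a a1))"
    by (rule CT.one.comp_arr[OF objs(2) o f2 g2])
  show "dual_ract \<in> arr C (to a1 a) a1"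
    unfolding dual_ract_def by (rule CT.one.comp_arr[OF objs(2) o(2) A(2) gf h])
  assume U: "U \<in> Obj M"
  have lo: "lo a1 U \<in> Obj M" using AC.bo_obj A U by simp
  have t: "nt m (lo a1 U) \<in> arr M (lo a (lo a (lo a1 U))) (lo a (lo a1 U))"
      "ea (by_obj a) (nt cv U) \<in> arr M (lo a U) (lo a (lo a (lo a1 U)))"
    using AM.m_arr[OF lo] linD(1)[OF AM.LT.R.ea_lin AM.LT.c_arr[OF U]] U lo AM.LT.objs
    by (simp_all add: by_obj_simps)
  have "nt dual_ract U = nt (ta el (Id C a1)) U \<cdot> (nt (ta (Id C a1) (ta m (Id C a1))) U \<cdot>
      nt (ta (Id C a1) (ta (Id C a) cv)) U)"
    unfolding dual_ract_def nt_comp[OF objs(2) o(2) A(2) gf h U] nt_comp[OF objs(2) o f2 g2 U] ..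
  also have "\<dots> = nt el (lo a1 U) \<cdot> (ea (by_obj a1) (nt m (lo a1 U)) \<cdot> ea (by_obj a1) (ea (by_obj a) (nt cv U)))"
    by (simp only: nt_left[OF objs(2) I_obj A(2) duals_in(4) U] nt_right[OF CT.bo_obj[OF A(1) objs(3)] objs(3) A(2) g1 U]
      nt_left[OF objs(1) A(1,2) m U] nt_right[OF A(1) CT.bo_obj[OF A(1) objs(3)] A(2) f1 U]
      nt_right[OF I_obj objs(3) A(1) duals_in(5) U])
  also have "\<dots> = raw (AM.ract U)"
    using AM.LT.L.ea_comp[OF _ _ _ t(2,1)] lo U AC.bo_obj A by (simp add: AM.ract_def by_obj_simps)
  finally show "nt dual_ract U = raw (AM.ract U)" .
qed

lemma dual_comu:
  shows "dual_comu \<in> arr C a1 (to a1 a1)" and "U \<in> Obj M \<Longrightarrow> nt dual_comu U = raw (AM.comu U)"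
proof -
  note A = duals_in(1-3) and i = CT.one.id_arr[OF duals_in(1)] CT.one.id_arr[OF duals_in(2)] CT.one.id_arr[OF objs(4)]
  let ?aa = "to a1 a1"
  note o = CT.bo_obj[OF A(1) objs(4)]
  note oo = CT.bo_obj[OF A(1) o]
  note o1 = CT.bo_obj[OF A(2) o] and oo1 = CT.bo_obj[OF A(2) oo]
  have c1: "ta cv (Id C a1) \<in> arr C a1 (to a ?aa)"
    using CT.ba_arr[OF I_obj objs(3) A(2,2) duals_in(5) i(2)] A by (simp add: to_unit to_assoc)
  have c2: "ta (Id C a) (ta cv (Id C a1)) \<in> arr C (to a a1) (to a (to a ?aa))"
    by (rule CT.ba_arr[OF A(1,1,2) o i(1) c1])
  have c3: "ta (Id C a) (ta cv (Id C a1)) \<star> cv \<in> arr C I (to a (to a ?aa))"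
    by (rule CT.one.comp_arr[OF I_obj objs(3) oo duals_in(5) c2])
  have f2: "ta (Id C a1) (ta (Id C a) (ta cv (Id C a1)) \<star> cv) \<in> arr C a1 (to a1 (to a (to a ?aa)))"
    using CT.ba_arr[OF A(2,2) I_obj oo i(2) c3] A by (simp add: to_unit)
  have g1: "ta m (Id C ?aa) \<in> arr C (to a (to a ?aa)) (to a ?aa)"
    using CT.ba_arr[OF objs(1) A(1) objs(4) objs(4) m i(3)] A objs by (simp add: to_assoc)
  have g2: "ta (Id C a1) (ta m (Id C ?aa)) \<in> arr C (to a1 (to a (to a ?aa))) (to a1 (to a ?aa))"
    by (rule CT.ba_arr[OF A(2,2) oo o i(2) g1])
  have h: "ta el (Id C ?aa) \<in> arr C (to a1 (to a ?aa)) ?aa"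
    using CT.ba_arr[OF objs(2) I_obj objs(4) objs(4) duals_in(4) i(3)] A objs by (simp add: to_assoc to_unit)
  have gf: "ta (Id C a1) (ta m (Id C ?aa)) \<star> ta (Id C a1) (ta (Id C a) (ta cv (Id C a1)) \<star> cv)
      \<in> arr C a1 (to a1 (to a ?aa))"
    by (rule CT.one.comp_arr[OF A(2) oo1 o1 f2 g2])
  show "dual_comu \<in> arr C a1 (to a1 a1)"
    unfolding dual_comu_def by (rule CT.one.comp_arr[OF A(2) o1 objs(4) gf h])
  assume U: "U \<in> Obj M"
  have lo: "lo a1 U \<in> Obj M" "lo a1 (lo a1 U) \<in> Obj M" using AC.bo_obj A U by simp_all
  have loaa: "lo ?aa U = lo a1 (lo a1 U)" using A U by (simp add: lo_to)
  have t: "nt m (lo a1 (lo a1 U)) \<in> arr M (lo a (lo a (lo a1 (lo a1 U)))) (lo a (lo a1 (lo a1 U)))"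
      "ea (by_obj a) (nt cv (lo a1 U)) \<in> arr M (lo a (lo a1 U)) (lo a (lo a (lo a1 (lo a1 U))))"
      "nt cv U \<in> arr M U (lo a (lo a1 U))"
    using AM.m_arr[OF lo(2)] linD(1)[OF AM.LT.R.ea_lin AM.LT.c_arr[OF lo(1)]] AM.LT.c_arr[OF U] U lo AM.LT.objs
    by (simp_all add: by_obj_simps)
  have oM: "lo a (lo a (lo a1 (lo a1 U))) \<in> Obj M" "lo a (lo a1 (lo a1 U)) \<in> Obj M" "lo a (lo a1 U) \<in> Obj M"
    using AC.bo_obj A lo by simp_all
  note t3 = comp_arr[OF U oM(3,1) t(3,2)]
  have "nt dual_comu U = nt (ta el (Id C ?aa)) U \<cdot> (nt (ta (Id C a1) (ta m (Id C ?aa))) U \<cdot>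
      nt (ta (Id C a1) (ta (Id C a) (ta cv (Id C a1)) \<star> cv)) U)"
    unfolding dual_comu_def nt_comp[OF A(2) o1 objs(4) gf h U] nt_comp[OF A(2) oo1 o1 f2 g2 U] ..
  also have "\<dots> = nt el (lo a1 (lo a1 U)) \<cdot> (ea (by_obj a1) (nt m (lo a1 (lo a1 U))) \<cdot>
      ea (by_obj a1) (ea (by_obj a) (nt cv (lo a1 U)) \<cdot> nt cv U))"
    by (simp only: nt_left[OF objs(2) I_obj objs(4) duals_in(4) U] nt_right[OF oo o A(2) g1 U]
      nt_left[OF objs(1) A(1) objs(4) m U] nt_right[OF I_obj oo A(2) c3 U] nt_comp[OF I_obj objs(3) oo duals_in(5) c2 U]
      nt_right[OF A(2) o A(1) c1 U] nt_left[OF I_obj objs(3) A(2) duals_in(5) U] loaa)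
  also have "\<dots> = raw (AM.comu U)"
    using AM.LT.L.ea_comp[OF U oM(1,2) t3 t(1)] by (simp add: AM.comu_def by_obj_simps)
  finally show "nt dual_comu U = raw (AM.comu U)" .
qed

lemma dual_lact:
  shows "dual_lact \<in> arr C (to a2 a1) a1" and "U \<in> Obj M \<Longrightarrow> nt dual_lact U = raw (AM.lact U)"
proof -
  note A = duals_in(1-3) and i = CT.one.id_arr[OF duals_in(2)] CT.one.id_arr[OF duals_in(3)]
  have f: "ta (Id C a2) dual_comu \<in> arr C (to a2 a1) (to a2 (to a1 a1))"
    by (rule CT.ba_arr[OF A(3,3,2) objs(4) i(2) dual_comu(1)])
  have g: "ta ev1 (Id C a1) \<in> arr C (to a2 (to a1 a1)) a1"
    using CT.ba_arr[OF objs(5) I_obj A(2,2) duals_in(6) i(1)] A by (simp add: to_assoc to_unit)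
  show "dual_lact \<in> arr C (to a2 a1) a1"
    unfolding dual_lact_def by (rule CT.one.comp_arr[OF objs(5) CT.bo_obj[OF A(3) objs(4)] A(2) f g])
  assume U: "U \<in> Obj M"
  have "nt dual_lact U = nt (ta ev1 (Id C a1)) U \<cdot> nt (ta (Id C a2) dual_comu) U"
    unfolding dual_lact_def by (rule nt_comp[OF objs(5) CT.bo_obj[OF A(3) objs(4)] A(2) f g U])
  also have "\<dots> = raw (AM.lact U)"
    by (simp add: nt_left[OF objs(5) I_obj A(2) duals_in(6) U] nt_right[OF A(2) objs(4) A(3) dual_comu(1) U]
      dual_comu(2)[OF U] AM.lact_def by_obj_simps)
  finally show "nt dual_lact U = raw (AM.lact U)" .
qed

end

section \<open>The identity monad\<close>

definition id_endo :: "('o, 'm) endo" where "id_endo = \<lparr>eo = (\<lambda>X. X), ea = (\<lambda>f. f)\<rparr>"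

lemma id_endo_simps [simp]: "eo id_endo X = X" "ea id_endo f = f"
  by (simp_all add: id_endo_def)

lemma ap_id_endo [simp]: "ap id_endo f = f"
  by (cases f) (simp add: ap_def)

context lin_category
begin

lemma endofunctor_id: "endofunctor C id_endo"
  by (intro endofunctor.intro endofunctor_axioms.intro lin_category_axioms) (auto intro: linI)

lemma adjunction_id: "adjunction C id_endo id_endo (Id C) (Id C)"
  by (intro adjunction.intro adjunction_axioms.intro lin_category_axioms endofunctor_id)
    (simp_all add: id_arr id_left id_right)

lemma adjoint_monad_id: "adjoint_monad C id_endo id_endo id_endo id_endo
    (Id C) (Id C) (Id C) (Id C) (Id C) (Id C) (Id C) (Id C)"
  by (intro adjoint_monad.intro adjoint_monad_axioms.intro lin_category_axioms adjunction_id)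
    (simp_all add: id_arr id_left id_right)

end

locale identity_monad = lin_category C for C :: "('o, 'm, 'k::field, 'z) lcat_scheme" (structure)
begin

sublocale IM: adjoint_monad C id_endo id_endo id_endo id_endo "Id C" "Id C" "Id C" "Id C" "Id C" "Id C" "Id C" "Id C"
  by (rule adjoint_monad_id)

lemma IM_simps: "X \<in> Obj C \<Longrightarrow> IM.ract X = tid X" "X \<in> Obj C \<Longrightarrow> IM.lact X = tid X"
  "IM.mu X = tid X" "IM.eta X = tid X" "IM.LT.unit X = tid X" "IM.LT.counit X = tid X"
proof -
  show 1: "IM.mu X = tid X" "IM.eta X = tid X" "IM.LT.unit X = tid X" "IM.LT.counit X = tid X" for X
    by (simp_all add: IM.mu_def IM.eta_def IM.LT.unit_def IM.LT.counit_def tid_def)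
  show "X \<in> Obj C \<Longrightarrow> IM.ract X = tid X" "X \<in> Obj C \<Longrightarrow> IM.lact X = tid X"
    by (simp_all add: 1 IM.ract_def IM.lact_def IM.comu_def)
qed

end

section \<open>The twist as defined by dinaturality\<close>

locale monad_nakayama_coend = copowered_category C + adjoint_monad C T L S R c e c1 e1 c2 e2 m u
  for C :: "('o, 'm, 'k::field, 'z) lcat_scheme" (structure) and T L S R :: "('o, 'm) endo"
    and c e c1 e1 c2 e2 m u :: "'o \<Rightarrow> 'm" +
  fixes N :: "('o, 'm, 'o, 'm) fctr" and i :: "'o \<Rightarrow> 'o \<Rightarrow> 'm"
  assumes nakayama: "is_nakayama C N i"
begin

abbreviation "jj \<equiv> \<lambda>M X \<xi>. i M X \<cdot> cpu C (hom_dual C M X) X \<xi>"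

sublocale MN: monad_nakayama C T L S R c e c1 e1 c2 e2 m u N jj
  by (intro monad_nakayama.intro nakayama_category.intro nakayama_category_axioms.intro
      lin_category_axioms adjoint_monad_axioms is_nakayama_nak_functor nakayama)

lemma i_arr: "Q \<in> Obj C \<Longrightarrow> X \<in> Obj C \<Longrightarrow> i Q X \<in> arr C (cpo C (hom_dual C Q X) X) (Fo N Q)"
  using nakayama by (simp add: is_nakayama_def is_nak_coend_def nak_dinatural_def)

text \<open>
  The dinaturality square for \<open>X\<close> is an equation between arrows out of a copower of \<open>T X\<close>. On generators it is the
  equation in \<open>is_twist\<close>.
\<close>

lemma nak_phi_is_twist:
  assumes Q: "Q \<in> Obj C" and G: "G = \<lparr>Fo = eo S, Fa = (\<lambda>_ _. ea S)\<rparr>" and H: "H = \<lparr>Fo = eo L, Fa = (\<lambda>_ _. ea L)\<rparr>"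
    and K: "K = \<lparr>Fo = eo T, Fa = (\<lambda>_ _. ea T)\<rparr>"
  shows "MN.is_twist Q (eo T (Fo N Q), nak_phi C C N i N i G H K c1 e Q, Fo N (eo S Q))"
proof -
  have SQ: "eo S Q \<in> Obj C" using Q by simp
  have NQ: "Fo N Q \<in> Obj C" and NSQ: "Fo N (eo S Q) \<in> Obj C" using Q by (simp_all add: MN.N_obj)
  have TNQ: "eo T (Fo N Q) \<in> Obj C" using NQ by simp
  define cond where "cond p \<longleftrightarrow> is_iso C (Fo K (Fo N Q)) (Fo N (Fo G Q)) p \<and>
      (\<forall>X\<in>Obj C. let V = hom_dual C Q X; P = cpo C V X in
         p \<cdot> (Fa K P (Fo N Q) (i Q X) \<cdot> cp_desc C V (Fo K X) (Fo K P) (\<lambda>\<xi>. Fa K X P (cpu C V X \<xi>)))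
         = i (Fo G Q) (Fo K X) \<cdot> cp_map C V (hom_dual C (Fo G Q) (Fo K X))
               (transp (Hom C (Fo G Q) (Fo K X)) (nak_t C G H K c1 e Q X)) (Fo K X) (Fo K X) (Id C (Fo K X)))" for p
  have t: "nak_t C G H K c1 e Q X = MN.ttw Q X" for X
    by (rule ext) (simp add: nak_t_def H MN.ttw_def)
  have iff: "(\<forall>X\<in>Obj C. let V = hom_dual C Q X; P = cpo C V X in
         p \<cdot> (Fa K P (Fo N Q) (i Q X) \<cdot> cp_desc C V (Fo K X) (Fo K P) (\<lambda>\<xi>. Fa K X P (cpu C V X \<xi>)))
         = i (Fo G Q) (Fo K X) \<cdot> cp_map C V (hom_dual C (Fo G Q) (Fo K X))
               (transp (Hom C (Fo G Q) (Fo K X)) (nak_t C G H K c1 e Q X)) (Fo K X) (Fo K X) (Id C (Fo K X)))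
      \<longleftrightarrow> MN.is_twist Q (eo T (Fo N Q), p, Fo N (eo S Q))"
    if p: "p \<in> arr C (eo T (Fo N Q)) (Fo N (eo S Q))" for p
  proof -
    have "(p \<cdot> (ea T (i Q X) \<cdot> cp_desc C (hom_dual C Q X) (eo T X) (eo T (cpo C (hom_dual C Q X) X))
            (\<lambda>\<xi>. ea T (cpu C (hom_dual C Q X) X \<xi>)))
         = i (eo S Q) (eo T X) \<cdot> cp_map C (hom_dual C Q X) (hom_dual C (eo S Q) (eo T X))
               (transp (Hom C (eo S Q) (eo T X)) (MN.ttw Q X)) (eo T X) (eo T X) (Id C (eo T X)))
      \<longleftrightarrow> (\<forall>\<xi>\<in>fnl C Q X. p \<cdot> ea T (jj Q X \<xi>)
            = jj (eo S Q) (eo T X) (transp (Hom C (eo S Q) (eo T X)) (MN.ttw Q X) \<xi>))" (is "?l = ?r \<longleftrightarrow> _")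
      if X: "X \<in> Obj C" for X
    proof -
      have TX: "eo T X \<in> Obj C" using X by simp
      note P = cpo_obj[OF Q X X] and u = cpu_lin[OF Q X X]
      have TP: "eo T (cpo C (hom_dual C Q X) X) \<in> Obj C" using P by simp
      note d = cp_desc[OF Q X TX TP lin_comp[OF u LT.R.ea_lin[OF X P]]]
      note Ti = linD(1)[OF LT.R.ea_lin[OF P NQ] i_arr[OF Q X]]
      have tl: "transp (Hom C (eo S Q) (eo T X)) (MN.ttw Q X) \<in> lin (hom_dual C Q X) (hom_dual C (eo S Q) (eo T X))"
        by (rule transp_lin[OF MN.ttw_lin[OF Q X] hom_space[OF SQ TX] hom_space[OF Q X]])
      note Tid = comp_arr[OF cpo_obj[OF Q X TX] TP TNQ d(1) Ti]
      have l: "?l \<in> arr C (cpo C (hom_dual C Q X) (eo T X)) (Fo N (eo S Q))"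
        by (rule comp_arr[OF cpo_obj[OF Q X TX] TNQ NSQ Tid p])
      have r: "?r \<in> arr C (cpo C (hom_dual C Q X) (eo T X)) (Fo N (eo S Q))"
        by (rule comp_arr[OF cpo_obj[OF Q X TX] cpo_obj[OF SQ TX TX] NSQ cp_map(1)[OF Q X SQ TX TX TX tl id_arr[OF TX]] i_arr[OF SQ TX]])
      have "?l \<cdot> cpu C (hom_dual C Q X) (eo T X) \<xi> = p \<cdot> ea T (jj Q X \<xi>)"
        "?r \<cdot> cpu C (hom_dual C Q X) (eo T X) \<xi> = jj (eo S Q) (eo T X) (transp (Hom C (eo S Q) (eo T X)) (MN.ttw Q X) \<xi>)"
        if \<xi>: "\<xi> \<in> fnl C Q X" for \<xi>
      proof -
        note uT = linD(1)[OF cpu_lin[OF Q X TX] \<xi>] and ux = linD(1)[OF u \<xi>]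
        show "?l \<cdot> cpu C (hom_dual C Q X) (eo T X) \<xi> = p \<cdot> ea T (jj Q X \<xi>)"
          using comp_assoc[OF TX cpo_obj[OF Q X TX] TNQ NSQ uT Tid p] comp_assoc[OF TX cpo_obj[OF Q X TX] TP TNQ uT d(1) Ti]
            d(2)[OF \<xi>] LT.R.ea_comp[OF X P NQ ux i_arr[OF Q X]] by simp
        note w = comp_arr[OF TX cpo_obj[OF SQ TX TX] NSQ linD(1)[OF cpu_lin[OF SQ TX TX] linD(1)[OF tl \<xi>]] i_arr[OF SQ TX]]
        show "?r \<cdot> cpu C (hom_dual C Q X) (eo T X) \<xi> = jj (eo S Q) (eo T X) (transp (Hom C (eo S Q) (eo T X)) (MN.ttw Q X) \<xi>)"
          unfolding comp_cp_map[OF Q X SQ TX TX TX tl id_arr[OF TX] NSQ i_arr[OF SQ TX] \<xi>]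
          by (rule id_right[OF TX NSQ w])
      qed
      note * = this
      show ?thesis
      proof
        assume "?l = ?r"
        then show "\<forall>\<xi>\<in>fnl C Q X. p \<cdot> ea T (jj Q X \<xi>)
            = jj (eo S Q) (eo T X) (transp (Hom C (eo S Q) (eo T X)) (MN.ttw Q X) \<xi>)"
          by (simp add: *[symmetric])
      next
        assume "\<forall>\<xi>\<in>fnl C Q X. p \<cdot> ea T (jj Q X \<xi>)
            = jj (eo S Q) (eo T X) (transp (Hom C (eo S Q) (eo T X)) (MN.ttw Q X) \<xi>)"
        then show "?l = ?r" by (intro cp_ext[OF Q X TX NSQ l r]) (simp add: *)
      qed
    qed
    then show ?thesis
      unfolding t using p TNQ NSQ by (simp add: Let_def G K MN.is_twist_def ok_typed tcomp_def MN.jt_def ap_def)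
  qed
  obtain p where p: "MN.is_twist Q p" using MN.twist_exists[OF Q] by blast
  then have p': "ok p" "src p = eo T (Fo N Q)" "tgt p = Fo N (eo S Q)" by (simp_all add: MN.is_twist_def)
  have pc: "(eo T (Fo N Q), raw p, Fo N (eo S Q)) = p" using p' by (simp add: typed_collapse)
  obtain q where q: "ok q" "src q = tgt p" "tgt q = src p" "p ** q = tid (tgt p)" "q ** p = tid (src p)"
    using MN.twist_inverse[OF Q p] by blast
  have iso: "is_iso C (eo T (Fo N Q)) (Fo N (eo S Q)) (raw p)"
    unfolding is_iso_def
    using arg_cong[OF q(4), of raw] arg_cong[OF q(5), of raw] okD(3)[OF p'(1)] okD(3)[OF q(1)] p' q(2,3)
    by (intro conjI bexI[of _ "raw q"]) simp_all
  have "cond (raw p)"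
    unfolding cond_def using iff[of "raw p"] iso p okD(3)[OF p'(1)] p' pc by (simp add: G K)
  moreover have "p2 = raw p" if "cond p2" for p2
  proof -
    have "p2 \<in> arr C (eo T (Fo N Q)) (Fo N (eo S Q))" using that by (simp add: cond_def is_iso_def G K)
    with iff[OF this] that have "MN.is_twist Q (eo T (Fo N Q), p2, Fo N (eo S Q))" by (simp add: cond_def)
    from arg_cong[OF MN.twist_unique[OF this p Q], of raw] show ?thesis by simp
  qed
  ultimately have "(THE p. cond p) = raw p" by (rule the_equality)
  then have "nak_phi C C N i N i G H K c1 e Q = raw p" by (simp only: nak_phi_def cond_def)
  then show ?thesis using p pc by simp
qed

end

section \<open>Relative tensor products with the dual\<close>

context lin_category
begin

text \<open>
  An arrow that is known to exist along a colimiting arrow is the one that \<open>desc\<close> describes.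
\<close>

lemma desc_joint_coeq:
  assumes q: "joint_coeq E q" and k: "ok k" "src k = tgt q"
  shows "desc C (tgt q) (tgt k) (raw q) (raw k \<cdot> raw q) = raw k"
  unfolding desc_def
proof (rule the_equality)
  show "raw k \<in> arr C (tgt q) (tgt k) \<and> raw k \<cdot> raw q = raw k \<cdot> raw q" using okD(3)[OF k(1)] k(2) by simp
  fix l assume l: "l \<in> arr C (tgt q) (tgt k) \<and> l \<cdot> raw q = raw k \<cdot> raw q"
  have "(tgt q, l, tgt k) = k"
    by (rule joint_coeqD(4)[OF q]) (use l k okD[OF k(1)] in \<open>simp_all add: ok_typed tcomp_def\<close>)
  from arg_cong[OF this, of raw] show "l = raw k" by simp
qed

lemma coeq_joint_coeq:
  assumes colim: "has_finite_colimits C" and fg: "ok f" "ok g" "src g = src f" "tgt g = tgt f"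
    and eq: "coeq C (src f) (tgt f) (raw f) (raw g) = p"
  shows "joint_coeq {(f, g)} (tgt f, snd p, fst p)"
proof -
  note o = okD[OF fg(1)] okD(3)[OF fg(2), unfolded fg(3,4)]
  have "\<exists>p. case p of (Q, q) \<Rightarrow> is_coequalizer C (src f) (tgt f) (raw f) (raw g) Q q"
    using colim o by (auto simp: has_finite_colimits_def)
  from someI_ex[OF this] have "case p of (Q, q) \<Rightarrow> is_coequalizer C (src f) (tgt f) (raw f) (raw g) Q q"
    unfolding eq[symmetric] coeq_def .
  then have "is_coequalizer C (src f) (tgt f) (raw f) (raw g) (fst p) (snd p)" by (simp add: case_prod_beta)
  then have "joint_coeq {((src f, raw f, tgt f), (src f, raw g, tgt f))} (tgt f, snd p, fst p)"
    using joint_coeq_is_coequalizer[OF o] by simp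
  then show ?thesis using fg by (simp add: typed_collapse)
qed

lemma coeq_swap: "coeq C X Y f g = coeq C X Y g f"
proof -
  have "is_coequalizer C X Y f g = is_coequalizer C X Y g f"
    by (intro ext) (simp add: is_coequalizer_def eq_commute[of "_ \<cdot> f" "_ \<cdot> g"])
  then show ?thesis by (simp add: coeq_def)
qed

lemma joint_coeq_insert_refl:
  assumes "ok f" "tgt f = src q"
  shows "joint_coeq (insert (f, f) E) q \<longleftrightarrow> joint_coeq E q"
  using assms by (simp add: joint_coeq_def)

end

locale dual_tensor = dual_algebra_action C M to ta lo la I a a1 a2 a0 el cv ev1 cv1 ev0 cv0 m u
  for C :: "('c, 'd, 'k::field, 'y) lcat_scheme" and M :: "('o, 'm, 'k, 'z) lcat_scheme" (structure)
    and to ta lo la I a a1 a2 a0 el cv ev1 cv1 ev0 cv0 m u +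
  assumes finite: "finite_abelian M"
begin

no_notation CT.one.tcomp (infixr "**" 55)
notation tcomp (infixr "**" 55)

definition tens :: "'o \<times> 'm \<Rightarrow> 'o \<times> 'm" where
  "tens x = coeq M (lo a1 (lo a (fst x))) (lo a1 (fst x)) (nt dual_ract (fst x)) (la (Id C a1) (snd x))"

definition tens_map :: "'o \<times> 'm \<Rightarrow> 'o \<times> 'm \<Rightarrow> 'm \<Rightarrow> 'm" where
  "tens_map x y f = desc M (fst (tens x)) (fst (tens y)) (snd (tens x)) (snd (tens y) \<cdot> la (Id C a1) f)"

definition tens_act :: "'o \<times> 'm \<Rightarrow> 'm" where
  "tens_act x = desc M (lo a2 (fst (tens x))) (fst (tens x)) (la (Id C a2) (snd (tens x)))
     (snd (tens x) \<cdot> nt dual_lact (fst x))"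

definition act_arr :: "'o \<times> 'm \<Rightarrow> ('o, 'm) tarr" where
  "act_arr x = (lo a (fst x), snd x, fst x)"

definition proj :: "'o \<times> 'm \<Rightarrow> ('o, 'm) tarr" where
  "proj x = (lo a1 (fst x), snd (tens x), fst (tens x))"

lemma act_arr_simps [simp]: "src (act_arr x) = lo a (fst x)" "tgt (act_arr x) = fst x" "raw (act_arr x) = snd x"
  "src (proj x) = lo a1 (fst x)" "tgt (proj x) = fst (tens x)" "raw (proj x) = snd (tens x)"
  by (simp_all add: act_arr_def proj_def)

lemma joint_coeq_proj:
  assumes x: "ok (act_arr x)"
  shows "joint_coeq {(AM.ract (fst x), ap (by_obj a1) (act_arr x))} (proj x)"
proof -
  have U: "fst x \<in> Obj M" using okD(2)[OF x] by simp
  have "joint_coeq {(AM.ract (fst x), ap (by_obj a1) (act_arr x))}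
      (tgt (AM.ract (fst x)), snd (tens x), fst (tens x))"
    by (rule coeq_joint_coeq[OF finite_abelian_colimits(2)[OF finite]])
      (use x U in \<open>simp_all add: by_obj_simps tens_def dual_ract(2)\<close>)
  then show ?thesis by (simp add: proj_def by_obj_simps)
qed

lemma tens_act:
  assumes x: "ok (act_arr x)"
  shows "ok (lo a2 (fst (tens x)), tens_act x, fst (tens x))"
    and "(lo a2 (fst (tens x)), tens_act x, fst (tens x)) ** ap (by_obj a2) (proj x) = proj x ** AM.lact (fst x)"
proof -
  have U: "fst x \<in> Obj M" using okD(2)[OF x] by simp
  obtain k where k: "ok k" "src k = eo (by_obj a2) (tgt (proj x))" "tgt k = tgt (proj x)"
      "k ** ap (by_obj a2) (proj x) = proj x ** AM.lact (fst x)"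
    using AM.lact_descends[OF x _ _ joint_coeq_proj[OF x]] by (auto simp: by_obj_simps)
  have "tens_act x = raw k"
    using desc_joint_coeq[OF AM.SL.left_adjoint_joint_coeq[OF joint_coeq_proj[OF x]] k(1)] k(2,3) U
      arg_cong[OF k(4), of raw] by (simp add: tens_act_def dual_lact(2) by_obj_simps)
  then have "(lo a2 (fst (tens x)), tens_act x, fst (tens x)) = k"
    using k(2,3) by (intro typed_eqI) (simp_all add: by_obj_simps)
  then show "ok (lo a2 (fst (tens x)), tens_act x, fst (tens x))"
    "(lo a2 (fst (tens x)), tens_act x, fst (tens x)) ** ap (by_obj a2) (proj x) = proj x ** AM.lact (fst x)"
    using k by simp_all
qed

lemma tens_map_eq:
  assumes x: "ok (act_arr x)" and f: "src f = fst x"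
    and k: "ok k" "src k = fst (tens x)" "tgt k = fst (tens y)" "k ** proj x = proj y ** ap (by_obj a1) f"
  shows "(fst (tens x), tens_map x y (raw f), fst (tens y)) = k"
proof -
  have "tens_map x y (raw f) = raw k"
    using desc_joint_coeq[OF joint_coeq_proj[OF x] k(1)] k(2,3) arg_cong[OF k(4), of raw]
    by (simp add: tens_map_def by_obj_simps)
  then show ?thesis using k by (intro typed_eqI) simp_all
qed

lemma tens_map:
  assumes x: "ok (act_arr x)" and y: "ok (act_arr y)" and f: "ok f" "src f = fst x" "tgt f = fst y"
    and lin: "f ** act_arr x = act_arr y ** ap (by_obj a) f"
  defines "k \<equiv> (fst (tens x), tens_map x y (raw f), fst (tens y))"
  shows "ok k" "k ** proj x = proj y ** ap (by_obj a1) f"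
proof -
  have U: "fst x \<in> Obj M" "fst y \<in> Obj M" using okD(2)[OF x] okD(2)[OF y] by simp_all
  note px = joint_coeqD[OF joint_coeq_proj[OF x]] and py = joint_coeqD[OF joint_coeq_proj[OF y]]
  let ?L = "by_obj a1" and ?T = "by_obj a"
  have "(proj y ** ap ?L f) ** AM.ract (fst x) = proj y ** (AM.ract (fst y) ** ap ?L (ap ?T f))"
    using AM.ract_nat[OF f(1)] f U py(1) by (simp add: by_obj_simps)
  also have "\<dots> = proj y ** (ap ?L (act_arr y) ** ap ?L (ap ?T f))"
    by (rule precomp2[where d = "proj y"]) (use py(1) py(2)[OF singletonI] y f U in \<open>simp_all add: by_obj_simps\<close>)
  also have "ap ?L (act_arr y) ** ap ?L (ap ?T f) = ap ?L f ** ap ?L (act_arr x)"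
    using lin x y f by (simp add: AM.LT.L.ap_tcomp[symmetric] by_obj_simps)
  finally have "(proj y ** ap ?L f) ** AM.ract (fst x) = (proj y ** ap ?L f) ** ap ?L (act_arr x)"
    using py(1) f x by (simp add: by_obj_simps)
  then obtain k' where k': "ok k'" "src k' = fst (tens x)" "tgt k' = fst (tens y)" "k' ** proj x = proj y ** ap ?L f"
    using px(3)[of "proj y ** ap ?L f"] f py(1) by (auto simp: by_obj_simps)
  have "k = k'" unfolding k_def by (rule tens_map_eq[OF x f(2) k'])
  then show "ok k" "k ** proj x = proj y ** ap ?L f" using k' by simp_all
qed

end

section \<open>Modules over one algebra\<close>

locale nakayama_tensor = dual_tensor C M to ta lo la I a a1 a2 a0 el cv ev1 cv1 ev0 cv0 m u
  for C :: "('c, 'd, 'k::field, 'y) lcat_scheme" and M :: "('o, 'm, 'k, 'z) lcat_scheme" (structure)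
    and to ta lo la I a a1 a2 a0 el cv ev1 cv1 ev0 cv0 m u +
  fixes N :: "('o, 'm, 'o, 'm) fctr" and i :: "'o \<Rightarrow> 'o \<Rightarrow> 'm"
  assumes nakayama: "is_nakayama M N i"
begin

lemma copowers: "vector_space_on V \<Longrightarrow> finite_coords V \<Longrightarrow> X \<in> Obj M \<Longrightarrow> \<exists>P w. is_copower M V X P w"
  by (rule copower_exists[OF finite_abelian_colimits(2)[OF finite]])

sublocale copowered_category M
proof (intro copowered_category.intro copowered_category_axioms.intro lin_category_axioms copowers)
  show "vector_space_on (hom_dual M X Y)" "finite_coords (hom_dual M X Y)" if "X \<in> Obj M" "Y \<in> Obj M" for X Y
    using that finite_abelian_colimits(3)[OF finite] vector_space_on_dual[OF hom_space[OF that]]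
      finite_coords_dual[OF hom_space[OF that]] by (simp_all add: finite_homs_def)
qed

sublocale MC: monad_nakayama_coend M "by_obj a" "by_obj a1" "by_obj a2" "by_obj a0"
    "nt cv" "nt el" "nt cv1" "nt ev1" "nt cv0" "nt ev0" "nt m" "nt u" N i
  by (intro monad_nakayama_coend.intro monad_nakayama_coend_axioms.intro copowered_category_axioms
      adjoint_monad_act nakayama)

definition by_fctr :: "'c \<Rightarrow> ('o, 'm, 'o, 'm) fctr" where
  "by_fctr X = \<lparr>Fo = lo X, Fa = (\<lambda>_ _. la (Id C X))\<rparr>"

definition twist :: "'o \<Rightarrow> 'm" where
  "twist Q = nak_phi M M N i N i (by_fctr a2) (by_fctr a1) (by_fctr a) (nt cv1) (nt el) Q"

lemma is_twist: "Q \<in> Obj M \<Longrightarrow> MC.MN.is_twist Q (lo a (Fo N Q), twist Q, Fo N (lo a2 Q))"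
  using MC.nak_phi_is_twist[of Q "by_fctr a2" "by_fctr a1" "by_fctr a"]
  by (simp add: twist_def by_fctr_def by_obj_def)

end

context identity_monad
begin

text \<open>The unit law forces every action of the identity monad to be the identity.\<close>

lemma is_mod_iff: "IM.is_mod s \<longleftrightarrow> ok s \<and> s = tid (tgt s)"
proof
  assume s: "IM.is_mod s"
  note d = IM.is_modD[OF s]
  show "ok s \<and> s = tid (tgt s)" using d by (simp add: IM_simps)
next
  assume s: "ok s \<and> s = tid (tgt s)"
  then have "src s = tgt s" "tgt s \<in> Obj C" using okD(2) by (metis tid_simps(1), auto)
  moreover have "s ** s = s" using tid_left[of s "tgt s"] s by metis
  ultimately show "IM.is_mod s" using s by (simp add: IM.is_mod_def IM.is_act_def IM_simps)
qed

lemma commuting: "adjoint_monad C T L S R c e c1 e1 c2 e2 m u \<Longrightarrow>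
    commuting_monads C T L S R c e c1 e1 c2 e2 m u id_endo id_endo id_endo id_endo
      (Id C) (Id C) (Id C) (Id C) (Id C) (Id C) (Id C) (Id C)"
proof (intro commuting_monads.intro commuting_monads_axioms.intro lin_category_axioms adjoint_monad_id)
  assume A: "adjoint_monad C T L S R c e c1 e1 c2 e2 m u"
  then interpret A: adjoint_monad C T L S R c e c1 e1 c2 e2 m u .
  show "adjoint_monad C T L S R c e c1 e1 c2 e2 m u" by (rule A)
  fix F G X
  show "commute_endo C F G" if "G \<in> {id_endo, id_endo, id_endo}"
    using that by (simp add: commute_endo_def)
  show "ea G (c X) = c (eo G X) \<and> ea G (e X) = e (eo G X) \<and> ea G (c1 X) = c1 (eo G X) \<and>
      ea G (m X) = m (eo G X) \<and> ea G (u X) = u (eo G X)" if "G \<in> {id_endo, id_endo}"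
    using that by simp
  show "ea F (Id C X) = Id C (eo F X) \<and> ea F (Id C X) = Id C (eo F X) \<and> ea F (Id C X) = Id C (eo F X)"
    if "F \<in> {T, L}" "X \<in> Obj C"
    using that A.LT.R.ea_id A.LT.L.ea_id by auto
qed

lemma is_twist_id:
  assumes nak: "nak_functor C N j" and Q: "Q \<in> Obj C"
  shows "monad_nakayama.is_twist C id_endo id_endo id_endo (Id C) (Id C) N j Q (tid (Fo N Q))"
proof -
  interpret MN: monad_nakayama C id_endo id_endo id_endo id_endo
      "Id C" "Id C" "Id C" "Id C" "Id C" "Id C" "Id C" "Id C" N j
    by (intro monad_nakayama.intro nakayama_category.intro nakayama_category_axioms.intro
        lin_category_axioms adjoint_monad_id nak)
  have "transp (Hom C Q X) (MN.ttw Q X) \<xi> = \<xi>" if "X \<in> Obj C" "\<xi> \<in> fnl C Q X" for X \<xi>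
    by (rule transp_ident[OF that(2)]) (use that Q in \<open>simp add: MN.ttw_def id_left id_right\<close>)
  then show ?thesis using Q by (simp add: MN.is_twist_def)
qed

end

context nakayama_tensor
begin

text \<open>
  The bimodule theorem with the identity monad on the other side. There the dual action, the twist and the
  action on the tensor product are identities.
\<close>

theorem nakayama_of_modules:
  fixes D :: "('o \<times> 'm, 'm, 'k, 'w) lcat_scheme"
  assumes D: "Obj D = {(U, \<rho>). U \<in> Obj M \<and> \<rho> \<in> arr M (lo a U) U \<and>
        \<rho> \<cdot> nt m U = \<rho> \<cdot> la (Id C a) \<rho> \<and> \<rho> \<cdot> nt u U = Id M U}"
      "Hom D = (\<lambda>(U, \<rho>) (V, \<sigma>). (Hom M U V)\<lparr>carrier := {f \<in> arr M U V. f \<cdot> \<rho> = \<sigma> \<cdot> la (Id C a) f}\<rparr>)"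
      "Id D = (\<lambda>(U, \<rho>). Id M U)" "Comp D = Comp M"
    and F: "Fo F = (\<lambda>x. (Fo N (fst (tens x)),
          Fa N (lo a2 (fst (tens x))) (fst (tens x)) (tens_act x) \<cdot> twist (fst (tens x))))"
      "Fa F = (\<lambda>x y f. Fa N (fst (tens x)) (fst (tens y)) (tens_map x y f))"
  shows "nakayama_given_by D F"
proof -
  interpret IM: identity_monad M by (intro identity_monad.intro lin_category_axioms)
  note nak = is_nakayama_nak_functor[OF nakayama]
  interpret CM: commuting_monads M "by_obj a" "by_obj a1" "by_obj a2" "by_obj a0"
      "nt cv" "nt el" "nt cv1" "nt ev1" "nt cv0" "nt ev0" "nt m" "nt u"
      id_endo id_endo id_endo id_endo "Id M" "Id M" "Id M" "Id M" "Id M" "Id M" "Id M" "Id M"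
    by (rule IM.commuting[OF adjoint_monad_act])
  have mod: "AM.is_mod (lo a U, \<rho>, U) \<longleftrightarrow> (U, \<rho>) \<in> Obj D" for U \<rho>
    by (auto simp: D(1) AM.is_mod_def AM.is_act_def ok_typed tcomp_def ap_def AM.mu_def AM.eta_def tid_def by_obj_simps
        AC.bo_obj duals_in)
  have bimod: "CM.bimod r s \<longleftrightarrow> AM.is_mod r \<and> s = tid (tgt r)" for r s
    using AM.is_modD[of r] by (auto simp: CM.bimod_def IM.is_mod_iff AM.LT.R.ap_tid)
  interpret BC: bimodule_category M "by_obj a" "by_obj a1" "by_obj a2" "by_obj a0"
      "nt cv" "nt el" "nt cv1" "nt ev1" "nt cv0" "nt ev0" "nt m" "nt u"
      id_endo id_endo id_endo id_endo "Id M" "Id M" "Id M" "Id M" "Id M" "Id M" "Id M" "Id M"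
      D fst snd "\<lambda>x. Id M (fst x)" "\<lambda>U r s. (U, r)"
  proof (intro bimodule_category.intro bimodule_category_axioms.intro CM.commuting_monads_axioms)
    show "CM.bimod (eo (by_obj a) (fst x), snd x, fst x) (eo id_endo (fst x), Id M (fst x), fst x)" if "x \<in> Obj D" for x
      using that mod[of "fst x" "snd x"] by (simp add: bimod by_obj_simps tid_def)
    show "(tgt r, raw r) \<in> Obj D \<and> fst (tgt r, raw r) = tgt r \<and> snd (tgt r, raw r) = raw r \<and>
        Id M (fst (tgt r, raw r)) = raw s" if "CM.bimod r s" for r s
      using that mod[of "tgt r" "raw r"] AM.is_modD(2)[of r] by (auto simp: bimod by_obj_simps typed_collapse)
    show "Hom D x y = (Hom M (fst x) (fst y))\<lparr>carrier := {f \<in> arr M (fst x) (fst y).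
        f \<cdot> snd x = snd y \<cdot> ea (by_obj a) f \<and> f \<cdot> Id M (fst x) = Id M (fst y) \<cdot> ea id_endo f}\<rparr>"
      if "x \<in> Obj D" "y \<in> Obj D" for x y
    proof -
      have "fst x \<in> Obj M" "fst y \<in> Obj M" using that by (auto simp: D(1))
      then have "{f \<in> arr M (fst x) (fst y). f \<cdot> snd x = snd y \<cdot> la (Id C a) f} = {f \<in> arr M (fst x) (fst y).
          f \<cdot> snd x = snd y \<cdot> ea (by_obj a) f \<and> f \<cdot> Id M (fst x) = Id M (fst y) \<cdot> ea id_endo f}"
        by (auto simp: by_obj_simps id_left id_right)
      then show ?thesis by (simp add: D(2) case_prod_beta)
    qed
    show "Id D x = Id M (fst x)" for x by (simp add: D(3) case_prod_beta)
    show "Comp D = Comp M" by (rule D(4))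
  qed
  have str: "BC.lt x = act_arr x" "BC.rt x = tid (fst x)" for x
    by (simp_all add: BC.lt_def BC.rt_def act_arr_def by_obj_simps tid_def)
  have ok: "ok (act_arr x)" "fst x \<in> Obj M" if "x \<in> Obj D" for x
    using BC.ok_lt(1)[OF that] BC.und_obj[OF that] by (simp_all add: str)
  let ?Q = "\<lambda>x. fst (tens x)"
  have Q: "?Q x \<in> Obj M" if "x \<in> Obj D" for x
    using okD(2)[OF joint_coeqD(1)[OF joint_coeq_proj[OF ok(1)[OF that]]]] by simp
  interpret BN: bimodule_nakayama M "by_obj a" "by_obj a1" "by_obj a2" "by_obj a0"
      "nt cv" "nt el" "nt cv1" "nt ev1" "nt cv0" "nt ev0" "nt m" "nt u"
      id_endo id_endo id_endo id_endo "Id M" "Id M" "Id M" "Id M" "Id M" "Id M" "Id M" "Id M"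
      D fst snd "\<lambda>x. Id M (fst x)" "\<lambda>U r s. (U, r)" N MC.jj
      proj "\<lambda>x. (lo a2 (?Q x), tens_act x, ?Q x)" "\<lambda>x. tid (?Q x)"
      "\<lambda>x. (lo a (Fo N (?Q x)), twist (?Q x), Fo N (lo a2 (?Q x)))" "\<lambda>x. tid (Fo N (?Q x))"
      "\<lambda>x y f. (?Q x, tens_map x y f, ?Q y)" F
  proof (intro bimodule_nakayama.intro bimodule_nakayama_axioms.intro BC.bimodule_category_axioms
      monad_nakayama.intro nakayama_category.intro nakayama_category_axioms.intro lin_category_axioms
      nak adjoint_monad_act adjoint_monad_id)
    fix x assume x: "x \<in> Obj D"
    note o = ok[OF x] Q[OF x]
    show "CM.is_tensor (BC.lt x) (BC.rt x) (proj x)"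
      using joint_coeq_proj[OF o(1)] o AM.LT.L.ap_tid[OF o(2)] AC.bo_obj[OF duals_in(2) o(2)]
      by (simp add: CM.is_tensor_def str IM.IM_simps insert_commute joint_coeq_insert_refl by_obj_simps)
    show "MC.MN.is_twist (tgt (proj x)) (lo a (Fo N (?Q x)), twist (?Q x), Fo N (lo a2 (?Q x)))"
      using is_twist[OF o(3)] by simp
    show "monad_nakayama.is_twist M id_endo id_endo id_endo (Id M) (Id M) N MC.jj (tgt (proj x)) (tid (Fo N (?Q x)))"
      using IM.is_twist_id[OF nak o(3)] by simp
    show "ok (lo a2 (?Q x), tens_act x, ?Q x) \<and>
        src (lo a2 (?Q x), tens_act x, ?Q x) = eo (by_obj a2) (tgt (proj x)) \<and>
        tgt (lo a2 (?Q x), tens_act x, ?Q x) = tgt (proj x) \<and>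
        (lo a2 (?Q x), tens_act x, ?Q x) ** ap (by_obj a2) (proj x) = proj x ** ap id_endo (AM.lact (fst x))"
      using tens_act[OF o(1)] by (simp add: by_obj_simps)
    show "ok (tid (?Q x)) \<and> src (tid (?Q x)) = eo id_endo (tgt (proj x)) \<and> tgt (tid (?Q x)) = tgt (proj x) \<and>
        tid (?Q x) ** ap id_endo (proj x) = proj x ** IM.IM.lact (eo (by_obj a1) (fst x))"
      using o joint_coeqD(1)[OF joint_coeq_proj[OF o(1)]] AC.bo_obj[OF duals_in(2) o(2)]
      by (simp add: IM.IM_simps by_obj_simps)
    show "Fo F x = (Fo N (tgt (proj x)), raw (MC.MN.Nt (lo a2 (?Q x), tens_act x, ?Q x) **
        (lo a (Fo N (?Q x)), twist (?Q x), Fo N (lo a2 (?Q x)))))"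
      by (simp add: F(1) MC.MN.Nt_def)
    fix y f assume y: "y \<in> Obj D" and f: "f \<in> arr D x y"
    have "ok (fst x, f, fst y)" "(fst x, f, fst y) ** act_arr x = act_arr y ** ap (by_obj a) (fst x, f, fst y)"
      using f o ok[OF y] unfolding BC.arr_D[OF x y] by (simp_all add: CM.bilin_def str)
    from tens_map[OF o(1) ok(1)[OF y] this(1) _ _ this(2)]
    show "ok (?Q x, tens_map x y f, ?Q y) \<and> src (?Q x, tens_map x y f, ?Q y) = tgt (proj x) \<and>
        tgt (?Q x, tens_map x y f, ?Q y) = tgt (proj y) \<and> (?Q x, tens_map x y f, ?Q y) ** proj x =
        proj y ** ap id_endo (ap (by_obj a1) (fst x, f, fst y))"
      by simp
    show "Fa F x y f = raw (MC.MN.Nt (?Q x, tens_map x y f, ?Q y))"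
      by (simp add: F(2) MC.MN.Nt_def)
  next
    show "\<exists>P w. is_copower M V X P w" if "vector_space_on V" "finite_coords V" "X \<in> Obj M"
      for V :: "('k, 'm \<Rightarrow> 'k) module" and X by (rule copowers[OF that])
    show "finite_homs M" by (rule finite_abelian_colimits(3)[OF finite])
  qed
  show ?thesis by (rule BN.nakayama_of_bimodules)
qed

end

section \<open>Iterated relative tensor products\<close>

context commuting_monads
begin

lemma ract_swap: "X \<in> Obj C \<Longrightarrow> ap T' (A.ract X) = A.ract (eo T' X)"
proof -
  assume X: "X \<in> Obj C"
  have "ap T' (ap L (A.mu (eo L X) ** ap T (A.LT.unit X))) = ap L (ap T' (A.mu (eo L X) ** ap T (A.LT.unit X)))"
    by (rule swap_arr) (use X in simp)
  also have "ap T' (A.mu (eo L X) ** ap T (A.LT.unit X)) = A.mu (eo L (eo T' X)) ** ap T (A.LT.unit (eo T' X))"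
    using X by (simp add: B.LT.R.ap_tcomp A_unit_swap swap_arr)
  finally show ?thesis using X by (simp add: A.ract_def B.LT.R.ap_tcomp A_unit_swap)
qed

text \<open>
  \<open>T'\<close> preserves the coequalizer, and \<open>s\<close> is linear for the other action.
\<close>

lemma tensor_right_act:
  assumes b: "bimod r s" and q: "joint_coeq {(A.ract (tgt r), ap L r)} q" "src q = eo L (tgt r)"
  shows "\<exists>k. ok k \<and> src k = eo T' (tgt q) \<and> tgt k = tgt q \<and> k ** ap T' q = q ** ap L s"
proof -
  note bb = bimodD[OF b] and qd = joint_coeqD[OF q(1)]
  have qr: "q ** A.ract (tgt r) = q ** ap L r" using qd(2)[OF singletonI] by simp
  have "(q ** ap L s) ** ap T' (A.ract (tgt r)) = q ** (A.ract (tgt r) ** ap L (ap T s))"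
    using bb q(2) qd(1) A.ract_nat[of s] by (simp add: ract_swap)
  also have "\<dots> = q ** (ap L r ** ap L (ap T s))"
    by (rule precomp2[OF qr]) (use bb q(2) qd(1) in simp_all)
  also have "ap L r ** ap L (ap T s) = ap L s ** ap T' (ap L r)"
    using bb by (simp add: A.LT.L.ap_tcomp[symmetric] swap_arr)
  finally have eq: "(q ** ap L s) ** ap T' (A.ract (tgt r)) = (q ** ap L s) ** ap T' (ap L r)"
    using bb q(2) qd(1) by simp
  note Tq = joint_coeqD(3)[OF B.TR.left_adjoint_joint_coeq[OF q(1)], of "q ** ap L s"]
  show ?thesis using Tq eq bb q(2) qd(1) by auto
qed

text \<open>
  Two successive coequalizers give the joint one, because \<open>L'\<close> and \<open>L' T'\<close> preserve the first.
\<close>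

lemma is_tensor_iterated:
  assumes b: "bimod r s" and q: "joint_coeq {(A.ract (tgt r), ap L r)} q" "src q = eo L (tgt r)"
    and t: "ok t" "src t = eo T' (tgt q)" "tgt t = tgt q" "t ** ap T' q = q ** ap L s"
    and q': "joint_coeq {(B.ract (tgt q), ap L' t)} q'" "src q' = eo L' (tgt q)"
  shows "is_tensor r s (q' ** ap L' q)"
proof -
  note bb = bimodD[OF b] and qd = joint_coeqD[OF q(1)] and qd' = joint_coeqD[OF q'(1)]
  let ?U = "tgt r"
  have o: "tgt q \<in> Obj C" by (rule okD(2)[OF qd(1)])
  have qr: "q ** A.ract ?U = q ** ap L r" using qd(2)[OF singletonI] by simp
  have qr': "q' ** B.ract (tgt q) = q' ** ap L' t" using qd'(2)[OF singletonI] by simp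
  note Lq = B.LT.left_adjoint_joint_coeq[OF q(1)]
  note LTq = B.LT.left_adjoint_joint_coeq[OF B.TR.left_adjoint_joint_coeq[OF q(1)]]
  have nat: "B.ract (tgt q) ** ap L' (ap T' q) = ap L' q ** B.ract (eo L ?U)"
    using B.ract_nat[OF qd(1)] q(2) by simp
  have Lt: "ap L' t ** ap L' (ap T' q) = ap L' q ** ap L' (ap L s)"
    by (rule B.LT.L.ap_square[OF t(4)]) (use t qd(1) q(2) bb in simp_all)
  have "q' ** (ap L' q ** B.ract (eo L ?U)) = q' ** (B.ract (tgt q) ** ap L' (ap T' q))" by (simp add: nat)
  also have "\<dots> = q' ** (ap L' t ** ap L' (ap T' q))"
    by (rule precomp2[OF qr']) (use q(2) qd(1) q'(2) qd'(1) t o in simp_all)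
  finally have e2: "(q' ** ap L' q) ** B.ract (eo L ?U) = (q' ** ap L' q) ** ap L' (ap L s)"
    using q(2) qd(1) q'(2) qd'(1) bb by (simp add: Lt)
  have e1: "(q' ** ap L' q) ** ap L' (A.ract ?U) = (q' ** ap L' q) ** ap L' (ap L r)"
    using q(2) qd(1) q'(2) qd'(1) bb by (simp add: B.LT.L.ap_tcomp[symmetric] qr)
  show ?thesis
    unfolding is_tensor_def joint_coeq_def
  proof (intro conjI allI impI)
    show "src (q' ** ap L' q) = eo L' (eo L ?U)" using q(2) by simp
    show "ok (q' ** ap L' q)" using q(2) qd(1) q'(2) qd'(1) by simp
    show "\<forall>(f, g)\<in>{(ap L' (A.ract ?U), ap L' (ap L r)), (B.ract (eo L ?U), ap L' (ap L s))}.
        ok f \<and> ok g \<and> src f = src g \<and> tgt f = src (q' ** ap L' q) \<and> tgt g = src (q' ** ap L' q) \<and>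
        (q' ** ap L' q) ** f = (q' ** ap L' q) ** g"
      using e1 e2 q(2) bb by simp
  next
    fix h assume h: "ok h \<and> src h = src (q' ** ap L' q) \<and>
      (\<forall>(f, g)\<in>{(ap L' (A.ract ?U), ap L' (ap L r)), (B.ract (eo L ?U), ap L' (ap L s))}. h ** f = h ** g)"
    then obtain k where k: "ok k" "src k = eo L' (tgt q)" "tgt k = tgt h" "k ** ap L' q = h"
      using joint_coeqD(3)[OF Lq, of h] by auto
    have "k ** B.ract (tgt q) = k ** ap L' t"
    proof (rule joint_coeqD(4)[OF LTq])
      have "(k ** B.ract (tgt q)) ** ap L' (ap T' q) = k ** (ap L' q ** B.ract (eo L ?U))"
        using k(1,2) o q(2) qd(1) by (simp add: nat)
      also have "\<dots> = h ** B.ract (eo L ?U)"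
        by (rule precomp[OF k(4)]) (use k(1,2) q(2) qd(1) bb in simp_all)
      also have "\<dots> = h ** ap L' (ap L s)" using h by simp
      also have "\<dots> = k ** (ap L' q ** ap L' (ap L s))"
        by (rule precomp[OF k(4), symmetric]) (use k(1,2) q(2) qd(1) bb in simp_all)
      also have "\<dots> = (k ** ap L' t) ** ap L' (ap T' q)" using k(1,2) t qd(1) by (simp add: Lt)
      finally show "(k ** B.ract (tgt q)) ** ap L' (ap T' q) = (k ** ap L' t) ** ap L' (ap T' q)" .
    qed (use k t o in simp_all)
    then obtain l where l: "ok l" "src l = tgt q'" "tgt l = tgt k" "l ** q' = k"
      using joint_coeqD(3)[OF q'(1), of k] k(1,2) q'(2) by auto
    have "l ** (q' ** ap L' q) = h"
      using precomp[OF l(4), of "ap L' q"] l qd(1) qd'(1) q'(2) k(4) by simp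
    then show "\<exists>k. ok k \<and> src k = tgt (q' ** ap L' q) \<and> tgt k = tgt h \<and> k ** (q' ** ap L' q) = h"
      using l k(3) by (intro exI[of _ l]) simp
  next
    fix k l assume kl: "ok k \<and> ok l \<and> src k = tgt (q' ** ap L' q) \<and> src l = tgt (q' ** ap L' q) \<and> tgt k = tgt l \<and>
      k ** (q' ** ap L' q) = l ** (q' ** ap L' q)"
    have "k ** q' = l ** q'"
      by (rule joint_coeqD(4)[OF Lq]) (use kl qd(1) qd'(1) q'(2) in simp_all)
    then show "k = l" by (rule joint_coeqD(4)[OF q'(1), rotated 5]) (use kl in simp_all)
  qed
qed

text \<open>
  The left action of \<open>S\<close> passes to the second coequalizer. It is constructed on the joint coequalizer, whose two pairs it
  respects by linearity of \<open>lact\<close> and of the structure maps.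
\<close>

lemma tensor_left_act:
  assumes b: "bimod r s" and q: "joint_coeq {(A.ract (tgt r), ap L r)} q" "src q = eo L (tgt r)"
    and q': "is_tensor r s (q' ** ap L' q)" "ok q'" "src q' = eo L' (tgt q)"
    and k: "ok k" "src k = eo S (tgt q)" "tgt k = tgt q" "k ** ap S q = q ** A.lact (tgt r)"
    and S: "ap S (B.ract (eo L (tgt r))) = B.ract (eo S (eo L (tgt r)))" "ap T' (A.lact (tgt r)) = A.lact (eo T' (tgt r))"
  shows "\<exists>l. ok l \<and> src l = eo S (tgt q') \<and> tgt l = tgt q' \<and> l ** ap S q' = q' ** ap L' k"
proof -
  note bb = bimodD[OF b] and qd = joint_coeqD[OF q(1)] and pd = is_tensorD[OF q'(1)]
  let ?U = "tgt r" and ?p = "q' ** ap L' q"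
  let ?h = "?p ** ap L' (A.lact ?U)"
  have p: "joint_coeq {(ap L' (A.ract ?U), ap L' (ap L r)), (B.ract (eo L ?U), ap L' (ap L s))} ?p"
    using q'(1) by (simp only: is_tensor_def)
  note Sp = A.SL.left_adjoint_joint_coeq[OF p]
  have o: "tgt q \<in> Obj C" by (rule okD(2)[OF qd(1)])
  have okp: "ok ?p" "src ?p = eo L' (eo L ?U)" using pd by simp_all
  define p where "p = ?p"
  have P: "ok p" "src p = eo L' (eo L ?U)" "tgt p = tgt q'" using okp by (simp_all add: p_def)
  have p1: "p ** ap L' (A.ract ?U) = p ** ap L' (ap L r)" and p2: "p ** B.ract (eo L ?U) = p ** ap L' (ap L s)"
    using pd(4,5) by (simp_all only: p_def)
  have "(p ** ap L' (A.lact ?U)) ** ap S (ap L' (A.ract ?U)) = p ** (ap L' (A.ract ?U) ** ap L' (A.lact (eo T ?U)))"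
    using P bb A.lact_ract[of ?U] by (simp add: swap_arr[symmetric] B.LT.L.ap_tcomp[symmetric])
  also have "\<dots> = p ** (ap L' (ap L r) ** ap L' (A.lact (eo T ?U)))"
    by (rule precomp2[OF p1]) (use P bb in simp_all)
  also have "\<dots> = (p ** ap L' (A.lact ?U)) ** ap S (ap L' (ap L r))"
    using P bb A.lact_nat[of r] by (simp add: swap_arr(4)[symmetric] B.LT.L.ap_tcomp[symmetric])
  finally have h1: "(p ** ap L' (A.lact ?U)) ** ap S (ap L' (A.ract ?U)) = (p ** ap L' (A.lact ?U)) ** ap S (ap L' (ap L r))" .
  have "(p ** ap L' (A.lact ?U)) ** ap S (B.ract (eo L ?U)) = p ** (B.ract (eo L ?U) ** ap L' (ap T' (A.lact ?U)))"
    using P bb B.ract_nat[of "A.lact ?U"] by (simp add: S(1))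
  also have "\<dots> = p ** (ap L' (ap L s) ** ap L' (ap T' (A.lact ?U)))"
    by (rule precomp2[OF p2]) (use P bb in simp_all)
  also have "\<dots> = (p ** ap L' (A.lact ?U)) ** ap S (ap L' (ap L s))"
    using P bb A.lact_nat[of s] by (simp add: swap_arr(4)[symmetric] B.LT.L.ap_tcomp[symmetric] S(2))
  finally have h2: "(p ** ap L' (A.lact ?U)) ** ap S (B.ract (eo L ?U)) = (p ** ap L' (A.lact ?U)) ** ap S (ap L' (ap L s))" .
  have hf: "(p ** ap L' (A.lact ?U)) ** f = (p ** ap L' (A.lact ?U)) ** g"
    if "(f, g) \<in> (\<lambda>(f, g). (ap S f, ap S g)) `
      {(ap L' (A.ract ?U), ap L' (ap L r)), (B.ract (eo L ?U), ap L' (ap L s))}" for f g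
    using that h1 h2 by auto
  obtain l where l: "ok l" "src l = eo S (tgt q')" "tgt l = tgt q'" "l ** ap S p = p ** ap L' (A.lact ?U)"
    using joint_coeqD(3)[OF Sp[folded p_def], of "p ** ap L' (A.lact ?U)"] hf P bb by auto
  have "l ** ap S q' = q' ** ap L' k"
  proof (rule joint_coeqD(4)[OF B.LT.left_adjoint_joint_coeq[OF A.SL.left_adjoint_joint_coeq[OF q(1)]]])
    have "(l ** ap S q') ** ap L' (ap S q) = p ** ap L' (A.lact ?U)"
      using l q q' qd(1) by (simp add: p_def A.SL.L.ap_tcomp swap_arr)
    also have "\<dots> = q' ** ap L' (q ** A.lact ?U)"
      using q q' qd(1) bb by (simp add: p_def B.LT.L.ap_tcomp)
    also have "\<dots> = (q' ** ap L' k) ** ap L' (ap S q)"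
      using q q' qd(1) k by (simp add: k(4)[symmetric] B.LT.L.ap_tcomp)
    finally show "(l ** ap S q') ** ap L' (ap S q) = (q' ** ap L' k) ** ap L' (ap S q)" .
  qed (use l q' k o in simp_all)
  then show ?thesis using l by blast
qed

lemma tensor_map_iterated:
  assumes b: "bimod r s" "bimod r1 s1"
    and q: "joint_coeq {(A.ract (tgt r), ap L r)} q" "src q = eo L (tgt r)"
    and q': "is_tensor r s (q' ** ap L' q)" "ok q'" "src q' = eo L' (tgt q)"
    and q1: "ok q1" "src q1 = eo L (tgt r1)" "is_tensor r1 s1 (q1' ** ap L' q1)" "ok q1'" "src q1' = eo L' (tgt q1)"
    and f: "bilin r s r1 s1 f" and k: "ok k" "src k = tgt q" "tgt k = tgt q1" "k ** q = q1 ** ap L f"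
  shows "\<exists>l. ok l \<and> src l = tgt q' \<and> tgt l = tgt q1' \<and> l ** q' = q1' ** ap L' k"
proof -
  note qd = joint_coeqD[OF q(1)] and ff = bilinD[OF f]
  obtain l where l: "ok l" "src l = tgt q'" "tgt l = tgt q1'"
      "l ** (q' ** ap L' q) = (q1' ** ap L' q1) ** ap L' (ap L f)"
    using tensor_map[OF b(1) q'(1) b(2) q1(3) f] by auto
  have "l ** q' = q1' ** ap L' k"
  proof (rule joint_coeqD(4)[OF B.LT.left_adjoint_joint_coeq[OF q(1)]])
    have "(l ** q') ** ap L' q = q1' ** ap L' (q1 ** ap L f)"
      using l q q' q1 qd(1) ff(1-3) by (simp add: B.LT.L.ap_tcomp)
    also have "\<dots> = (q1' ** ap L' k) ** ap L' q"
      using q q1 k qd(1) by (simp add: k(4)[symmetric] B.LT.L.ap_tcomp)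
    finally show "(l ** q') ** ap L' q = (q1' ** ap L' k) ** ap L' q" .
  qed (use l q' q1 k in simp_all)
  then show ?thesis using l by blast
qed

end

section \<open>Bimodules\<close>

text \<open>
  Two actions on \<open>M\<close> that commute strictly. The second one is the right action, over the reversed tensor
  product of the same category.
\<close>

locale nakayama_bitensor = lin_category M
    + LA: nakayama_tensor C M to ta lo la I a a1 a2 a0 el cv ev1 cv1 ev0 cv0 m u N i
    + RA: nakayama_tensor C M to' ta' lo' la' I b b1 b2 b0 el' cv' ev1' cv1' ev0' cv0' m' u' N i
  for C :: "('c, 'd, 'k::field, 'y) lcat_scheme" and M :: "('o, 'm, 'k, 'z) lcat_scheme" (structure)
    and to ta lo la I a a1 a2 a0 el cv ev1 cv1 ev0 cv0 m u
    and to' ta' lo' la' b b1 b2 b0 el' cv' ev1' cv1' ev0' cv0' m' u' N i +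
  assumes middle: "X \<in> Obj C \<Longrightarrow> Y \<in> Obj C \<Longrightarrow> U \<in> Obj M \<Longrightarrow> lo' Y (lo X U) = lo X (lo' Y U)"
    and middle_arr: "\<lbrakk>X \<in> Obj C; X' \<in> Obj C; Y \<in> Obj C; Y' \<in> Obj C; U \<in> Obj M; V \<in> Obj M;
      f \<in> arr C X X'; g \<in> arr C Y Y'; h \<in> arr M U V\<rbrakk> \<Longrightarrow> la' g (la f h) = la f (la' g h)"
begin

no_notation LA.CT.one.tcomp (infixr "**" 55)
notation tcomp (infixr "**" 55)

lemma right_nt:
  assumes "X \<in> Obj C" "X' \<in> Obj C" "f \<in> arr C X X'" "Y \<in> Obj C" "U \<in> Obj M"
  shows "la' (Id C Y) (LA.nt f U) = LA.nt f (lo' Y U)"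
  using middle_arr[OF assms(1,2,4,4,5,5,3) LA.CT.one.id_arr[OF assms(4)] id_arr[OF assms(5)]]
    RA.AC.ba_id[OF assms(4,5)] by (simp add: LA.nt_def)

lemma left_nt:
  assumes "X \<in> Obj C" "X' \<in> Obj C" "f \<in> arr C X X'" "Y \<in> Obj C" "U \<in> Obj M"
  shows "la (Id C Y) (RA.nt f U) = RA.nt f (lo Y U)"
  using middle_arr[OF assms(4,4,1,2,5,5) LA.CT.one.id_arr[OF assms(4)] assms(3) id_arr[OF assms(5)]]
    LA.AC.ba_id[OF assms(4,5)] by (simp add: RA.nt_def)

sublocale CM: commuting_monads M
    "LA.by_obj a" "LA.by_obj a1" "LA.by_obj a2" "LA.by_obj a0"
    "LA.nt cv" "LA.nt el" "LA.nt cv1" "LA.nt ev1" "LA.nt cv0" "LA.nt ev0" "LA.nt m" "LA.nt u"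
    "RA.by_obj b" "RA.by_obj b1" "RA.by_obj b2" "RA.by_obj b0"
    "RA.nt cv'" "RA.nt el'" "RA.nt cv1'" "RA.nt ev1'" "RA.nt cv0'" "RA.nt ev0'" "RA.nt m'" "RA.nt u'"
proof (intro commuting_monads.intro commuting_monads_axioms.intro lin_category_axioms
    LA.adjoint_monad_act RA.adjoint_monad_act)
  have cv1: "cv1 \<in> arr C I (to a1 a2)" using LA.dp1 by (simp add: LA.dual_pair_def)
  note r = right_nt[OF LA.I_obj LA.objs(3) LA.duals_in(5)] right_nt[OF LA.objs(2) LA.I_obj LA.duals_in(4)]
    right_nt[OF LA.I_obj LA.CT.bo_obj[OF LA.duals_in(2,3)] cv1]
    right_nt[OF LA.objs(1) LA.duals_in(1) LA.m] right_nt[OF LA.I_obj LA.duals_in(1) LA.u]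
  note l = left_nt[OF RA.I_obj RA.objs(3) RA.duals_in(5)]
    left_nt[OF RA.objs(1) RA.duals_in(1) RA.m] left_nt[OF RA.I_obj RA.duals_in(1) RA.u]
  fix F G :: "('o, 'm) endo" and X
  have c: "commute_endo M (LA.by_obj X) (RA.by_obj Y)" if "X \<in> Obj C" "Y \<in> Obj C" for X Y
    unfolding commute_endo_def LA.by_obj_simps RA.by_obj_simps
    using middle[OF that] middle_arr[OF that(1,1,2,2) _ _ LA.CT.one.id_arr[OF that(1)] LA.CT.one.id_arr[OF that(2)]]
    by blast
  show "commute_endo M F G" if "F \<in> {LA.by_obj a, LA.by_obj a1, LA.by_obj a2}" "G \<in> {RA.by_obj b, RA.by_obj b1, RA.by_obj b2}"
    using that by (auto intro!: c LA.duals_in(1-3) RA.duals_in(1-3))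
  show "ea G (LA.nt cv X) = LA.nt cv (eo G X) \<and> ea G (LA.nt el X) = LA.nt el (eo G X) \<and>
      ea G (LA.nt cv1 X) = LA.nt cv1 (eo G X) \<and> ea G (LA.nt m X) = LA.nt m (eo G X) \<and> ea G (LA.nt u X) = LA.nt u (eo G X)"
    if "G \<in> {RA.by_obj b, RA.by_obj b1}" "X \<in> Obj M"
    using that by (auto simp: RA.by_obj_simps r RA.duals_in(1,2))
  show "ea F (RA.nt cv' X) = RA.nt cv' (eo F X) \<and> ea F (RA.nt m' X) = RA.nt m' (eo F X) \<and> ea F (RA.nt u' X) = RA.nt u' (eo F X)"
    if "F \<in> {LA.by_obj a, LA.by_obj a1}" "X \<in> Obj M"
    using that by (auto simp: LA.by_obj_simps l LA.duals_in(1,2))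
qed

definition lmod :: "'o \<times> 'm \<times> 'm \<Rightarrow> 'o \<times> 'm" where
  "lmod x = (fst x, fst (snd x))"

text \<open>The left tensor product with its induced right action.\<close>

definition mid :: "'o \<times> 'm \<times> 'm \<Rightarrow> 'o \<times> 'm" where
  "mid x = (fst (LA.tens (lmod x)), desc M (lo' b (fst (LA.tens (lmod x)))) (fst (LA.tens (lmod x)))
     (la' (Id C b) (snd (LA.tens (lmod x)))) (snd (LA.tens (lmod x)) \<cdot> la (Id C a1) (snd (snd x))))"

definition bitens :: "'o \<times> 'm \<times> 'm \<Rightarrow> 'o \<times> 'm" where
  "bitens x = RA.tens (mid x)"

definition bitens_map :: "'o \<times> 'm \<times> 'm \<Rightarrow> 'o \<times> 'm \<times> 'm \<Rightarrow> 'm \<Rightarrow> 'm" where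
  "bitens_map x y f = RA.tens_map (mid x) (mid y) (LA.tens_map (lmod x) (lmod y) f)"

definition bitens_lact :: "'o \<times> 'm \<times> 'm \<Rightarrow> 'm" where
  "bitens_lact x = desc M (lo a2 (fst (bitens x))) (fst (bitens x)) (la (Id C a2) (snd (bitens x)))
     (snd (bitens x) \<cdot> la' (Id C b1) (LA.tens_act (lmod x)))"

definition biproj :: "'o \<times> 'm \<times> 'm \<Rightarrow> ('o, 'm) tarr" where
  "biproj x = RA.proj (mid x) ** ap (RA.by_obj b1) (LA.proj (lmod x))"

definition bimod :: "'o \<times> 'm \<times> 'm \<Rightarrow> bool" where
  "bimod x \<longleftrightarrow> CM.bimod (LA.act_arr (lmod x)) (RA.act_arr (fst x, snd (snd x)))"

lemma fst_mid [simp]: "fst (lmod x) = fst x" "snd (lmod x) = fst (snd x)" "fst (mid x) = fst (LA.tens (lmod x))"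
  "fst (RA.tens (mid x)) = fst (bitens x)" "snd (RA.tens (mid x)) = snd (bitens x)"
  by (simp_all add: lmod_def mid_def bitens_def)

lemma ok_lmod: "bimod x \<Longrightarrow> ok (LA.act_arr (lmod x))"
  using CM.bimodD(5) unfolding bimod_def by blast

lemma LA_proj:
  assumes x: "bimod x"
  shows "joint_coeq {(LA.AM.ract (tgt (LA.act_arr (lmod x))), ap (LA.by_obj a1) (LA.act_arr (lmod x)))} (LA.proj (lmod x))"
    "src (LA.proj (lmod x)) = eo (LA.by_obj a1) (tgt (LA.act_arr (lmod x)))"
  using LA.joint_coeq_proj[OF ok_lmod[OF x]] by (simp_all add: LA.by_obj_simps)

lemma mid:
  assumes x: "bimod x"
  shows "ok (RA.act_arr (mid x))"
    "RA.act_arr (mid x) ** ap (RA.by_obj b) (LA.proj (lmod x)) =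
     LA.proj (lmod x) ** ap (LA.by_obj a1) (RA.act_arr (fst x, snd (snd x)))"
proof -
  note q = LA_proj[OF x]
  obtain k where k: "ok k" "src k = eo (RA.by_obj b) (tgt (LA.proj (lmod x)))" "tgt k = tgt (LA.proj (lmod x))"
    "k ** ap (RA.by_obj b) (LA.proj (lmod x)) = LA.proj (lmod x) ** ap (LA.by_obj a1) (RA.act_arr (fst x, snd (snd x)))"
    using CM.tensor_right_act[OF x[unfolded bimod_def] q] by blast
  have "snd (mid x) = raw k"
    using desc_joint_coeq[OF RA.AM.TR.left_adjoint_joint_coeq[OF q(1)] k(1)] k(2,3) arg_cong[OF k(4), of raw]
    by (simp add: mid_def RA.by_obj_simps LA.by_obj_simps)
  then have "RA.act_arr (mid x) = k" using k(2,3) by (intro typed_eqI) (simp_all add: RA.by_obj_simps)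
  with k show "ok (RA.act_arr (mid x))"
    "RA.act_arr (mid x) ** ap (RA.by_obj b) (LA.proj (lmod x)) =
     LA.proj (lmod x) ** ap (LA.by_obj a1) (RA.act_arr (fst x, snd (snd x)))" by simp_all
qed

lemma is_tensor_biproj:
  assumes x: "bimod x"
  shows "CM.is_tensor (LA.act_arr (lmod x)) (RA.act_arr (fst x, snd (snd x))) (biproj x)"
  unfolding biproj_def
  using RA.joint_coeq_proj[OF mid(1)[OF x]]
  by (intro CM.is_tensor_iterated[OF x[unfolded bimod_def] LA_proj[OF x] mid(1)[OF x] _ _ mid(2)[OF x]])
    (simp_all add: RA.by_obj_simps)

lemma biproj_simps [simp]: "tgt (biproj x) = fst (bitens x)"
  by (simp add: biproj_def)

lemma ok_RA_proj: "bimod x \<Longrightarrow> ok (RA.proj (mid x))"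
  by (rule joint_coeqD(1)[OF RA.joint_coeq_proj[OF mid(1)]])

lemma bitens_in: "bimod x \<Longrightarrow> fst (bitens x) \<in> Obj M"
  using okD(2)[OF ok_RA_proj] by simp

lemma bitens_ract:
  assumes x: "bimod x"
  shows "ok (lo' b2 (fst (bitens x)), RA.tens_act (mid x), fst (bitens x))"
    and "(lo' b2 (fst (bitens x)), RA.tens_act (mid x), fst (bitens x)) ** ap (RA.by_obj b2) (biproj x) =
      biproj x ** RA.AM.lact (eo (LA.by_obj a1) (fst x))"
proof -
  let ?k = "(lo' b2 (fst (bitens x)), RA.tens_act (mid x), fst (bitens x))"
  note k = RA.tens_act[OF mid(1)[OF x], simplified] and qd = joint_coeqD(1)[OF LA_proj(1)[OF x]] and q = ok_RA_proj[OF x]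
  have o: "fst (LA.tens (lmod x)) \<in> Obj M" using okD(2)[OF qd] by simp
  show "ok ?k" by (rule k(1))
  have "?k ** ap (RA.by_obj b2) (biproj x) = ?k ** (ap (RA.by_obj b2) (RA.proj (mid x)) **
      ap (RA.by_obj b2) (ap (RA.by_obj b1) (LA.proj (lmod x))))"
    using q qd by (simp add: biproj_def RA.AM.SL.L.ap_tcomp RA.by_obj_simps)
  also have "\<dots> = RA.proj (mid x) ** (RA.AM.lact (fst (LA.tens (lmod x))) **
      ap (RA.by_obj b2) (ap (RA.by_obj b1) (LA.proj (lmod x))))"
    by (rule precomp2[OF k(2)]) (use k(1) q qd o in \<open>simp_all add: RA.by_obj_simps\<close>)
  also have "\<dots> = biproj x ** RA.AM.lact (eo (LA.by_obj a1) (fst x))"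
    using RA.AM.lact_nat[OF qd] q qd okD(1)[OF qd] by (simp add: biproj_def RA.by_obj_simps LA.by_obj_simps)
  finally show "?k ** ap (RA.by_obj b2) (biproj x) = biproj x ** RA.AM.lact (eo (LA.by_obj a1) (fst x))" .
qed

text \<open>
  The left action is defined by descent along the second projection only; that it is compatible with the whole
  projection \<open>biproj\<close> is what the bimodule theorem asks for.
\<close>

lemma bitens_lact:
  assumes x: "bimod x"
  shows "ok (lo a2 (fst (bitens x)), bitens_lact x, fst (bitens x))"
    and "(lo a2 (fst (bitens x)), bitens_lact x, fst (bitens x)) ** ap (LA.by_obj a2) (biproj x) =
      biproj x ** ap (RA.by_obj b1) (LA.AM.lact (fst x))"
proof -
  let ?q = "LA.proj (lmod x)" and ?q' = "RA.proj (mid x)"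
  let ?S = "LA.by_obj a2" and ?L' = "RA.by_obj b1"
  let ?k = "(lo a2 (fst (LA.tens (lmod x))), LA.tens_act (lmod x), fst (LA.tens (lmod x)))"
  note qd = joint_coeqD(1)[OF LA_proj(1)[OF x]] and q = ok_RA_proj[OF x] and k = LA.tens_act[OF ok_lmod[OF x]]
  have U: "fst x \<in> Obj M" and LU: "lo a1 (fst x) \<in> Obj M" using okD[OF qd] okD(2)[OF ok_lmod[OF x]] by simp_all
  have o: "fst (LA.tens (lmod x)) \<in> Obj M" using okD(2)[OF qd] by simp
  have S1: "ap ?S (RA.AM.ract (lo a1 (fst x))) = RA.AM.ract (lo a2 (lo a1 (fst x)))"
    using left_nt[OF RA.objs(2) RA.duals_in(2) RA.dual_ract(1) LA.duals_in(3) LU] LU LA.AC.bo_obj[OF LA.duals_in(3) LU]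
      middle[OF LA.duals_in(3) RA.duals_in(2) LU] middle[OF LA.duals_in(3) RA.duals_in(1) LU]
      middle[OF LA.duals_in(3) RA.duals_in(2) RA.AC.bo_obj[OF RA.duals_in(1) LU]]
    by (intro typed_eqI) (simp_all add: RA.by_obj_simps LA.by_obj_simps RA.dual_ract(2)[symmetric])
  have S2: "ap (RA.by_obj b) (LA.AM.lact (fst x)) = LA.AM.lact (lo' b (fst x))"
    using right_nt[OF LA.objs(5) LA.duals_in(2) LA.dual_lact(1) RA.duals_in(1) U] U RA.AC.bo_obj[OF RA.duals_in(1) U]
      middle[OF LA.duals_in(2) RA.duals_in(1) U] middle[OF LA.duals_in(3) RA.duals_in(1) LU]
    by (intro typed_eqI) (simp_all add: RA.by_obj_simps LA.by_obj_simps LA.dual_lact(2)[symmetric])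
  obtain l where l: "ok l" "src l = lo a2 (fst (bitens x))" "tgt l = fst (bitens x)" "l ** ap ?S ?q' = ?q' ** ap ?L' ?k"
    using CM.tensor_left_act[OF x[unfolded bimod_def] LA_proj[OF x] is_tensor_biproj[OF x, unfolded biproj_def] q _ k(1)
      _ _ _ _ _] k(2) S1 S2 by (auto simp: RA.by_obj_simps LA.by_obj_simps)
  have "bitens_lact x = raw l"
    using desc_joint_coeq[OF LA.AM.SL.left_adjoint_joint_coeq[OF RA.joint_coeq_proj[OF mid(1)[OF x]]] l(1)] l(2,3)
      arg_cong[OF l(4), of raw] by (simp add: bitens_lact_def RA.by_obj_simps LA.by_obj_simps)
  then have eq: "(lo a2 (fst (bitens x)), bitens_lact x, fst (bitens x)) = l"
    using l(2,3) by (intro typed_eqI) simp_all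
  then show "ok (lo a2 (fst (bitens x)), bitens_lact x, fst (bitens x))" using l by simp
  have "l ** ap ?S (biproj x) = l ** (ap ?S ?q' ** ap ?L' (ap ?S ?q))"
    using q qd by (simp add: biproj_def LA.AM.SL.L.ap_tcomp CM.swap_arr RA.by_obj_simps)
  also have "\<dots> = ?q' ** (ap ?L' ?k ** ap ?L' (ap ?S ?q))"
    by (rule precomp2[OF l(4)]) (use l q qd o k(1) middle[OF LA.duals_in(3) RA.duals_in(2) o] in \<open>simp_all add: RA.by_obj_simps LA.by_obj_simps\<close>)
  also have "ap ?L' ?k ** ap ?L' (ap ?S ?q) = ap ?L' (?q ** LA.AM.lact (fst x))"
    using k qd by (simp add: RA.AM.LT.L.ap_tcomp[symmetric] LA.by_obj_simps)
  also have "?q' ** \<dots> = biproj x ** ap ?L' (LA.AM.lact (fst x))"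
    using q qd U by (simp add: biproj_def RA.AM.LT.L.ap_tcomp RA.by_obj_simps LA.by_obj_simps)
  finally show "(lo a2 (fst (bitens x)), bitens_lact x, fst (bitens x)) ** ap ?S (biproj x) =
      biproj x ** ap ?L' (LA.AM.lact (fst x))" by (simp add: eq)
qed

lemma bitens_map:
  assumes x: "bimod x" and y: "bimod y"
    and f: "CM.bilin (LA.act_arr (lmod x)) (RA.act_arr (fst x, snd (snd x)))
      (LA.act_arr (lmod y)) (RA.act_arr (fst y, snd (snd y))) (fst x, f, fst y)"
  shows "ok (fst (bitens x), bitens_map x y f, fst (bitens y))"
    and "(fst (bitens x), bitens_map x y f, fst (bitens y)) ** biproj x =
      biproj y ** ap (RA.by_obj b1) (ap (LA.by_obj a1) (fst x, f, fst y))"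
proof -
  let ?f = "(fst x, f, fst y)" and ?L' = "RA.by_obj b1"
  let ?k = "(fst (LA.tens (lmod x)), LA.tens_map (lmod x) (lmod y) f, fst (LA.tens (lmod y)))"
  note ff = CM.bilinD[OF f]
  note qx = joint_coeqD(1)[OF LA_proj(1)[OF x]] and qy = joint_coeqD(1)[OF LA_proj(1)[OF y]]
  have k: "ok ?k" "?k ** LA.proj (lmod x) = LA.proj (lmod y) ** ap (LA.by_obj a1) ?f"
    using LA.tens_map[OF ok_lmod[OF x] ok_lmod[OF y] ff(1)] ff(4) by simp_all
  obtain l where l: "ok l" "src l = fst (bitens x)" "tgt l = fst (bitens y)" "l ** RA.proj (mid x) = RA.proj (mid y) ** ap ?L' ?k"
    using CM.tensor_map_iterated[OF x[unfolded bimod_def] y[unfolded bimod_def] LA_proj[OF x]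
      is_tensor_biproj[OF x, unfolded biproj_def] ok_RA_proj[OF x] _ qy LA_proj(2)[OF y]
      is_tensor_biproj[OF y, unfolded biproj_def] ok_RA_proj[OF y] _ f k(1) _ _ k(2)]
    by (auto simp: RA.by_obj_simps)
  have eq: "(fst (bitens x), bitens_map x y f, fst (bitens y)) = l"
    using RA.tens_map_eq[OF mid(1)[OF x], of ?k l "mid y"] l by (simp add: bitens_map_def)
  then show "ok (fst (bitens x), bitens_map x y f, fst (bitens y))" using l by simp
  have "l ** biproj x = RA.proj (mid y) ** (ap ?L' ?k ** ap ?L' (LA.proj (lmod x)))"
    unfolding biproj_def
    by (rule precomp2[OF l(4)]) (use l k(1) qx ok_RA_proj[OF x] ok_RA_proj[OF y] in \<open>simp_all add: RA.by_obj_simps\<close>)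
  also have "ap ?L' ?k ** ap ?L' (LA.proj (lmod x)) = ap ?L' (LA.proj (lmod y)) ** ap ?L' (ap (LA.by_obj a1) ?f)"
    by (rule RA.AM.LT.L.ap_square[OF k(2)]) (use k(1) qx qy ff(1) in \<open>simp_all add: LA.by_obj_simps\<close>)
  finally show "(fst (bitens x), bitens_map x y f, fst (bitens y)) ** biproj x =
      biproj y ** ap ?L' (ap (LA.by_obj a1) ?f)"
    using ok_RA_proj[OF y] qy ff(1) by (simp add: eq biproj_def RA.by_obj_simps LA.by_obj_simps)
qed

theorem nakayama_of_bimodules:
  fixes D :: "('o \<times> 'm \<times> 'm, 'm, 'k, 'w) lcat_scheme"
  assumes D: "Obj D = {(U, \<rho>, \<sigma>). U \<in> Obj M \<and> (\<rho> \<in> arr M (lo a U) U \<and>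
          \<rho> \<cdot> LA.nt m U = \<rho> \<cdot> la (Id C a) \<rho> \<and> \<rho> \<cdot> LA.nt u U = Id M U) \<and> (\<sigma> \<in> arr M (lo' b U) U \<and>
          \<sigma> \<cdot> RA.nt m' U = \<sigma> \<cdot> la' (Id C b) \<sigma> \<and> \<sigma> \<cdot> RA.nt u' U = Id M U) \<and>
          \<sigma> \<cdot> la' (Id C b) \<rho> = \<rho> \<cdot> la (Id C a) \<sigma>}"
      "Hom D = (\<lambda>(U, \<rho>, \<sigma>) (V, \<rho>', \<sigma>'). (Hom M U V)\<lparr>carrier :=
          {f \<in> arr M U V. f \<cdot> \<rho> = \<rho>' \<cdot> la (Id C a) f \<and> f \<cdot> \<sigma> = \<sigma>' \<cdot> la' (Id C b) f}\<rparr>)"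
      "Id D = (\<lambda>(U, \<rho>, \<sigma>). Id M U)" "Comp D = Comp M"
    and F: "Fo F = (\<lambda>x. (Fo N (fst (bitens x)),
          Fa N (lo a2 (fst (bitens x))) (fst (bitens x)) (bitens_lact x) \<cdot> LA.twist (fst (bitens x)),
          Fa N (lo' b2 (fst (bitens x))) (fst (bitens x)) (RA.tens_act (mid x)) \<cdot> RA.twist (fst (bitens x))))"
      "Fa F = (\<lambda>x y f. Fa N (fst (bitens x)) (fst (bitens y)) (bitens_map x y f))"
  shows "nakayama_given_by D F"
proof -
  note nak = LA.is_nakayama_nak_functor[OF LA.nakayama]
  have mod: "LA.AM.is_mod (lo a U, \<rho>, U) \<longleftrightarrow> U \<in> Obj M \<and> \<rho> \<in> arr M (lo a U) U \<and>
      \<rho> \<cdot> LA.nt m U = \<rho> \<cdot> la (Id C a) \<rho> \<and> \<rho> \<cdot> LA.nt u U = Id M U" for U \<rho>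
    by (auto simp: LA.AM.is_mod_def LA.AM.is_act_def ok_typed tcomp_def ap_def LA.AM.mu_def LA.AM.eta_def tid_def
        LA.by_obj_simps LA.AC.bo_obj LA.duals_in)
  have mod': "RA.AM.is_mod (lo' b U, \<rho>, U) \<longleftrightarrow> U \<in> Obj M \<and> \<rho> \<in> arr M (lo' b U) U \<and>
      \<rho> \<cdot> RA.nt m' U = \<rho> \<cdot> la' (Id C b) \<rho> \<and> \<rho> \<cdot> RA.nt u' U = Id M U" for U \<rho>
    by (auto simp: RA.AM.is_mod_def RA.AM.is_act_def ok_typed tcomp_def ap_def RA.AM.mu_def RA.AM.eta_def tid_def
        RA.by_obj_simps RA.AC.bo_obj RA.duals_in)
  have obj: "x \<in> Obj D \<longleftrightarrow> bimod x" for x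
    by (auto simp: D(1) bimod_def CM.bimod_def LA.act_arr_def RA.act_arr_def mod mod' tcomp_def ap_def
        RA.by_obj_simps LA.by_obj_simps middle LA.duals_in RA.duals_in)
  interpret BC: bimodule_category M
      "LA.by_obj a" "LA.by_obj a1" "LA.by_obj a2" "LA.by_obj a0"
      "LA.nt cv" "LA.nt el" "LA.nt cv1" "LA.nt ev1" "LA.nt cv0" "LA.nt ev0" "LA.nt m" "LA.nt u"
      "RA.by_obj b" "RA.by_obj b1" "RA.by_obj b2" "RA.by_obj b0"
      "RA.nt cv'" "RA.nt el'" "RA.nt cv1'" "RA.nt ev1'" "RA.nt cv0'" "RA.nt ev0'" "RA.nt m'" "RA.nt u'"
      D fst "\<lambda>x. fst (snd x)" "\<lambda>x. snd (snd x)" "\<lambda>U r s. (U, r, s)"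
  proof (intro bimodule_category.intro bimodule_category_axioms.intro CM.commuting_monads_axioms)
    show "CM.bimod (eo (LA.by_obj a) (fst x), fst (snd x), fst x) (eo (RA.by_obj b) (fst x), snd (snd x), fst x)"
      if "x \<in> Obj D" for x
      using that by (simp add: obj bimod_def LA.act_arr_def RA.act_arr_def LA.by_obj_simps RA.by_obj_simps)
    show "(tgt r, raw r, raw s) \<in> Obj D \<and> fst (tgt r, raw r, raw s) = tgt r \<and>
        fst (snd (tgt r, raw r, raw s)) = raw r \<and> snd (snd (tgt r, raw r, raw s)) = raw s" if "CM.bimod r s" for r s
    proof -
      have "LA.act_arr (lmod (tgt r, raw r, raw s)) = r" "RA.act_arr (tgt r, raw s) = s"
        using CM.bimodD[OF that] by (auto intro!: typed_eqI simp: LA.by_obj_simps RA.by_obj_simps)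
      then show ?thesis using that by (simp add: obj bimod_def)
    qed
    show "Hom D x y = (Hom M (fst x) (fst y))\<lparr>carrier := {f \<in> arr M (fst x) (fst y).
        f \<cdot> fst (snd x) = fst (snd y) \<cdot> ea (LA.by_obj a) f \<and> f \<cdot> snd (snd x) = snd (snd y) \<cdot> ea (RA.by_obj b) f}\<rparr>"
      for x y by (simp add: D(2) case_prod_beta LA.by_obj_simps RA.by_obj_simps)
    show "Id D x = Id M (fst x)" for x by (simp add: D(3) case_prod_beta)
    show "Comp D = Comp M" by (rule D(4))
  qed
  have str: "BC.lt x = LA.act_arr (lmod x)" "BC.rt x = RA.act_arr (fst x, snd (snd x))" for x
    by (simp_all add: BC.lt_def BC.rt_def LA.act_arr_def RA.act_arr_def LA.by_obj_simps RA.by_obj_simps)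
  let ?Q = "\<lambda>x. fst (bitens x)"
  interpret BN: bimodule_nakayama M
      "LA.by_obj a" "LA.by_obj a1" "LA.by_obj a2" "LA.by_obj a0"
      "LA.nt cv" "LA.nt el" "LA.nt cv1" "LA.nt ev1" "LA.nt cv0" "LA.nt ev0" "LA.nt m" "LA.nt u"
      "RA.by_obj b" "RA.by_obj b1" "RA.by_obj b2" "RA.by_obj b0"
      "RA.nt cv'" "RA.nt el'" "RA.nt cv1'" "RA.nt ev1'" "RA.nt cv0'" "RA.nt ev0'" "RA.nt m'" "RA.nt u'"
      D fst "\<lambda>x. fst (snd x)" "\<lambda>x. snd (snd x)" "\<lambda>U r s. (U, r, s)" N LA.MC.jj
      biproj "\<lambda>x. (lo a2 (?Q x), bitens_lact x, ?Q x)" "\<lambda>x. (lo' b2 (?Q x), RA.tens_act (mid x), ?Q x)"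
      "\<lambda>x. (lo a (Fo N (?Q x)), LA.twist (?Q x), Fo N (lo a2 (?Q x)))"
      "\<lambda>x. (lo' b (Fo N (?Q x)), RA.twist (?Q x), Fo N (lo' b2 (?Q x)))"
      "\<lambda>x y f. (?Q x, bitens_map x y f, ?Q y)" F
  proof (intro bimodule_nakayama.intro bimodule_nakayama_axioms.intro BC.bimodule_category_axioms
      monad_nakayama.intro nakayama_category.intro nakayama_category_axioms.intro lin_category_axioms
      nak LA.adjoint_monad_act RA.adjoint_monad_act)
    fix x assume xD: "x \<in> Obj D"
    then have x: "bimod x" by (simp only: obj)
    show "CM.is_tensor (BC.lt x) (BC.rt x) (biproj x)" using is_tensor_biproj[OF x] by (simp add: str)
    show "LA.MC.MN.is_twist (tgt (biproj x)) (lo a (Fo N (?Q x)), LA.twist (?Q x), Fo N (lo a2 (?Q x)))"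
      using LA.is_twist[OF bitens_in[OF x]] by simp
    show "RA.MC.MN.is_twist (tgt (biproj x)) (lo' b (Fo N (?Q x)), RA.twist (?Q x), Fo N (lo' b2 (?Q x)))"
      using RA.is_twist[OF bitens_in[OF x]] by simp
    show "ok (lo a2 (?Q x), bitens_lact x, ?Q x) \<and>
        src (lo a2 (?Q x), bitens_lact x, ?Q x) = eo (LA.by_obj a2) (tgt (biproj x)) \<and>
        tgt (lo a2 (?Q x), bitens_lact x, ?Q x) = tgt (biproj x) \<and>
        (lo a2 (?Q x), bitens_lact x, ?Q x) ** ap (LA.by_obj a2) (biproj x) =
          biproj x ** ap (RA.by_obj b1) (LA.AM.lact (fst x))"
      using bitens_lact[OF x] by (simp add: LA.by_obj_simps)
    show "ok (lo' b2 (?Q x), RA.tens_act (mid x), ?Q x) \<and>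
        src (lo' b2 (?Q x), RA.tens_act (mid x), ?Q x) = eo (RA.by_obj b2) (tgt (biproj x)) \<and>
        tgt (lo' b2 (?Q x), RA.tens_act (mid x), ?Q x) = tgt (biproj x) \<and>
        (lo' b2 (?Q x), RA.tens_act (mid x), ?Q x) ** ap (RA.by_obj b2) (biproj x) =
          biproj x ** RA.AM.lact (eo (LA.by_obj a1) (fst x))"
      using bitens_ract[OF x] by (simp add: RA.by_obj_simps)
    show "Fo F x = (Fo N (tgt (biproj x)),
        raw (LA.MC.MN.Nt (lo a2 (?Q x), bitens_lact x, ?Q x) **
          (lo a (Fo N (?Q x)), LA.twist (?Q x), Fo N (lo a2 (?Q x)))),
        raw (LA.MC.MN.Nt (lo' b2 (?Q x), RA.tens_act (mid x), ?Q x) **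
          (lo' b (Fo N (?Q x)), RA.twist (?Q x), Fo N (lo' b2 (?Q x)))))"
      by (simp add: F(1) LA.MC.MN.Nt_def)
    fix y f assume y: "y \<in> Obj D" and f: "f \<in> arr D x y"
    show "ok (?Q x, bitens_map x y f, ?Q y) \<and> src (?Q x, bitens_map x y f, ?Q y) = tgt (biproj x) \<and>
        tgt (?Q x, bitens_map x y f, ?Q y) = tgt (biproj y) \<and> (?Q x, bitens_map x y f, ?Q y) ** biproj x =
        biproj y ** ap (RA.by_obj b1) (ap (LA.by_obj a1) (fst x, f, fst y))"
      using bitens_map[OF x y[unfolded obj]] f unfolding BC.arr_D[OF xD y] str by simp
    show "Fa F x y f = raw (LA.MC.MN.Nt (?Q x, bitens_map x y f, ?Q y))"
      by (simp add: F(2) LA.MC.MN.Nt_def)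
  next
    show "\<exists>P w. is_copower M V X P w" if "vector_space_on V" "finite_coords V" "X \<in> Obj M"
      for V :: "('k, 'm \<Rightarrow> 'k) module" and X by (rule LA.copowers[OF that])
    show "finite_homs M" by (rule finite_abelian_colimits(3)[OF LA.finite])
  qed
  show ?thesis by (rule BN.nakayama_of_bimodules)
qed

end

section \<open>Duals in a rigid category\<close>

context strict_rigid
begin

lemma rev_ev_rdual: "X \<in> Obj C \<Longrightarrow> ev C (rdual C X) = rev_ev C X" "X \<in> Obj C \<Longrightarrow> coev C (rdual C X) = rev_coev C X"
  using rev_ev_ldual[of "rdual C X"] rev_coev_ldual[of "rdual C X"] by (simp_all add: rdual_obj ldual_rdual)

text \<open>
  Right duals inherit strictness from left duals, since \<open>X\<close> is the left dual of its right dual.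
\<close>

lemma rdual_tens:
  assumes "X \<in> Obj C" "Y \<in> Obj C"
  shows "rdual C (X \<boxtimes> Y) = rdual C Y \<boxtimes> rdual C X"
    "rev_coev C (X \<boxtimes> Y) = (Id C (rdual C Y) \<boxdot> rev_coev C X \<boxdot> Id C Y) \<cdot> rev_coev C Y"
proof -
  note r = rdual_obj[OF assms(1)] rdual_obj[OF assms(2)]
  have l: "ldual C (rdual C Y \<boxtimes> rdual C X) = X \<boxtimes> Y" using ldual_tens[OF r(2,1)] assms by (simp add: ldual_rdual)
  show "rdual C (X \<boxtimes> Y) = rdual C Y \<boxtimes> rdual C X"
    using rdual_ldual[OF bo_obj[OF r(2,1)]] l by simp
  show "rev_coev C (X \<boxtimes> Y) = (Id C (rdual C Y) \<boxdot> rev_coev C X \<boxdot> Id C Y) \<cdot> rev_coev C Y"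
    using coev_tens[OF r(2,1)] rev_coev_ldual[OF bo_obj[OF r(2,1)]] l assms by (simp add: rev_ev_rdual ldual_rdual)
qed

lemma arrs_in [simp]:
  "X \<in> Obj C \<Longrightarrow> Id C X \<in> arr C X X" "X \<in> Obj C \<Longrightarrow> ldual C X \<in> Obj C" "X \<in> Obj C \<Longrightarrow> rdual C X \<in> Obj C"
  by (simp_all add: one.id_arr ldual_obj rdual_obj)

end

section \<open>The three cases\<close>

locale left_nakayama =
  fixes C :: "('c, 'd, 'k::field, 'y) mcat_scheme" and M :: "('o, 'm, 'k, 'z) lcat_scheme"
    and L :: "('c, 'd, 'o, 'm) laction" and A :: "('c, 'd) algebra_obj"
    and N :: "('o, 'm, 'o, 'm) fctr" and i :: "'o \<Rightarrow> 'o \<Rightarrow> 'm"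
  assumes C: "finite_multitensor C" and A: "is_algebra C A" and L: "finite_left_module_category C M L"
    and N: "is_nakayama M N i"
begin

abbreviation "a \<equiv> aobj A"

lemma nakayama_tensor: "nakayama_tensor C M (tens_obj C) (tens_arr C) (lact_obj L) (lact_arr L) (unit_obj C)
     a (ldual C a) (ldual C (ldual C a)) (rdual C a) (ev C a) (coev C a) (ev C (ldual C a)) (coev C (ldual C a))
     (rev_ev C a) (rev_coev C a) (amult A) (aunit A) N i"
proof -
  interpret C: strict_rigid C using C by (simp add: finite_multitensor_def)
  interpret L: finite_left_module_category C M L by (rule L)
  note al = A[unfolded is_algebra_def]
  have a: "a \<in> Obj C" using al by simp
  interpret MA: monoidal_action C M "tens_obj C" "tens_arr C" "lact_obj L" "lact_arr L" "unit_obj C"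
    by (intro monoidal_action.intro monoidal_action_axioms.intro L.two.lin_category_axioms
      C.bilin_bifunctor_axioms L.bilin_bifunctor_axioms C.unit_in C.unit_left C.unit_right C.tens_assoc
      L.lunit L.lassoc L.lunit_arr L.lassoc_arr)
  have dp: "MA.dual_pair X (ldual C X) (ev C X) (coev C X)" if "X \<in> Obj C" for X
    using that by (simp add: MA.dual_pair_def C.ev_arr C.coev_arr C.ldual_zigzag C.ldual_zigzag')
  have dp0: "MA.dual_pair (rdual C a) a (rev_ev C a) (rev_coev C a)"
    using dp[of "rdual C a"] a by (simp add: C.rev_ev_rdual C.ldual_rdual)
  show ?thesis
    by (intro nakayama_tensor.intro nakayama_tensor_axioms.intro dual_tensor.intro dual_tensor_axioms.intro
      dual_algebra_action.intro dual_algebra_action_axioms.intro MA.monoidal_action_axioms dp dp0 L.finite N)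
      (use al in \<open>simp_all add: a\<close>)
qed

sublocale T: nakayama_tensor C M "tens_obj C" "tens_arr C" "lact_obj L" "lact_arr L" "unit_obj C"
     a "ldual C a" "ldual C (ldual C a)" "rdual C a" "ev C a" "coev C a" "ev C (ldual C a)" "coev C (ldual C a)"
     "rev_ev C a" "rev_coev C a" "amult A" "aunit A" N i
  by (rule nakayama_tensor)

lemma dual_bimodule: "ldual_ract C A = T.dual_ract" "ldual_lact C A = T.dual_lact"
proof -
  interpret C: strict_rigid C using C by (simp add: finite_multitensor_def)
  have a: "a \<in> Obj C" using A by (simp add: is_algebra_def)
  show "ldual_ract C A = T.dual_ract" by (simp add: ldual_ract_def T.dual_ract_def Let_def)
  show "ldual_lact C A = T.dual_lact"
    by (simp add: ldual_lact_def T.dual_lact_def T.dual_comu_def ldual_arr_def Let_def C.ldual_tens C.coev_tens a)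
qed

lemma ltens: "ltens C M L A = T.tens" "ltens_arr C M L A = T.tens_map" "ltens_lact C M L A = T.tens_act"
proof -
  show 1: "ltens C M L A = T.tens"
    by (rule ext) (simp add: ltens_def T.tens_def dual_bimodule T.nt_def case_prod_beta Let_def)
  show "ltens_arr C M L A = T.tens_map" "ltens_lact C M L A = T.tens_act"
    by (intro ext, simp add: ltens_arr_def ltens_lact_def T.tens_map_def T.tens_act_def dual_bimodule
      T.nt_def case_prod_beta Let_def 1)+
qed

lemma nak_lact: "nak_lact C M L A N i Q \<alpha> =
    Fa N (lact_obj L (ldual C (ldual C a)) Q) Q \<alpha> \<cdot>\<^bsub>M\<^esub> T.twist Q"
proof -
  interpret C: strict_rigid C using C by (simp add: finite_multitensor_def)
  have a: "a \<in> Obj C" using A by (simp add: is_algebra_def)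
  have "ltwist C M L N i (ldual C (ldual C a)) Q = T.twist Q"
    using a by (simp add: ltwist_def T.twist_def T.by_fctr_def lact_by_def C.rdual_ldual C.rev_ev_ldual
      C.rev_coev_ldual T.nt_def[abs_def])
  then show ?thesis by (simp add: nak_lact_def Let_def)
qed

text \<open>
  The definitions of the relative tensor product and of its action agree with those of \<open>T\<close>, up to unfolding and
  strictness of duals.
\<close>

theorem nakayama_left_modules: "nakayama_given_by (left_modules C M L A) (nak_left_modules C M L A N i)"
  by (rule T.nakayama_of_modules)
    (auto simp: left_modules_def is_left_module_def T.nt_def nak_left_modules_def ltens nak_lact Let_def fun_eq_iff)

end

text \<open>
  The mirror image: the left action \<open>X, U \<mapsto> U \<lhd> X\<close> of the category with the reversed tensor product, in which
  the right dual takes the place of the left dual.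
\<close>

locale right_nakayama =
  fixes C :: "('c, 'd, 'k::field, 'y) mcat_scheme" and M :: "('o, 'm, 'k, 'z) lcat_scheme"
    and R :: "('c, 'd, 'o, 'm) raction" and B :: "('c, 'd) algebra_obj"
    and N :: "('o, 'm, 'o, 'm) fctr" and i :: "'o \<Rightarrow> 'o \<Rightarrow> 'm"
  assumes C: "finite_multitensor C" and B: "is_algebra C B" and R: "finite_right_module_category C M R"
    and N: "is_nakayama M N i"
begin

abbreviation "b \<equiv> aobj B"

lemma nakayama_tensor: "nakayama_tensor C M (\<lambda>X Y. tens_obj C Y X) (\<lambda>f g. tens_arr C g f) (\<lambda>X U. ract_obj R U X)
     (\<lambda>f h. ract_arr R h f) (unit_obj C)
     b (rdual C b) (rdual C (rdual C b)) (ldual C b) (rev_ev C b) (rev_coev C b)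
     (rev_ev C (rdual C b)) (rev_coev C (rdual C b)) (ev C b) (coev C b) (amult B) (aunit B) N i"
proof -
  interpret C: strict_rigid C using C by (simp add: finite_multitensor_def)
  interpret R: finite_right_module_category C M R by (rule R)
  note al = B[unfolded is_algebra_def]
  have b: "b \<in> Obj C" using al by simp
  have bi: "bilin_bifunctor C C C (\<lambda>X Y. tens_obj C Y X) (\<lambda>f g. tens_arr C g f)"
    by (intro bilin_bifunctor.intro bilin_bifunctor_axioms.intro C.one.lin_category_axioms C.bo_obj C.ba_arr
      C.ba_id C.ba_comp C.ba_lin_left C.ba_lin_right)
  have bR: "bilin_bifunctor C M M (\<lambda>X U. ract_obj R U X) (\<lambda>f h. ract_arr R h f)"
    by (intro bilin_bifunctor.intro bilin_bifunctor_axioms.intro C.one.lin_category_axioms R.one.lin_category_axioms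
      R.bo_obj R.ba_arr R.ba_id R.ba_comp R.ba_lin_left R.ba_lin_right)
  interpret MA: monoidal_action C M "\<lambda>X Y. tens_obj C Y X" "\<lambda>f g. tens_arr C g f" "\<lambda>X U. ract_obj R U X"
      "\<lambda>f h. ract_arr R h f" "unit_obj C"
    by (intro monoidal_action.intro monoidal_action_axioms.intro R.one.lin_category_axioms bi bR C.unit_in
      C.unit_left C.unit_right C.tens_assoc[symmetric] R.runit R.rassoc R.runit_arr R.rassoc_arr)
  have dp: "MA.dual_pair X (rdual C X) (rev_ev C X) (rev_coev C X)" if "X \<in> Obj C" for X
    using that by (simp add: MA.dual_pair_def C.rev_ev_arr C.rev_coev_arr C.rdual_zigzag C.rdual_zigzag')
  have dp0: "MA.dual_pair (ldual C b) b (ev C b) (coev C b)"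
    using dp[of "ldual C b"] b by (simp add: C.rev_ev_ldual C.rev_coev_ldual C.rdual_ldual)
  show ?thesis
    by (intro nakayama_tensor.intro nakayama_tensor_axioms.intro dual_tensor.intro dual_tensor_axioms.intro
      dual_algebra_action.intro dual_algebra_action_axioms.intro MA.monoidal_action_axioms dp dp0 R.finite N)
      (use al in \<open>simp_all add: b\<close>)
qed

sublocale T: nakayama_tensor C M "\<lambda>X Y. tens_obj C Y X" "\<lambda>f g. tens_arr C g f" "\<lambda>X U. ract_obj R U X"
     "\<lambda>f h. ract_arr R h f" "unit_obj C"
     b "rdual C b" "rdual C (rdual C b)" "ldual C b" "rev_ev C b" "rev_coev C b"
     "rev_ev C (rdual C b)" "rev_coev C (rdual C b)" "ev C b" "coev C b" "amult B" "aunit B" N i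
  by (rule nakayama_tensor)

lemma dual_bimodule: "rdual_lact C B = T.dual_ract" "rdual_ract C B = T.dual_lact"
proof -
  interpret C: strict_rigid C using C by (simp add: finite_multitensor_def)
  have b: "b \<in> Obj C" and m: "amult B \<in> arr C (b \<boxtimes>\<^bsub>C\<^esub> b) b" using B by (simp_all add: is_algebra_def)
  let ?b = "rdual C b"
  have o: "?b \<in> Obj C" "b \<boxtimes>\<^bsub>C\<^esub> b \<in> Obj C" "?b \<boxtimes>\<^bsub>C\<^esub> b \<in> Obj C" "?b \<boxtimes>\<^bsub>C\<^esub> ?b \<in> Obj C"
    using b by (simp_all add: C.rdual_obj C.bo_obj)
  note i = C.arrs_in(1)[OF o(1)] C.arrs_in(1)[OF b] C.arrs_in(1)[OF o(4)] and c = C.rev_coev_arr[OF b]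
  have 1: "(Id C ?b \<boxdot>\<^bsub>C\<^esub> amult B) \<boxdot>\<^bsub>C\<^esub> Id C ?b = Id C ?b \<boxdot>\<^bsub>C\<^esub> (amult B \<boxdot>\<^bsub>C\<^esub> Id C ?b)"
    by (rule C.tens_assoc_arr[OF o(1,1,2) b o(1,1) i(1) m i(1)])
  have 2: "(rev_coev C b \<boxdot>\<^bsub>C\<^esub> Id C b) \<boxdot>\<^bsub>C\<^esub> Id C ?b = rev_coev C b \<boxdot>\<^bsub>C\<^esub> (Id C b \<boxdot>\<^bsub>C\<^esub> Id C ?b)"
    by (rule C.tens_assoc_arr[OF C.unit_in o(3) b b o(1,1) c i(2,1)])
  have 3: "(Id C (?b \<boxtimes>\<^bsub>C\<^esub> ?b) \<boxdot>\<^bsub>C\<^esub> amult B) \<boxdot>\<^bsub>C\<^esub> Id C ?b = Id C (?b \<boxtimes>\<^bsub>C\<^esub> ?b) \<boxdot>\<^bsub>C\<^esub> (amult B \<boxdot>\<^bsub>C\<^esub> Id C ?b)"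
    by (rule C.tens_assoc_arr[OF o(4,4,2) b o(1,1) i(3) m i(1)])
  have 4: "(Id C ?b \<boxdot>\<^bsub>C\<^esub> rev_coev C b) \<boxdot>\<^bsub>C\<^esub> Id C b = Id C ?b \<boxdot>\<^bsub>C\<^esub> (rev_coev C b \<boxdot>\<^bsub>C\<^esub> Id C b)"
    by (rule C.tens_assoc_arr[OF o(1,1) C.unit_in o(3) b b i(1) c i(2)])
  show "rdual_lact C B = T.dual_ract" by (simp only: rdual_lact_def T.dual_ract_def Let_def 1 2)
  show "rdual_ract C B = T.dual_lact"
    by (simp only: rdual_ract_def T.dual_lact_def T.dual_comu_def rdual_arr_def Let_def 3 4 C.rdual_tens[OF b b])
qed

lemma rtens: "rtens C M R B = T.tens" "rtens_arr C M R B = T.tens_map" "rtens_ract C M R B = T.tens_act"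
proof -
  show 1: "rtens C M R B = T.tens"
    by (rule ext, subst T.tens_def, subst T.coeq_swap)
      (simp add: rtens_def dual_bimodule T.nt_def case_prod_beta Let_def)
  show "rtens_arr C M R B = T.tens_map" "rtens_ract C M R B = T.tens_act"
    by (intro ext, simp add: rtens_arr_def rtens_ract_def T.tens_map_def T.tens_act_def dual_bimodule
      T.nt_def case_prod_beta Let_def 1)+
qed

lemma nak_ract: "nak_ract C M R B N i Q \<beta> =
    Fa N (ract_obj R Q (rdual C (rdual C b))) Q \<beta> \<cdot>\<^bsub>M\<^esub> T.twist Q"
proof -
  interpret C: strict_rigid C using C by (simp add: finite_multitensor_def)
  have b: "b \<in> Obj C" using B by (simp add: is_algebra_def)
  have "rtwist C M R N i (rdual C (rdual C b)) Q = T.twist Q"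
    using b by (simp add: rtwist_def T.twist_def T.by_fctr_def ract_by_def C.ldual_rdual C.rev_ev_rdual
      T.nt_def[abs_def])
  then show ?thesis by (simp add: nak_ract_def Let_def)
qed

theorem nakayama_right_modules: "nakayama_given_by (right_modules C M R B) (nak_right_modules C M R B N i)"
  by (rule T.nakayama_of_modules)
    (auto simp: right_modules_def is_right_module_def T.nt_def nak_right_modules_def rtens nak_ract Let_def fun_eq_iff)

end

theorem nakayama_bimodules:
  assumes C: "finite_multitensor C" and A: "is_algebra C A" and B: "is_algebra C B"
    and M: "finite_bimodule_category C M L R" and N: "is_nakayama M N i"
  shows "nakayama_given_by (bimodules C M L R A B) (nak_bimodules C M L R A B N i)"
proof -
  interpret M: finite_bimodule_category C M L R by (rule M)
  interpret l: left_nakayama C M L A N i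
    by (intro left_nakayama.intro C A M.left.finite_left_module_category_axioms N)
  interpret r: right_nakayama C M R B N i
    by (intro right_nakayama.intro C B M.right.finite_right_module_category_axioms N)
  interpret b: nakayama_bitensor C M "tens_obj C" "tens_arr C" "lact_obj L" "lact_arr L" "unit_obj C"
     l.a "ldual C l.a" "ldual C (ldual C l.a)" "rdual C l.a" "ev C l.a" "coev C l.a" "ev C (ldual C l.a)"
     "coev C (ldual C l.a)" "rev_ev C l.a" "rev_coev C l.a" "amult A" "aunit A"
     "\<lambda>X Y. tens_obj C Y X" "\<lambda>f g. tens_arr C g f" "\<lambda>X U. ract_obj R U X" "\<lambda>f h. ract_arr R h f"
     r.b "rdual C r.b" "rdual C (rdual C r.b)" "ldual C r.b" "rev_ev C r.b" "rev_coev C r.b"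
     "rev_ev C (rdual C r.b)" "rev_coev C (rdual C r.b)" "ev C r.b" "coev C r.b" "amult B" "aunit B" N i
    by (intro nakayama_bitensor.intro nakayama_bitensor_axioms.intro finite_abelian_colimits(1)[OF M.left.finite]
      l.nakayama_tensor r.nakayama_tensor M.middle M.middle_arr)
  have mid: "ltens_rmod C M L R A B = b.mid"
    by (rule ext) (simp add: ltens_rmod_def b.mid_def b.lmod_def l.ltens case_prod_beta Let_def)
  have bt: "btens C M L R A B = b.bitens" "btens_ract C M L R A B x = r.T.tens_act (b.mid x)" for x
    by (rule ext) (simp_all add: btens_def btens_ract_def b.bitens_def r.rtens mid)
  have bm: "btens_arr C M L R A B = b.bitens_map"
    by (intro ext) (simp add: btens_arr_def b.bitens_map_def r.rtens l.ltens mid b.lmod_def case_prod_beta)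
  have bl: "btens_lact C M L R A B = b.bitens_lact"
    by (intro ext) (simp add: btens_lact_def b.bitens_lact_def bt l.ltens b.lmod_def case_prod_beta Let_def)
  show ?thesis
    by (rule b.nakayama_of_bimodules)
      (auto simp: bimodules_def is_left_module_def is_right_module_def l.T.nt_def r.T.nt_def nak_bimodules_def
        bt bm bl l.nak_lact r.nak_ract Let_def fun_eq_iff)
qed

theorem theorem5p1:
  fixes C :: "('c, 'd, 'k::field) mcat" and A B :: "('c, 'd) algebra_obj"
    and M1 :: "('o1, 'm1, 'k) lcat" and L1 :: "('c, 'd, 'o1, 'm1) laction"
    and N1 :: "('o1, 'm1, 'o1, 'm1) fctr" and i1 :: "'o1 \<Rightarrow> 'o1 \<Rightarrow> 'm1"
    and M2 :: "('o2, 'm2, 'k) lcat" and R2 :: "('c, 'd, 'o2, 'm2) raction"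
    and N2 :: "('o2, 'm2, 'o2, 'm2) fctr" and i2 :: "'o2 \<Rightarrow> 'o2 \<Rightarrow> 'm2"
    and M3 :: "('o3, 'm3, 'k) lcat" and L3 :: "('c, 'd, 'o3, 'm3) laction"
    and R3 :: "('c, 'd, 'o3, 'm3) raction"
    and N3 :: "('o3, 'm3, 'o3, 'm3) fctr" and i3 :: "'o3 \<Rightarrow> 'o3 \<Rightarrow> 'm3"
  assumes "finite_multitensor C" and "is_algebra C A" and "is_algebra C B"
  shows
    "(finite_left_module_category C M1 L1 \<and> is_nakayama M1 N1 i1 \<longrightarrow>
        nakayama_given_by (left_modules C M1 L1 A) (nak_left_modules C M1 L1 A N1 i1)) \<and>
     (finite_right_module_category C M2 R2 \<and> is_nakayama M2 N2 i2 \<longrightarrow>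
        nakayama_given_by (right_modules C M2 R2 B) (nak_right_modules C M2 R2 B N2 i2)) \<and>
     (finite_bimodule_category C M3 L3 R3 \<and> is_nakayama M3 N3 i3 \<longrightarrow>
        nakayama_given_by (bimodules C M3 L3 R3 A B) (nak_bimodules C M3 L3 R3 A B N3 i3))"
  using assms left_nakayama.nakayama_left_modules left_nakayama.intro
    right_nakayama.nakayama_right_modules right_nakayama.intro nakayama_bimodules
  by metis

end
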